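(* Let $r,s\ge 0$, let $\Delta=(v_1,\dots,v_n)$ be a collection of vectors in $\mathbb{Z}^2\setminus\{0\}$, and let $F\subset\{1,\dots,n\}$ with $r+2s+|F|=|\Delta|-1$. For a collection of conditions $\mathcal{P}\in\mathbb{R}^{2(r+s)+|F|}$ in general position for $\mathrm{ev}_F: M^B_{(r,s)}(\Delta,F)\to\mathbb{R}^{2(r+s)+|F|}$ let $$N^B_{(r,s)}(\Delta,F,\mathcal{P})=\frac{1}{|G(\Delta,F)|}\sum_C m_C,$$ the sum being over all broccoli curves $C\in M^B_{(r,s)}(\Delta,F)$ with $\mathrm{ev}_F(C)=\mathcal{P}$. Then the number $N^B_{(r,s)}(\Delta,F,\mathcal{P})$ is independent of the choice of the collection of conditions $\mathcal{P}$ in general position.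
   Context: **Marked curves.** For $r,s\in\mathbb{N}=\{0,1,\dots\}$, an $(r,s)$-marked (plane tropical) curve is a tuple $C=(\Gamma,x_1,\dots,x_{r+s},y_1,\dots,y_n,h)$: $\Gamma$ is a connected metric graph of genus $0$ (a tree), unbounded edges ("ends") allowed, all vertices of valence $\ge 3$; $h:\Gamma\to\mathbb{R}^2$ is continuous and on each edge $E$ of the form $h(t)=a+tv$ with $a\in\mathbb{R}^2$, $v\in\mathbb{Z}^2$; parametrizing $E$ from its vertex $V$, $v=:v(E,V)$ is the direction of $E$ at $V$ (written $v(E)$ for an end). An edge is contracted if its direction is $0$. At each vertex $V$ the balancing condition $\sum_{E\ni V}v(E,V)=0$ holds. $x_1,\dots,x_{r+s}$ label the contracted ends (markings; $x_1,\dots,x_r$ are real, $x_{r+1},\dots,x_{r+s}$ complex), $y_1,\dots,y_n$ label the non-contracted ends (unmarked ends). The degree is $\Delta=(v(y_1),\dots,v(y_n))$, $|\Delta|=n$. $M_{(r,s)}(\Delta)$ is the set of such curves of degree $\Delta$ (up to isomorphism). The combinatorial type of $C$ is the non-metric graph with end labels and all edge directions; curves of a fixed type form an open polyhedron, parametrized by the position of a root vertex and the positive lengths of the bounded edges, and $M_{(r,s)}(\Delta)$ is a polyhedral complex glued from these cells (faces arise when edge lengths go to $0$). A vector in $\mathbb{Z}^2$ is even if both coordinates are even, odd otherwise; an edge is even/odd if its direction is. The weight $\omega(E)$ is the non-negative integer by which a primitive integral vector must be multiplied to get the direction of $E$. **Evaluation, general position.** For $\Delta=(v_1,\dots,v_n)$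 and $F\subset\{1,\dots,n\}$ (fixed ends), $\mathrm{ev}_F$ sends $C$ to $\big((h(x_1),\dots,h(x_{r+s})),(h(y_i))_{i\in F}\big)\in(\mathbb{R}^2)^{r+s}\times\prod_{i\in F}\mathbb{R}^2/\langle v_i\rangle\cong\mathbb{R}^{2(r+s)+|F|}$. For a map $f:M\to\mathbb{R}^N$ on a polyhedral complex, linear on cells, a point is in general position for $f$ if it lies in no $f(M^\alpha)$, $M^\alpha$ a cell of $M$, with $\dim f(M^\alpha)\le N-1$. $G(\Delta,F)$ is the group of permutations $\sigma$ of $\{1,\dots,n\}$ with $\sigma(i)=i$ for $i\in F$ and $v_{\sigma(i)}=v_i$ for all $i$. **Oriented curves.** An oriented marked curve is a marked curve with an orientation on each unmarked edge (bounded edges and unmarked ends). $F(C)$ is the set of $i$ such that $y_i$ is oriented inwards (fixed ends). $M^{\mathrm{or}}_{(r,s)}(\Delta,F)$ is the polyhedral complex of oriented $(r,s)$-marked curves of degree $\Delta$ with $F(C)=F$ (combinatorial types now include the orientations); on it, $\mathrm{ev}_F$ is the map sending an oriented curve $C$ to $\big((h(x_1),\dots,h(x_{r+s})),(h(y_i))_{i\in F}\big)\in\mathbb{R}^{2(r+s)+|F|}$, disregarding the orientations. **Broccoli curves.** An (oriented) broccoli curve is a curve in $M^{\mathrm{or}}_{(r,s)}(\Delta,F)$ all of whose vertices are of one of the following types. "In/out" means oriented towards/away from the vertex; $a$ is the absolute value of the determinant of the directions of two of the unmarked adjacent edges; $m_V$ is the vertex multiplicity. (1) one real marking, two odd edges,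 both out; $m_V=1$. (2) no marking, three odd edges, two in, one out; $m_V=i^{a-1}$. (3) no marking, one even edge in, one odd edge in, one odd edge out; $m_V=a\,i^{a-1}$. (4) no marking, three even edges, two in, one out; $m_V=a\,i^{a-1}$. (5) one complex marking, three odd edges, all out; $m_V=a\,i^{a-1}$. (6) one complex marking, one even and two odd edges, all out; $m_V=i^{a-1}$. The multiplicity of $C$ is $m_C=\prod_{k=1}^n i^{\omega(y_k)-1}\cdot\prod_V m_V$ (here $i=\sqrt{-1}$). $M^B_{(r,s)}(\Delta,F)$ is the closure in $M^{\mathrm{or}}_{(r,s)}(\Delta,F)$ of the set of all broccoli curves; its maximal open cells correspond exactly to the broccoli curves. *)

theory Defs
  imports "HOL-Analysis.Analysis" "HOL-Analysis.Finite_Function_Topology"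
begin

section \<open>Lattice vectors\<close>

definition real_vec :: "int \<times> int \<Rightarrow> real \<times> real" where
  "real_vec d = (real_of_int (fst d), real_of_int (snd d))"

definition det2 :: "'a::comm_ring \<times> 'a \<Rightarrow> 'a \<times> 'a \<Rightarrow> 'a" where
  "det2 u w = fst u * snd w - snd u * fst w"

definition even_vec :: "int \<times> int \<Rightarrow> bool" where
  "even_vec d \<longleftrightarrow> even (fst d) \<and> even (snd d)"

definition primitive_vec :: "int \<times> int \<Rightarrow> bool" where
  "primitive_vec d \<longleftrightarrow> coprime (fst d) (snd d)"

definition weight :: "int \<times> int \<Rightarrow> nat" where
  "weight d = (THE w. \<exists>p. primitive_vec p \<and> d = (int w * fst p, int w * snd p))"

lemma weight_eq_gcd: "weight d = nat (gcd (fst d) (snd d))"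
proof -
  obtain p q where d: "d = (p, q)" by (cases d)
  have ex: "\<exists>e. primitive_vec e \<and> d = (int (nat (gcd p q)) * fst e, int (nat (gcd p q)) * snd e)"
  proof (cases "d = 0")
    case True
    then have "primitive_vec (1, 0)" "d = (0, 0)"
      by (simp_all add: primitive_vec_def zero_prod_def)
    then show ?thesis using d by (intro exI[of _ "(1,0)"]) auto
  next
    case False
    then have "coprime (p div gcd p q) (q div gcd p q)"
      using d by (intro div_gcd_coprime) (auto simp: zero_prod_def)
    then show ?thesis
      using d by (intro exI[of _ "(p div gcd p q, q div gcd p q)"]) (simp add: primitive_vec_def)
  qed
  have uniq: "w = nat (gcd p q)"
    if "\<exists>e. primitive_vec e \<and> d = (int w * fst e, int w * snd e)" for w
  proof -
    from that obtain e where "primitive_vec e" "d = (int w * fst e, int w * snd e)" by blast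
    then have e: "coprime (fst e) (snd e)" "p = int w * fst e" "q = int w * snd e"
      using d by (simp_all add: primitive_vec_def)
    have "gcd p q = int w"
      using e by (simp add: gcd_mult_distrib_int[symmetric] coprime_imp_gcd_eq_1)
    then show ?thesis by simp
  qed
  show ?thesis
    unfolding weight_def using ex uniq d by (intro the_equality) auto
qed

section \<open>Marked and oriented curves\<close>

text \<open>
  A curve is given by a finite graph together with its metric and the map \<open>h\<close>. The graph is
  encoded by its flags: a flag \<open>f\<close> is a pair of an edge and a vertex on it (its \<open>base\<close>).
  The involution \<open>opp\<close> exchanges the two flags of a bounded edge; its fixed points are the
  unbounded edges. For a flag \<open>f\<close> of an edge \<open>E\<close> at a vertex \<open>V\<close>, \<open>dir C f\<close> is \<open>v(E,V)\<close>, and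
  \<open>h\<close> is \<open>t \<mapsto> pos C V + t *\<^sub>R real_vec (dir C f)\<close> on \<open>E\<close> parametrized from \<open>V\<close>, with \<open>t\<close>
  in \<open>[0, len C f]\<close> for a bounded edge and in \<open>[0, \<infinity>)\<close> for an end. So \<open>h\<close> is determined by
  \<open>pos\<close>, \<open>len\<close> and \<open>dir\<close>. The values of \<open>len\<close> on ends, and of all functions outside
  \<open>verts\<close>, \<open>flags\<close> or the label ranges, are irrelevant.
\<close>

record marked_curve =
  verts :: "nat set"
  flags :: "nat set"
  base :: "nat \<Rightarrow> nat"
  opp :: "nat \<Rightarrow> nat"
  len :: "nat \<Rightarrow> real"
  pos :: "nat \<Rightarrow> real \<times> real"
  dir :: "nat \<Rightarrow> int \<times> int"
  xend :: "nat \<Rightarrow> nat"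
  yend :: "nat \<Rightarrow> nat"

text \<open>
  \<open>outw C f\<close> says that the edge of the flag \<open>f\<close> is oriented away from \<open>base C f\<close>; it is
  irrelevant on markings.
\<close>

record oriented_curve = marked_curve +
  outw :: "nat \<Rightarrow> bool"

definition bounded_flags :: "'a marked_curve_scheme \<Rightarrow> nat set" where
  "bounded_flags C = {f \<in> flags C. opp C f \<noteq> f}"

definition ends :: "'a marked_curve_scheme \<Rightarrow> nat set" where
  "ends C = {f \<in> flags C. opp C f = f}"

definition bounded_edges :: "'a marked_curve_scheme \<Rightarrow> nat set set" where
  "bounded_edges C = (\<lambda>f. {f, opp C f}) ` bounded_flags C"

definition flags_at :: "'a marked_curve_scheme \<Rightarrow> nat \<Rightarrow> nat set" where
  "flags_at C V = {f \<in> flags C. base C f = V}"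

definition connected_curve :: "'a marked_curve_scheme \<Rightarrow> bool" where
  "connected_curve C \<longleftrightarrow>
     (\<forall>V\<in>verts C. \<forall>W\<in>verts C. (V, W) \<in> {(base C f, base C (opp C f)) | f. f \<in> flags C}\<^sup>*)"

text \<open>
  The genus of a connected graph is \<open>1 - |vertices| + |bounded edges|\<close>.
\<close>

definition genus :: "'a marked_curve_scheme \<Rightarrow> int" where
  "genus C = 1 - int (card (verts C)) + int (card (bounded_edges C))"

text \<open>
  The parameters fixed below are the numbers \<open>r\<close>, \<open>s\<close> of real and complex markings, the degree
  \<open>\<Delta> = (v 1, \<dots>, v n)\<close> and the set \<open>F\<close> of fixed ends. Markings \<open>1..r\<close> are real, markings
  \<open>r+1..r+s\<close> are complex.
\<close>

type_synonym conditions = "(nat \<Rightarrow>\<^sub>0 real \<times> real) \<times> (nat \<Rightarrow>\<^sub>0 real)"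

context
  fixes r s n :: nat and v :: "nat \<Rightarrow> int \<times> int" and F :: "nat set"
begin

definition is_marked_curve :: "'a marked_curve_scheme \<Rightarrow> bool" where
  "is_marked_curve C \<longleftrightarrow>
     finite (verts C) \<and> finite (flags C) \<and>
     (\<forall>f\<in>flags C. base C f \<in> verts C \<and> opp C f \<in> flags C \<and> opp C (opp C f) = f) \<and>
     connected_curve C \<and> genus C = 0 \<and>
     (\<forall>V\<in>verts C. 3 \<le> card (flags_at C V)) \<and>
     (\<forall>f\<in>bounded_flags C.
        0 < len C f \<and> len C (opp C f) = len C f \<and> dir C (opp C f) = - dir C f \<and>
        pos C (base C (opp C f)) = pos C (base C f) + len C f *\<^sub>R real_vec (dir C f)) \<and>
     (\<forall>V\<in>verts C. (\<Sum>f\<in>flags_at C V. dir C f) = 0) \<and>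
     bij_betw (xend C) {1..r + s} {f \<in> ends C. dir C f = 0} \<and>
     bij_betw (yend C) {1..n} {f \<in> ends C. dir C f \<noteq> 0} \<and>
     (\<forall>j\<in>{1..n}. dir C (yend C j) = v j)"

text \<open>
  Flags of unmarked edges, i.e. of bounded edges (contracted ones included) and unmarked ends.
\<close>

definition unmarked_flags :: "'a marked_curve_scheme \<Rightarrow> nat set" where
  "unmarked_flags C = flags C - xend C ` {1..r + s}"

definition inward_ends :: "oriented_curve \<Rightarrow> nat set" where
  "inward_ends C = {j \<in> {1..n}. \<not> outw C (yend C j)}"

text \<open>
  Representatives of the points of \<open>M\<^sup>o\<^sup>r\<close>; its points are the classes of the relation
  \<open>curve_iso\<close> below.
\<close>

definition oriented_curves :: "oriented_curve set" where
  "oriented_curves =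
     {C. is_marked_curve C \<and> (\<forall>f\<in>bounded_flags C. outw C (opp C f) \<longleftrightarrow> \<not> outw C f) \<and>
         inward_ends C = F}"


subsection \<open>Combinatorial types, isomorphisms and the topology\<close>

text \<open>
  \<open>type_contraction \<phi> \<psi> C D\<close>: the combinatorial type of \<open>D\<close> arises from that of \<open>C\<close> by
  contracting some bounded edges, namely those whose flags are not in the image of \<open>\<psi>\<close>. The
  map \<open>\<phi>\<close> sends a vertex of \<open>C\<close> to its image in \<open>D\<close>, and \<open>\<psi>\<close> sends a flag of \<open>D\<close> to the
  flag of \<open>C\<close> it comes from. As both graphs are trees, the fibres of \<open>\<phi>\<close> are exactly the
  vertex sets of the connected components of the subgraph of contracted edges.
\<close>

definition type_contraction ::
  "(nat \<Rightarrow> nat) \<Rightarrow> (nat \<Rightarrow> nat) \<Rightarrow> oriented_curve \<Rightarrow> oriented_curve \<Rightarrow> bool" where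
  "type_contraction \<phi> \<psi> C D \<longleftrightarrow>
     \<phi> ` verts C = verts D \<and>
     inj_on \<psi> (flags D) \<and> \<psi> ` flags D \<subseteq> flags C \<and>
     (\<forall>g\<in>flags D. base D g = \<phi> (base C (\<psi> g)) \<and> \<psi> (opp D g) = opp C (\<psi> g) \<and>
                  dir D g = dir C (\<psi> g)) \<and>
     (\<forall>g\<in>unmarked_flags D. outw D g \<longleftrightarrow> outw C (\<psi> g)) \<and>
     (\<forall>i\<in>{1..r + s}. xend C i = \<psi> (xend D i)) \<and>
     (\<forall>j\<in>{1..n}. yend C j = \<psi> (yend D j)) \<and>
     (\<forall>f\<in>flags C - \<psi> ` flags D.
        f \<in> bounded_flags C \<and> \<phi> (base C (opp C f)) = \<phi> (base C f))"

definition type_iso ::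
  "(nat \<Rightarrow> nat) \<Rightarrow> (nat \<Rightarrow> nat) \<Rightarrow> oriented_curve \<Rightarrow> oriented_curve \<Rightarrow> bool" where
  "type_iso \<phi> \<psi> C D \<longleftrightarrow>
     type_contraction \<phi> \<psi> C D \<and> inj_on \<phi> (verts C) \<and> \<psi> ` flags D = flags C"

definition same_type :: "oriented_curve \<Rightarrow> oriented_curve \<Rightarrow> bool" where
  "same_type C D \<longleftrightarrow> (\<exists>\<phi> \<psi>. type_iso \<phi> \<psi> C D)"

definition isomorphic :: "oriented_curve \<Rightarrow> oriented_curve \<Rightarrow> bool" where
  "isomorphic C D \<longleftrightarrow>
     (\<exists>\<phi> \<psi>. type_iso \<phi> \<psi> C D \<and> (\<forall>V\<in>verts C. pos D (\<phi> V) = pos C V) \<and>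
            (\<forall>g\<in>bounded_flags D. len D g = len C (\<psi> g)))"

definition curve_iso :: "(oriented_curve \<times> oriented_curve) set" where
  "curve_iso = {(C, D). C \<in> oriented_curves \<and> D \<in> oriented_curves \<and> isomorphic C D}"

text \<open>
  Convergence in the polyhedral complex \<open>M\<^sup>o\<^sup>r\<close>, glued from the cells of the combinatorial types
  along the faces where edge lengths become \<open>0\<close>: near \<open>D\<close> there are only curves whose type
  contracts to that of \<open>D\<close>, and the coordinates (positions and edge lengths) have to converge,
  the lengths of the contracted edges to \<open>0\<close>. (The condition on all \<open>k\<close>, instead of almost all
  \<open>k\<close>, makes no difference for the closure of a set.)
\<close>

definition curves_tendsto :: "(nat \<Rightarrow> oriented_curve) \<Rightarrow> oriented_curve \<Rightarrow> bool" where
  "curves_tendsto X D \<longleftrightarrow>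
     (\<exists>\<phi> \<psi>. (\<forall>k. type_contraction (\<phi> k) (\<psi> k) (X k) D) \<and>
            (\<forall>g\<in>flags D. (\<lambda>k. pos (X k) (base (X k) (\<psi> k g))) \<longlonglongrightarrow> pos D (base D g)) \<and>
            (\<forall>g\<in>bounded_flags D. (\<lambda>k. len (X k) (\<psi> k g)) \<longlonglongrightarrow> len D g) \<and>
            (\<lambda>k. \<Sum>f\<in>flags (X k) - \<psi> k ` flags D. len (X k) f) \<longlonglongrightarrow> 0)"


subsection \<open>Broccoli curves\<close>

text \<open>
  The numbers of real markings, complex markings, inward even, outward even, inward odd and
  outward odd unmarked edges at a vertex. (A contracted bounded edge has direction \<open>0\<close> and is
  therefore even.)
\<close>

definition num_edges :: "oriented_curve \<Rightarrow> nat \<Rightarrow> bool \<Rightarrow> bool \<Rightarrow> nat" where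
  "num_edges C V ev ou =
     card {f \<in> flags_at C V \<inter> unmarked_flags C. even_vec (dir C f) = ev \<and> outw C f = ou}"

definition vertex_profile :: "oriented_curve \<Rightarrow> nat \<Rightarrow> nat \<times> nat \<times> nat \<times> nat \<times> nat \<times> nat" where
  "vertex_profile C V =
     (card {i \<in> {1..r}. base C (xend C i) = V}, card {i \<in> {r + 1..r + s}. base C (xend C i) = V},
      num_edges C V True False, num_edges C V True True,
      num_edges C V False False, num_edges C V False True)"

definition vertex1 :: "oriented_curve \<Rightarrow> nat \<Rightarrow> bool" where
  "vertex1 C V \<longleftrightarrow> vertex_profile C V = (1, 0, 0, 0, 0, 2)"

definition vertex2 :: "oriented_curve \<Rightarrow> nat \<Rightarrow> bool" where
  "vertex2 C V \<longleftrightarrow> vertex_profile C V = (0, 0, 0, 0, 2, 1)"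

definition vertex3 :: "oriented_curve \<Rightarrow> nat \<Rightarrow> bool" where
  "vertex3 C V \<longleftrightarrow> vertex_profile C V = (0, 0, 1, 0, 1, 1)"

definition vertex4 :: "oriented_curve \<Rightarrow> nat \<Rightarrow> bool" where
  "vertex4 C V \<longleftrightarrow> vertex_profile C V = (0, 0, 2, 1, 0, 0)"

definition vertex5 :: "oriented_curve \<Rightarrow> nat \<Rightarrow> bool" where
  "vertex5 C V \<longleftrightarrow> vertex_profile C V = (0, 1, 0, 0, 0, 3)"

definition vertex6 :: "oriented_curve \<Rightarrow> nat \<Rightarrow> bool" where
  "vertex6 C V \<longleftrightarrow> vertex_profile C V = (0, 1, 0, 1, 0, 2)"

definition broccoli_curves :: "oriented_curve set" where
  "broccoli_curves =
     {C \<in> oriented_curves. \<forall>V\<in>verts C.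
        vertex1 C V \<or> vertex2 C V \<or> vertex3 C V \<or> vertex4 C V \<or> vertex5 C V \<or> vertex6 C V}"

text \<open>
  The number \<open>a\<close> of a vertex. At a vertex with exactly three unmarked edges (types 2 to 6) it
  does not depend on the choice of the two edges, by the balancing condition.
\<close>

definition vertex_det :: "oriented_curve \<Rightarrow> nat \<Rightarrow> nat" where
  "vertex_det C V =
     (THE a. \<exists>f\<in>flags_at C V \<inter> unmarked_flags C. \<exists>g\<in>flags_at C V \<inter> unmarked_flags C.
        f \<noteq> g \<and> a = nat \<bar>det2 (dir C f) (dir C g)\<bar>)"

text \<open>
  The exponent \<open>a - 1\<close> is an integer: at a vertex of type 6 with parallel edges, \<open>a = 0\<close> and
  the multiplicity is \<open>\<i> powi (-1)\<close>.
\<close>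

definition vertex_mult :: "oriented_curve \<Rightarrow> nat \<Rightarrow> complex" where
  "vertex_mult C V =
     (let a = vertex_det C V in
      if vertex1 C V then 1
      else if vertex2 C V \<or> vertex6 C V then \<i> powi (int a - 1)
      else of_nat a * \<i> powi (int a - 1))"

definition curve_mult :: "oriented_curve \<Rightarrow> complex" where
  "curve_mult C =
     (\<Prod>k=1..n. \<i> powi (int (weight (dir C (yend C k))) - 1)) * (\<Prod>V\<in>verts C. vertex_mult C V)"

text \<open>The closure of the set of broccoli curves in \<open>M\<^sup>o\<^sup>r\<close> (representatives).\<close>

definition broccoli_space :: "oriented_curve set" where
  "broccoli_space =
     {D \<in> oriented_curves. \<exists>X. (\<forall>k. X k \<in> broccoli_curves) \<and> curves_tendsto X D}"

definition broccoli_cell :: "oriented_curve \<Rightarrow> oriented_curve set" where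
  "broccoli_cell D = {C \<in> broccoli_space. same_type C D}"


subsection \<open>Evaluation and general position\<close>

text \<open>
  \<open>\<real>\<^bsup>2(r+s)+|F|\<^esup>\<close>, with one component in \<open>\<real>\<^sup>2\<close> for each marking and one component in \<open>\<real>\<close> for
  each fixed end. Since \<open>v j\<close> is non-zero, \<open>w \<mapsto> det2 (v j) w\<close> induces the isomorphism from
  \<open>\<real>\<^sup>2\<close> modulo the span of \<open>v j\<close> to \<open>\<real>\<close> that is used to write \<open>h(y\<^sub>j)\<close> as a real number.
\<close>

definition condition_space :: "conditions set" where
  "condition_space =
     {P. Poly_Mapping.keys (fst P) \<subseteq> {1..r + s} \<and> Poly_Mapping.keys (snd P) \<subseteq> F}"

definition evaluation :: "oriented_curve \<Rightarrow> conditions" where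
  "evaluation C =
     (\<Sum>i=1..r + s. Poly_Mapping.single i (pos C (base C (xend C i))),
      \<Sum>j\<in>F. Poly_Mapping.single j (det2 (real_vec (v j)) (pos C (base C (yend C j)))))"

text \<open>
  The image of a cell is a convex polyhedron; its dimension is the dimension of the vector space
  spanned by the differences of its points.
\<close>

definition general_position :: "conditions \<Rightarrow> bool" where
  "general_position P \<longleftrightarrow>
     (\<forall>D\<in>broccoli_space.
        int (dim {x - y | x y. x \<in> evaluation ` broccoli_cell D \<and> y \<in> evaluation ` broccoli_cell D})
          \<le> int (2 * (r + s) + card F) - 1 \<longrightarrow>
        P \<notin> evaluation ` broccoli_cell D)"


subsection \<open>Broccoli numbers\<close>

definition symmetry_group :: "(nat \<Rightarrow> nat) set" where
  "symmetry_group =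
     {\<sigma>. \<sigma> permutes {1..n} \<and> (\<forall>i\<in>F. \<sigma> i = i) \<and> (\<forall>i\<in>{1..n}. v (\<sigma> i) = v i)}"

definition broccoli_number :: "conditions \<Rightarrow> complex" where
  "broccoli_number P =
     1 / of_nat (card symmetry_group) *
     (\<Sum>K\<in>{C \<in> broccoli_curves. evaluation C = P} // curve_iso. curve_mult (SOME C. C \<in> K))"

end

end

theory Submission
  imports Defs "HOL-Library.Disjoint_Sets" "HOL-Library.Nat_Bijection"
begin

text \<open>
  The type of a rational curve is encoded by the partitions of the end labels that its vertices
  induce. It determines the orientations of a broccoli curve: the number of outgoing edges of a
  vertex is \<open>1\<close>, plus \<open>1\<close> for a real and \<open>2\<close> for a complex marking.
  If no two incoming edges of a vertex are parallel, the conditions determine the positions of the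
  vertices, following the orientations, and the lengths of the edges are linear forms in the
  conditions. So for conditions in general position one has to count, with multiplicity, the types
  all of whose lengths are positive. Along a generic line of conditions this count can only change
  where the length of one edge vanishes. Then the types that become equal when this edge is
  contracted are the resolutions of one vertex, and their multiplicities, with the signs of the
  derivatives of the lengths of the new edges, add up to zero; this is a Jacobi identity for the
  structure constants \<open>\<i>\<^bsup>a-1\<^esup>\<close> and \<open>a \<i>\<^bsup>a-1\<^esup>\<close>. Conditions at which some lengths vanish are not in
  general position, because contracting all edges of length zero leads to a cell whose image is
  too small.
\<close>

section \<open>Trees as sets of partitions\<close>

text \<open>The multiplicities contain absolute values of determinants, and the cancellation at a
  wall needs signed ones. The missing signs are geometric: at a wall the length of the new edge is a
  linear form whose sign is common to all resolutions, divided by the determinants of the joins at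
  its two ends. Their signs turn the multiplicities of joins into the antisymmetric coefficients
  \<open>join_coeff\<close>. A tail with a marking has no such sign, its position being a condition,
  and \<open>source_coeff\<close> needs none. All ends are labelled and all valences are at least 3,
  so such a tree has no automorphisms and an isomorphism class can be represented by a set of
  partitions. That two types have the same contraction is then an equality of sets, and the order of
  \<open>symmetry_group\<close> and the weights of the ends are common factors. A cell of broccoli
  curves has two translations and \<open>r + n - 3\<close> edge lengths as parameters, and the
  condition on \<open>r\<close>, \<open>s\<close> and \<open>F\<close> makes this the number of
  conditions. So any lost parameter, be it a contracted edge or a motion invisible to the
  conditions, contradicts general position.\<close>

definition partition_tree :: "'a set \<Rightarrow> 'a set set set \<Rightarrow> bool" where
  "partition_tree L T \<longleftrightarrow>
     finite T \<and> T \<noteq> {} \<and>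
     (\<forall>V\<in>T. partition_on L V \<and> 3 \<le> card V) \<and>
     (\<forall>V\<in>T. \<forall>W\<in>T. \<forall>f. f \<in> V \<longrightarrow> f \<in> W \<longrightarrow> V = W) \<and>
     (\<forall>V\<in>T. \<forall>f\<in>V. 2 \<le> card f \<longrightarrow> (\<exists>W\<in>T. L - f \<in> W))"

definition vertex_of :: "'a set set set \<Rightarrow> 'a set \<Rightarrow> 'a set set" where
  "vertex_of T f = (THE V. V \<in> T \<and> f \<in> V)"

text \<open>A block is a flag, given by the labels behind it. Blocks of size 1 are the ends; a
  larger block is one flag of a bounded edge, and its complement is the other one. Connectedness and
  absence of cycles are not demanded of \<open>T\<close>, they follow: see
  \<open>walk_to_label\<close> and \<open>card_away_flags\<close>.\<close>

definition inner_flags :: "'a set set set \<Rightarrow> 'a set set" where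
  "inner_flags T = {f \<in> \<Union>T. 2 \<le> card f}"

text \<open>The vertex lies beyond the edge \<open>S\<close>: all labels on the near side of the
  edge are seen through one flag of the vertex.\<close>

definition on_side :: "'a set \<Rightarrow> 'a set \<Rightarrow> 'a set set \<Rightarrow> bool" where
  "on_side L S V \<longleftrightarrow> (\<exists>g\<in>V. L - S \<subseteq> g)"

text \<open>With \<open>\<rho>\<close> as root, this picks one of the two flags of every bounded
  edge.\<close>

definition away_flags :: "'a set set set \<Rightarrow> 'a \<Rightarrow> 'a set set" where
  "away_flags T \<rho> = {f \<in> inner_flags T. \<rho> \<notin> f}"

lemma card_union_blocks_gt:
  assumes "finite L" "partition_on L V" "a \<in> V" "b \<in> V" "a \<noteq> b"
  shows "2 \<le> card (a \<union> b)"
proof -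
  have "a \<noteq> {}" "b \<noteq> {}" "a \<inter> b = {}" "finite a" "finite b"
    using assms partition_onD2[OF assms(2)] unfolding partition_on_def
    by (blast, blast, meson disjointD, (meson Union_upper finite_subset)+)
  then have "card (a \<union> b) = card a + card b" "0 < card a" "0 < card b"
    by (auto simp: card_Un_disjoint card_gt_0_iff)
  then show ?thesis by linarith
qed

locale ptree =
  fixes L :: "'a set" and T :: "'a set set set"
  assumes fin_L: "finite L" and tree: "partition_tree L T"
begin

lemma fin_T: "finite T" and T_nonempty: "T \<noteq> {}"
  using tree by (auto simp: partition_tree_def)

lemma part: "V \<in> T \<Longrightarrow> partition_on L V"
  and card3: "V \<in> T \<Longrightarrow> 3 \<le> card V"
  and uniq: "V \<in> T \<Longrightarrow> W \<in> T \<Longrightarrow> f \<in> V \<Longrightarrow> f \<in> W \<Longrightarrow> V = W"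
  and opposite_ex: "V \<in> T \<Longrightarrow> f \<in> V \<Longrightarrow> 2 \<le> card f \<Longrightarrow> \<exists>W\<in>T. L - f \<in> W"
  using tree unfolding partition_tree_def by metis+

lemma Union_vertex: "V \<in> T \<Longrightarrow> \<Union>V = L"
  using part by (auto simp: partition_on_def)

lemma fin_vertex: "V \<in> T \<Longrightarrow> finite V"
  using card3 card.infinite by fastforce

lemma block_sub: "V \<in> T \<Longrightarrow> f \<in> V \<Longrightarrow> f \<subseteq> L"
  using Union_vertex by auto

lemma fin_block: "V \<in> T \<Longrightarrow> f \<in> V \<Longrightarrow> finite f"
  using block_sub fin_L finite_subset by metis

lemma block_nonempty: "V \<in> T \<Longrightarrow> f \<in> V \<Longrightarrow> f \<noteq> {}"
  using part by (auto simp: partition_on_def)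

lemma block_disj: "V \<in> T \<Longrightarrow> f \<in> V \<Longrightarrow> g \<in> V \<Longrightarrow> f \<noteq> g \<Longrightarrow> f \<inter> g = {}"
  using part by (fastforce simp: partition_on_def disjoint_def)

lemma block_sub_compl: "V \<in> T \<Longrightarrow> f \<in> V \<Longrightarrow> g \<in> V \<Longrightarrow> f \<noteq> g \<Longrightarrow> g \<subseteq> L - f"
  using block_disj[of V f g] block_sub[of V g] by blast

lemma block_eq: "V \<in> T \<Longrightarrow> f \<in> V \<Longrightarrow> g \<in> V \<Longrightarrow> x \<in> f \<Longrightarrow> x \<in> g \<Longrightarrow> f = g"
  using block_disj by blast

lemma third_block:
  assumes "V \<in> T"
  shows "\<exists>h\<in>V. h \<noteq> f \<and> h \<noteq> g"
proof (rule ccontr)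
  assume "\<not> ?thesis"
  then have "V \<subseteq> {f, g}" by auto
  then have "card V \<le> card {f, g}" by (intro card_mono) auto
  also have "\<dots> \<le> 2" by (simp add: card_insert_if)
  finally show False using card3[OF assms] by simp
qed

lemma block_psub_compl:
  assumes "V \<in> T" "f \<in> V" "g \<in> V" "f \<noteq> g"
  shows "g \<subset> L - f"
proof -
  obtain h where h: "h \<in> V" "h \<noteq> f" "h \<noteq> g" using third_block[OF assms(1)] by blast
  obtain x where "x \<in> h" using block_nonempty[OF assms(1) h(1)] by blast
  then have "x \<in> L - f" "x \<notin> g" using assms h block_eq block_sub by blast+
  then show ?thesis using block_sub_compl[OF assms] by blast
qed

text \<open>A third block lies in \<open>L - f\<close> as well, so no single block exhausts it.
  Hence no edge is a loop.\<close>

lemma compl_notin_same: "V \<in> T \<Longrightarrow> f \<in> V \<Longrightarrow> L - f \<notin> V"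
proof
  assume V: "V \<in> T" "f \<in> V" "L - f \<in> V"
  have "f \<noteq> {}" "f \<subseteq> L" using block_nonempty block_sub V by auto
  then have "f \<noteq> L - f" by blast
  then show False using block_psub_compl[OF V] by simp
qed

text \<open>Crossing an edge makes the blocks strictly smaller; most inductions along the tree use
  this as their measure.\<close>

lemma beyond_psub:
  assumes "W \<in> T" "L - f \<in> W" "g \<in> W" "g \<noteq> L - f" "f \<subseteq> L"
  shows "g \<subset> f"
  using block_psub_compl[of W "L - f" g] assms by (auto simp: double_diff)

lemma vertex_of_eq: "V \<in> T \<Longrightarrow> f \<in> V \<Longrightarrow> vertex_of T f = V"
  unfolding vertex_of_def by (rule the_equality, blast, erule conjE, rule uniq)

lemma vertex_of_in:
  assumes "f \<in> \<Union>T" shows "vertex_of T f \<in> T" "f \<in> vertex_of T f"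
proof -
  obtain V where V: "V \<in> T" "f \<in> V" using assms by blast
  then show "vertex_of T f \<in> T" "f \<in> vertex_of T f" using vertex_of_eq[OF V] by simp_all
qed

lemma card_block: "V \<in> T \<Longrightarrow> f \<in> V \<Longrightarrow> 1 \<le> card f"
  using fin_block block_nonempty by (simp add: Suc_leI card_gt_0_iff)

text \<open>If \<open>L - f\<close> is a block, its vertex has a further block, which lies strictly
  inside \<open>f\<close> and is not empty; so \<open>f\<close> has at least two labels.\<close>

lemma inner_flags_compl: "inner_flags T = {f \<in> \<Union>T. L - f \<in> \<Union>T}"
proof -
  have "2 \<le> card f" if V: "V \<in> T" "f \<in> V" and W: "W \<in> T" "L - f \<in> W" for V W f
  proof -
    obtain h where h: "h \<in> W" "h \<noteq> L - f" using third_block[OF W(1)] by metis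
    have "h \<subset> f" using beyond_psub[OF W h] block_sub[OF V] by blast
    then have "card h < card f" using fin_block[OF V] by (simp add: psubset_card_mono)
    then show ?thesis using card_block[OF W(1) h(1)] by simp
  qed
  then show ?thesis unfolding inner_flags_def using opposite_ex by blast
qed

lemma inner_flags_sub: "f \<in> inner_flags T \<Longrightarrow> f \<subseteq> L"
  unfolding inner_flags_def using block_sub by blast

lemma inner_flagsD:
  assumes "f \<in> inner_flags T"
  shows "vertex_of T f \<in> T" "f \<in> vertex_of T f" "vertex_of T (L - f) \<in> T" "L - f \<in> vertex_of T (L - f)"
    "f \<subseteq> L" "L - f \<in> inner_flags T" "L - (L - f) = f" "f \<noteq> L - f"
proof -
  show *: "f \<subseteq> L" by (rule inner_flags_sub[OF assms])
  then show **: "L - (L - f) = f" by blast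
  show "vertex_of T f \<in> T" "f \<in> vertex_of T f" "vertex_of T (L - f) \<in> T" "L - f \<in> vertex_of T (L - f)"
    using vertex_of_in assms by (auto simp: inner_flags_compl)
  show "L - f \<in> inner_flags T" using assms ** by (auto simp: inner_flags_compl)
  show "f \<noteq> L - f" using block_nonempty[of "vertex_of T f" f] \<open>vertex_of T f \<in> T\<close> \<open>f \<in> vertex_of T f\<close> * by blast
qed

lemma label_block_ex:
  assumes "V \<in> T" "\<rho> \<in> L" shows "\<exists>b\<in>V. \<rho> \<in> b"
  using Union_vertex assms by blast

lemma singleton_block: "card f = 1 \<Longrightarrow> \<rho> \<in> f \<Longrightarrow> f = {\<rho>}"
  by (metis card_1_singletonE singletonD)

text \<open>Walking towards a label makes the block containing it smaller at every step.\<close>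

lemma walk_to_label:
  assumes "V \<in> T" "\<rho> \<in> L"
  shows "\<exists>W\<in>T. {\<rho>} \<in> W \<and> (V, W) \<in> {(A, B). A \<in> T \<and> B \<in> T \<and> (\<exists>f\<in>A. L - f \<in> B)}\<^sup>*"
    (is "?P V")
proof -
  have "\<And>V b. V \<in> T \<Longrightarrow> b \<in> V \<Longrightarrow> \<rho> \<in> b \<Longrightarrow> card b = k \<Longrightarrow> ?P V" for k
  proof (induction k rule: less_induct)
    case (less k)
    show ?case
    proof (cases "2 \<le> card b")
      case True
      then obtain W where W: "W \<in> T" "L - b \<in> W" using opposite_ex less.prems by blast
      obtain c where c: "c \<in> W" "\<rho> \<in> c" using label_block_ex[OF W(1) assms(2)] by blast
      have "c \<subset> b" using beyond_psub[OF W c(1)] c less.prems block_sub by blast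
      then have "card c < k" using less.prems fin_block psubset_card_mono by metis
      from less.IH[OF this W(1) c refl] less.prems W show ?thesis
        by (blast intro: converse_rtrancl_into_rtrancl)
    next
      case False
      then have "card b = 1" using card_block less.prems by force
      then have "b = {\<rho>}" using singleton_block[OF _ less.prems(3)] by simp
      then show ?thesis using less.prems by blast
    qed
  qed
  then show ?thesis using label_block_ex[OF assms] assms by blast
qed

lemma singleton_in: "\<rho> \<in> L \<Longrightarrow> {\<rho>} \<in> \<Union>T"
  using walk_to_label T_nonempty by blast

text \<open>\<open>g\<close> and \<open>b\<close> are the flags by which the two vertices face each
  other. The proof roots the tree at a label and moves one of the vertices a step towards it; the
  total size of the two blocks that contain the root label drops.\<close>

lemma behind:
  assumes "V \<in> T" "V1 \<in> T" "V \<noteq> V1"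
  shows "\<exists>g\<in>V1. \<exists>b\<in>V. L - g \<subseteq> b" (is "?P V V1")
proof -
  obtain \<rho> where \<rho>: "\<rho> \<in> L"
    using assms(1) block_sub block_nonempty third_block by (metis all_not_in_conv subsetD)
  have "\<And>V V1 b0 g0. V \<in> T \<Longrightarrow> V1 \<in> T \<Longrightarrow> V \<noteq> V1 \<Longrightarrow> b0 \<in> V \<Longrightarrow> \<rho> \<in> b0 \<Longrightarrow> g0 \<in> V1 \<Longrightarrow> \<rho> \<in> g0 \<Longrightarrow>
     card b0 + card g0 = k \<Longrightarrow> ?P V V1" for k
  proof (induction k rule: less_induct)
    case (less k)
    note p = less.prems
    have sub: "b0 \<subseteq> L" "g0 \<subseteq> L" using p(1,2,4,6) block_sub by auto
    \<comment> \<open>The step of \<open>V\<close> towards the root label settles the claim unless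
      the edge just crossed is the one facing \<open>V1\<close>. This leads to
      \<open>b0 \<subset> g0\<close>: the vertex \<open>V\<close> separates \<open>V1\<close> from
      the root label.\<close>
    have up: goal if big: "2 \<le> card b0" and k1: "b0 \<subset> g0 \<Longrightarrow> goal" and k2: "?P V V1 \<Longrightarrow> goal" for goal
    proof -
      obtain V' where V': "V' \<in> T" "L - b0 \<in> V'" using opposite_ex[OF p(1,4) big] by blast
      obtain b1 where b1: "b1 \<in> V'" "\<rho> \<in> b1" using label_block_ex[OF V'(1) \<rho>] by blast
      have "b1 \<subset> b0" using beyond_psub[OF V' b1(1) _ sub(1)] b1(2) p(5) by blast
      from psubset_card_mono[OF fin_block[OF p(1,4)] this]
      have lt: "card b1 + card g0 < k" using p(8) by linarith
      show goal
      proof (cases "V' = V1")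
        case True
        then have "L - b0 \<in> V1" "L - (L - b0) \<subseteq> b0" using V' by auto
        then show goal using k2 p(4) by blast
      next
        case False
        from less.IH[OF lt V'(1) p(2) False b1 p(6,7) refl]
        obtain g b where gb: "g \<in> V1" "b \<in> V'" "L - g \<subseteq> b" by blast
        show goal
        proof (cases "b = L - b0")
          case True
          then have "b0 \<subseteq> g" using gb sub by blast
          then have "g = g0" using block_eq[OF p(2) gb(1) p(6) _ p(7)] p(5) by auto
          moreover have "b0 \<noteq> g0" using uniq[OF p(1,2,4)] p(3,6) by auto
          ultimately show goal using k1 \<open>b0 \<subseteq> g\<close> by blast
        next
          case False
          then have "b \<subseteq> b0" using beyond_psub[OF V' gb(2)] sub by blast
          then show goal using gb p(4) k2 by blast
        qed
      qed
    qed
    have down: goal if big: "2 \<le> card g0" and k1: "g0 \<subseteq> b0 \<Longrightarrow> goal" and k2: "?P V V1 \<Longrightarrow> goal" for goal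
    proof -
      obtain V' where V': "V' \<in> T" "L - g0 \<in> V'" using opposite_ex[OF p(2,6) big] by blast
      obtain g1 where g1: "g1 \<in> V'" "\<rho> \<in> g1" using label_block_ex[OF V'(1) \<rho>] by blast
      have "g1 \<subset> g0" using beyond_psub[OF V' g1(1) _ sub(2)] g1(2) p(7) by blast
      from psubset_card_mono[OF fin_block[OF p(2,6)] this]
      have lt: "card b0 + card g1 < k" using p(8) by linarith
      show goal
      proof (cases "V' = V")
        case True
        then show goal using V' k2 p(6) by blast
      next
        case False
        from less.IH[OF lt p(1) V'(1) False[symmetric] p(4,5) g1 refl]
        obtain g b where gb: "g \<in> V'" "b \<in> V" "L - g \<subseteq> b" by blast
        show goal
        proof (cases "g = L - g0")
          case True
          then have "g0 \<subseteq> b" using gb sub by blast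
          then have "b = b0" using block_eq[OF p(1) gb(2) p(4) _ p(5)] p(7) by auto
          then show goal using k1 \<open>g0 \<subseteq> b\<close> by blast
        next
          case False
          then have "g \<subseteq> g0" using beyond_psub[OF V' gb(1)] sub by blast
          then have "L - g0 \<subseteq> b" using gb by blast
          then show goal using gb p(6) k2 by blast
        qed
      qed
    qed
    show ?case
    proof (cases "2 \<le> card b0")
      case True
      show ?thesis
      proof (rule up[OF True])
        \<comment> \<open>Now \<open>V1\<close> is moved instead. Its exceptional case
          \<open>g0 \<subseteq> b0\<close> is excluded by \<open>lt\<close>.\<close>
        assume lt: "b0 \<subset> g0"
        have "2 \<le> card g0" using psubset_card_mono[OF fin_block[OF p(2,6)] lt] True by simp
        then show ?thesis by (rule down) (use lt in auto)
      qed auto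
    next
      case False
      then have "card b0 = 1" using card_block[OF p(1,4)] by simp
      then have b0: "b0 = {\<rho>}" using singleton_block[OF _ p(5)] by simp
      have "g0 \<noteq> b0" using uniq[OF p(1,2,4)] p(3,6) by auto
      then have "\<not> g0 \<subseteq> b0" using b0 p by blast
      moreover have "card g0 \<noteq> 1" using singleton_block[of g0 \<rho>] p(7) b0 \<open>g0 \<noteq> b0\<close> by auto
      ultimately have "2 \<le> card g0" using card_block[OF p(2,6)] by linarith
      then show ?thesis by (rule down) (use \<open>\<not> g0 \<subseteq> b0\<close> in auto)
    qed
  qed
  then show ?thesis
    using label_block_ex[OF assms(1) \<rho>] label_block_ex[OF assms(2) \<rho>] assms by (metis (no_types, lifting))
qed

lemma on_side_head: "L - S \<in> V \<Longrightarrow> on_side L S V"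
  unfolding on_side_def by blast

lemma not_on_side_tail:
  assumes "V \<in> T" "S \<in> V" "L - S \<in> W" "W \<in> T"
  shows "\<not> on_side L S V"
proof
  assume "on_side L S V"
  then obtain g where g: "g \<in> V" "L - S \<subseteq> g" unfolding on_side_def by blast
  have "L - S \<noteq> {}" using block_nonempty assms by blast
  then have "g \<noteq> S" using g by blast
  then have "g \<subset> L - S" using block_psub_compl[OF assms(1,2) g(1)] by blast
  then show False using g by blast
qed

text \<open>The only doubtful case is that the edge between the two vertices is itself the flag
  through which \<open>V\<close> sees \<open>L - S\<close>. Comparing \<open>V'\<close> with the
  head of \<open>S\<close> by \<open>behind\<close> shows that this flag could only fail if it were
  \<open>L - S\<close>.\<close>

lemma on_side_adj:
  assumes V: "V \<in> T" "f \<in> V" and V': "V' \<in> T" "L - f \<in> V'"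
    and S: "S \<in> inner_flags T" and ne: "f \<noteq> S" "f \<noteq> L - S"
    and side: "on_side L S V"
  shows "on_side L S V'"
proof -
  define B where "B = vertex_of T (L - S)"
  have B: "B \<in> T" "L - S \<in> B" "S \<subseteq> L" using inner_flagsD[OF S] by (auto simp: B_def)
  obtain g where g: "g \<in> V" "L - S \<subseteq> g" using side unfolding on_side_def by blast
  show ?thesis
  proof (cases "g = f")
    case False
    then have "g \<subseteq> L - f" using block_sub_compl[OF V g(1)] by blast
    then show ?thesis using g V' unfolding on_side_def by blast
  next
    case gf: True
    show ?thesis
    proof (cases "V' = B")
      case True then show ?thesis using on_side_head B by blast
    next
      case False
      from behind[OF V'(1) B(1) False] obtain h b where hb: "h \<in> B" "b \<in> V'" "L - h \<subseteq> b" by blast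
      show ?thesis
      proof (cases "h = L - S")
        case False
        then have "h \<subseteq> S" using beyond_psub[OF B(1,2) hb(1)] B by blast
        then have "L - S \<subseteq> b" using hb by blast
        then show ?thesis using hb unfolding on_side_def by blast
      next
        case True
        then have "S \<subseteq> b" using hb B by blast
        moreover have "L - f \<subseteq> S" using g gf by blast
        moreover have "L - f \<noteq> {}" using block_nonempty V' by blast
        ultimately have "b = L - f" using block_eq[OF V'(1) hb(2) V'(2)] by blast
        then have "f = L - S" using \<open>S \<subseteq> b\<close> \<open>L - f \<subseteq> S\<close> block_sub[OF V] by blast
        then show ?thesis using ne by blast
      qed
    qed
  qed
qed

lemma on_side_adj_iff:
  assumes V: "V \<in> T" "f \<in> V" and V': "V' \<in> T" "L - f \<in> V'"
    and S: "S \<in> inner_flags T" and ne: "f \<noteq> S" "f \<noteq> L - S"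
  shows "on_side L S V \<longleftrightarrow> on_side L S V'"
proof
  show "on_side L S V \<Longrightarrow> on_side L S V'" using on_side_adj[OF assms] .
  have f: "L - (L - f) = f" "L - (L - S) = S" using block_sub[OF V] inner_flagsD(7)[OF S] by auto
  have ne': "L - f \<noteq> S" "L - f \<noteq> L - S" using f ne by metis+
  then show "on_side L S V' \<Longrightarrow> on_side L S V"
    using on_side_adj[OF V' V(1) _ S ne'] f(1) V(2) by simp
qed

lemma fin_Union: "finite (\<Union>T)" using fin_T fin_vertex by blast

lemma fin_inner: "finite (inner_flags T)" unfolding inner_flags_def by (rule finite_subset[OF _ fin_Union]) auto

text \<open>Every vertex but the one carrying the root end has exactly one edge towards the root,
  and every bounded edge arises so once. This yields genus 0 for realized types and, later, the
  dimension of a cell.\<close>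

lemma card_away_flags:
  assumes \<rho>: "\<rho> \<in> L"
  shows "card T = card (away_flags T \<rho>) + 1"
proof -
  define r where "r V = (THE b. b \<in> V \<and> \<rho> \<in> b)" for V
  have r: "r V \<in> V" "\<rho> \<in> r V" if V: "V \<in> T" for V
  proof -
    obtain b where "b \<in> V" "\<rho> \<in> b" using label_block_ex[OF V \<rho>] by blast
    then have "\<exists>!b. b \<in> V \<and> \<rho> \<in> b" by (intro ex1I[of _ b]) (blast, rule block_eq[OF V], blast+)
    from theI'[OF this] show "r V \<in> V" "\<rho> \<in> r V" unfolding r_def by auto
  qed
  have r_eq: "r V = b" if "V \<in> T" "b \<in> V" "\<rho> \<in> b" for V b
    using block_eq[OF that(1) r(1)[OF that(1)] that(2) r(2)[OF that(1)] that(3)] .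
  define V0 where "V0 = vertex_of T {\<rho>}"
  have V0: "V0 \<in> T" "{\<rho>} \<in> V0" using vertex_of_in[OF singleton_in[OF \<rho>]] by (auto simp: V0_def)
  have "bij_betw (\<lambda>V. L - r V) (T - {V0}) (away_flags T \<rho>)"
  proof (rule bij_betw_imageI)
    show "inj_on (\<lambda>V. L - r V) (T - {V0})"
    proof (rule inj_onI)
      fix V W assume VW: "V \<in> T - {V0}" "W \<in> T - {V0}" "L - r V = L - r W"
      have "r V = r W" using VW block_sub[of V "r V"] block_sub[of W "r W"] r
        by (metis DiffD1 double_diff subset_refl)
      have "V \<in> T" "W \<in> T" using VW(1,2) by auto
      from uniq[OF this r(1)[OF this(1)]] show "V = W" using r(1)[OF \<open>W \<in> T\<close>] \<open>r V = r W\<close> by simp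
    qed
    show "(\<lambda>V. L - r V) ` (T - {V0}) = away_flags T \<rho>"
    proof (intro set_eqI iffI)
      fix f assume "f \<in> (\<lambda>V. L - r V) ` (T - {V0})"
      then obtain V where "V \<in> T - {V0}" and f: "f = L - r V" by (rule imageE)
      then have V: "V \<in> T" "V \<noteq> V0" by simp_all
      have "card (r V) \<noteq> 1" using singleton_block[of "r V" \<rho>] r[OF V(1)] uniq[OF V(1) V0(1)] V(2) V0(2) by fastforce
      then have "r V \<in> inner_flags T" 
        using card_block[OF V(1) r(1)[OF V(1)]] r(1)[OF V(1)] V(1) unfolding inner_flags_def by (simp, force)
      then show "f \<in> away_flags T \<rho>" using inner_flagsD(6) f r(2)[OF V(1)] by (simp add: away_flags_def)
    next
      fix f assume f: "f \<in> away_flags T \<rho>"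
      then have fi: "f \<in> inner_flags T" "\<rho> \<notin> f" by (auto simp: away_flags_def)
      note d = inner_flagsD[OF fi(1)]
      have "r (vertex_of T (L - f)) = L - f" using r_eq[OF d(3,4)] \<rho> fi(2) by simp
      moreover have "vertex_of T (L - f) \<noteq> V0"
      proof
        assume "vertex_of T (L - f) = V0"
        then have "L - f = {\<rho>}" using r_eq[OF V0(1) V0(2)] \<open>r (vertex_of T (L - f)) = L - f\<close> by simp
        moreover have "2 \<le> card (L - f)" using d(6) by (simp add: inner_flags_def)
        ultimately show False by simp
      qed
      ultimately show "f \<in> (\<lambda>V. L - r V) ` (T - {V0})"
        using d by (intro image_eqI[of _ _ "vertex_of T (L - f)"]) auto
    qed
  qed
  then have "card (away_flags T \<rho>) = card (T - {V0})" by (simp add: bij_betw_same_card)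
  then show ?thesis using V0(1) fin_T by (metis Suc_eq_plus1 card_Suc_Diff1)
qed

lemma inner_flags_away:
  assumes "\<rho> \<in> L" "f \<in> inner_flags T"
  shows "f \<in> away_flags T \<rho> \<or> L - f \<in> away_flags T \<rho>"
proof (cases "\<rho> \<in> f")
  case True
  then have "\<rho> \<notin> L - f" by simp
  then show ?thesis using inner_flagsD(6)[OF assms(2)] unfolding away_flags_def by blast
next
  case False
  then show ?thesis using assms(2) unfolding away_flags_def by blast
qed

text \<open>Flags are counted twice, by vertices and by edges: one for each end, two for each
  bounded edge.\<close>

lemma sum_card_vertices: 
  assumes \<rho>: "\<rho> \<in> L"
  shows "(\<Sum>V\<in>T. card V) = card L + 2 * card (away_flags T \<rho>)"
proof -
  have disj: "V \<inter> W = {}" if VW: "V \<in> T" "W \<in> T" "V \<noteq> W" for V W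
  proof (rule equals0I)
    fix x assume "x \<in> V \<inter> W"
    then have "x \<in> V" "x \<in> W" by simp_all
    then show False using uniq[OF VW(1,2)] VW(3) by blast
  qed
  have "card (\<Union>T) = (\<Sum>V\<in>T. card V)"
    using disj fin_vertex by (intro card_Union_disjoint) (auto simp: pairwise_def disjnt_def)
  moreover have "\<Union>T = (\<lambda>x. {x}) ` L \<union> inner_flags T" (is "_ = ?A \<union> _")
  proof (intro set_eqI iffI)
    fix f assume f: "f \<in> \<Union>T"
    then obtain V where V: "V \<in> T" "f \<in> V" by blast
    show "f \<in> ?A \<union> inner_flags T"
    proof (cases "2 \<le> card f")
      case True then show ?thesis using f by (simp add: inner_flags_def)
    next
      case False
      then have "card f = 1" using card_block[OF V] by simp
      then obtain x where "f = {x}" by (rule card_1_singletonE)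
      then show ?thesis using block_sub[OF V] by auto
    qed
  next
    fix f assume "f \<in> ?A \<union> inner_flags T"
    then show "f \<in> \<Union>T"
    proof
      assume "f \<in> ?A"
      then obtain x where "x \<in> L" "f = {x}" by (rule imageE)
      then show ?thesis using singleton_in[of x] by simp
    next
      assume "f \<in> inner_flags T"
      then show ?thesis by (simp add: inner_flags_def)
    qed
  qed
  moreover have "?A \<inter> inner_flags T = {}" by (auto simp: inner_flags_def)
  moreover have "card ?A = card L" by (simp add: card_image)
  moreover have "card (inner_flags T) = 2 * card (away_flags T \<rho>)"
  proof -
    have "inner_flags T = away_flags T \<rho> \<union> (\<lambda>f. L - f) ` away_flags T \<rho>"
    proof (intro set_eqI iffI)
      fix f assume f: "f \<in> inner_flags T"
      then have "f \<in> away_flags T \<rho> \<or> L - f \<in> away_flags T \<rho>" using inner_flags_away[OF \<rho>] by blast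
      then show "f \<in> away_flags T \<rho> \<union> (\<lambda>f. L - f) ` away_flags T \<rho>"
        using inner_flagsD(7)[OF f] by (metis UnCI image_eqI)
    next
      fix f assume "f \<in> away_flags T \<rho> \<union> (\<lambda>f. L - f) ` away_flags T \<rho>"
      then show "f \<in> inner_flags T" using inner_flagsD(6) by (auto simp: away_flags_def)
    qed
    moreover have "away_flags T \<rho> \<inter> (\<lambda>f. L - f) ` away_flags T \<rho> = {}"
      using \<rho> by (auto simp: away_flags_def)
    moreover have "inj_on (\<lambda>f. L - f) (away_flags T \<rho>)"
    proof (rule inj_onI)
      fix f g assume "f \<in> away_flags T \<rho>" "g \<in> away_flags T \<rho>" "L - f = L - g"
      then have fg: "f \<in> inner_flags T" "g \<in> inner_flags T" "L - f = L - g" by (simp_all add: away_flags_def)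
      show "f = g" using inner_flagsD(7)[OF fg(1)] inner_flagsD(7)[OF fg(2)] fg(3) by metis
    qed
    moreover have "finite (away_flags T \<rho>)" using fin_inner by (simp add: away_flags_def)
    ultimately show ?thesis by (simp add: card_Un_disjoint card_image)
  qed
  moreover have "finite ?A" using fin_L by simp
  ultimately show ?thesis using fin_inner by (simp add: card_Un_disjoint)
qed

end

section \<open>Structure constants\<close>

lemma det2_add_left: "det2 (a + b) c = det2 a c + det2 b c"
  and det2_add_right: "det2 c (a + b) = det2 c a + det2 c b"
  and det2_minus_left: "det2 (- a) c = - det2 a c"
  and det2_minus_right: "det2 c (- a) = - det2 c a"
  and det2_diff_left: "det2 (a - b) c = det2 a c - det2 b c"
  and det2_diff_right: "det2 c (a - b) = det2 c a - det2 c b"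
  and det2_swap: "det2 c a = - det2 a c"
  and det2_self: "det2 a a = 0"
  and det2_zero_left: "det2 0 a = 0"
  and det2_zero_right: "det2 a 0 = 0"
  by (simp_all add: det2_def algebra_simps)

lemma det2_scale_right: "det2 u (c *\<^sub>R w) = c * det2 u (w :: real \<times> real)"
  by (simp add: det2_def algebra_simps)

lemma real_vec_add: "real_vec (a + b) = real_vec a + real_vec b"
  and real_vec_minus: "real_vec (- a) = - real_vec a"
  by (simp_all add: real_vec_def zero_prod_def)

lemma real_vec_eq_0: "real_vec a = 0 \<longleftrightarrow> a = 0"
  by (simp add: real_vec_def zero_prod_def prod_eq_iff)

lemma det2_real_vec: "det2 (real_vec a) (real_vec b) = real_of_int (det2 a b)"
  by (simp add: det2_def real_vec_def)

definition parity_sign :: "int \<Rightarrow> complex" where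
  "parity_sign k = (if even k then 1 else - 1)"

lemma ii_powi_add: "\<i> powi (a + b) = \<i> powi a * \<i> powi b"
  by (simp add: power_int_add)

lemma ii_powi_double: "\<i> powi (2 * k) = parity_sign k"
proof -
  have "\<i> powi (2 * k) = (\<i> powi 2) powi k" by (rule power_int_mult)
  also have "\<i> powi 2 = (-1 :: complex)" by simp
  also have "(-1 :: complex) powi k = parity_sign k"
    by (simp add: parity_sign_def power_int_minus_left)
  finally show ?thesis .
qed

lemma parity_sign_minus: "parity_sign (- k) = parity_sign k"
  by (simp add: parity_sign_def)

text \<open>Two odd inflows with odd sum form a vertex of type (2), which has no factor
  \<open>a\<close>; with even sum they form no allowed vertex, whence 0. An even inflow means type
  (3) or (4), with the factor \<open>a\<close> taken with its sign.\<close>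

definition join_int :: "int \<times> int \<Rightarrow> int \<times> int \<Rightarrow> int" where
  "join_int p q =
     (if \<not> even_vec p \<and> \<not> even_vec q then (if even_vec (p + q) then 0 else 1) else det2 p q)"

text \<open>Three odd edges form type (5), with the factor \<open>a\<close>; exactly one even edge
  forms type (6), without it; three even edges form no allowed vertex.\<close>

definition source_int :: "int \<times> int \<Rightarrow> int \<times> int \<Rightarrow> int" where
  "source_int p q =
     (if \<not> even_vec p \<and> \<not> even_vec q \<and> \<not> even_vec (p + q) then det2 p q
      else if even_vec p \<and> even_vec q then 0 else 1)"

text \<open>
  Up to the sign of the determinant, these are the multiplicities of the vertices with two
  incoming edges of directions \<open>p\<close> and \<open>q\<close>, and of the vertices with a complex marking and
  outgoing edges of directions \<open>p\<close>, \<open>q\<close> and \<open>- p - q\<close>. The first are the structure constants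
  of a Lie algebra graded by the lattice.
\<close>

definition join_coeff :: "int \<times> int \<Rightarrow> int \<times> int \<Rightarrow> complex" where
  "join_coeff p q = of_int (join_int p q) * \<i> powi (det2 p q - 1)"

definition source_coeff :: "int \<times> int \<Rightarrow> int \<times> int \<Rightarrow> complex" where
  "source_coeff p q = of_int (source_int p q) * \<i> powi (det2 p q - 1)"

text \<open>This splits off a power of \<open>\<i>\<close> that is symmetric in the three
  determinants. What remains of the exponents is a sign, so the identities below become identities
  of integers.\<close>

lemma powi_product:
  "\<i> powi (x - 1) * \<i> powi (z - y - 1) = \<i> powi (x + y + z - 2) * parity_sign y"
proof -
  have "\<i> powi (x - 1) * \<i> powi (z - y - 1) = \<i> powi ((x + y + z - 2) + 2 * (- y))"
    unfolding ii_powi_add[symmetric] by (rule arg_cong[of _ _ "\<lambda>k. \<i> powi k"]) simp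
  then show ?thesis by (simp only: ii_powi_add ii_powi_double parity_sign_minus)
qed

lemma even_vec_Pair: "even_vec (a, b) \<longleftrightarrow> even a \<and> even b"
  by (simp add: even_vec_def)

text \<open>The parities of the six coordinates decide all case distinctions. In each case every
  factor is 0, 1 or a determinant, and the remaining identity is polynomial.\<close>

lemma jacobi_int:
  fixes a b c :: "int \<times> int"
  defines "x \<equiv> det2 b c" and "y \<equiv> det2 c a" and "z \<equiv> det2 a b"
  shows "join_int b c * join_int a (b + c) * (if even y then 1 else -1)
       + join_int c a * join_int b (c + a) * (if even z then 1 else -1)
       + join_int a b * join_int c (a + b) * (if even x then 1 else -1) = 0"
proof -
  obtain a1 a2 b1 b2 c1 c2 where [simp]: "a = (a1, a2)" "b = (b1, b2)" "c = (c1, c2)"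
    by (metis surj_pair)
  show ?thesis unfolding x_def y_def z_def join_int_def
    by (cases "even a1"; cases "even a2"; cases "even b1"; cases "even b2"; cases "even c1"; cases "even c2")
       (simp_all add: even_vec_Pair det2_def, (simp add: algebra_simps)+)
qed

text \<open>The signs are shifted cyclically against \<open>jacobi_int\<close>, because
  \<open>det2 w (b + c)\<close> is \<open>y - z\<close> whereas \<open>det2 a (b + c)\<close> is
  \<open>z - y\<close>.\<close>

lemma source_int_identity:
  fixes a b c :: "int \<times> int"
  defines "x \<equiv> det2 b c" and "y \<equiv> det2 c a" and "z \<equiv> det2 a b" and "w \<equiv> - (a + b + c)"
  shows "source_int b c * join_int w (b + c) * (if even z then 1 else -1)
       + source_int c a * join_int w (c + a) * (if even x then 1 else -1)
       + source_int a b * join_int w (a + b) * (if even y then 1 else -1) = 0"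
proof -
  obtain a1 a2 b1 b2 c1 c2 where [simp]: "a = (a1, a2)" "b = (b1, b2)" "c = (c1, c2)"
    by (metis surj_pair)
  show ?thesis unfolding x_def y_def z_def w_def join_int_def source_int_def
    by (cases "even a1"; cases "even a2"; cases "even b1"; cases "even b2"; cases "even c1"; cases "even c2")
       (simp_all add: even_vec_Pair det2_def, (simp add: algebra_simps)+)
qed

lemma join_coeff_jacobi:
  "join_coeff b c * join_coeff a (b + c) + join_coeff c a * join_coeff b (c + a)
     + join_coeff a b * join_coeff c (a + b) = 0"
proof -
  define x y z where "x = det2 b c" "y = det2 c a" "z = det2 a b"
  note xyz = this
  define E where "E = \<i> powi (x + y + z - 2)"
  have d: "det2 a (b + c) = z - y" "det2 b (c + a) = x - z" "det2 c (a + b) = y - x"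
    by (simp_all add: xyz det2_def algebra_simps)
  have "join_coeff b c * join_coeff a (b + c) = of_int (join_int b c * join_int a (b + c)) * (E * parity_sign y)"
    unfolding join_coeff_def d xyz(1)[symmetric] E_def powi_product[symmetric] by simp
  moreover have "join_coeff c a * join_coeff b (c + a) = of_int (join_int c a * join_int b (c + a)) * (E * parity_sign z)"
    using powi_product[of y x z] unfolding join_coeff_def d xyz(2)[symmetric] E_def by (simp add: algebra_simps)
  moreover have "join_coeff a b * join_coeff c (a + b) = of_int (join_int a b * join_int c (a + b)) * (E * parity_sign x)"
    using powi_product[of z y x] unfolding join_coeff_def d xyz(3)[symmetric] E_def by (simp add: algebra_simps)
  ultimately have "?thesis \<longleftrightarrow> E * of_int (join_int b c * join_int a (b + c) * (if even y then 1 else -1)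
       + join_int c a * join_int b (c + a) * (if even z then 1 else -1)
       + join_int a b * join_int c (a + b) * (if even x then 1 else -1)) = 0"
    by (simp add: parity_sign_def algebra_simps split: if_splits)
  then show ?thesis using jacobi_int[of b c a] by (simp add: xyz)
qed

lemma source_coeff_identity:
  assumes "w + a + b + c = 0"
  shows "source_coeff b c * join_coeff w (b + c) + source_coeff c a * join_coeff w (c + a)
     + source_coeff a b * join_coeff w (a + b) = 0"
proof -
  have w: "w = - (a + b + c)" using assms by (simp add: eq_neg_iff_add_eq_0 algebra_simps)
  define x y z where "x = det2 b c" "y = det2 c a" "z = det2 a b"
  note xyz = this
  define E where "E = \<i> powi (x + y + z - 2)"
  have d: "det2 w (b + c) = y - z" "det2 w (c + a) = z - x" "det2 w (a + b) = x - y"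
    by (simp_all add: w xyz det2_def algebra_simps)
  have "source_coeff b c * join_coeff w (b + c) = of_int (source_int b c * join_int w (b + c)) * (E * parity_sign z)"
    using powi_product[of x y z] unfolding join_coeff_def source_coeff_def d xyz(1)[symmetric] E_def by (simp add: algebra_simps)
  moreover have "source_coeff c a * join_coeff w (c + a) = of_int (source_int c a * join_int w (c + a)) * (E * parity_sign x)"
    using powi_product[of y z x] unfolding join_coeff_def source_coeff_def d xyz(2)[symmetric] E_def by (simp add: algebra_simps)
  moreover have "source_coeff a b * join_coeff w (a + b) = of_int (source_int a b * join_int w (a + b)) * (E * parity_sign y)"
    using powi_product[of z x y] unfolding join_coeff_def source_coeff_def d xyz(3)[symmetric] E_def by (simp add: algebra_simps)
  ultimately have "?thesis \<longleftrightarrow> E * of_int (source_int b c * join_int w (b + c) * (if even z then 1 else -1)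
       + source_int c a * join_int w (c + a) * (if even x then 1 else -1)
       + source_int a b * join_int w (a + b) * (if even y then 1 else -1)) = 0"
    by (simp add: parity_sign_def algebra_simps split: if_splits)
  then show ?thesis
    using source_int_identity[of b c a, folded xyz, folded w] by (simp only: of_int_0 mult_zero_right)
qed

text \<open>The factors 0 and 1 are the multiplicities of a vertex with a real marking. If
  \<open>a\<close> and \<open>b\<close> are odd, the two terms belong to the determinants
  \<open>- k\<close> and \<open>k\<close>. For even \<open>w\<close> the number \<open>k\<close> is
  even and the coefficient is odd in \<open>k\<close>; for odd \<open>w\<close> it is odd and the
  two powers of \<open>\<i>\<close> are opposite.\<close>

lemma real_source_identity:
  assumes "w + a + b = 0"
  shows "(if even_vec b then 0 else join_coeff w b) + (if even_vec a then 0 else join_coeff w a) = 0"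
proof -
  have w: "w = - a - b" using assms by (simp add: algebra_simps eq_neg_iff_add_eq_0)
  have d: "det2 w b = - det2 a b" "det2 w a = det2 a b" by (simp_all add: w det2_def algebra_simps)
  have ev: "even_vec (w + b) = even_vec a" "even_vec (w + a) = even_vec b" by (simp_all add: w even_vec_def)
  show ?thesis
  proof (cases "even_vec a \<or> even_vec b")
    case True
    moreover have "even_vec w" if "even_vec a" "even_vec b" using that by (simp add: w even_vec_def)
    moreover have "\<not> even_vec w" if "even_vec a \<noteq> even_vec b" using that by (auto simp add: w even_vec_def)
    ultimately show ?thesis by (auto simp: join_coeff_def join_int_def ev)
  next
    case False
    define k where "k = det2 a b"
    have "\<i> powi (- k - 1) = \<i> powi ((k - 1) + 2 * (- k))" by (rule arg_cong[of _ _ "\<lambda>k. \<i> powi k"]) simp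
    then have p: "\<i> powi (- k - 1) = \<i> powi (k - 1) * parity_sign k"
      by (simp only: ii_powi_add ii_powi_double parity_sign_minus)
    have "even k" if "even_vec w" using that False unfolding k_def w det2_def even_vec_def
      by (auto simp: fst_diff snd_diff)
    moreover have "odd k" if "\<not> even_vec w" using that False unfolding k_def w det2_def even_vec_def
      by (auto simp: fst_diff snd_diff)
    ultimately show ?thesis using False
      by (auto simp: join_coeff_def join_int_def ev d k_def[symmetric] p parity_sign_def)
  qed
qed

lemma powi_abs: "\<i> powi (\<bar>k\<bar> - 1) = \<i> powi (k - 1) * (if k < 0 then parity_sign k else 1)"
proof (cases "k < 0")
  case True
  have "\<i> powi (\<bar>k\<bar> - 1) = \<i> powi ((k - 1) + 2 * (- k))" using True by (intro arg_cong[of _ _ "\<lambda>k. \<i> powi k"]) simp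
  then show ?thesis using True by (simp only: ii_powi_add ii_powi_double parity_sign_minus if_True)
qed simp

lemma odd_det2: "\<not> even_vec p \<Longrightarrow> \<not> even_vec q \<Longrightarrow> \<not> even_vec (p + q) \<Longrightarrow> odd (det2 p q)"
  by (auto simp: even_vec_def det2_def)

lemma even_det2: "even_vec p \<or> even_vec q \<or> even_vec (p + q) \<Longrightarrow> even (det2 p q)"
  by (auto simp: even_vec_def det2_def)

text \<open>Replacing the absolute value of \<open>k\<close> by \<open>k\<close> in the exponent
  costs \<open>(-1)^k\<close> if \<open>k\<close> is negative. For three odd edges \<open>k\<close>
  is odd, and this factor is cancelled by the sign of the determinant; otherwise \<open>k\<close> is
  even, and the sign goes into the factor \<open>a\<close>.\<close>

lemma join_coeff_abs:
  assumes "even_vec p \<or> even_vec q \<or> \<not> even_vec (p + q)"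
  shows "of_int (sgn (det2 p q)) *
      (if \<not> even_vec p \<and> \<not> even_vec q then \<i> powi (\<bar>det2 p q\<bar> - 1)
       else of_int \<bar>det2 p q\<bar> * \<i> powi (\<bar>det2 p q\<bar> - 1)) = join_coeff p q"
proof (cases "\<not> even_vec p \<and> \<not> even_vec q")
  case True
  then have "odd (det2 p q)" using assms odd_det2 by blast
  then have "det2 p q \<noteq> 0" by auto
  then show ?thesis using True assms \<open>odd (det2 p q)\<close>
    by (auto simp: join_coeff_def join_int_def powi_abs parity_sign_def sgn_if)
next
  case False
  then have "even (det2 p q)" using even_det2 by blast
  then show ?thesis using False by (auto simp: join_coeff_def join_int_def powi_abs parity_sign_def sgn_if)
qed

text \<open>In contrast to \<open>join_coeff_abs\<close> no sign is left over: \<open>k\<close> is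
  odd exactly when the factor \<open>a\<close> is present, and then the sign from the exponent and
  the sign from the factor cancel.\<close>

lemma source_coeff_abs:
  assumes "\<not> (even_vec p \<and> even_vec q)"
  shows "(if even_vec p \<or> even_vec q \<or> even_vec (p + q) then \<i> powi (\<bar>det2 p q\<bar> - 1)
       else of_int \<bar>det2 p q\<bar> * \<i> powi (\<bar>det2 p q\<bar> - 1)) = source_coeff p q"
proof (cases "even_vec p \<or> even_vec q \<or> even_vec (p + q)")
  case True
  then have "even (det2 p q)" by (rule even_det2)
  then show ?thesis using True assms
    by (auto simp: source_coeff_def source_int_def powi_abs parity_sign_def)
next
  case False
  then have "odd (det2 p q)" using odd_det2 by blast
  then show ?thesis using False
    by (auto simp: source_coeff_def source_int_def powi_abs parity_sign_def)
qed

text \<open>The only case without a factor \<open>det2 p q\<close> is that of three odd edges, and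
  there the determinant is odd. So types with parallel inflows contribute nothing to the identities
  and can be left out of the count.\<close>

lemma join_coeff_parallel: "det2 p q = 0 \<Longrightarrow> join_coeff p q = 0"
  using odd_det2[of p q] by (auto simp: join_coeff_def join_int_def)

lemma join_coeff_forbidden: "\<not> even_vec p \<Longrightarrow> \<not> even_vec q \<Longrightarrow> even_vec (p + q) \<Longrightarrow> join_coeff p q = 0"
  by (simp add: join_coeff_def join_int_def)

lemma source_coeff_even: "even_vec p \<Longrightarrow> even_vec q \<Longrightarrow> source_coeff p q = 0"
  by (auto simp: source_coeff_def source_int_def even_vec_def)

section \<open>Types of broccoli curves\<close>

text \<open>The assumption \<open>v_sum\<close> is not one of the theorem: it follows as soon as one
  marked curve exists (\<open>marked_curve_degree_sum\<close>), and without broccoli curves both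
  numbers are 0.\<close>

locale broccoli_data =
  fixes r s n :: nat and v :: "nat \<Rightarrow> int \<times> int" and F :: "nat set"
  assumes v_nonzero: "j \<in> {1..n} \<Longrightarrow> v j \<noteq> 0"
    and F_sub: "F \<subseteq> {1..n}"
    and count: "int r + 2 * int s + int (card F) = int n - 1"
    and v_sum: "(\<Sum>j=1..n. v j) = 0"
begin

text \<open>
  The labels \<open>1..r+s\<close> stand for the markings and \<open>r+s+j\<close> for the end \<open>y\<^sub>j\<close>. The charge of
  the set of labels behind an edge is \<open>1\<close> if the edge is oriented towards them and \<open>0\<close>
  otherwise; at a vertex the charges sum up to \<open>1\<close>.
\<close>

definition labels :: "nat set" where "labels = {1..r + s + n}"

definition label_dir :: "nat \<Rightarrow> int \<times> int" where
  "label_dir l = (if l \<le> r + s then 0 else v (l - (r + s)))"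

definition label_charge :: "nat \<Rightarrow> int" where
  "label_charge l = (if l \<le> r then - 1 else if l \<le> r + s then - 2 else if l - (r + s) \<in> F then 0 else 1)"

definition bdir :: "nat set \<Rightarrow> int \<times> int" where "bdir f = (\<Sum>l\<in>f. label_dir l)"

definition charge :: "nat set \<Rightarrow> int" where "charge f = (\<Sum>l\<in>f. label_charge l)"

definition markings :: "nat set set" where "markings = (\<lambda>i. {i}) ` {1..r + s}"

definition block_det :: "nat set set \<Rightarrow> nat" where
  "block_det V =
     (THE a. \<exists>f\<in>V - markings. \<exists>g\<in>V - markings. f \<noteq> g \<and> a = nat \<bar>det2 (bdir f) (bdir g)\<bar>)"

text \<open>Types (2) to (4) together. By balancing the parities of \<open>a\<close> and
  \<open>b\<close> determine that of \<open>c\<close>, and only two odd edges flowing into an even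
  one must be excluded.\<close>

definition is_join :: "nat set set \<Rightarrow> nat set \<Rightarrow> nat set \<Rightarrow> nat set \<Rightarrow> bool" where
  "is_join V a b c \<longleftrightarrow> V = {a, b, c} \<and> a \<noteq> b \<and> a \<noteq> c \<and> b \<noteq> c \<and>
     charge a = 0 \<and> charge b = 0 \<and> charge c = 1 \<and>
     (even_vec (bdir a) \<or> even_vec (bdir b) \<or> \<not> even_vec (bdir c))"

definition is_real :: "nat set set \<Rightarrow> nat \<Rightarrow> nat set \<Rightarrow> nat set \<Rightarrow> bool" where
  "is_real V i a b \<longleftrightarrow> V = {{i}, a, b} \<and> i \<in> {1..r} \<and> a \<noteq> b \<and>
     charge a = 1 \<and> charge b = 1 \<and> \<not> even_vec (bdir a) \<and> \<not> even_vec (bdir b)"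

text \<open>Types (5) and (6) together. By balancing there cannot be exactly two even edges, so
  excluding three leaves none or one.\<close>

definition is_complex :: "nat set set \<Rightarrow> nat \<Rightarrow> nat set \<Rightarrow> nat set \<Rightarrow> nat set \<Rightarrow> bool" where
  "is_complex V i a b c \<longleftrightarrow> V = {{i}, a, b, c} \<and> i \<in> {r + 1..r + s} \<and> a \<noteq> b \<and> a \<noteq> c \<and> b \<noteq> c \<and>
     charge a = 1 \<and> charge b = 1 \<and> charge c = 1 \<and>
     \<not> (even_vec (bdir a) \<and> even_vec (bdir b) \<and> even_vec (bdir c))"

definition join_vertex :: "nat set set \<Rightarrow> bool" where
  "join_vertex V \<longleftrightarrow> (\<exists>a b c. is_join V a b c)"

definition real_vertex :: "nat set set \<Rightarrow> bool" where
  "real_vertex V \<longleftrightarrow> (\<exists>i a b. is_real V i a b)"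

definition complex_vertex :: "nat set set \<Rightarrow> bool" where
  "complex_vertex V \<longleftrightarrow> (\<exists>i a b c. is_complex V i a b c)"

definition block_mult :: "nat set set \<Rightarrow> complex" where
  "block_mult V =
     (if real_vertex V then 1
      else if (join_vertex V \<and> (\<forall>f\<in>V. \<not> even_vec (bdir f))) \<or>
              (complex_vertex V \<and> (\<exists>f\<in>V - markings. even_vec (bdir f)))
        then \<i> powi (int (block_det V) - 1)
      else of_nat (block_det V) * \<i> powi (int (block_det V) - 1))"

definition broccoli_vertex :: "nat set set \<Rightarrow> bool" where
  "broccoli_vertex V \<longleftrightarrow> join_vertex V \<or> real_vertex V \<or> complex_vertex V"

definition degenerate :: "nat set set \<Rightarrow> bool" where
  "degenerate V \<longleftrightarrow> (\<exists>a b c. is_join V a b c \<and> det2 (bdir a) (bdir b) = 0)"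

lemma fin_labels: "finite labels" by (simp add: labels_def)

lemma label_cases:
  assumes "l \<in> labels"
  obtains "l \<in> {1..r}" | "l \<in> {r + 1..r + s}" | j where "j \<in> {1..n}" "l = r + s + j"
proof -
  have "1 \<le> l" "l \<le> r + s + n" using assms by (auto simp: labels_def)
  then consider "l \<in> {1..r}" | "l \<in> {r + 1..r + s}" | "l - (r + s) \<in> {1..n} \<and> l = r + s + (l - (r + s))"
    by force
  then show thesis using that by cases metis+
qed

lemma labels_split: "labels = {1..r} \<union> {r + 1..r + s} \<union> (\<lambda>j. r + s + j) ` {1..n}"
proof (intro set_eqI iffI)
  fix l assume "l \<in> labels"
  then show "l \<in> {1..r} \<union> {r + 1..r + s} \<union> (\<lambda>j. r + s + j) ` {1..n}"
    by (cases rule: label_cases) auto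
qed (auto simp: labels_def)

text \<open>This is where the condition on \<open>r\<close>, \<open>s\<close> and \<open>F\<close>
  enters. As the total charge is 1, the charges of the two flags of an edge add up to 1, as an
  orientation requires.\<close>

lemma charge_labels: "charge labels = 1"
proof -
  have d: "{1..r} \<inter> {r + 1..r + s} = {}" "({1..r} \<union> {r + 1..r + s}) \<inter> (\<lambda>j. r + s + j) ` {1..n} = {}"
    by auto
  have "charge labels = (\<Sum>l\<in>{1..r} \<union> {r + 1..r + s}. label_charge l)
      + (\<Sum>l\<in>(\<lambda>j. r + s + j) ` {1..n}. label_charge l)"
    unfolding charge_def labels_split by (rule sum.union_disjoint[OF _ _ d(2)]) auto
  also have "(\<Sum>l\<in>{1..r} \<union> {r + 1..r + s}. label_charge l)
      = (\<Sum>l\<in>{1..r}. label_charge l) + (\<Sum>l\<in>{r + 1..r + s}. label_charge l)"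
    by (rule sum.union_disjoint[OF _ _ d(1)]) auto
  also have "(\<Sum>l\<in>{1..r}. label_charge l) = (\<Sum>l\<in>{1..r}. - 1)"
    by (rule sum.cong) (auto simp: label_charge_def)
  also have "(\<Sum>l\<in>{r + 1..r + s}. label_charge l) = (\<Sum>l\<in>{r + 1..r + s}. - 2)"
    by (rule sum.cong) (auto simp: label_charge_def)
  also have "(\<Sum>l\<in>(\<lambda>j. r + s + j) ` {1..n}. label_charge l) = (\<Sum>j\<in>{1..n}. if j \<in> F then 0 else 1)"
    by (subst sum.reindex) (auto simp: label_charge_def intro!: sum.cong)
  also have "\<dots> = (\<Sum>j\<in>{1..n} - F. 1)"
    by (rule sum.mono_neutral_cong_right) auto
  also have "\<dots> = int n - int (card F)"
  proof -
    have "card F \<le> n" using card_mono[OF _ F_sub] by simp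
    then show ?thesis using F_sub by (simp add: card_Diff_subset finite_subset[OF F_sub] of_nat_diff)
  qed
  finally show ?thesis using count by simp
qed

lemma bdir_labels: "bdir labels = 0"
proof -
  have "bdir labels = (\<Sum>l\<in>(\<lambda>j. r + s + j) ` {1..n}. label_dir l)"
    unfolding bdir_def by (rule sum.mono_neutral_right) (auto simp: labels_split label_dir_def)
  also have "\<dots> = (\<Sum>j=1..n. v j)"
    by (subst sum.reindex) (auto simp: label_dir_def intro!: sum.cong)
  finally show ?thesis using v_sum by simp
qed

lemma bdir_compl: "f \<subseteq> labels \<Longrightarrow> bdir (labels - f) = - bdir f"
  using bdir_labels sum.subset_diff[OF _ fin_labels, of f label_dir]
  by (simp add: bdir_def eq_neg_iff_add_eq_0)

lemma charge_compl: "f \<subseteq> labels \<Longrightarrow> charge (labels - f) = 1 - charge f"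
  using charge_labels sum.subset_diff[OF _ fin_labels, of f label_charge] by (simp add: charge_def)

lemma bdir_Un: "finite f \<Longrightarrow> finite g \<Longrightarrow> f \<inter> g = {} \<Longrightarrow> bdir (f \<union> g) = bdir f + bdir g"
  and charge_Un: "finite f \<Longrightarrow> finite g \<Longrightarrow> f \<inter> g = {} \<Longrightarrow> charge (f \<union> g) = charge f + charge g"
  by (simp_all add: bdir_def charge_def sum.union_disjoint)

lemma charge_marking: "f \<in> markings \<Longrightarrow> charge f < 0"
  by (auto simp: markings_def charge_def label_charge_def)

lemma bdir_marking: "f \<in> markings \<Longrightarrow> bdir f = 0"
  by (auto simp: markings_def bdir_def label_dir_def)

lemma real_charge: "i \<in> {1..r} \<Longrightarrow> charge {i} = - 1"
  and complex_charge: "i \<in> {r + 1..r + s} \<Longrightarrow> charge {i} = - 2"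
  by (auto simp: charge_def label_charge_def)

lemma end_block: "j \<in> {1..n} \<Longrightarrow> bdir {r + s + j} = v j"
  "j \<in> {1..n} \<Longrightarrow> charge {r + s + j} = (if j \<in> F then 0 else 1)"
  by (auto simp: bdir_def label_dir_def charge_def label_charge_def)

lemma singleton_charge0:
  assumes "l \<in> labels" "charge {l} = 0"
  shows "\<exists>j\<in>F. l = r + s + j"
  using assms(1)
proof (cases rule: label_cases)
  case (3 j)
  then show ?thesis using assms(2) end_block(2)[of j] by (auto split: if_splits)
qed (use assms(2) real_charge complex_charge in auto)

lemma partition_sums:
  assumes "partition_on labels V"
  shows "(\<Sum>f\<in>V. bdir f) = 0" "(\<Sum>f\<in>V. charge f) = 1"
proof -
  have "finite V" using finite_elements[OF fin_labels assms] .
  moreover have "\<forall>f\<in>V. finite f"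
    using assms fin_labels by (auto simp: partition_on_def intro: finite_subset[OF Union_upper])
  moreover have "\<forall>f\<in>V. \<forall>g\<in>V. f \<noteq> g \<longrightarrow> f \<inter> g = {}"
    using assms by (meson partition_on_def disjointD)
  ultimately have "(\<Sum>f\<in>V. sum h f) = sum h (\<Union>V)" for h :: "nat \<Rightarrow> 'z::comm_monoid_add"
    by (simp add: sum.Union_disjoint)
  moreover have "\<Union>V = labels" using assms by (simp add: partition_on_def)
  ultimately show "(\<Sum>f\<in>V. bdir f) = 0" "(\<Sum>f\<in>V. charge f) = 1"
    using bdir_labels charge_labels unfolding bdir_def charge_def by metis+
qed

lemma join_dirs:
  assumes "partition_on labels V" "is_join V a b c"
  shows "bdir c = - (bdir a + bdir b)"
  using partition_sums(1)[OF assms(1)] assms(2) by (auto simp: is_join_def eq_neg_iff_add_eq_0 algebra_simps)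

lemma complex_dirs:
  assumes "partition_on labels V" "is_complex V i a b c"
  shows "bdir c = - (bdir a + bdir b)"
proof -
  have i: "{i} \<in> markings" using assms(2) by (auto simp: is_complex_def markings_def)
  then have "{i} \<noteq> a" "{i} \<noteq> b" "{i} \<noteq> c" using charge_marking[OF i] assms(2) by (auto simp: is_complex_def)
  then show ?thesis
    using partition_sums(1)[OF assms(1)] assms(2) bdir_marking[OF i]
    by (auto simp: is_complex_def eq_neg_iff_add_eq_0 algebra_simps)
qed

lemma block_det_three:
  assumes "V - markings = {a, b, c}" "a \<noteq> b" "a \<noteq> c" "b \<noteq> c" "bdir c = - (bdir a + bdir b)"
  shows "block_det V = nat \<bar>det2 (bdir a) (bdir b)\<bar>"
proof -
  have "det2 (bdir a) (bdir c) = - det2 (bdir a) (bdir b)" "det2 (bdir c) (bdir a) = det2 (bdir a) (bdir b)"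
    "det2 (bdir b) (bdir c) = det2 (bdir a) (bdir b)" "det2 (bdir c) (bdir b) = - det2 (bdir a) (bdir b)"
    "det2 (bdir b) (bdir a) = - det2 (bdir a) (bdir b)"
    unfolding assms(5) by (simp_all add: det2_def algebra_simps)
  then show ?thesis unfolding block_det_def assms(1)
    by (intro the_equality) (use assms(2-4) in auto)
qed

lemma not_marking: "0 \<le> charge f \<Longrightarrow> f \<notin> markings"
  using charge_marking by fastforce

lemma join_unmarked: "is_join V a b c \<Longrightarrow> V - markings = {a, b, c}" "is_join V a b c \<Longrightarrow> V \<inter> markings = {}"
  using not_marking by (auto simp: is_join_def)

lemma complex_unmarked: "is_complex V i a b c \<Longrightarrow> V - markings = {a, b, c}"
proof -
  assume V: "is_complex V i a b c"
  then have "{i} \<in> markings" "a \<notin> markings" "b \<notin> markings" "c \<notin> markings"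
    using not_marking[of a] not_marking[of b] not_marking[of c] by (simp_all add: is_complex_def markings_def)
  moreover have "V = {{i}, a, b, c}" using V by (simp add: is_complex_def)
  ultimately show ?thesis by (simp add: insert_Diff_if)
qed

lemma real_unmarked: "is_real V i a b \<Longrightarrow> V - markings = {a, b}"
proof -
  assume V: "is_real V i a b"
  then have "{i} \<in> markings" "a \<notin> markings" "b \<notin> markings"
    using not_marking[of a] not_marking[of b] by (simp_all add: is_real_def markings_def)
  moreover have "V = {{i}, a, b}" using V by (simp add: is_real_def)
  ultimately show ?thesis by (simp add: insert_Diff_if)
qed

lemma vertex_kinds_disjoint:
  "join_vertex V \<Longrightarrow> \<not> real_vertex V" "join_vertex V \<Longrightarrow> \<not> complex_vertex V" "complex_vertex V \<Longrightarrow> \<not> real_vertex V"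
proof -
  have m: "{i} \<in> V \<and> {i} \<in> markings \<and> charge {i} = - 1" if "is_real V i a b" for i a b
    using that real_charge by (auto simp: is_real_def markings_def)
  have m': "{i} \<in> V \<and> {i} \<in> markings \<and> charge {i} = - 2 \<and> (\<forall>f\<in>V. charge f \<noteq> - 1)" if "is_complex V i a b c" for i a b c
    using that complex_charge by (auto simp: is_complex_def markings_def)
  show "join_vertex V \<Longrightarrow> \<not> real_vertex V" "join_vertex V \<Longrightarrow> \<not> complex_vertex V"
    using m m' join_unmarked(2) unfolding join_vertex_def real_vertex_def complex_vertex_def by blast+
  show "complex_vertex V \<Longrightarrow> \<not> real_vertex V"
    using m m' unfolding real_vertex_def complex_vertex_def by blast
qed

lemma block_mult_join:
  assumes "partition_on labels V" "is_join V a b c"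
  shows "of_int (sgn (det2 (bdir a) (bdir b))) * block_mult V = join_coeff (bdir a) (bdir b)"
proof -
  have j: "join_vertex V" using assms by (auto simp: join_vertex_def)
  note d = join_dirs[OF assms]
  have neg: "even_vec (- x - y) = even_vec (x + y)" for x y by (auto simp add: even_vec_def)
  have "block_det V = nat \<bar>det2 (bdir a) (bdir b)\<bar>"
    using block_det_three[OF join_unmarked(1)[OF assms(2)] _ _ _ d] assms(2) by (auto simp: is_join_def)
  then have bd: "int (block_det V) = \<bar>det2 (bdir a) (bdir b)\<bar>" "of_nat (block_det V) = of_int \<bar>det2 (bdir a) (bdir b)\<bar>"
    by (simp_all)
  have ev: "even_vec (bdir a) \<or> even_vec (bdir b) \<or> \<not> even_vec (bdir a + bdir b)"
    using assms(2) d neg by (simp add: is_join_def)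
  have "(\<forall>f\<in>V. \<not> even_vec (bdir f)) \<longleftrightarrow> \<not> even_vec (bdir a) \<and> \<not> even_vec (bdir b)"
    using assms(2) by (auto simp: is_join_def)
  then have "block_mult V = (if \<not> even_vec (bdir a) \<and> \<not> even_vec (bdir b) then \<i> powi (\<bar>det2 (bdir a) (bdir b)\<bar> - 1)
       else of_int \<bar>det2 (bdir a) (bdir b)\<bar> * \<i> powi (\<bar>det2 (bdir a) (bdir b)\<bar> - 1))"
    unfolding block_mult_def bd using j vertex_kinds_disjoint[of V] by simp
  then show ?thesis using join_coeff_abs[OF ev] by simp
qed

lemma block_mult_complex:
  assumes "partition_on labels V" "is_complex V i a b c"
  shows "block_mult V = source_coeff (bdir a) (bdir b)"
proof -
  have j: "complex_vertex V" using assms by (auto simp: complex_vertex_def)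
  note d = complex_dirs[OF assms]
  have neg: "even_vec (- x - y) = even_vec (x + y)" for x y by (auto simp add: even_vec_def)
  note u = complex_unmarked[OF assms(2)]
  have "block_det V = nat \<bar>det2 (bdir a) (bdir b)\<bar>"
    using block_det_three[OF u _ _ _ d] assms(2) by (auto simp: is_complex_def)
  then have bd: "int (block_det V) = \<bar>det2 (bdir a) (bdir b)\<bar>" "of_nat (block_det V) = of_int \<bar>det2 (bdir a) (bdir b)\<bar>"
    by (simp_all)
  have ev: "\<not> (even_vec (bdir a) \<and> even_vec (bdir b))"
    using assms(2) d neg by (auto simp: is_complex_def even_vec_def)
  have "(\<exists>f\<in>V - markings. even_vec (bdir f)) \<longleftrightarrow> even_vec (bdir a) \<or> even_vec (bdir b) \<or> even_vec (bdir a + bdir b)"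
    unfolding u using d neg by simp
  then have "block_mult V = (if even_vec (bdir a) \<or> even_vec (bdir b) \<or> even_vec (bdir a + bdir b) then \<i> powi (\<bar>det2 (bdir a) (bdir b)\<bar> - 1)
       else of_int \<bar>det2 (bdir a) (bdir b)\<bar> * \<i> powi (\<bar>det2 (bdir a) (bdir b)\<bar> - 1))"
    unfolding block_mult_def bd using j vertex_kinds_disjoint[of V] by auto
  then show ?thesis using source_coeff_abs[OF ev] by simp
qed

lemma broccoli_charges:
  assumes "broccoli_vertex V" "f \<in> V"
  shows "f \<in> markings \<or> charge f = 0 \<or> charge f = 1"
  using assms unfolding broccoli_vertex_def join_vertex_def real_vertex_def complex_vertex_def
  by (auto simp: is_join_def is_real_def is_complex_def markings_def)

text \<open>At a vertex with a marking all unmarked edges flow out, and the marking itself has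
  negative charge.\<close>

lemma broccoli_inflow:
  assumes "broccoli_vertex V" "f \<in> V" "charge f = 0"
  shows "join_vertex V"
proof (rule ccontr)
  assume "\<not> join_vertex V"
  then have "real_vertex V \<or> complex_vertex V" using assms(1) by (simp add: broccoli_vertex_def)
  then show False using assms(2,3) real_charge complex_charge
    unfolding real_vertex_def complex_vertex_def is_real_def is_complex_def by fastforce
qed

definition marked_vertex :: "nat set set \<Rightarrow> bool" where
  "marked_vertex V \<longleftrightarrow> (\<exists>i\<in>{1..r + s}. {i} \<in> V)"

definition vertex_marking :: "nat set set \<Rightarrow> nat" where
  "vertex_marking V = (THE i. i \<in> {1..r + s} \<and> {i} \<in> V)"

lemma broccoli_marked_iff:
  assumes "broccoli_vertex V" shows "marked_vertex V \<longleftrightarrow> \<not> join_vertex V"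
proof
  assume "marked_vertex V"
  then show "\<not> join_vertex V" using join_unmarked(2) unfolding marked_vertex_def join_vertex_def markings_def by blast
next
  assume "\<not> join_vertex V"
  then have "real_vertex V \<or> complex_vertex V" using assms by (simp add: broccoli_vertex_def)
  then consider i a b where "is_real V i a b" | i a b c where "is_complex V i a b c"
    by (auto simp: real_vertex_def complex_vertex_def)
  then show "marked_vertex V"
  proof cases
    case 1
    then have "i \<in> {1..r + s}" "{i} \<in> V" by (simp_all add: is_real_def)
    then show ?thesis by (auto simp: marked_vertex_def)
  next
    case 2
    then have "i \<in> {1..r + s}" "{i} \<in> V" by (simp_all add: is_complex_def)
    then show ?thesis by (auto simp: marked_vertex_def)
  qed
qed

lemma vertex_marking_eq:
  assumes "broccoli_vertex V" "i \<in> {1..r + s}" "{i} \<in> V"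
  shows "vertex_marking V = i"
proof -
  have "\<not> join_vertex V" using broccoli_marked_iff[OF assms(1)] assms(2,3) by (auto simp: marked_vertex_def)
  then consider i' a b where "is_real V i' a b" | i' a b c where "is_complex V i' a b c"
    using assms(1) by (auto simp: broccoli_vertex_def real_vertex_def complex_vertex_def)
  then have "\<exists>i'. \<forall>k. {k} \<in> V \<and> {k} \<in> markings \<longrightarrow> k = i'"
  proof cases
    case 1
    then have "{k} \<in> V \<and> {k} \<in> markings \<longrightarrow> k = i'" for k
      using not_marking[of a] not_marking[of b] by (auto simp: is_real_def)
    then show ?thesis by blast
  next
    case 2
    then have "{k} \<in> V \<and> {k} \<in> markings \<longrightarrow> k = i'" for k
      using not_marking[of a] not_marking[of b] not_marking[of c] by (auto simp: is_complex_def)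
    then show ?thesis by blast
  qed
  then obtain i' where i': "\<And>k. {k} \<in> V \<Longrightarrow> {k} \<in> markings \<Longrightarrow> k = i'" by blast
  have "k = i" if "k \<in> {1..r + s}" "{k} \<in> V" for k
    using i'[of k] i'[of i] that assms(2,3) by (simp add: markings_def)
  then show ?thesis unfolding vertex_marking_def using assms(2,3) by (intro the_equality) blast+
qed

definition broccoli_type :: "nat set set set \<Rightarrow> bool" where
  "broccoli_type T \<longleftrightarrow> partition_tree labels T \<and> (\<forall>V\<in>T. broccoli_vertex V)"

definition regular_type :: "nat set set set \<Rightarrow> bool" where
  "regular_type T \<longleftrightarrow> broccoli_type T \<and> (\<forall>V\<in>T. \<not> degenerate V)"

definition type_mult :: "nat set set set \<Rightarrow> complex" where
  "type_mult T = (\<Prod>V\<in>T. block_mult V)"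

end

section \<open>Curves of a given type\<close>

lemma lookup_scaleR: "Poly_Mapping.lookup (c *\<^sub>R P) i = c *\<^sub>R Poly_Mapping.lookup P i"
proof -
  have "finite {j. c *\<^sub>R Poly_Mapping.lookup P j \<noteq> 0}"
    by (rule finite_subset[OF _ finite_lookup[of P]]) auto
  then show ?thesis unfolding scaleR_poly_mapping_def by (simp add: Abs_poly_mapping_inverse)
qed

lemma cramer:
  fixes a b :: "real \<times> real"
  assumes "det2 a b \<noteq> 0"
  shows "\<exists>!p. det2 a p = x \<and> det2 b p = y"
proof -
  obtain a1 a2 b1 b2 where ab: "a = (a1, a2)" "b = (b1, b2)" by (metis surj_pair)
  define d where "d = det2 a b"
  have d: "d \<noteq> 0" "a1 * b2 - a2 * b1 = d" using assms by (auto simp: d_def ab det2_def)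
  define p where "p = (1 / d) *\<^sub>R (x *\<^sub>R b - y *\<^sub>R a)"
  have "det2 a p = x" "det2 b p = y"
    unfolding p_def det2_scale_right det2_diff_right using d
    by (auto simp: d_def det2_self det2_swap[of b a] divide_simps)
  moreover have "q = p" if "det2 a q = x" "det2 b q = y" for q
  proof -
    obtain q1 q2 where q: "q = (q1, q2)" by (metis surj_pair)
    have e: "a1 * q2 - a2 * q1 = x" "b1 * q2 - b2 * q1 = y" using that by (auto simp: q ab det2_def)
    have "x * b1 - y * a1 = d * q1" "x * b2 - y * a2 = d * q2"
      unfolding e[symmetric] d(2)[symmetric] by (simp_all add: algebra_simps)
    then show ?thesis using d(1) by (simp add: p_def q ab divide_simps mult.commute)
  qed
  ultimately show ?thesis by blast
qed

lemma det2_zero_parallel: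
  fixes u w :: "real \<times> real"
  assumes "u \<noteq> 0" "det2 u w = 0"
  shows "w = ((w \<bullet> u) / (u \<bullet> u)) *\<^sub>R u"
proof -
  obtain u1 u2 w1 w2 where uw: "u = (u1, u2)" "w = (w1, w2)" by (metis surj_pair)
  have nz: "u1 * u1 + u2 * u2 \<noteq> 0" using assms(1) by (auto simp: uw zero_prod_def sum_squares_eq_zero_iff)
  have e: "u1 * w2 = u2 * w1" using assms(2) by (simp add: uw det2_def)
  have "w1 * (u1 * u1 + u2 * u2) = (w1 * u1 + w2 * u2) * u1"
    using e by (simp add: algebra_simps)
  moreover have "w2 * (u1 * u1 + u2 * u2) = (w1 * u1 + w2 * u2) * u2"
    using e by (simp add: algebra_simps)
  ultimately show ?thesis using nz by (simp add: uw inner_prod_def divide_simps)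
qed

context broccoli_data
begin

abbreviation rdir :: "nat set \<Rightarrow> real \<times> real" where "rdir f \<equiv> real_vec (bdir f)"

text \<open>The two vertices of an edge only have to lie on a common line in its direction, so
  lengths of any sign are allowed. This makes the relation linear and, for regular types, solvable
  for all conditions; positivity is imposed separately by \<open>active\<close>.\<close>

definition solves :: "nat set set set \<Rightarrow> conditions \<Rightarrow> (nat set set \<Rightarrow> real \<times> real) \<Rightarrow> bool" where
  "solves T P q \<longleftrightarrow>
     (\<forall>f\<in>inner_flags T. det2 (rdir f) (q (vertex_of T f)) = det2 (rdir f) (q (vertex_of T (labels - f)))) \<and>
     (\<forall>V\<in>T. \<forall>i\<in>{1..r + s}. {i} \<in> V \<longrightarrow> q V = Poly_Mapping.lookup (fst P) i) \<and>
     (\<forall>V\<in>T. \<forall>j\<in>F. {r + s + j} \<in> V \<longrightarrow> det2 (real_vec (v j)) (q V) = Poly_Mapping.lookup (snd P) j)"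

text \<open>
  The moment \<open>det2 (rdir f) p\<close> is the same for all points \<open>p\<close> of the line carrying the edge. Since
  moments add up to \<open>0\<close> at a vertex, those of the edges flowing into a vertex are determined by
  the conditions upstream.
\<close>

function moment :: "nat set set set \<Rightarrow> conditions \<Rightarrow> nat set \<Rightarrow> real" where
  "moment T P f =
     (if finite f \<and> 2 \<le> card f then
        (if marked_vertex (vertex_of T (labels - f))
         then det2 (rdir f) (Poly_Mapping.lookup (fst P) (vertex_marking (vertex_of T (labels - f))))
         else (\<Sum>g\<in>{g \<in> vertex_of T (labels - f). g \<subset> f}. moment T P g))
      else Poly_Mapping.lookup (snd P) (THE j. f = {r + s + j}))"
  by pat_completeness auto
termination
  by (relation "Wellfounded.measure (\<lambda>(T, P, f). card f)") (auto intro: psubset_card_mono)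

declare moment.simps [simp del]

text \<open>At a non-degenerate join two inflows determine the point by \<open>cramer\<close>, and
  the choice is unique.\<close>

definition position :: "nat set set set \<Rightarrow> conditions \<Rightarrow> nat set set \<Rightarrow> real \<times> real" where
  "position T P V =
     (if marked_vertex V then Poly_Mapping.lookup (fst P) (vertex_marking V)
      else (SOME p. \<forall>f\<in>V. charge f = 0 \<longrightarrow> det2 (rdir f) p = moment T P f))"

text \<open>The coefficient of the displacement along the edge, obtained by projection. It may be
  negative, and as a formula it is linear in \<open>q\<close> even if the displacement is not
  parallel to the edge.\<close>

definition edge_length :: "nat set set set \<Rightarrow> (nat set set \<Rightarrow> real \<times> real) \<Rightarrow> nat set \<Rightarrow> real" where
  "edge_length T q f =
     ((q (vertex_of T (labels - f)) - q (vertex_of T f)) \<bullet> rdir f) / (rdir f \<bullet> rdir f)"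

definition type_length :: "nat set set set \<Rightarrow> nat set \<Rightarrow> conditions \<Rightarrow> real" where
  "type_length T f P = edge_length T (position T P) f"

definition evaluate :: "nat set set set \<Rightarrow> (nat set set \<Rightarrow> real \<times> real) \<Rightarrow> conditions" where
  "evaluate T q =
     (\<Sum>i=1..r + s. Poly_Mapping.single i (q (vertex_of T {i})),
      \<Sum>j\<in>F. Poly_Mapping.single j (det2 (real_vec (v j)) (q (vertex_of T {r + s + j}))))"

text \<open>The velocities of the vertices when the edge \<open>S\<close> grows at unit rate and
  carries the part of the tree beyond it along.\<close>

definition side_shift :: "nat set \<Rightarrow> nat set set \<Rightarrow> real \<times> real" where
  "side_shift S V = (if on_side labels S V then rdir S else 0)"

lemma fin_F: "finite F" using F_sub finite_subset by blast

lemma lookup_evaluate: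
  "i \<in> {1..r + s} \<Longrightarrow> Poly_Mapping.lookup (fst (evaluate T q)) i = q (vertex_of T {i})"
  "j \<in> F \<Longrightarrow> Poly_Mapping.lookup (snd (evaluate T q)) j = det2 (real_vec (v j)) (q (vertex_of T {r + s + j}))"
  unfolding evaluate_def using fin_F
  by (simp_all add: lookup_sum lookup_single when_def if_distrib sum.delta cong: if_cong)

lemma solves_add: "solves T P q \<Longrightarrow> solves T P' q' \<Longrightarrow> solves T (P + P') (\<lambda>V. q V + q' V)"
  unfolding solves_def by (simp add: det2_add_right lookup_add)

lemma solves_scale: "solves T P q \<Longrightarrow> solves T (c *\<^sub>R P) (\<lambda>V. c *\<^sub>R q V)"
  unfolding solves_def by (simp add: det2_scale_right lookup_scaleR)

end

locale broccoli_tree = broccoli_data +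
  fixes T assumes bt: "broccoli_type T"

sublocale broccoli_tree \<subseteq> ptree labels T
  using bt fin_labels by unfold_locales (auto simp: broccoli_type_def)

context broccoli_tree
begin

lemma bvertex: "V \<in> T \<Longrightarrow> broccoli_vertex V"
  using bt by (simp add: broccoli_type_def)

lemma inner_charges:
  assumes "f \<in> inner_flags T"
  shows "charge f = 0 \<or> charge f = 1"
proof -
  have "f \<notin> markings" using assms by (auto simp: inner_flags_def markings_def)
  then show ?thesis using broccoli_charges bvertex inner_flagsD(1,2)[OF assms] by blast
qed

lemma inner_bdir: "f \<in> inner_flags T \<Longrightarrow> bdir (labels - f) = - bdir f"
  and inner_charge: "f \<in> inner_flags T \<Longrightarrow> charge (labels - f) = 1 - charge f"
  using inner_flags_sub bdir_compl charge_compl by blast+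

text \<open>An edge flowing into a vertex comes either from a marking, whose position is prescribed,
  or from a join, whose two inflows lie strictly inside \<open>f\<close>. This is the recursion by
  which \<open>moment\<close> is defined.\<close>

lemma tail_cases:
  assumes f: "f \<in> inner_flags T" "charge f = 0"
  obtains "marked_vertex (vertex_of T (labels - f))"
  | a b where "\<not> marked_vertex (vertex_of T (labels - f))"
      "is_join (vertex_of T (labels - f)) a b (labels - f)"
      "a \<subset> f" "b \<subset> f" "a \<noteq> b" "bdir f = bdir a + bdir b"
      "{g \<in> vertex_of T (labels - f). g \<subset> f} = {a, b}"
proof (cases "marked_vertex (vertex_of T (labels - f))")
  case False
  define W where "W = vertex_of T (labels - f)"
  note fd = inner_flagsD[OF f(1)]
  have W: "W \<in> T" "labels - f \<in> W" using fd by (auto simp: W_def)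
  have "join_vertex W" using False broccoli_marked_iff[OF bvertex[OF W(1)]] by (simp add: W_def)
  then obtain a b c where abc: "is_join W a b c" by (auto simp: join_vertex_def)
  have ch: "charge (labels - f) = 1" using inner_charge[OF f(1)] f(2) by simp
  have mem: "a \<in> W" "b \<in> W" "charge a = 0" "charge b = 0" "W = {a, b, c}" "a \<noteq> b" using abc by (auto simp: is_join_def)
  then have ne: "a \<noteq> labels - f" "b \<noteq> labels - f" using ch by auto
  then have c: "c = labels - f" using W(2) mem(5) by auto
  have ps: "a \<subset> f" "b \<subset> f" using beyond_psub[OF W mem(1) ne(1) fd(5)] beyond_psub[OF W mem(2) ne(2) fd(5)] by auto
  have "bdir (labels - f) = - (bdir a + bdir b)" using join_dirs[OF part[OF W(1)] abc] c by metis
  then have "bdir f = bdir a + bdir b" using inner_bdir[OF f(1)] by (metis neg_equal_iff_equal)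
  moreover have "\<not> labels - f \<subset> f" using fd block_nonempty[OF W] by blast
  then have "{g \<in> W. g \<subset> f} = {a, b}" using ps mem(5) c by auto
  ultimately show thesis using that(2)[of a b] False abc c ps mem(6) unfolding W_def by simp
qed

lemma moment_unique:
  assumes q: "solves T P q"
  shows "V \<in> T \<Longrightarrow> f \<in> V \<Longrightarrow> charge f = 0 \<Longrightarrow> det2 (rdir f) (q V) = moment T P f"
proof (induction "card f" arbitrary: f V rule: less_induct)
  case less
  have ff: "finite f" using fin_block less.prems by blast
  show ?case
  proof (cases "2 \<le> card f")
    case False
    then have "card f = 1" using card_block[OF less.prems(1,2)] by simp
    then obtain l where l: "f = {l}" by (rule card_1_singletonE)
    then have "l \<in> labels" using block_sub[OF less.prems(1,2)] by simp
    then obtain j where j: "j \<in> F" "l = r + s + j" using singleton_charge0 less.prems(3) l by auto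
    \<comment> \<open>A single label of charge 0 belongs to a fixed end; the last branch of
      \<open>moment\<close> reads off its condition.\<close>
    have "(THE j'. f = {r + s + j'}) = j" unfolding l j by (rule the_equality) auto
    then have "moment T P f = Poly_Mapping.lookup (snd P) j" using False by (subst moment.simps) simp
    moreover have "bdir f = v j" using end_block(1)[of j] F_sub j l by auto
    ultimately show ?thesis using q less.prems(1,2) j(1) unfolding solves_def l j(2) by simp
  next
    case True
    then have fi: "f \<in> inner_flags T" using less.prems by (auto simp: inner_flags_def)
    have V: "vertex_of T f = V" using vertex_of_eq less.prems by blast
    define W where "W = vertex_of T (labels - f)"
    note fd = inner_flagsD[OF fi]
    have "det2 (rdir f) (q (vertex_of T f)) = det2 (rdir f) (q W)"
      using conjunct1[OF q[unfolded solves_def]] fi unfolding W_def by (rule bspec)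
    then have eq: "det2 (rdir f) (q V) = det2 (rdir f) (q W)" using V by simp
    show ?thesis
    proof (cases rule: tail_cases[OF fi less.prems(3)])
      case 1
      obtain i where i: "i \<in> {1..r + s}" "{i} \<in> W" using 1 by (auto simp: marked_vertex_def W_def)
      have "W \<in> T" using fd by (simp add: W_def)
      then have "vertex_marking W = i" using vertex_marking_eq[OF bvertex i] by blast
      moreover have "q W = Poly_Mapping.lookup (fst P) i" using q i \<open>W \<in> T\<close> unfolding solves_def by blast
      ultimately show ?thesis using eq 1 True ff by (subst moment.simps) (simp add: W_def)
    next
      case (2 a b)
      have W: "W \<in> T" "a \<in> W" "b \<in> W" "charge a = 0" "charge b = 0"
        using 2(2) fd by (auto simp: W_def is_join_def)
      have "moment T P f = moment T P a + moment T P b"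
        using 2 True ff by (subst moment.simps) simp
      also have "moment T P a = det2 (rdir a) (q W)"
        using less.hyps[OF psubset_card_mono[OF ff 2(3)] W(1,2,4)] by simp
      also have "moment T P b = det2 (rdir b) (q W)"
        using less.hyps[OF psubset_card_mono[OF ff 2(4)] W(1,3,5)] by simp
      finally show ?thesis using eq 2(6) by (simp add: real_vec_add det2_add_left)
    qed
  qed
qed

end

locale regular_tree = broccoli_tree +
  assumes nondeg: "V \<in> T \<Longrightarrow> \<not> degenerate V"

lemma (in broccoli_data) regular_tree_iff: "regular_tree r s n v F T \<longleftrightarrow> regular_type T"
  unfolding regular_tree_def regular_tree_axioms_def broccoli_tree_def broccoli_tree_axioms_def regular_type_def
  using broccoli_data_axioms by auto

section \<open>Unique solvability without parallel inflows\<close>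

context regular_tree
begin

lemma regular: "regular_type T"
  using bt nondeg by (simp add: regular_type_def)

lemma join_det: "V \<in> T \<Longrightarrow> is_join V a b c \<Longrightarrow> det2 (rdir a) (rdir b) \<noteq> 0"
  using nondeg by (auto simp: degenerate_def det2_real_vec)

lemma inflow_join:
  assumes "V \<in> T" "f \<in> V" "charge f = 0"
  obtains a b c where "is_join V a b c" "f = a"
proof -
  have "join_vertex V" using broccoli_inflow[OF bvertex] assms by blast
  then obtain a b c where j: "is_join V a b c" by (auto simp: join_vertex_def)
  then have "is_join V b a c" by (auto simp: is_join_def)
  moreover have "f = a \<or> f = b" using j assms by (auto simp: is_join_def)
  ultimately show thesis using j that by blast
qed

lemma unmarked_join:
  assumes "V \<in> T" "\<not> marked_vertex V"
  obtains a b c where "is_join V a b c"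
  using assms broccoli_marked_iff[OF bvertex] by (auto simp: join_vertex_def)

lemma solves_unique:
  assumes "solves T P q" "solves T P q'" "V \<in> T"
  shows "q V = q' V"
proof (cases "marked_vertex V")
  case True
  then show ?thesis using assms by (auto simp: marked_vertex_def solves_def)
next
  case False
  obtain a b c where j: "is_join V a b c" using unmarked_join[OF assms(3) False] .
  then have m: "a \<in> V" "b \<in> V" "charge a = 0" "charge b = 0" by (auto simp: is_join_def)
  show ?thesis
    using cramer[OF join_det[OF assms(3) j], of "moment T P a" "moment T P b"]
      moment_unique[OF assms(1) assms(3) m(1,3)] moment_unique[OF assms(1) assms(3) m(2,4)]
      moment_unique[OF assms(2) assms(3) m(1,3)] moment_unique[OF assms(2) assms(3) m(2,4)] by blast
qed

lemma position_moment:
  assumes "V \<in> T" "f \<in> V" "charge f = 0"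
  shows "det2 (rdir f) (position T P V) = moment T P f"
proof -
  obtain a b c where j: "is_join V a b c" "f = a" using inflow_join[OF assms] .
  have nm: "\<not> marked_vertex V"
    using broccoli_marked_iff[OF bvertex[OF assms(1)]] j by (auto simp: join_vertex_def)
  obtain p where p: "det2 (rdir a) p = moment T P a" "det2 (rdir b) p = moment T P b"
    using cramer[OF join_det[OF assms(1) j(1)]] by blast
  have "\<forall>f\<in>V. charge f = 0 \<longrightarrow> f = a \<or> f = b" using j by (auto simp: is_join_def)
  then have "\<forall>f\<in>V. charge f = 0 \<longrightarrow> det2 (rdir f) p = moment T P f" using p by blast
  then have "\<forall>f\<in>V. charge f = 0 \<longrightarrow> det2 (rdir f) (position T P V) = moment T P f"
    unfolding position_def using nm by (simp only: if_False) (rule someI)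
  then show ?thesis using assms by blast
qed

lemma position_solves: "solves T P (position T P)"
  unfolding solves_def
proof (intro conjI ballI impI)
  \<comment> \<open>Flags of charge 0 suffice: the other flag of an edge has the negated direction
    and gives the same equation.\<close>
  have main: "det2 (rdir f) (position T P (vertex_of T f)) = det2 (rdir f) (position T P (vertex_of T (labels - f)))"
    if f: "f \<in> inner_flags T" "charge f = 0" for f
  proof -
    define W where "W = vertex_of T (labels - f)"
    note fd = inner_flagsD[OF f(1)]
    have ff: "finite f" "2 \<le> card f" using f fin_labels finite_subset[OF fd(5)] by (auto simp: inner_flags_def)
    have lhs: "det2 (rdir f) (position T P (vertex_of T f)) = moment T P f"
      using position_moment[OF fd(1,2) f(2)] .
    show ?thesis
    proof (cases rule: tail_cases[OF f])
      case 1
      then show ?thesis using lhs ff by (subst (asm) moment.simps) (simp add: position_def)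
    next
      case (2 a b)
      have W: "W \<in> T" "a \<in> W" "b \<in> W" "charge a = 0" "charge b = 0"
        using 2(2) fd by (auto simp: W_def is_join_def)
      have "moment T P f = moment T P a + moment T P b"
        using 2 ff by (subst moment.simps) simp
      also have "\<dots> = det2 (rdir f) (position T P W)"
        using position_moment[OF W(1,2,4)] position_moment[OF W(1,3,5)] 2(6) by (simp add: real_vec_add det2_add_left)
      finally show ?thesis using lhs by (simp add: W_def)
    qed
  qed
  fix f assume f: "f \<in> inner_flags T"
  show "det2 (rdir f) (position T P (vertex_of T f)) = det2 (rdir f) (position T P (vertex_of T (labels - f)))"
  proof (cases "charge f = 0")
    case False
    then have "charge (labels - f) = 0" using inner_charges[OF f] inner_charge[OF f] by auto
    from main[OF inner_flagsD(6)[OF f] this] show ?thesis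
      using inner_flagsD(7)[OF f] inner_bdir[OF f] by (simp add: real_vec_minus det2_minus_left)
  qed (use main f in blast)
next
  fix V i assume "V \<in> T" "i \<in> {1..r + s}" "{i} \<in> V"
  then show "position T P V = Poly_Mapping.lookup (fst P) i"
    using vertex_marking_eq[OF bvertex] by (auto simp: position_def marked_vertex_def)
next
  fix V j assume j: "V \<in> T" "j \<in> F" "{r + s + j} \<in> V"
  have e: "bdir {r + s + j} = v j" "charge {r + s + j} = 0" using end_block[of j] F_sub j by auto
  have "(THE j'. {r + s + j} = {r + s + j'}) = j" by (rule the_equality) auto
  then have "moment T P {r + s + j} = Poly_Mapping.lookup (snd P) j" by (subst moment.simps) simp
  then show "det2 (real_vec (v j)) (position T P V) = Poly_Mapping.lookup (snd P) j"
    using position_moment[OF j(1,3) e(2), of P] e(1) by simp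
qed

lemma position_eq: "solves T P q \<Longrightarrow> V \<in> T \<Longrightarrow> position T P V = q V"
  using solves_unique position_solves by blast

text \<open>One flag of the edge is an inflow of a non-degenerate join, and its direction has a
  non-zero determinant with the other inflow.\<close>

lemma inner_rdir_nonzero:
  assumes "f \<in> inner_flags T" shows "rdir f \<noteq> 0"
proof -
  have main: "rdir f \<noteq> 0" if f: "f \<in> inner_flags T" "charge f = 0" for f
  proof -
    note fd = inner_flagsD[OF f(1)]
    obtain a b c where j: "is_join (vertex_of T f) a b c" and "f = a" using inflow_join[OF fd(1,2) f(2)] .
    show ?thesis using join_det[OF fd(1) j] unfolding \<open>f = a\<close>[symmetric] by (auto simp: det2_zero_left)
  qed
  show ?thesis
  proof (cases "charge f = 0")
    case False
    then have "charge (labels - f) = 0" using inner_charges[OF assms] inner_charge[OF assms] by auto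
    from main[OF inner_flagsD(6)[OF assms] this] show ?thesis
      using inner_bdir[OF assms] by (simp add: real_vec_minus)
  qed (use main assms in blast)
qed

lemma edge_vector:
  assumes "solves T P q" "f \<in> inner_flags T"
  shows "q (vertex_of T (labels - f)) - q (vertex_of T f) = edge_length T q f *\<^sub>R rdir f"
  unfolding edge_length_def
  using assms by (intro det2_zero_parallel inner_rdir_nonzero) (auto simp: det2_diff_right solves_def)

lemma edge_length_compl:
  assumes "f \<in> inner_flags T"
  shows "edge_length T q (labels - f) = edge_length T q f"
  unfolding edge_length_def inner_flagsD(7)[OF assms] inner_bdir[OF assms] real_vec_minus
  by (simp add: inner_diff_left)

lemma edge_length_cong:
  assumes "f \<in> inner_flags T" "\<And>V. V \<in> T \<Longrightarrow> q V = q' V"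
  shows "edge_length T q f = edge_length T q' f"
  using assms(2) inner_flagsD[OF assms(1)] by (simp add: edge_length_def)

lemma type_length_eq:
  assumes "f \<in> inner_flags T" "solves T P q"
  shows "type_length T f P = edge_length T q f"
  unfolding type_length_def using edge_length_cong[OF assms(1)] position_eq[OF assms(2)] by blast

lemma type_length_compl: "f \<in> inner_flags T \<Longrightarrow> type_length T (labels - f) P = type_length T f P"
  unfolding type_length_def by (rule edge_length_compl)

text \<open>Solutions superpose and are unique; so linearity needs no formula for the
  length.\<close>

lemma type_length_linear:
  assumes "f \<in> inner_flags T"
  shows "linear (type_length T f)"
proof
  fix P P' c
  show "type_length T f (P + P') = type_length T f P + type_length T f P'"
    using type_length_eq[OF assms solves_add[OF position_solves position_solves], of P P']
    by (simp add: type_length_def edge_length_def inner_add_left inner_diff_left add_divide_distrib diff_divide_distrib)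
  show "type_length T f (c *\<^sub>R P) = c *\<^sub>R type_length T f P"
    using type_length_eq[OF assms solves_scale[OF position_solves], of c P]
    by (simp add: type_length_def edge_length_def inner_diff_left algebra_simps flip: scaleR_diff_right)
qed

end

text \<open>
  Moving the part of a curve beyond one edge along this edge changes only the length of this edge.
\<close>

lemma (in ptree) side_shift_change:
  assumes f: "f \<in> inner_flags T" and S: "S \<in> inner_flags T"
  shows "f \<noteq> S \<Longrightarrow> f \<noteq> L - S \<Longrightarrow> on_side L S (vertex_of T f) \<longleftrightarrow> on_side L S (vertex_of T (L - f))"
    and "\<not> on_side L S (vertex_of T S)" "on_side L S (vertex_of T (L - S))"
proof -
  note fd = inner_flagsD[OF f] note Sd = inner_flagsD[OF S]
  show "f \<noteq> S \<Longrightarrow> f \<noteq> L - S \<Longrightarrow> on_side L S (vertex_of T f) \<longleftrightarrow> on_side L S (vertex_of T (L - f))"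
    using on_side_adj_iff[OF fd(1-4) S] by blast
  show "\<not> on_side L S (vertex_of T S)" "on_side L S (vertex_of T (L - S))"
    using not_on_side_tail[OF Sd(1,2,4,3)] on_side_head[OF Sd(4)] by blast+
qed

context regular_tree
begin

lemma solves_evaluate:
  assumes "\<And>f. f \<in> inner_flags T \<Longrightarrow>
      det2 (rdir f) (q (vertex_of T f)) = det2 (rdir f) (q (vertex_of T (labels - f)))"
  shows "solves T (evaluate T q) q"
  unfolding solves_def using assms vertex_of_eq by (auto simp: lookup_evaluate)

text \<open>The deformation \<open>side_shift S\<close> solves the conditions obtained by evaluating
  it, and changes the length of \<open>S\<close> only. So the lengths of different edges are
  linearly independent forms, which later keeps a generic line away from their common zeros.\<close>

lemma dual_condition:
  assumes S: "S \<in> inner_flags T"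
  shows "\<exists>Z. type_length T S Z = 1 \<and> (\<forall>f\<in>inner_flags T. f \<noteq> S \<longrightarrow> f \<noteq> labels - S \<longrightarrow> type_length T f Z = 0)"
proof -
  let ?q = "side_shift S"
  have sol: "solves T (evaluate T ?q) ?q"
  proof (rule solves_evaluate)
    fix f assume f: "f \<in> inner_flags T"
    consider "f = S" | "f = labels - S" | "f \<noteq> S" "f \<noteq> labels - S" by blast
    then show "det2 (rdir f) (?q (vertex_of T f)) = det2 (rdir f) (?q (vertex_of T (labels - f)))"
    proof cases
      case 3 then show ?thesis using side_shift_change(1)[OF f S] by (simp add: side_shift_def)
    qed (simp_all add: side_shift_def det2_self det2_zero_right inner_bdir[OF S] real_vec_minus det2_minus_left)
  qed
  have "type_length T S (evaluate T ?q) = 1"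
    unfolding type_length_eq[OF S sol] edge_length_def
    using side_shift_change(2,3)[OF S S] inner_rdir_nonzero[OF S] by (simp add: side_shift_def)
  moreover have "type_length T f (evaluate T ?q) = 0" if "f \<in> inner_flags T" "f \<noteq> S" "f \<noteq> labels - S" for f
    unfolding type_length_eq[OF that(1) sol] edge_length_def
    using side_shift_change(1)[OF that(1) S that(2,3)] by (simp add: side_shift_def)
  ultimately show ?thesis by blast
qed

end

section \<open>Contracting and resolving an edge\<close>

lemma union_two_notin_partition:
  assumes "partition_on A W" "a \<in> W" "b \<in> W" "a \<noteq> b" "a \<union> b \<subseteq> c"
  shows "c \<notin> W"
proof
  assume c: "c \<in> W"
  have "a \<noteq> {}" "b \<noteq> {}" using assms(1-3) by (auto simp: partition_on_def)
  moreover have "a = c" if "a \<inter> c \<noteq> {}" using disjointD[OF partition_onD2[OF assms(1)] assms(2) c] that by metis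
  moreover have "b = c" if "b \<inter> c \<noteq> {}" using disjointD[OF partition_onD2[OF assms(1)] assms(3) c] that by metis
  ultimately show False using assms(4,5) by blast
qed

locale ptree_edge = ptree +
  fixes S assumes S: "S \<in> inner_flags T"
begin

definition "V1 = vertex_of T S"
definition "V2 = vertex_of T (L - S)"
definition "rest = T - {V1, V2}"
definition "merged = (V1 - {S}) \<union> (V2 - {L - S})"
text \<open>A resolution splits a trivalent vertex with the flags \<open>i\<close> and
  \<open>p\<close> off the vertex \<open>merged\<close> that arises by contracting \<open>S\<close>.
  The new edge is \<open>i \<union> p\<close> seen from \<open>resolve1\<close> and its complement
  seen from \<open>resolve2\<close>. Resolutions of this shape suffice, because the head of an edge
  is always a join (\<open>head_join\<close>).\<close>

definition "resolve1 i p = insert (i \<union> p) (merged - {i, p})"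
definition "resolve2 i p = {i, p, L - (i \<union> p)}"
definition "resolved i p = rest \<union> {resolve1 i p, resolve2 i p}"

lemma V12: "V1 \<in> T" "S \<in> V1" "V2 \<in> T" "L - S \<in> V2" "V1 \<noteq> V2" "S \<subseteq> L" "L - (L - S) = S"
proof -
  note Sd = inner_flagsD[OF S]
  show *: "V1 \<in> T" "S \<in> V1" "V2 \<in> T" "L - S \<in> V2" "S \<subseteq> L" "L - (L - S) = S"
    using Sd(1-5,7) by (simp_all only: V1_def V2_def)
  show "V1 \<noteq> V2" using compl_notin_same[OF *(1,2)] *(4) by metis
qed

lemma T_eq: "T = rest \<union> {V1, V2}" using V12 by (auto simp: rest_def)

lemma rest: "V \<in> rest \<Longrightarrow> V \<in> T" "V1 \<notin> rest" "V2 \<notin> rest" by (auto simp: rest_def)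

lemma S_notin: "S \<notin> V2" "L - S \<notin> V1"
  using uniq[OF V12(1,3,2)] uniq[OF V12(1,3) _ V12(4)] V12(5) by metis+

lemma merged_in: "g \<in> merged \<Longrightarrow> g \<in> V1 \<or> g \<in> V2" "g \<in> merged \<Longrightarrow> g \<in> \<Union>T"
  "S \<notin> merged" "L - S \<notin> merged" "g \<in> V1 \<Longrightarrow> g \<noteq> S \<Longrightarrow> g \<in> merged" "g \<in> V2 \<Longrightarrow> g \<noteq> L - S \<Longrightarrow> g \<in> merged"
  using V12 S_notin by (auto simp: merged_def)

lemma V1_sub: "g \<in> V1 \<Longrightarrow> g \<noteq> S \<Longrightarrow> g \<subset> L - S"
  and V2_sub: "g \<in> V2 \<Longrightarrow> g \<noteq> L - S \<Longrightarrow> g \<subset> S"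
  using block_psub_compl[OF V12(1,2)] beyond_psub[OF V12(3,4) _ _ V12(6)] by blast+

lemma V1_union: "\<Union>(V1 - {S}) = L - S"
  using Union_vertex[OF V12(1)] V1_sub V12(2) by blast

lemma V2_union: "\<Union>(V2 - {L - S}) = S"
  using Union_vertex[OF V12(3)] V2_sub V12(4,6) by blast

lemma merged_disj:
  assumes "g \<in> merged" "h \<in> merged" "g \<noteq> h" shows "g \<inter> h = {}"
proof -
  have "g \<in> V1 - {S} \<or> g \<in> V2 - {L - S}" "h \<in> V1 - {S} \<or> h \<in> V2 - {L - S}" using assms by (auto simp: merged_def)
  then consider "g \<in> V1" "h \<in> V1" | "g \<in> V2" "h \<in> V2" | "g \<subseteq> L - S" "h \<subseteq> S" | "g \<subseteq> S" "h \<subseteq> L - S"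
    using V1_sub V2_sub by blast
  then show ?thesis
  proof cases
    case 1 then show ?thesis using block_disj[OF V12(1) _ _ assms(3)] by blast
  next
    case 2 then show ?thesis using block_disj[OF V12(3) _ _ assms(3)] by blast
  qed auto
qed

lemma part_merged: "partition_on L merged"
  unfolding partition_on_def disjoint_def
proof (intro conjI ballI impI)
  have "\<Union>merged = (L - S) \<union> S" unfolding merged_def Union_Un_distrib V1_union V2_union ..
  then show "\<Union>merged = L" using V12(6) by blast
  show "g \<inter> h = {}" if "g \<in> merged" "h \<in> merged" "g \<noteq> h" for g h using merged_disj that .
  show "{} \<notin> merged" using merged_in(1) block_nonempty[OF V12(1)] block_nonempty[OF V12(3)] by metis
qed

lemma fin_merged: "finite merged" using part_merged fin_L finite_elements by blast

lemma merged_block: "g \<in> merged \<Longrightarrow> g \<subseteq> L" "g \<in> merged \<Longrightarrow> g \<noteq> {}"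
  using merged_in(1)[of g] block_sub[OF V12(1), of g] block_sub[OF V12(3), of g]
    block_nonempty[OF V12(1), of g] block_nonempty[OF V12(3), of g] by auto

lemma V1_two: "\<exists>g h. g \<in> V1 - {S} \<and> h \<in> V1 - {S} \<and> g \<noteq> h"
proof -
  obtain g where g: "g \<in> V1" "g \<noteq> S" using third_block[OF V12(1)] by metis
  obtain h where "h \<in> V1" "h \<noteq> S" "h \<noteq> g" using third_block[OF V12(1)] by metis
  with g show ?thesis by blast
qed

lemma V2_two: "\<exists>g h. g \<in> V2 - {L - S} \<and> h \<in> V2 - {L - S} \<and> g \<noteq> h"
proof -
  obtain g where g: "g \<in> V2" "g \<noteq> L - S" using third_block[OF V12(3)] by metis
  obtain h where "h \<in> V2" "h \<noteq> L - S" "h \<noteq> g" using third_block[OF V12(3)] by metis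
  with g show ?thesis by blast
qed

lemma card_merged: "card merged = card V1 + card V2 - 2" "4 \<le> card merged"
proof -
  have "(V1 - {S}) \<inter> (V2 - {L - S}) = {}"
  proof (rule equals0I)
    fix g assume "g \<in> (V1 - {S}) \<inter> (V2 - {L - S})"
    then have g: "g \<subset> L - S" "g \<subset> S" "g \<in> V1" using V1_sub[of g] V2_sub[of g] by auto
    then show False using block_nonempty[OF V12(1) g(3)] by blast
  qed
  then have "card merged = card (V1 - {S}) + card (V2 - {L - S})"
    unfolding merged_def using fin_vertex[OF V12(1)] fin_vertex[OF V12(3)] by (intro card_Un_disjoint) auto
  moreover have "card (V1 - {S}) = card V1 - 1" "card (V2 - {L - S}) = card V2 - 1"
    using V12 by simp_all
  ultimately show "card merged = card V1 + card V2 - 2" "4 \<le> card merged"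
    using card3[OF V12(1)] card3[OF V12(3)] by simp_all
qed

text \<open>\<open>behind\<close>, applied to \<open>V1\<close> and to \<open>V2\<close>, gives a
  block of \<open>merged\<close> unless it names both flags of the contracted edge. In that case two
  blocks of \<open>V\<close> would cover \<open>L\<close>, leaving no room for a third one.\<close>

lemma rest_behind:
  assumes "V \<in> rest"
  shows "\<exists>g\<in>merged. \<exists>b\<in>V. L - g \<subseteq> b"
proof -
  have V: "V \<in> T" "V \<noteq> V1" "V \<noteq> V2" using assms by (auto simp: rest_def)
  obtain g b where gb: "g \<in> V1" "b \<in> V" "L - g \<subseteq> b" using behind[OF V(1) V12(1) V(2)] by blast
  obtain h c where hc: "h \<in> V2" "c \<in> V" "L - h \<subseteq> c" using behind[OF V(1) V12(3) V(3)] by blast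
  show ?thesis
  proof (cases "g = S \<and> h = L - S")
    case True
    then have "L - S \<subseteq> b" "S \<subseteq> c" using gb hc V12(7) by auto
    obtain x where x: "x \<in> V" "x \<noteq> b" "x \<noteq> c" using third_block[OF V(1)] by blast
    have "x \<inter> b = {}" "x \<inter> c = {}" "x \<subseteq> L" "x \<noteq> {}"
      using block_disj[OF V(1) x(1) gb(2) x(2)] block_disj[OF V(1) x(1) hc(2) x(3)] block_sub[OF V(1) x(1)]
        block_nonempty[OF V(1) x(1)] by simp_all
    then show ?thesis using \<open>L - S \<subseteq> b\<close> \<open>S \<subseteq> c\<close> by blast
  next
    case False
    then show ?thesis using gb hc merged_in(5,6) by metis
  qed
qed

lemma rest_blocks: "V \<in> rest \<Longrightarrow> f \<in> V \<Longrightarrow> f \<notin> V1" "V \<in> rest \<Longrightarrow> f \<in> V \<Longrightarrow> f \<notin> V2"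
  using uniq[OF rest(1) V12(1)] uniq[OF rest(1) V12(3)] rest(2,3) by metis+

text \<open>A vertex of \<open>rest\<close> sees all blocks of \<open>merged\<close> but one through
  a single flag \<open>b\<close>. If \<open>U\<close> and its complement contain two blocks each,
  both contain one inside \<open>b\<close>; so \<open>U\<close> meets \<open>b\<close> without being
  \<open>b\<close>. Hence the edge created by a resolution is new.\<close>

lemma two_blocks_notin_rest:
  assumes "V \<in> rest" "c1 \<in> merged" "c2 \<in> merged" "c1 \<noteq> c2" "d1 \<in> merged" "d2 \<in> merged" "d1 \<noteq> d2"
    "c1 \<union> c2 \<subseteq> U" "d1 \<union> d2 \<subseteq> L - U" "U \<subseteq> L"
  shows "U \<notin> V"
proof
  assume U: "U \<in> V"
  obtain g b where gb: "g \<in> merged" "b \<in> V" "L - g \<subseteq> b" using rest_behind[OF assms(1)] by blast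
  have V: "V \<in> T" using rest(1) assms(1) .
  have sub: "x \<subseteq> L - g" if "x \<in> merged" "x \<noteq> g" for x
    using merged_disj[OF that(1) gb(1) that(2)] merged_block(1)[OF that(1)] by blast
  obtain c where c: "c \<in> merged" "c \<noteq> g" "c \<subseteq> U" using assms(2-4,8) by (metis Un_subset_iff)
  obtain d where d: "d \<in> merged" "d \<noteq> g" "d \<subseteq> L - U" using assms(5-7,9) by (metis Un_subset_iff)
  obtain x where "x \<in> c" using merged_block(2)[OF c(1)] by blast
  then have "x \<in> U" "x \<in> b" using c sub[OF c(1,2)] gb by auto
  then have "U = b" using block_eq[OF V U gb(2)] by blast
  then have "d \<subseteq> U" using sub[OF d(1,2)] gb by blast
  then show False using d(3) merged_block(2)[OF d(1)] by blast
qed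

context
  fixes i p assumes ip: "i \<in> merged" "p \<in> merged" "i \<noteq> p"
begin

lemma other_two: "\<exists>d1 d2. d1 \<in> merged - {i, p} \<and> d2 \<in> merged - {i, p} \<and> d1 \<noteq> d2"
proof -
  have "card (merged - {i, p}) = card merged - 2" using ip by (simp add: card_Diff_subset)
  then have "2 \<le> card (merged - {i, p})" using card_merged by simp
  then obtain A where "A \<subseteq> merged - {i, p}" "card A = 2" by (meson obtain_subset_with_card_n)
  then show ?thesis by (auto simp: card_2_iff)
qed

lemma others_sub: "d \<in> merged - {i, p} \<Longrightarrow> d \<subseteq> L - (i \<union> p)"
  using merged_disj[of d i] merged_disj[of d p] merged_block(1)[of d] ip by blast

lemma U_sub: "i \<union> p \<subseteq> L" "L - (L - (i \<union> p)) = i \<union> p" using merged_block(1) ip by blast+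

lemma U_notin: "i \<union> p \<notin> merged" "L - (i \<union> p) \<notin> merged" "V \<in> rest \<Longrightarrow> i \<union> p \<notin> V" "V \<in> rest \<Longrightarrow> L - (i \<union> p) \<notin> V"
proof -
  obtain d1 d2 where d: "d1 \<in> merged - {i, p}" "d2 \<in> merged - {i, p}" "d1 \<noteq> d2" using other_two by blast
  have ds: "d1 \<union> d2 \<subseteq> L - (i \<union> p)" using others_sub d by blast
  have dm: "d1 \<in> merged" "d2 \<in> merged" using d by auto
  show "i \<union> p \<notin> merged" by (rule union_two_notin_partition[OF part_merged ip]) simp
  show "L - (i \<union> p) \<notin> merged" by (rule union_two_notin_partition[OF part_merged dm d(3) ds])
  show "V \<in> rest \<Longrightarrow> i \<union> p \<notin> V" by (rule two_blocks_notin_rest[OF _ ip dm d(3) _ ds U_sub(1)]) auto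
  show "V \<in> rest \<Longrightarrow> L - (i \<union> p) \<notin> V"
    by (rule two_blocks_notin_rest[OF _ dm d(3) ip ds]) (use U_sub in auto)
qed

lemma U_card: "2 \<le> card (i \<union> p)" "2 \<le> card (L - (i \<union> p))"
proof -
  show "2 \<le> card (i \<union> p)" by (rule card_union_blocks_gt[OF fin_L part_merged ip])
  obtain d1 d2 where d: "d1 \<in> merged - {i, p}" "d2 \<in> merged - {i, p}" "d1 \<noteq> d2" using other_two by blast
  then have "2 \<le> card (d1 \<union> d2)" using card_union_blocks_gt[OF fin_L part_merged] by blast
  also have "\<dots> \<le> card (L - (i \<union> p))" using others_sub d fin_L by (intro card_mono) auto
  finally show "2 \<le> card (L - (i \<union> p))" .
qed

lemma resolve_disj: "resolve1 i p \<inter> resolve2 i p = {}"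
proof -
  have "i \<union> p \<noteq> i" "i \<union> p \<noteq> p" using U_notin(1) ip by metis+
  moreover have "i \<union> p \<noteq> L - (i \<union> p)" using merged_block(2)[OF ip(1)] by blast
  ultimately show ?thesis using U_notin(2) unfolding resolve1_def resolve2_def by auto
qed

lemma resolve_Un: "resolve1 i p \<union> resolve2 i p = merged \<union> {i \<union> p, L - (i \<union> p)}"
  unfolding resolve1_def resolve2_def using ip by auto

lemma part_resolve: "partition_on L (resolve1 i p)" "partition_on L (resolve2 i p)"
proof -
  have un: "\<Union>merged = L" using partition_onD1[OF part_merged] by simp
  have "\<Union>(merged - {i, p}) = L - (i \<union> p)"
  proof
    show "\<Union>(merged - {i, p}) \<subseteq> L - (i \<union> p)" using others_sub by blast
    show "L - (i \<union> p) \<subseteq> \<Union>(merged - {i, p})" using un by blast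
  qed
  then show "partition_on L (resolve1 i p)"
    unfolding resolve1_def
    unfolding partition_on_def disjoint_def
  proof (intro conjI ballI impI)
    assume un': "\<Union>(merged - {i, p}) = L - (i \<union> p)"
    show "\<Union>(insert (i \<union> p) (merged - {i, p})) = L" unfolding Union_insert un' using U_sub(1) by blast
    show "{} \<notin> insert (i \<union> p) (merged - {i, p})" using merged_block(2)[of "{}"] merged_block(2)[OF ip(1)] by auto
    fix g h assume gh: "g \<in> insert (i \<union> p) (merged - {i, p})" "h \<in> insert (i \<union> p) (merged - {i, p})" "g \<noteq> h"
    then consider "g \<in> merged" "h \<in> merged" | "g = i \<union> p" "h \<in> merged - {i, p}" | "h = i \<union> p" "g \<in> merged - {i, p}"
      by (elim insertE) auto
    then show "g \<inter> h = {}" using merged_disj gh(3) others_sub by cases blast+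
  qed
  have "L - (i \<union> p) \<noteq> {}" using U_card(2) by (metis card.empty not_numeral_le_zero)
  then show "partition_on L (resolve2 i p)"
    unfolding resolve2_def
    unfolding partition_on_def disjoint_def
  proof (intro conjI ballI impI)
    assume ne: "L - (i \<union> p) \<noteq> {}"
    show "\<Union>{i, p, L - (i \<union> p)} = L" using U_sub(1) by auto
    show "{} \<notin> {i, p, L - (i \<union> p)}" using merged_block(2) ip ne by blast
    fix g h assume gh: "g \<in> {i, p, L - (i \<union> p)}" "h \<in> {i, p, L - (i \<union> p)}" "g \<noteq> h"
    then show "g \<inter> h = {}" using merged_disj[OF ip] by (elim insertE emptyE) auto
  qed
qed

lemma card_resolve: "card (resolve1 i p) = card merged - 1" "card (resolve2 i p) = 3"
proof -
  have "card (merged - {i, p}) = card merged - 2" using ip by (simp add: card_Diff_subset)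
  then show "card (resolve1 i p) = card merged - 1"
    unfolding resolve1_def using U_notin(1) fin_merged card_merged by simp
  show "card (resolve2 i p) = 3" 
  proof -
    have "i \<noteq> L - (i \<union> p)" "p \<noteq> L - (i \<union> p)" using U_notin(2) ip by metis+
    then show ?thesis unfolding resolve2_def using ip(3) by simp
  qed
qed

lemma resolve_notin_rest: "resolve1 i p \<notin> rest" "resolve2 i p \<notin> rest" "resolve1 i p \<noteq> resolve2 i p"
proof -
  have "i \<union> p \<in> resolve1 i p" "L - (i \<union> p) \<in> resolve2 i p" by (auto simp: resolve1_def resolve2_def)
  then show "resolve1 i p \<notin> rest" "resolve2 i p \<notin> rest" "resolve1 i p \<noteq> resolve2 i p"
    using U_notin(3,4) resolve_disj by blast+
qed

lemma merged_opposite: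
  assumes "f \<in> merged" "2 \<le> card f" shows "\<exists>V\<in>rest. L - f \<in> V"
proof -
  have fT: "f \<in> \<Union>T" using merged_in(2) assms(1) .
  then obtain V where V: "V \<in> T" "L - f \<in> V" using opposite_ex assms(2) by blast
  have fL: "L - (L - f) = f" using merged_block(1)[OF assms(1)] by blast
  obtain a b where ab: "a \<in> merged" "b \<in> merged" "a \<noteq> b" "a \<noteq> f" "b \<noteq> f"
  proof -
    have "card (merged - {f}) = card merged - 1" using assms(1) by simp
    then have "2 \<le> card (merged - {f})" using card_merged by simp
    then obtain A where "A \<subseteq> merged - {f}" "card A = 2" by (meson obtain_subset_with_card_n)
    then show thesis using that by (auto simp: card_2_iff)
  qed
  have "a \<union> b \<subseteq> L - f"
    using merged_disj[OF ab(1) assms(1) ab(4)] merged_disj[OF ab(2) assms(1) ab(5)] merged_block(1)[OF ab(1)] merged_block(1)[OF ab(2)] by blast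
  then have nm: "L - f \<notin> merged" by (rule union_two_notin_partition[OF part_merged ab(1-3)])
  have "L - f \<noteq> S" "L - f \<noteq> L - S"
    using assms(1) merged_in(3,4) fL V12(7) by metis+
  then have "V \<noteq> V1" "V \<noteq> V2" using nm V(2) merged_in(5,6) by blast+
  then show ?thesis using V by (auto simp: rest_def)
qed

lemma rest_opposite:
  assumes "V \<in> rest" "f \<in> V" "2 \<le> card f" shows "(\<exists>X\<in>rest. L - f \<in> X) \<or> L - f \<in> merged"
proof -
  have V: "V \<in> T" using rest(1) assms(1) .
  obtain X where X: "X \<in> T" "L - f \<in> X" using opposite_ex[OF V assms(2,3)] by blast
  have fL: "L - (L - f) = f" using block_sub[OF V assms(2)] by blast
  have "L - f \<noteq> S" "L - f \<noteq> L - S"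
    using rest_blocks[OF assms(1,2)] fL V12(2,4,7) by metis+
  then show ?thesis using X merged_in(5,6) unfolding rest_def by blast
qed

lemma resolved_tree: "partition_tree L (resolved i p)"
  unfolding partition_tree_def
proof (intro conjI ballI allI impI)
  show "finite (resolved i p)" "resolved i p \<noteq> {}" using fin_T by (auto simp: resolved_def rest_def)
  fix V assume "V \<in> resolved i p"
  then consider "V \<in> rest" | "V = resolve1 i p" | "V = resolve2 i p" by (auto simp: resolved_def)
  then show "partition_on L V" "3 \<le> card V"
    using part rest(1) card3 part_resolve card_resolve card_merged by (cases; simp)+
next
  have aux: "V = W" if "V \<in> rest" "W \<in> {resolve1 i p, resolve2 i p}" "f \<in> V" "f \<in> W" for V W f
  proof -
    have "f \<in> merged \<union> {i \<union> p, L - (i \<union> p)}" using that(2,4) resolve_Un by blast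
    then have "f \<in> V1 \<or> f \<in> V2" using U_notin(3,4)[OF that(1)] that(3) merged_in(1) by blast
    then show ?thesis using rest_blocks[OF that(1,3)] by blast
  qed
  fix V W f assume VW: "V \<in> resolved i p" "W \<in> resolved i p" "f \<in> V" "f \<in> W"
  consider "V \<in> rest" "W \<in> rest" | "V \<in> rest" "W \<in> {resolve1 i p, resolve2 i p}"
    | "W \<in> rest" "V \<in> {resolve1 i p, resolve2 i p}"
    | "V \<in> {resolve1 i p, resolve2 i p}" "W \<in> {resolve1 i p, resolve2 i p}"
    using VW(1,2) unfolding resolved_def by blast
  then show "V = W"
  proof cases
    case 1 show ?thesis by (rule uniq[OF rest(1)[OF 1(1)] rest(1)[OF 1(2)] VW(3,4)])
  next
    case 2 show ?thesis by (rule aux[OF 2 VW(3,4)])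
  next
    case 3 show ?thesis by (rule sym[OF aux[OF 3 VW(4,3)]])
  next
    case 4
    have "\<not> (f \<in> resolve1 i p \<and> f \<in> resolve2 i p)" using resolve_disj by blast
    with 4 VW(3,4) show ?thesis by (elim insertE emptyE) simp_all
  qed
next
  fix V f assume V: "V \<in> resolved i p" "f \<in> V" "2 \<le> card f"
  have un: "\<exists>X\<in>resolved i p. x \<in> X" if "x \<in> merged \<union> {i \<union> p, L - (i \<union> p)}" for x
  proof -
    have "x \<in> resolve1 i p \<union> resolve2 i p" unfolding resolve_Un by (rule that)
    then show ?thesis unfolding resolved_def by blast
  qed
  show "\<exists>X\<in>resolved i p. L - f \<in> X"
  proof (cases "V \<in> rest")
    case True
    then show ?thesis using rest_opposite[OF True V(2,3)] un unfolding resolved_def by blast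
  next
    case False
    then have "f \<in> merged \<union> {i \<union> p, L - (i \<union> p)}" using V resolve_Un unfolding resolved_def by blast
    then consider "f \<in> merged" | "f = i \<union> p" | "f = L - (i \<union> p)" by blast
    then show ?thesis
    proof cases
      case 1 then show ?thesis using merged_opposite V(3) unfolding resolved_def by blast
    next
      case 2 show ?thesis unfolding 2 by (rule un) simp
    next
      case 3 show ?thesis unfolding 3 U_sub(2) by (rule un) simp
    qed
  qed
qed

lemma ptree_resolved: "ptree L (resolved i p)"
  using resolved_tree fin_L by unfold_locales

lemma Union_resolved: "\<Union>(resolved i p) = (\<Union>T - {S, L - S}) \<union> {i \<union> p, L - (i \<union> p)}"
proof -
  have "\<Union>(resolved i p) = \<Union>rest \<union> merged \<union> {i \<union> p, L - (i \<union> p)}"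
    unfolding resolved_def using resolve_Un by auto
  moreover have "\<Union>rest \<union> merged = \<Union>T - {S, L - S}"
  proof -
    have "\<Union>T = \<Union>(rest \<union> {V1, V2})" by (rule arg_cong[OF T_eq])
    then have UT: "\<Union>T = \<Union>rest \<union> V1 \<union> V2" by auto
    have "S \<notin> \<Union>rest" "L - S \<notin> \<Union>rest" using rest_blocks V12(2,4) by blast+
    then show ?thesis unfolding UT merged_def using S_notin by blast
  qed
  ultimately show ?thesis by simp
qed

lemma inner_resolved: "inner_flags (resolved i p) = (inner_flags T - {S, L - S}) \<union> {i \<union> p, L - (i \<union> p)}"
  unfolding inner_flags_def Union_resolved using U_card by auto

lemma vertex_resolved:
  "vertex_of (resolved i p) (i \<union> p) = resolve1 i p"
  "vertex_of (resolved i p) (L - (i \<union> p)) = resolve2 i p"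
  "V \<in> rest \<Longrightarrow> f \<in> V \<Longrightarrow> vertex_of (resolved i p) f = V"
  by (rule ptree.vertex_of_eq[OF ptree_resolved]; simp add: resolved_def resolve1_def resolve2_def)+

lemma vertex_resolved_merged:
  assumes "f \<in> merged" shows "vertex_of (resolved i p) f \<in> {resolve1 i p, resolve2 i p}"
proof -
  have "f \<in> resolve1 i p \<or> f \<in> resolve2 i p" using assms by (auto simp: resolve1_def resolve2_def)
  moreover have "resolve1 i p \<in> resolved i p" "resolve2 i p \<in> resolved i p" by (simp_all add: resolved_def)
  ultimately show ?thesis using ptree.vertex_of_eq[OF ptree_resolved] by blast
qed

end

text \<open>\<open>f\<close> contains at most one block of \<open>merged\<close> and its complement
  at least two. So \<open>L - f\<close> can belong neither to \<open>merged\<close> nor to the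
  contracted edge, and what lies behind \<open>f\<close> is untouched by contraction and
  resolution.\<close>

lemma beyond_merged:
  assumes g: "g \<in> merged" and f: "f \<in> inner_flags T" "f \<subseteq> g"
  shows "vertex_of T (L - f) \<in> rest"
proof -
  note fd = inner_flagsD[OF f(1)]
  define V where "V = vertex_of T (L - f)"
  have V: "V \<in> T" "L - f \<in> V" using fd by (auto simp: V_def)
  have no: "\<not> h1 \<union> h2 \<subseteq> f" if "h1 \<in> merged" "h2 \<in> merged" "h1 \<noteq> h2" for h1 h2
    using union_two_notin_partition[OF part_merged that, of g] f(2) g by blast
  have "L - f \<noteq> L - S"
  proof
    assume "L - f = L - S"
    then have "f = S" using fd(7) V12(7) by metis
    obtain h1 h2 where h: "h1 \<in> V2 - {L - S}" "h2 \<in> V2 - {L - S}" "h1 \<noteq> h2" using V2_two by blast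
    then have "h1 \<union> h2 \<subseteq> f" using V2_sub \<open>f = S\<close> by blast
    then show False using no[of h1 h2] h by (simp add: merged_def)
  qed
  moreover have "L - f \<noteq> S"
  proof
    assume "L - f = S"
    then have "f = L - S" using fd(7) by metis
    obtain h1 h2 where h: "h1 \<in> V1 - {S}" "h2 \<in> V1 - {S}" "h1 \<noteq> h2" using V1_two by blast
    then have "h1 \<union> h2 \<subseteq> f" using V1_sub \<open>f = L - S\<close> by blast
    then show False using no[of h1 h2] h by (simp add: merged_def)
  qed
  moreover have "L - f \<notin> merged"
  proof -
    have "card (merged - {g}) = card merged - 1" using g by simp
    then have "2 \<le> card (merged - {g})" using card_merged by simp
    then obtain A where "A \<subseteq> merged - {g}" "card A = 2" by (meson obtain_subset_with_card_n)
    then obtain a b where ab: "a \<in> merged" "b \<in> merged" "a \<noteq> b" "a \<noteq> g" "b \<noteq> g" by (auto simp: card_2_iff)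
    have "a \<union> b \<subseteq> L - f"
      using merged_disj[OF ab(1) g ab(4)] merged_disj[OF ab(2) g ab(5)] merged_block(1)[OF ab(1)] merged_block(1)[OF ab(2)] f(2) by blast
    then show ?thesis by (rule union_two_notin_partition[OF part_merged ab(1-3)])
  qed
  ultimately have "V \<noteq> V1" "V \<noteq> V2" using V(2) merged_in(5,6) by blast+
  then show ?thesis using V unfolding rest_def V_def by blast
qed

end

section \<open>The resolutions of a contracted edge and their jumps\<close>

lemma filter_insert:
  "{f \<in> insert a A. Q f} = (if Q a then insert a {f \<in> A. Q f} else {f \<in> A. Q f})"
  by auto

context broccoli_data
begin

text \<open>The extension by 0 to vertices that regular types do not have allows summation over all
  resolutions, whether or not they yield a regular type.\<close>

definition regular_mult :: "nat set set \<Rightarrow> complex" where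
  "regular_mult V = (if broccoli_vertex V \<and> \<not> degenerate V then block_mult V else 0)"

lemma is_join_shape:
  assumes V: "V = {a, b, c}" "a \<noteq> b" "charge a = 0" "charge b = 0" "charge c = 1"
    and j: "is_join V a' b' c'"
  shows "is_join V a b c" "det2 (bdir a') (bdir b') = 0 \<longleftrightarrow> det2 (bdir a) (bdir b) = 0"
proof -
  have j': "{a', b', c'} = {a, b, c}" "a' \<noteq> b'" "charge a' = 0" "charge b' = 0" "charge c' = 1"
    "even_vec (bdir a') \<or> even_vec (bdir b') \<or> \<not> even_vec (bdir c')"
    using j unfolding is_join_def V(1) by simp_all
  have "c' \<in> {a, b, c}" using j'(1) by blast
  then have c: "c' = c" using V(3,4) j'(5) by auto
  have "a' \<in> {a, b, c}" "b' \<in> {a, b, c}" using j'(1) by blast+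
  then have ab: "a' = a \<and> b' = b \<or> a' = b \<and> b' = a" using j'(2-4) V(5) by auto
  have "even_vec (bdir a) \<or> even_vec (bdir b) \<or> \<not> even_vec (bdir c)" using ab c j'(6) by metis
  moreover have "a \<noteq> c" "b \<noteq> c" using V(3-5) by auto
  ultimately show "is_join V a b c" unfolding is_join_def using V by simp
  show "det2 (bdir a') (bdir b') = 0 \<longleftrightarrow> det2 (bdir a) (bdir b) = 0"
    using ab det2_swap[of "bdir a" "bdir b"] by (metis neg_equal_0_iff_equal)
qed

lemma regular_join_det:
  assumes "partition_on labels V" "V = {a, b, c}" "a \<noteq> b" "charge a = 0" "charge b = 0" "charge c = 1"
    and "broccoli_vertex V" "\<not> degenerate V"
  shows "is_join V a b c" "det2 (bdir a) (bdir b) \<noteq> 0"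
proof -
  have "a \<in> V" using assms(2) by simp
  then have "join_vertex V" using broccoli_inflow[OF assms(7)] assms(4) by blast
  then obtain a' b' c' where j: "is_join V a' b' c'" by (auto simp: join_vertex_def)
  show 1: "is_join V a b c" using is_join_shape(1)[OF assms(2-6) j] .
  then show "det2 (bdir a) (bdir b) \<noteq> 0" using assms(8) unfolding degenerate_def by blast
qed

text \<open>If the left side vanishes, the inflows are parallel or two odd edges flow into an even
  one; in both cases \<open>join_coeff\<close> vanishes too.\<close>

lemma regular_mult_join:
  assumes "partition_on labels V" "V = {a, b, c}" "a \<noteq> b" "charge a = 0" "charge b = 0" "charge c = 1"
  shows "of_int (sgn (det2 (bdir a) (bdir b))) * regular_mult V = join_coeff (bdir a) (bdir b)"
proof (cases "broccoli_vertex V \<and> \<not> degenerate V")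
  case True
  then show ?thesis using block_mult_join[OF assms(1) regular_join_det(1)[OF assms]] by (simp add: regular_mult_def)
next
  case False
  have "a \<noteq> c" "b \<noteq> c" using assms(4-6) by auto
  then have s: "bdir c = - (bdir a + bdir b)"
    using partition_sums(1)[OF assms(1)] assms(3) unfolding assms(2) by (simp add: eq_neg_iff_add_eq_0 algebra_simps)
  show ?thesis
  proof (cases "broccoli_vertex V")
    case True
    then obtain a' b' c' where j: "is_join V a' b' c'" "det2 (bdir a') (bdir b') = 0"
      using False by (auto simp: degenerate_def)
    then have "det2 (bdir a) (bdir b) = 0" using is_join_shape(2)[OF assms(2-6) j(1)] by simp
    then show ?thesis using join_coeff_parallel by simp
  next
    case nb: False
    then have "\<not> is_join V a b c" unfolding broccoli_vertex_def join_vertex_def by blast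
    then have "\<not> even_vec (bdir a)" "\<not> even_vec (bdir b)" "even_vec (bdir c)"
      using assms(2-6) \<open>a \<noteq> c\<close> \<open>b \<noteq> c\<close> by (auto simp: is_join_def)
    then have "join_coeff (bdir a) (bdir b) = 0"
      using s by (intro join_coeff_forbidden) (auto simp: even_vec_def)
    then show ?thesis using nb by (simp add: regular_mult_def)
  qed
qed

lemma source_not_degenerate: "real_vertex V \<or> complex_vertex V \<Longrightarrow> \<not> degenerate V"
  using vertex_kinds_disjoint unfolding degenerate_def join_vertex_def by blast

lemma regular_mult_real:
  assumes "partition_on labels V" "V = {{x}, a, b}" "x \<in> {1..r}" "a \<noteq> b" "charge a = 1" "charge b = 1"
  shows "regular_mult V = (if even_vec (bdir a) then 0 else 1)"
proof -
  have xc: "charge {x} = - 1" using real_charge[OF assms(3)] .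
  have "{x} \<in> markings" using assms(3) by (auto simp: markings_def)
  then have b0: "bdir {x} = 0" by (rule bdir_marking)
  have "{x} \<noteq> a" "{x} \<noteq> b" using assms(5,6) xc by auto
  then have "bdir a + bdir b = 0"
    using partition_sums(1)[OF assms(1)] assms(4) b0 unfolding assms(2) by simp
  then have "bdir b = - bdir a" by (simp add: eq_neg_iff_add_eq_0 algebra_simps)
  then have ev: "even_vec (bdir b) = even_vec (bdir a)" by (simp add: even_vec_def)
  show ?thesis
  proof (cases "even_vec (bdir a)")
    case False
    then have "real_vertex V" unfolding real_vertex_def is_real_def using assms ev by blast
    then show ?thesis using False source_not_degenerate
      by (auto simp: regular_mult_def block_mult_def broccoli_vertex_def)
  next
    case True
    have "\<not> broccoli_vertex V"
    proof
      assume bv: "broccoli_vertex V"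
      have xm: "{x} \<in> V" "{x} \<in> markings" using assms(2,3) by (auto simp: markings_def)
      then have "\<not> join_vertex V" using join_unmarked(2) unfolding join_vertex_def by blast
      moreover have "\<not> complex_vertex V"
      proof
        assume "complex_vertex V"
        then obtain k a' b' c' where "is_complex V k a' b' c'" by (auto simp: complex_vertex_def)
        then show False using xm(1) xc complex_charge[of k] by (auto simp: is_complex_def)
      qed
      ultimately obtain k a' b' where k: "is_real V k a' b'" using bv by (auto simp: broccoli_vertex_def real_vertex_def)
      then have k': "{{k}, a', b'} = V" "charge {k} = - 1" "\<not> even_vec (bdir a')" "\<not> even_vec (bdir b')"
        using real_charge[of k] by (auto simp: is_real_def)
      have "a \<in> {{k}, a', b'}" unfolding k'(1) assms(2) by simp
      moreover have "a \<noteq> {k}" using assms(5) k'(2) by auto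
      ultimately show False using k'(3,4) True by auto
    qed
    then show ?thesis using True by (simp add: regular_mult_def)
  qed
qed

lemma regular_mult_complex:
  assumes "partition_on labels V" "V = {{x}, a, b, c}" "x \<in> {r + 1..r + s}" "a \<noteq> b" "a \<noteq> c" "b \<noteq> c"
    "charge a = 1" "charge b = 1" "charge c = 1"
  shows "regular_mult V = source_coeff (bdir a) (bdir b)"
proof (cases "even_vec (bdir a) \<and> even_vec (bdir b) \<and> even_vec (bdir c)")
  case False
  then have c: "is_complex V x a b c" unfolding is_complex_def using assms by blast
  then have "complex_vertex V" by (auto simp: complex_vertex_def)
  then show ?thesis using source_not_degenerate block_mult_complex[OF assms(1) c]
    by (simp add: regular_mult_def broccoli_vertex_def)
next
  case True
  have xc: "charge {x} = - 2" using complex_charge[OF assms(3)] .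
  have xm: "{x} \<in> V" "{x} \<in> markings" using assms(2,3) by (auto simp: markings_def)
  have "\<not> broccoli_vertex V"
  proof
    assume bv: "broccoli_vertex V"
    have "\<not> join_vertex V" using xm join_unmarked(2) unfolding join_vertex_def by blast
    moreover have "\<not> real_vertex V"
    proof
      assume "real_vertex V"
      then obtain k a' b' where "is_real V k a' b'" by (auto simp: real_vertex_def)
      then show False using xm(1) xc real_charge[of k] by (auto simp: is_real_def)
    qed
    ultimately obtain k a' b' c' where k: "is_complex V k a' b' c'" using bv by (auto simp: broccoli_vertex_def complex_vertex_def)
    have e: "even_vec (bdir f)" if "f \<in> V" "charge f = 1" for f using that True xc assms(2) by auto
    have "a' \<in> V" "b' \<in> V" "c' \<in> V" "charge a' = 1" "charge b' = 1" "charge c' = 1" using k by (auto simp: is_complex_def)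
    then show False using e k unfolding is_complex_def by blast
  qed
  then show ?thesis using True source_coeff_even by (simp add: regular_mult_def)
qed

end

text \<open>Of the two flags of an edge exactly one has charge 1. Choosing it as \<open>S\<close>
  makes \<open>V1\<close> the tail and \<open>V2\<close> the head of the edge.\<close>

locale wall = regular_tree + 
  fixes S assumes S_inner: "S \<in> inner_flags T" and S_charge: "charge S = 1"

sublocale wall \<subseteq> ptree_edge labels T S
  using S_inner by unfold_locales

context wall
begin

text \<open>Inside a block of \<open>merged\<close> the recursion of \<open>moment\<close> meets
  only vertices of \<open>rest\<close>, which all resolutions share.\<close>

lemma moment_resolved:
  assumes ip: "i \<in> merged" "p \<in> merged" "i \<noteq> p" and g: "g \<in> merged"
  shows "f \<in> \<Union>T \<Longrightarrow> f \<subseteq> g \<Longrightarrow> moment (resolved i p) P f = moment T P f"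
proof (induction "card f" arbitrary: f rule: less_induct)
  case less
  show ?case
  proof (cases "finite f \<and> 2 \<le> card f")
    case False
    then show ?thesis
      by (simp only: moment.simps[of T P f] moment.simps[of "resolved i p" P f] False if_False)
  next
    case True
    then have fi: "f \<in> inner_flags T" using less.prems by (simp add: inner_flags_def)
    define V where "V = vertex_of T (labels - f)"
    have V: "V \<in> rest" "labels - f \<in> V" using beyond_merged[OF g fi less.prems(2)] inner_flagsD(4)[OF fi] by (simp_all add: V_def)
    have V': "vertex_of (resolved i p) (labels - f) = V" using vertex_resolved(3)[OF ip V] .
    have "moment (resolved i p) P h = moment T P h" if "h \<in> {h \<in> V. h \<subset> f}" for h
    proof (rule less.hyps)
      show "card h < card f" using that True by (auto intro: psubset_card_mono)
      show "h \<in> \<Union>T" using that rest(1)[OF V(1)] by blast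
      show "h \<subseteq> g" using that less.prems(2) by blast
    qed
    then show ?thesis using True V'
      unfolding moment.simps[of T P f] moment.simps[of "resolved i p" P f] by (simp add: V_def[symmetric])
  qed
qed

text \<open>On the wall the two vertices of \<open>S\<close> have the same position. Giving it to
  both new vertices solves every resolution, with length 0 for the new edge and unchanged lengths
  elsewhere; so all resolutions meet at the same conditions.\<close>

lemma solves_resolved:
  assumes ip: "i \<in> merged" "p \<in> merged" "i \<noteq> p"
    and q: "solves T P q" and eq: "q V1 = q V2"
  defines "q' \<equiv> (\<lambda>V. if V \<in> rest then q V else q V1)"
  shows "solves (resolved i p) P q'"
    and "f \<in> inner_flags T \<Longrightarrow> f \<noteq> S \<Longrightarrow> f \<noteq> labels - S \<Longrightarrow> edge_length (resolved i p) q' f = edge_length T q f"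
    and "edge_length (resolved i p) q' (i \<union> p) = 0"
proof -
  note nr = resolve_notin_rest[OF ip]
  have q'12: "q' (resolve1 i p) = q V1" "q' (resolve2 i p) = q V1" using nr by (simp_all add: q'_def)
  have main: "q' (vertex_of (resolved i p) f) = q (vertex_of T f)" if f: "f \<in> \<Union>T" "f \<noteq> S" "f \<noteq> labels - S" for f
  proof -
    define V where "V = vertex_of T f"
    have V: "V \<in> T" "f \<in> V" using vertex_of_in[OF f(1)] by (simp_all add: V_def)
    show ?thesis
    proof (cases "V \<in> rest")
      case True
      then show ?thesis using vertex_resolved(3)[OF ip True V(2)] by (simp add: q'_def V_def)
    next
      case False
      then have V12: "V = V1 \<or> V = V2" using V(1) by (simp add: rest_def)
      then have "f \<in> merged" using V(2) f(2,3) merged_in(5,6) by blast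
      from vertex_resolved_merged[OF ip this] show ?thesis using q'12 V12 eq unfolding V_def by auto
    qed
  qed
  have inner: "f \<in> \<Union>T \<and> labels - f \<in> \<Union>T \<and> labels - f \<noteq> S \<and> labels - f \<noteq> labels - S"
    if f: "f \<in> inner_flags T" "f \<noteq> S" "f \<noteq> labels - S" for f
  proof -
    note fd = inner_flagsD[OF f(1)]
    have "labels - f \<noteq> S" "labels - f \<noteq> labels - S" using fd(7) V12(7) f(2,3) by metis+
    then show ?thesis using fd(1-4) by blast
  qed
  have U: "labels - (labels - (i \<union> p)) = i \<union> p" using U_sub(2)[OF ip] .
  have S2: "2 \<le> card S" "2 \<le> card (labels - S)"
    using inner_flagsD(6)[OF S_inner] S_inner by (simp_all add: inner_flags_def)
  have single: "{k} \<noteq> X" if "2 \<le> card X" for k :: nat and X using that by auto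
  have single_T: "{k} \<in> \<Union>T" if "{k} \<in> \<Union>(resolved i p)" for k
    using that single[OF U_card(1)[OF ip], of k] single[OF U_card(2)[OF ip], of k]
    unfolding Union_resolved[OF ip] by (metis DiffD1 UnE emptyE insertE)
  show "solves (resolved i p) P q'"
    unfolding solves_def
  proof (intro conjI ballI impI)
    fix f assume "f \<in> inner_flags (resolved i p)"
    then consider "f \<in> inner_flags T" "f \<noteq> S" "f \<noteq> labels - S" | "f = i \<union> p" | "f = labels - (i \<union> p)"
      unfolding inner_resolved[OF ip] by blast
    then show "det2 (rdir f) (q' (vertex_of (resolved i p) f)) = det2 (rdir f) (q' (vertex_of (resolved i p) (labels - f)))"
    proof cases
      case 1
      then show ?thesis using main inner[OF 1] q unfolding solves_def by simp
    next
      case 2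
      show ?thesis unfolding 2 vertex_resolved(1,2)[OF ip] q'12 ..
    next
      case 3
      show ?thesis unfolding 3 U vertex_resolved(1,2)[OF ip] q'12 ..
    qed
  next
    fix V k assume k: "V \<in> resolved i p" "k \<in> {1..r + s}" "{k} \<in> V"
    have V: "V = vertex_of (resolved i p) {k}" using ptree.vertex_of_eq[OF ptree_resolved[OF ip] k(1,3)] by simp
    have "{k} \<in> \<Union>(resolved i p)" using k by blast
    note kT = single_T[OF this] single[OF S2(1), of "k"] single[OF S2(2), of "k"]
    have "q' V = q (vertex_of T {k})" using main[OF kT] V by simp
    then show "q' V = Poly_Mapping.lookup (fst P) k" using q vertex_of_in[OF kT(1)] k(2) unfolding solves_def by simp
  next
    fix V j assume k: "V \<in> resolved i p" "j \<in> F" "{r + s + j} \<in> V"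
    have V: "V = vertex_of (resolved i p) {r + s + j}" using ptree.vertex_of_eq[OF ptree_resolved[OF ip] k(1,3)] by simp
    have "{r + s + j} \<in> \<Union>(resolved i p)" using k by blast
    note kT = single_T[OF this] single[OF S2(1), of "r + s + j"] single[OF S2(2), of "r + s + j"]
    have "q' V = q (vertex_of T {r + s + j})" using main[OF kT] V by simp
    then show "det2 (real_vec (v j)) (q' V) = Poly_Mapping.lookup (snd P) j"
      using q vertex_of_in[OF kT(1)] k(2) unfolding solves_def by simp
  qed
  show "edge_length (resolved i p) q' f = edge_length T q f"
    if f: "f \<in> inner_flags T" "f \<noteq> S" "f \<noteq> labels - S"
    unfolding edge_length_def using main inner[OF f] f by simp
  show "edge_length (resolved i p) q' (i \<union> p) = 0"
    unfolding edge_length_def vertex_resolved(1,2)[OF ip] q'12 by simp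
qed

text \<open>The flag \<open>labels - S\<close> has charge 0, so it flows into \<open>V2\<close>, and
  \<open>V2\<close> is a join. In particular it is trivalent, and \<open>T\<close> is itself a
  resolution of its contraction.\<close>

lemma head_join:
  obtains i p where "is_join V2 (labels - S) i p" "i \<in> merged" "p \<in> merged" "i \<noteq> p"
    "charge i = 0" "charge p = 1" "S = i \<union> p" "resolve1 i p = V1" "resolve2 i p = V2"
proof -
  have ch: "charge (labels - S) = 0" using inner_charge[OF S_inner] S_charge by simp
  obtain a i p where j: "is_join V2 a i p" and a: "labels - S = a" using inflow_join[OF V12(3,4) ch] .
  have m: "i \<in> V2" "p \<in> V2" "i \<noteq> labels - S" "p \<noteq> labels - S" "i \<noteq> p" "V2 = {labels - S, i, p}" "charge i = 0" "charge p = 1"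
    using j unfolding a is_join_def by auto
  have mm: "i \<in> merged" "p \<in> merged" using merged_in(6) m by auto
  have "V2 - {labels - S} = {i, p}" using m by auto
  then have U: "S = i \<union> p" using V2_union by simp
  have r2: "resolve2 i p = V2" unfolding resolve2_def U[symmetric] using m(6) by auto
  have "merged - {i, p} = V1 - {S}"
  proof -
    have "i \<notin> V1" "p \<notin> V1" using uniq[OF V12(1,3)] m(1,2) V12(5) by blast+
    then show ?thesis unfolding merged_def \<open>V2 - {labels - S} = {i, p}\<close> by blast
  qed
  then have r1: "resolve1 i p = V1" unfolding resolve1_def U[symmetric] using V12(2) by auto
  show thesis using that[OF j[unfolded a[symmetric]] mm m(5,7,8) U r1 r2] .
qed

lemma self_resolved: "resolve1 i p = V1 \<Longrightarrow> resolve2 i p = V2 \<Longrightarrow> resolved i p = T"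
  unfolding resolved_def by (simp only: T_eq[symmetric])

text \<open>The trivalent vertex is to be the head of the new edge, hence a join: apart from the new
  edge it has one inflow \<open>i\<close> and one outflow \<open>p\<close>.\<close>

definition resolutions :: "(nat set \<times> nat set) set" where
  "resolutions = {(i, p). i \<in> merged \<and> p \<in> merged \<and> charge i = 0 \<and> charge p = 1}"

lemma resolutions_Times: "resolutions = {f \<in> merged. charge f = 0} \<times> {f \<in> merged. charge f = 1}"
  by (auto simp: resolutions_def)

lemma resolutionsD:
  assumes "(i, p) \<in> resolutions"
  shows "i \<in> merged" "p \<in> merged" "i \<noteq> p" "charge i = 0" "charge p = 1"
    "charge (i \<union> p) = 1" "charge (labels - (i \<union> p)) = 0"
    "bdir (i \<union> p) = bdir i + bdir p" "bdir (labels - (i \<union> p)) = - (bdir i + bdir p)"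
proof -
  show m: "i \<in> merged" "p \<in> merged" "charge i = 0" "charge p = 1" using assms by (auto simp: resolutions_def)
  then show ne: "i \<noteq> p" by auto
  have fin: "finite i" "finite p" "i \<inter> p = {}"
    using merged_block(1)[OF m(1)] merged_block(1)[OF m(2)] fin_labels finite_subset merged_disj[OF m(1,2) ne] by blast+
  show c: "charge (i \<union> p) = 1" and b: "bdir (i \<union> p) = bdir i + bdir p"
    using charge_Un[OF fin] bdir_Un[OF fin] m by auto
  show "charge (labels - (i \<union> p)) = 0" "bdir (labels - (i \<union> p)) = - (bdir i + bdir p)"
    using charge_compl[OF U_sub(1)[OF m(1,2) ne]] bdir_compl[OF U_sub(1)[OF m(1,2) ne]] c b by auto
qed

lemma regular_resolved_iff:
  assumes "(i, p) \<in> resolutions"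
  shows "regular_type (resolved i p) \<longleftrightarrow>
     broccoli_vertex (resolve1 i p) \<and> \<not> degenerate (resolve1 i p) \<and>
     broccoli_vertex (resolve2 i p) \<and> \<not> degenerate (resolve2 i p)"
proof -
  note d = resolutionsD[OF assms]
  have "broccoli_vertex V \<and> \<not> degenerate V" if "V \<in> rest" for V
    using rest(1)[OF that] bvertex nondeg by blast
  then show ?thesis unfolding regular_type_def broccoli_type_def
    using resolved_tree[OF d(1-3)] unfolding resolved_def by blast
qed

definition rest_mult :: complex where "rest_mult = (\<Prod>V\<in>rest. block_mult V)"

lemma type_mult_resolved:
  assumes "(i, p) \<in> resolutions"
  shows "type_mult (resolved i p) = rest_mult * (block_mult (resolve1 i p) * block_mult (resolve2 i p))"
proof -
  note nr = resolve_notin_rest[OF resolutionsD(1-3)[OF assms]]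
  have "finite rest" using fin_T by (simp add: rest_def)
  then show ?thesis unfolding type_mult_def resolved_def rest_mult_def
    using nr by (subst prod.union_disjoint) auto
qed

text \<open>
  The contribution of a resolution to the jump of the count when crossing the wall in
  direction \<open>U\<close>.
\<close>

definition jump :: "conditions \<Rightarrow> nat set \<times> nat set \<Rightarrow> complex" where
  "jump U = (\<lambda>(i, p). if regular_type (resolved i p)
      then type_mult (resolved i p) * of_real (sgn (type_length (resolved i p) (i \<union> p) U)) else 0)"

text \<open>
  The new edge leaves its tail in direction \<open>bdir i + bdir p\<close> and ends on the line of \<open>i\<close>.
\<close>

lemma resolved_length:
  assumes "(i, p) \<in> resolutions" "regular_type (resolved i p)"
  shows "type_length (resolved i p) (i \<union> p) P * real_of_int (det2 (bdir i) (bdir p)) =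
     moment T P i - det2 (rdir i) (position (resolved i p) P (resolve1 i p))"
proof -
  note d = resolutionsD[OF assms(1)]
  interpret R: regular_tree r s n v F "resolved i p" using regular_tree_iff assms(2) by blast
  let ?q = "position (resolved i p) P"
  have U: "i \<union> p \<in> inner_flags (resolved i p)" unfolding inner_resolved[OF d(1-3)] by blast
  have r2: "resolve2 i p \<in> resolved i p" "i \<in> resolve2 i p" by (auto simp: resolved_def resolve2_def)
  have "?q (resolve2 i p) - ?q (resolve1 i p) = type_length (resolved i p) (i \<union> p) P *\<^sub>R (rdir i + rdir p)"
    using R.edge_vector[OF R.position_solves U] unfolding vertex_resolved(1,2)[OF d(1-3)] d(8) real_vec_add type_length_def .
  then have "det2 (rdir i) (?q (resolve2 i p)) - det2 (rdir i) (?q (resolve1 i p)) =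
      type_length (resolved i p) (i \<union> p) P * det2 (rdir i) (rdir i + rdir p)"
    unfolding det2_diff_right[symmetric] by (simp add: det2_scale_right)
  moreover have "det2 (rdir i) (?q (resolve2 i p)) = moment T P i"
    using R.position_moment[OF r2 d(4)] moment_resolved[OF d(1-3) d(1) merged_in(2)[OF d(1)], of P] by simp
  ultimately show ?thesis by (simp add: det2_add_right det2_self det2_real_vec)
qed

lemma sum_merged: "(\<Sum>f\<in>merged. bdir f) = 0"
  using partition_sums(1)[OF part_merged] .

lemma jump_eq:
  assumes "(i, p) \<in> resolutions"
  shows "jump U (i, p) = rest_mult * (regular_mult (resolve1 i p) * regular_mult (resolve2 i p)) *
     of_real (sgn (type_length (resolved i p) (i \<union> p) U))"
  unfolding jump_def using regular_resolved_iff[OF assms] type_mult_resolved[OF assms]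
  by (auto simp: regular_mult_def)

lemma regular_mult_cases:
  assumes "(i, p) \<in> resolutions"
  obtains "regular_type (resolved i p)" | "regular_mult (resolve1 i p) = 0" | "regular_mult (resolve2 i p) = 0"
  using regular_resolved_iff[OF assms] unfolding regular_mult_def by metis

lemma resolve2_mult:
  assumes "(i, p) \<in> resolutions" "d = - (bdir i + bdir p)"
  shows "of_int (sgn (det2 (bdir i) d)) * regular_mult (resolve2 i p) = join_coeff (bdir i) d"
proof -
  note r = resolutionsD[OF assms(1)]
  have ne: "i \<noteq> labels - (i \<union> p)" using U_notin(2)[OF r(1-3)] r(1) by metis
  have V: "resolve2 i p = {i, labels - (i \<union> p), p}" by (auto simp: resolve2_def)
  show ?thesis using regular_mult_join[OF part_resolve(2)[OF r(1-3)] V ne r(4,7,5)] r(9) assms(2) by simp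
qed

lemma resolve2_det:
  assumes "(i, p) \<in> resolutions" "d = - (bdir i + bdir p)"
    "broccoli_vertex (resolve2 i p)" "\<not> degenerate (resolve2 i p)"
  shows "det2 (bdir i) d \<noteq> 0"
proof -
  note r = resolutionsD[OF assms(1)]
  have ne: "i \<noteq> labels - (i \<union> p)" using U_notin(2)[OF r(1-3)] r(1) by metis
  have V: "resolve2 i p = {i, labels - (i \<union> p), p}" by (auto simp: resolve2_def)
  show ?thesis using regular_join_det(2)[OF part_resolve(2)[OF r(1-3)] V ne r(4,7,5) assms(3,4)] r(9) assms(2) by simp
qed

text \<open>\<open>K\<close> is the form that vanishes when the lines carrying the three inflows
  pass through one point. It is invariant under cyclic permutations of \<open>a\<close>,
  \<open>b\<close> and \<open>c\<close>, so its sign is common to the three resolutions, and the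
  rest is one term of the Jacobi identity.\<close>

lemma jump_join:
  fixes U :: conditions
  assumes m: "merged = {a, b, c, p}" and ch: "charge a = 0" "charge b = 0" "charge c = 0" "charge p = 1"
    and ne: "a \<noteq> b" "a \<noteq> c" "b \<noteq> c"
  defines "K \<equiv> moment T U a * det2 (bdir b) (bdir c) + moment T U b * det2 (bdir c) (bdir a) +
    moment T U c * det2 (bdir a) (bdir b)"
  shows "jump U (a, p) = - rest_mult * of_real (sgn K) *
    (join_coeff (bdir b) (bdir c) * join_coeff (bdir a) (bdir b + bdir c))"
proof -
  have res: "(a, p) \<in> resolutions" using m ch by (simp add: resolutions_def)
  note r = resolutionsD[OF res]
  have pne: "p \<noteq> a" "p \<noteq> b" "p \<noteq> c" using ch by auto
  have "bdir a + bdir b + bdir c + bdir p = 0" using sum_merged ne pne unfolding m by (simp add: algebra_simps)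
  then have bp: "bdir b + bdir c = - (bdir a + bdir p)" by (simp add: eq_neg_iff_add_eq_0 algebra_simps)
  define D E where "D = det2 (bdir b) (bdir c)" and "E = det2 (bdir a) (bdir b + bdir c)"
  have r1: "resolve1 a p = {b, c, a \<union> p}"
    unfolding resolve1_def m using ne pne by auto
  have J1: "of_int (sgn D) * regular_mult (resolve1 a p) = join_coeff (bdir b) (bdir c)"
    unfolding D_def using regular_mult_join[OF part_resolve(1)[OF r(1-3)] r1 ne(3) ch(2,3) r(6)] .
  have J2: "of_int (sgn E) * regular_mult (resolve2 a p) = join_coeff (bdir a) (bdir b + bdir c)"
    unfolding E_def by (rule resolve2_mult[OF res bp])
  show ?thesis
  proof (cases rule: regular_mult_cases[OF res])
    case 1
    interpret R: regular_tree r s n v F "resolved a p" using regular_tree_iff 1 by blast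
    let ?q = "position (resolved a p) U (resolve1 a p)"
    define l where "l = type_length (resolved a p) (a \<union> p) U"
    have rin: "resolve1 a p \<in> resolved a p" "b \<in> resolve1 a p" "c \<in> resolve1 a p" unfolding r1 by (simp_all add: resolved_def r1)
    have bm: "b \<in> merged" "c \<in> merged" using m by auto
    have M: "det2 (rdir b) ?q = moment T U b" "det2 (rdir c) ?q = moment T U c"
      using R.position_moment[OF rin(1,2) ch(2)] R.position_moment[OF rin(1,3) ch(3)]
        moment_resolved[OF r(1-3) bm(1) merged_in(2)[OF bm(1)]] moment_resolved[OF r(1-3) bm(2) merged_in(2)[OF bm(2)]] by simp_all
    \<comment> \<open>The Pluecker relation expresses the moment of \<open>a\<close> about the
      intersection point of the lines of \<open>b\<close> and \<open>c\<close> by the moments of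
      \<open>b\<close> and \<open>c\<close>.\<close>
    have plucker: "det2 (rdir b) (rdir c) * det2 (rdir a) ?q = det2 (rdir b) ?q * det2 (rdir a) (rdir c) - det2 (rdir c) ?q * det2 (rdir a) (rdir b)"
      by (simp add: det2_def algebra_simps)
    have len: "l * real_of_int (det2 (bdir a) (bdir p)) = moment T U a - det2 (rdir a) ?q"
      unfolding l_def by (rule resolved_length[OF res 1])
    have dE: "det2 (bdir a) (bdir p) = - E"
      unfolding E_def bp by (simp add: det2_minus_right det2_add_right det2_diff_right det2_self)
    have "l * real_of_int E * real_of_int D = - ((moment T U a - det2 (rdir a) ?q) * real_of_int D)"
      unfolding len[symmetric] dE by simp
    also have "\<dots> = - K"
      using plucker unfolding M K_def D_def det2_real_vec det2_swap[of "bdir c" "bdir a"] by (simp add: algebra_simps)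
    finally have lK: "l * real_of_int E * real_of_int D = - K" .
    have D: "D \<noteq> 0" unfolding D_def
      using regular_join_det(2)[OF part_resolve(1)[OF r(1-3)] r1 ne(3) ch(2,3) r(6)] regular_resolved_iff[OF res] 1 by blast
    have E: "E \<noteq> 0" unfolding E_def using resolve2_det[OF res bp] regular_resolved_iff[OF res] 1 by blast
    have K: "K = - (l * real_of_int E * real_of_int D)" using lK by simp
    \<comment> \<open>The sign of the length is, up to that of \<open>K\<close>, the product of the
      signs of the two join determinants. These are the signs missing in the multiplicities, see
      \<open>J1\<close> and \<open>J2\<close>.\<close>
    have "sgn l = - sgn K * sgn (real_of_int E) * sgn (real_of_int D)"
      unfolding K sgn_mult sgn_minus using D E by (simp add: sgn_if)
    then have "of_real (sgn l) = - of_real (sgn K) * (of_int (sgn E) * of_int (sgn D) :: complex)"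
      by (simp add: sgn_if split: if_splits)
    then show ?thesis unfolding jump_eq[OF res] l_def[symmetric] J1[symmetric] J2[symmetric] by simp
  \<comment> \<open>In the other cases a multiplicity on the left is 0; by \<open>J1\<close> or
    \<open>J2\<close> its coefficient on the right is 0 as well.\<close>
  qed (use J1 J2 jump_eq[OF res] in auto)
qed

text \<open>The tail carries the marking, so its position is a condition and only the head
  contributes a determinant. The remaining sign tells on which side of the line of \<open>w\<close>
  the marked point lies; it does not involve \<open>p\<close> and is common to all
  resolutions.\<close>

lemma jump_source:
  assumes x: "{x} \<in> merged" "x \<in> {1..r + s}" and res: "(w, p) \<in> resolutions" and wx: "w \<noteq> {x}" "p \<noteq> {x}"
    and d: "d = - (bdir w + bdir p)"
  shows "jump U (w, p) = - rest_mult * of_real (sgn (moment T U w - det2 (rdir w) (Poly_Mapping.lookup (fst U) x))) *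
    (regular_mult (resolve1 w p) * join_coeff (bdir w) d)"
proof -
  note r = resolutionsD[OF res]
  define E where "E = det2 (bdir w) d"
  define K where "K = moment T U w - det2 (rdir w) (Poly_Mapping.lookup (fst U) x)"
  have J2: "of_int (sgn E) * regular_mult (resolve2 w p) = join_coeff (bdir w) d"
    unfolding E_def by (rule resolve2_mult[OF res d])
  show ?thesis
  proof (cases rule: regular_mult_cases[OF res])
    case 1
    interpret R: regular_tree r s n v F "resolved w p" using regular_tree_iff 1 by blast
    let ?q = "position (resolved w p) U (resolve1 w p)"
    define l where "l = type_length (resolved w p) (w \<union> p) U"
    have "resolve1 w p \<in> resolved w p" "{x} \<in> resolve1 w p" using x wx by (auto simp: resolved_def resolve1_def)
    then have q: "?q = Poly_Mapping.lookup (fst U) x" using R.position_solves[of U] x(2) unfolding solves_def by blast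
    have len: "l * real_of_int (det2 (bdir w) (bdir p)) = K"
      unfolding l_def K_def q[symmetric] by (rule resolved_length[OF res 1])
    have dE: "det2 (bdir w) (bdir p) = - E"
      unfolding E_def d by (simp add: det2_minus_right det2_add_right det2_diff_right det2_self)
    have E: "E \<noteq> 0" unfolding E_def using resolve2_det[OF res d] regular_resolved_iff[OF res] 1 by blast
    have "sgn l = - sgn K * sgn (real_of_int E)"
      unfolding len[symmetric] dE using E by (simp add: sgn_mult sgn_minus)
    then have "of_real (sgn l) = - of_real (sgn K) * (of_int (sgn E) :: complex)"
      by (simp add: sgn_if split: if_splits)
    then show ?thesis unfolding jump_eq[OF res] l_def[symmetric] J2[symmetric] K_def by simp
  qed (use J2 jump_eq[OF res] in auto)
qed

text \<open>The head of the short edge is a join, so only the kind of the tail matters. If it is a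
  join, three edges flow into \<open>merged\<close>, and each of them can be split off together with
  the only outflow. If it carries a marking, there is one inflow, and each outflow can be split off
  with it: two terms for a real and three for a complex marking.\<close>

lemma jump_sum_zero: "(\<Sum>x\<in>resolutions. jump U x) = 0"
proof -
  obtain i p where j: "is_join V2 (labels - S) i p" "i \<in> merged" "p \<in> merged" "i \<noteq> p"
    "charge i = 0" "charge p = 1" using head_join by metis
  have V2: "V2 - {labels - S} = {i, p}" using j(1) by (auto simp: is_join_def)
  have card_V2: "card V2 = 3" using j(1) by (auto simp: is_join_def)
  consider a b c where "is_join V1 a b c" | x a b where "is_real V1 x a b" | x a b c where "is_complex V1 x a b c"
    using bvertex[OF V12(1)] unfolding broccoli_vertex_def join_vertex_def real_vertex_def complex_vertex_def by blast
  then show ?thesis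
  proof cases
    case (1 a b c)
    then have ch: "charge a = 0" "charge b = 0" and V1: "V1 = {a, b, c}" and ne: "a \<noteq> b" "a \<noteq> c" "b \<noteq> c"
      by (auto simp: is_join_def)
    have "S = c" using V12(2) ch S_charge unfolding V1 by auto
    then have m: "merged = {a, b, i, p}" unfolding merged_def V2 unfolding V1 using ne by auto
    \<comment> \<open>The cardinality excludes coincidences between blocks of the tail and blocks of
      the head.\<close>
    have "card merged = 4" using card_merged(1) card_V2 ne unfolding V1 by simp
    then have ne: "a \<noteq> b" "a \<noteq> i" "b \<noteq> i" unfolding m by (auto simp: card_insert_if split: if_splits)
    have pne: "a \<noteq> p" "b \<noteq> p" using ch j(6) by auto
    have R: "resolutions = {(a, p), (b, p), (i, p)}" unfolding resolutions_Times m filter_insert using ch j(5,6) by simp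
    have m2: "merged = {b, i, a, p}" "merged = {i, a, b, p}" unfolding m by auto
    define K where "K = moment T U a * det2 (bdir b) (bdir i) + moment T U b * det2 (bdir i) (bdir a) +
      moment T U i * det2 (bdir a) (bdir b)"
    have J1: "jump U (a, p) = - rest_mult * of_real (sgn K) * (join_coeff (bdir b) (bdir i) * join_coeff (bdir a) (bdir b + bdir i))"
      using jump_join[OF m ch j(5,6) ne, of U] by (simp add: K_def)
    have J2: "jump U (b, p) = - rest_mult * of_real (sgn K) * (join_coeff (bdir i) (bdir a) * join_coeff (bdir b) (bdir i + bdir a))"
      using jump_join[OF m2(1) ch(2) j(5) ch(1) j(6) ne(3) ne(1)[symmetric] ne(2)[symmetric], of U] by (simp add: K_def add_ac)
    have J3: "jump U (i, p) = - rest_mult * of_real (sgn K) * (join_coeff (bdir a) (bdir b) * join_coeff (bdir i) (bdir a + bdir b))"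
      using jump_join[OF m2(2) j(5) ch j(6) ne(2)[symmetric] ne(3)[symmetric] ne(1), of U] by (simp add: K_def add_ac)
    have "(\<Sum>x\<in>resolutions. jump U x) = jump U (a, p) + jump U (b, p) + jump U (i, p)"
      unfolding R using ne by (simp add: add.assoc)
    then show ?thesis
      unfolding J1 J2 J3 distrib_left[symmetric] join_coeff_jacobi by simp
  next
    case (2 x a b)
    then have "charge {x} = - 1" "V1 = {{x}, a, b}" using real_charge[of x] by (simp_all add: is_real_def)
    then have "S = a \<or> S = b" using V12(2) S_charge by (metis empty_iff insert_iff one_neq_neg_one)
    moreover have "is_real V1 x b a" using 2 unfolding is_real_def by (metis insert_commute)
    ultimately have "\<exists>q. is_real V1 x S q" using 2 by blast
    then obtain q where q: "is_real V1 x S q" by blast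
    then have V1: "V1 = {{x}, S, q}" and x: "x \<in> {1..r}" and ch: "charge q = 1" and neq: "S \<noteq> q" by (auto simp: is_real_def)
    have xc: "charge {x} = - 1" using real_charge[OF x] .
    then have xne: "{x} \<noteq> S" "{x} \<noteq> q" "{x} \<noteq> i" "{x} \<noteq> p" using S_charge ch j(5,6) by auto
    have m: "merged = {{x}, q, i, p}" unfolding merged_def V2 unfolding V1 using neq xne by auto
    have "card merged = 4" using card_merged(1) card_V2 neq xne unfolding V1 by simp
    then have pq: "p \<noteq> q" using xne unfolding m by (auto simp: card_insert_if split: if_splits)
    have iq: "i \<noteq> q" using j(5) ch by auto
    have R: "resolutions = {(i, q), (i, p)}" unfolding resolutions_Times m filter_insert using ch j(5,6) xc by simp
    have res: "(i, p) \<in> resolutions" "(i, q) \<in> resolutions" using R by auto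
    have x': "{x} \<in> merged" "x \<in> {1..r + s}" using m x by auto
    have "{x} \<in> markings" using x' by (auto simp: markings_def)
    then have s0: "bdir i + bdir p + bdir q = 0" using sum_merged xne iq pq j(4) bdir_marking unfolding m by (simp add: algebra_simps)
    then have dq: "bdir q = - (bdir i + bdir p)" and dp: "bdir p = - (bdir i + bdir q)"
      by (simp_all add: eq_neg_iff_add_eq_0 algebra_simps)
    have r1: "resolve1 i p = {{x}, q, i \<union> p}" "resolve1 i q = {{x}, p, i \<union> q}"
      unfolding resolve1_def m using xne iq pq j(4) by auto
    have reg: "regular_mult (resolve1 i p) = (if even_vec (bdir q) then 0 else 1)"
      "regular_mult (resolve1 i q) = (if even_vec (bdir p) then 0 else 1)"
      using regular_mult_real[OF part_resolve(1)[OF resolutionsD(1-3)[OF res(1)]] r1(1) x _ ch resolutionsD(6)[OF res(1)]]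
        regular_mult_real[OF part_resolve(1)[OF resolutionsD(1-3)[OF res(2)]] r1(2) x _ j(6) resolutionsD(6)[OF res(2)]]
        U_notin(1)[OF resolutionsD(1-3)[OF res(1)]] U_notin(1)[OF resolutionsD(1-3)[OF res(2)]] resolutionsD(2)[OF res(1)] resolutionsD(2)[OF res(2)]
      by metis+
    have "(\<Sum>x\<in>resolutions. jump U x) = jump U (i, p) + jump U (i, q)" unfolding R using pq by (simp add: add_ac)
    also have "\<dots> = 0"
      unfolding jump_source[OF x' res(1) xne(3)[symmetric] xne(4)[symmetric] dq]
        jump_source[OF x' res(2) xne(3)[symmetric] xne(2)[symmetric] dp] distrib_left[symmetric]
      using real_source_identity[OF s0] unfolding reg by (simp split: if_splits)
    finally show ?thesis .
  next
    case (3 x a b c)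
    then have "charge {x} = - 2" "V1 = {{x}, a, b, c}" using complex_charge[of x] by (simp_all add: is_complex_def)
    then have "S \<noteq> {x}" "S \<in> {{x}, a, b, c}" using V12(2) S_charge by auto
    then have "S = a \<or> S = b \<or> S = c" by simp
    moreover have "is_complex V1 x b a c" "is_complex V1 x c a b" using 3 unfolding is_complex_def by (metis insert_commute)+
    ultimately have "\<exists>q q'. is_complex V1 x S q q'" using 3 by blast
    then obtain q q' where q: "is_complex V1 x S q q'" by blast
    then have V1: "V1 = {{x}, S, q, q'}" and x: "x \<in> {r + 1..r + s}" and ch: "charge q = 1" "charge q' = 1"
      and neq: "S \<noteq> q" "S \<noteq> q'" "q \<noteq> q'" by (auto simp: is_complex_def)
    have xc: "charge {x} = - 2" using complex_charge[OF x] .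
    then have xne: "{x} \<noteq> S" "{x} \<noteq> q" "{x} \<noteq> q'" "{x} \<noteq> i" "{x} \<noteq> p" using S_charge ch j(5,6) by auto
    have m: "merged = {{x}, q, q', i, p}" unfolding merged_def V2 unfolding V1 using neq xne by auto
    have "card merged = 5" using card_merged(1) card_V2 neq xne unfolding V1 by simp
    then have pq: "p \<noteq> q" "p \<noteq> q'" using xne neq j(4) unfolding m by (auto simp: card_insert_if split: if_splits)
    have iq: "i \<noteq> q" "i \<noteq> q'" using j(5) ch by auto
    have R: "resolutions = {(i, q), (i, q'), (i, p)}" unfolding resolutions_Times m filter_insert using ch j(5,6) xc by simp
    have res: "(i, p) \<in> resolutions" "(i, q) \<in> resolutions" "(i, q') \<in> resolutions" using R by auto
    have x': "{x} \<in> merged" "x \<in> {1..r + s}" using m x by auto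
    have "{x} \<in> markings" using x' by (auto simp: markings_def)
    then have s0: "bdir i + bdir p + bdir q + bdir q' = 0"
      using sum_merged xne iq pq j(4) neq bdir_marking unfolding m by (simp add: algebra_simps)
    have dp: "bdir q + bdir q' = - (bdir i + bdir p)" and dq: "bdir q' + bdir p = - (bdir i + bdir q)"
      and dq': "bdir p + bdir q = - (bdir i + bdir q')"
      using s0 by (simp_all add: eq_neg_iff_add_eq_0 algebra_simps)
    have r1: "resolve1 i p = {{x}, q, q', i \<union> p}" "resolve1 i q = {{x}, q', p, i \<union> q}" "resolve1 i q' = {{x}, p, q, i \<union> q'}"
    proof -
      have D: "merged - {i, p} = {{x}, q, q'}" "merged - {i, q} = {{x}, q', p}" "merged - {i, q'} = {{x}, p, q}"
        unfolding m using xne iq pq j(4) neq iq[symmetric] pq[symmetric] neq(3)[symmetric] j(4)[symmetric]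
        by (simp_all add: insert_Diff_if insert_commute)
      show "resolve1 i p = {{x}, q, q', i \<union> p}" "resolve1 i q = {{x}, q', p, i \<union> q}" "resolve1 i q' = {{x}, p, q, i \<union> q'}"
        unfolding resolve1_def D by blast+
    qed
    have ne3: "f \<noteq> i' \<union> p'" if "f \<in> merged" "(i', p') \<in> resolutions" for f i' p'
      using U_notin(1)[OF resolutionsD(1-3)[OF that(2)]] that(1) by metis
    have qm: "q \<in> merged" "q' \<in> merged" "p \<in> merged" using m by auto
    have reg: "regular_mult (resolve1 i p) = source_coeff (bdir q) (bdir q')"
      "regular_mult (resolve1 i q) = source_coeff (bdir q') (bdir p)"
      "regular_mult (resolve1 i q') = source_coeff (bdir p) (bdir q)"
      using regular_mult_complex[OF part_resolve(1)[OF resolutionsD(1-3)[OF res(1)]] r1(1) x neq(3) ne3[OF qm(1) res(1)] ne3[OF qm(2) res(1)] ch(1,2) resolutionsD(6)[OF res(1)]]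
        regular_mult_complex[OF part_resolve(1)[OF resolutionsD(1-3)[OF res(2)]] r1(2) x pq(2)[symmetric] ne3[OF qm(2) res(2)] ne3[OF qm(3) res(2)] ch(2) j(6) resolutionsD(6)[OF res(2)]]
        regular_mult_complex[OF part_resolve(1)[OF resolutionsD(1-3)[OF res(3)]] r1(3) x pq(1) ne3[OF qm(3) res(3)] ne3[OF qm(1) res(3)] j(6) ch(1) resolutionsD(6)[OF res(3)]]
      by simp_all
    have "(\<Sum>x\<in>resolutions. jump U x) = jump U (i, p) + jump U (i, q) + jump U (i, q')"
      unfolding R using pq neq(3) by (simp add: add_ac)
    also have "\<dots> = 0"
      unfolding jump_source[OF x' res(1) xne(4)[symmetric] xne(5)[symmetric] dp]
        jump_source[OF x' res(2) xne(4)[symmetric] xne(2)[symmetric] dq]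
        jump_source[OF x' res(3) xne(4)[symmetric] xne(3)[symmetric] dq'] distrib_left[symmetric]
      using source_coeff_identity[OF s0] unfolding reg by simp
    finally show ?thesis .
  qed
qed

end

section \<open>The count of active types near a wall\<close>

context broccoli_data
begin

definition active :: "nat set set set \<Rightarrow> conditions \<Rightarrow> bool" where
  "active T P \<longleftrightarrow> (\<forall>f\<in>inner_flags T. 0 < type_length T f P)"

definition type_count :: "conditions \<Rightarrow> complex" where
  "type_count P = (\<Sum>T\<in>{T. regular_type T \<and> active T P}. type_mult T)"

lemma finite_regular_types: "finite {T. regular_type T}"
proof (rule finite_subset)
  show "{T. regular_type T} \<subseteq> Pow (Pow (Pow labels))"
  proof
    fix T assume "T \<in> {T. regular_type T}"
    then have "regular_tree r s n v F T" using regular_tree_iff by simp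
    then interpret regular_tree r s n v F T .
    show "T \<in> Pow (Pow (Pow labels))" using block_sub by blast
  qed
qed (simp add: fin_labels)

lemma finite_inner: "regular_type T \<Longrightarrow> finite (inner_flags T)"
proof -
  assume "regular_type T"
  then interpret regular_tree r s n v F T using regular_tree_iff by simp
  show ?thesis by (rule fin_inner)
qed

lemma type_length_affine:
  assumes "regular_type T" "f \<in> inner_flags T"
  shows "type_length T f (P + t *\<^sub>R U) = type_length T f P + t * type_length T f U"
proof -
  interpret regular_tree r s n v F T using regular_tree_iff assms(1) by simp
  show ?thesis using type_length_linear[OF assms(2)] by (simp add: linear_add linear_scale)
qed

end

context wall
begin

context
  fixes P0 :: conditions
  assumes zero: "type_length T S P0 = 0"
    and pos: "f \<in> inner_flags T \<Longrightarrow> f \<noteq> S \<Longrightarrow> f \<noteq> labels - S \<Longrightarrow> 0 < type_length T f P0"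
begin

lemma resolved_lengths:
  assumes res: "(i, p) \<in> resolutions" and reg: "regular_type (resolved i p)"
  shows "type_length (resolved i p) (i \<union> p) P0 = 0"
    "f \<in> inner_flags (resolved i p) \<Longrightarrow> f \<noteq> i \<union> p \<Longrightarrow> f \<noteq> labels - (i \<union> p) \<Longrightarrow> 0 < type_length (resolved i p) f P0"
proof -
  note ip = resolutionsD(1-3)[OF res]
  interpret R: regular_tree r s n v F "resolved i p" using regular_tree_iff reg by simp
  let ?q = "position T P0"
  have "?q V2 - ?q V1 = 0"
    using edge_vector[OF position_solves S_inner, of P0] zero
    unfolding V1_def V2_def type_length_def by simp
  then have eq: "?q V1 = ?q V2" by simp
  note sr = solves_resolved[OF ip position_solves eq]
  have U: "i \<union> p \<in> inner_flags (resolved i p)" unfolding inner_resolved[OF ip] by blast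
  show "type_length (resolved i p) (i \<union> p) P0 = 0"
    unfolding R.type_length_eq[OF U sr(1)] by (rule sr(3))
  assume f: "f \<in> inner_flags (resolved i p)" "f \<noteq> i \<union> p" "f \<noteq> labels - (i \<union> p)"
  then have f': "f \<in> inner_flags T" "f \<noteq> S" "f \<noteq> labels - S" unfolding inner_resolved[OF ip] by auto
  show "0 < type_length (resolved i p) f P0"
    unfolding R.type_length_eq[OF f(1) sr(1)] sr(2)[OF f'] using pos[OF f'] by (simp add: type_length_def)
qed

end

text \<open>Contracting the new edge leads back to \<open>rest\<close> and \<open>merged\<close>. So
  the types that meet at a wall can be recognized by their contraction.\<close>

lemma resolved_wall:
  assumes res: "(i, p) \<in> resolutions" and reg: "regular_type (resolved i p)"
  shows "wall r s n v F (resolved i p) (i \<union> p)"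
    "ptree_edge.rest labels (resolved i p) (i \<union> p) = rest"
    "ptree_edge.merged labels (resolved i p) (i \<union> p) = merged"
proof -
  note ip = resolutionsD(1-3)[OF res]
  have U: "i \<union> p \<in> inner_flags (resolved i p)" unfolding inner_resolved[OF ip] by blast
  have "regular_tree r s n v F (resolved i p)" using regular_tree_iff reg by simp
  then show w: "wall r s n v F (resolved i p) (i \<union> p)"
    unfolding wall_def wall_axioms_def using U resolutionsD(6)[OF res] by blast
  interpret R: wall r s n v F "resolved i p" "i \<union> p" by (rule w)
  have V: "R.V1 = resolve1 i p" "R.V2 = resolve2 i p"
    unfolding R.V1_def R.V2_def by (rule vertex_resolved(1,2)[OF ip])+
  show "R.rest = rest" unfolding R.rest_def V unfolding resolved_def using resolve_notin_rest[OF ip] by auto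
  have "i \<union> p \<notin> merged - {i, p}" using U_notin(1)[OF ip] by blast
  moreover have "i \<noteq> labels - (i \<union> p)" "p \<noteq> labels - (i \<union> p)" using U_notin(2)[OF ip] ip by metis+
  ultimately show "R.merged = merged"
    unfolding R.merged_def V unfolding resolve1_def resolve2_def using ip by auto
qed

text \<open>\<open>i\<close> and \<open>p\<close> are the only blocks of \<open>merged\<close>
  inside the new edge, and their charges tell them apart.\<close>

lemma resolution_inj:
  assumes "(i, p) \<in> resolutions" "(i', p') \<in> resolutions" "i \<union> p = i' \<union> p'"
  shows "i = i' \<and> p = p'"
proof -
  note d = resolutionsD[OF assms(1)] note d' = resolutionsD[OF assms(2)]
  have "f = i' \<or> f = p'" if f: "f \<in> merged" "f \<subseteq> i' \<union> p'" for f
    using merged_disj[OF f(1) d'(1)] merged_disj[OF f(1) d'(2)] merged_block(2)[OF f(1)] f(2) by blast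
  then have "i = i' \<or> i = p'" "p = i' \<or> p = p'" using d(1,2) assms(3) by blast+
  then show ?thesis using d(4,5) d'(4,5) by auto
qed

end

context broccoli_data
begin

context
  fixes P0 U :: conditions
  assumes simple: "regular_type T \<Longrightarrow> f \<in> inner_flags T \<Longrightarrow> g \<in> inner_flags T \<Longrightarrow> g \<noteq> f \<Longrightarrow> g \<noteq> labels - f \<Longrightarrow>
      type_length T f P0 = 0 \<Longrightarrow> type_length T g P0 \<noteq> 0"
    and transverse: "regular_type T \<Longrightarrow> f \<in> inner_flags T \<Longrightarrow> type_length T f P0 = 0 \<Longrightarrow> type_length T f U \<noteq> 0"
begin

text \<open>Activity of \<open>T\<close> at the conditions \<open>P0 + t *\<^sub>R U\<close> for all
  small non-zero \<open>t\<close> with the sign of \<open>e\<close>, expressed at \<open>P0\<close>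
  alone.\<close>

definition right_active :: "nat set set set \<Rightarrow> real \<Rightarrow> bool" where
  "right_active T e \<longleftrightarrow>
     (\<forall>f\<in>inner_flags T. 0 < type_length T f P0 \<or> type_length T f P0 = 0 \<and> 0 < e * type_length T f U)"

definition wall_types :: "nat set set set set" where
  "wall_types = {T. regular_type T \<and> (\<forall>f\<in>inner_flags T. 0 \<le> type_length T f P0) \<and>
     (\<exists>f\<in>inner_flags T. type_length T f P0 = 0)}"

definition short_flag :: "nat set set set \<Rightarrow> nat set" where
  "short_flag T = (SOME S. S \<in> inner_flags T \<and> type_length T S P0 = 0 \<and> charge S = 1)"

lemma short_flag:
  assumes "T \<in> wall_types"
  shows "wall r s n v F T (short_flag T)" "type_length T (short_flag T) P0 = 0"
    "f \<in> inner_flags T \<Longrightarrow> f \<noteq> short_flag T \<Longrightarrow> f \<noteq> labels - short_flag T \<Longrightarrow> 0 < type_length T f P0"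
proof -
  have reg: "regular_type T" using assms by (simp add: wall_types_def)
  then interpret regular_tree r s n v F T using regular_tree_iff by simp
  obtain e where e: "e \<in> inner_flags T" "type_length T e P0 = 0" using assms by (auto simp: wall_types_def)
  have "\<exists>S. S \<in> inner_flags T \<and> type_length T S P0 = 0 \<and> charge S = 1"
  proof (cases "charge e = 1")
    case False
    then have "charge (labels - e) = 1" using inner_charges[OF e(1)] inner_charge[OF e(1)] by auto
    then show ?thesis using inner_flagsD(6)[OF e(1)] type_length_compl[OF e(1)] e(2) by metis
  qed (use e in blast)
  from someI_ex[OF this] have S: "short_flag T \<in> inner_flags T" "type_length T (short_flag T) P0 = 0" "charge (short_flag T) = 1"
    unfolding short_flag_def by auto
  show "type_length T (short_flag T) P0 = 0" by (rule S(2))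
  show "wall r s n v F T (short_flag T)" unfolding wall_def wall_axioms_def
    using regular_tree_axioms S by blast
  assume g: "f \<in> inner_flags T" "f \<noteq> short_flag T" "f \<noteq> labels - short_flag T"
  then show "0 < type_length T f P0"
    using simple[OF reg S(1) g S(2)] assms unfolding wall_types_def by force
qed

lemma short_flag_eq:
  assumes "T \<in> wall_types" "S \<in> inner_flags T" "type_length T S P0 = 0" "charge S = 1"
  shows "short_flag T = S"
proof -
  interpret W: wall r s n v F T "short_flag T" by (rule short_flag(1)[OF assms(1)])
  have "S = short_flag T \<or> S = labels - short_flag T" using short_flag(3)[OF assms(1,2)] assms(3) by fastforce
  moreover have "charge (labels - short_flag T) = 0" using W.inner_charge[OF W.S_inner] W.S_charge by simp
  ultimately show ?thesis using assms(4) by auto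
qed

lemma right_active_wall:
  assumes "T \<in> wall_types"
  shows "right_active T e \<longleftrightarrow> 0 < e * type_length T (short_flag T) U"
proof -
  interpret W: wall r s n v F T "short_flag T" by (rule short_flag(1)[OF assms])
  have z: "type_length T (labels - short_flag T) X = type_length T (short_flag T) X" for X
    by (rule W.type_length_compl[OF W.S_inner])
  show ?thesis
  proof
    assume "right_active T e"
    then show "0 < e * type_length T (short_flag T) U"
      using W.S_inner short_flag(2)[OF assms] unfolding right_active_def by fastforce
  next
    assume *: "0 < e * type_length T (short_flag T) U"
    show "right_active T e" unfolding right_active_def
    proof
      fix f assume f: "f \<in> inner_flags T"
      consider "f = short_flag T" | "f = labels - short_flag T" | "f \<noteq> short_flag T" "f \<noteq> labels - short_flag T" by blast
      then show "0 < type_length T f P0 \<or> type_length T f P0 = 0 \<and> 0 < e * type_length T f U"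
        using * z short_flag(2)[OF assms] short_flag(3)[OF assms f] by cases auto
    qed
  qed
qed

lemma right_active_off_wall:
  assumes "regular_type T" "T \<notin> wall_types"
  shows "right_active T 1 \<longleftrightarrow> right_active T (- 1)"
proof -
  have "right_active T e \<longleftrightarrow> (\<forall>f\<in>inner_flags T. 0 < type_length T f P0)" for e
  proof
    assume r: "right_active T e"
    then have "\<forall>f\<in>inner_flags T. 0 \<le> type_length T f P0" unfolding right_active_def by force
    then have "\<forall>f\<in>inner_flags T. type_length T f P0 \<noteq> 0" using assms unfolding wall_types_def by blast
    then show "\<forall>f\<in>inner_flags T. 0 < type_length T f P0" using r unfolding right_active_def by blast
  qed (auto simp: right_active_def)
  then show ?thesis by blast
qed

text \<open>This pair determines the type contracted along its short edge; a class of types with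
  equal keys consists of the regular resolutions of one fused vertex.\<close>

definition wall_key :: "nat set set set \<Rightarrow> nat set set set \<times> nat set set" where
  "wall_key T = (ptree_edge.rest labels T (short_flag T), ptree_edge.merged labels T (short_flag T))"

text \<open>By \<open>head_join\<close> every member of the class is a resolution of the common
  contraction, and every regular resolution is a member. The other resolutions have jump 0, so the
  sum is the one of \<open>jump_sum_zero\<close>.\<close>

lemma wall_class_sum:
  assumes T: "T \<in> wall_types"
  shows "(\<Sum>X\<in>{X \<in> wall_types. wall_key X = wall_key T}.
     type_mult X * of_real (sgn (type_length X (short_flag X) U))) = 0"
proof -
  interpret W: wall r s n v F T "short_flag T" by (rule short_flag(1)[OF T])
  define A where "A = {x \<in> W.resolutions. regular_type (W.resolved (fst x) (snd x))}"
  have mem: "W.resolved i p \<in> wall_types" "short_flag (W.resolved i p) = i \<union> p" "wall_key (W.resolved i p) = wall_key T"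
    if "(i, p) \<in> A" for i p
  proof -
    have ip: "(i, p) \<in> W.resolutions" "regular_type (W.resolved i p)" using that by (auto simp: A_def)
    note w = W.resolved_wall[OF ip]
    interpret R: wall r s n v F "W.resolved i p" "i \<union> p" by (rule w(1))
    have len: "type_length (W.resolved i p) (i \<union> p) P0 = 0"
      "f \<in> inner_flags (W.resolved i p) \<Longrightarrow> f \<noteq> i \<union> p \<Longrightarrow> f \<noteq> labels - (i \<union> p) \<Longrightarrow> 0 < type_length (W.resolved i p) f P0" for f
      using W.resolved_lengths[OF short_flag(2)[OF T] short_flag(3)[OF T] ip] by blast+
    have len': "type_length (W.resolved i p) (labels - (i \<union> p)) P0 = 0"
      using R.type_length_compl[OF R.S_inner] len(1) by simp
    have "0 \<le> type_length (W.resolved i p) f P0" if "f \<in> inner_flags (W.resolved i p)" for f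
    proof -
      consider "f = i \<union> p" | "f = labels - (i \<union> p)" | "f \<noteq> i \<union> p" "f \<noteq> labels - (i \<union> p)" by blast
      then show ?thesis using len(1) len' len(2)[OF that] by cases auto
    qed
    then show wt: "W.resolved i p \<in> wall_types"
      unfolding wall_types_def using ip(2) len(1) R.S_inner by blast
    show sf: "short_flag (W.resolved i p) = i \<union> p"
      by (rule short_flag_eq[OF wt R.S_inner len(1) R.S_charge])
    show "wall_key (W.resolved i p) = wall_key T"
      unfolding wall_key_def sf w(2,3) ..
  qed
  have "{X \<in> wall_types. wall_key X = wall_key T} = (\<lambda>x. W.resolved (fst x) (snd x)) ` A"
  proof (intro set_eqI iffI)
    fix X assume "X \<in> {X \<in> wall_types. wall_key X = wall_key T}"
    then have X: "X \<in> wall_types" "wall_key X = wall_key T" by auto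
    interpret X: wall r s n v F X "short_flag X" by (rule short_flag(1)[OF X(1)])
    have k: "X.rest = W.rest" "X.merged = W.merged" using X(2) by (simp_all add: wall_key_def)
    obtain i p where ip: "i \<in> X.merged" "p \<in> X.merged" "charge i = 0" "charge p = 1"
      "X.resolve1 i p = X.V1" "X.resolve2 i p = X.V2" using X.head_join by metis
    have "X.resolved i p = W.resolved i p"
      unfolding X.resolved_def W.resolved_def X.resolve1_def W.resolve1_def X.resolve2_def W.resolve2_def k ..
    then have eq: "X = W.resolved i p" using X.self_resolved[OF ip(5,6)] by simp
    have "(i, p) \<in> W.resolutions" using ip unfolding W.resolutions_def k by blast
    then have "(i, p) \<in> A" unfolding A_def using X.regular eq by simp
    then show "X \<in> (\<lambda>x. W.resolved (fst x) (snd x)) ` A" using eq by (intro image_eqI[of _ _ "(i, p)"]) auto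
  next
    fix X assume "X \<in> (\<lambda>x. W.resolved (fst x) (snd x)) ` A"
    then obtain i p where "(i, p) \<in> A" "X = W.resolved i p" by auto
    then show "X \<in> {X \<in> wall_types. wall_key X = wall_key T}" using mem by simp
  qed
  moreover have "inj_on (\<lambda>x. W.resolved (fst x) (snd x)) A"
  proof (rule inj_onI)
    fix x y assume xy: "x \<in> A" "y \<in> A" "W.resolved (fst x) (snd x) = W.resolved (fst y) (snd y)"
    obtain i p i' p' where e: "x = (i, p)" "y = (i', p')" by (metis surj_pair)
    have "i \<union> p = i' \<union> p'" using mem(2)[of i p] mem(2)[of i' p'] xy unfolding e by simp
    then show "x = y" using W.resolution_inj[of i p i' p'] xy(1,2) unfolding e A_def by simp
  qed
  ultimately have "(\<Sum>X\<in>{X \<in> wall_types. wall_key X = wall_key T}. type_mult X * of_real (sgn (type_length X (short_flag X) U)))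
      = (\<Sum>x\<in>A. type_mult (W.resolved (fst x) (snd x)) *
          of_real (sgn (type_length (W.resolved (fst x) (snd x)) (short_flag (W.resolved (fst x) (snd x))) U)))"
    by (simp add: sum.reindex)
  also have "\<dots> = (\<Sum>x\<in>A. W.jump U x)"
    by (rule sum.cong) (use mem(2) in \<open>auto simp: W.jump_def A_def\<close>)
  also have "\<dots> = (\<Sum>x\<in>W.resolutions. W.jump U x)"
  proof (rule sum.mono_neutral_left)
    show "finite W.resolutions" unfolding W.resolutions_Times using W.fin_merged by simp
    show "\<forall>x\<in>W.resolutions - A. W.jump U x = 0" by (auto simp: A_def W.jump_def split: if_splits)
  qed (auto simp: A_def)
  also have "\<dots> = 0" by (rule W.jump_sum_zero)
  finally show ?thesis .
qed

lemma fin_wall_types: "finite wall_types"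
  by (rule finite_subset[OF _ finite_regular_types]) (auto simp: wall_types_def)

text \<open>For a type on the wall the indicator of activity changes by the sign of the derivative
  of its short length. The sum of these changes is grouped by \<open>wall_key\<close>.\<close>

lemma crossing:
  "(\<Sum>T\<in>{T. regular_type T \<and> right_active T 1}. type_mult T) =
   (\<Sum>T\<in>{T. regular_type T \<and> right_active T (- 1)}. type_mult T)"
proof -
  let ?R = "{T. regular_type T}"
  let ?i = "\<lambda>T e. if right_active T e then type_mult T else 0"
  have sum_if: "(\<Sum>T\<in>{T. regular_type T \<and> right_active T e}. type_mult T) = (\<Sum>T\<in>?R. ?i T e)" for e
    using sum.inter_filter[OF finite_regular_types, of type_mult "\<lambda>T. right_active T e"] by simp
  \<comment> \<open>Types without vanishing lengths, or with a negative one, have the same activity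
    on both sides.\<close>
  have "(\<Sum>T\<in>?R. ?i T 1 - ?i T (- 1)) = (\<Sum>T\<in>wall_types. ?i T 1 - ?i T (- 1))"
    by (rule sum.mono_neutral_right[OF finite_regular_types])
      (use right_active_off_wall in \<open>auto simp: wall_types_def\<close>)
  also have "\<dots> = (\<Sum>T\<in>wall_types. type_mult T * of_real (sgn (type_length T (short_flag T) U)))"
  proof (rule sum.cong[OF refl])
    fix T assume T: "T \<in> wall_types"
    interpret W: wall r s n v F T "short_flag T" by (rule short_flag(1)[OF T])
    have "type_length T (short_flag T) U \<noteq> 0" using transverse[OF W.regular W.S_inner short_flag(2)[OF T]] .
    then show "?i T 1 - ?i T (- 1) = type_mult T * of_real (sgn (type_length T (short_flag T) U))"
      unfolding right_active_wall[OF T] by (auto simp: sgn_if)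
  qed
  also have "\<dots> = (\<Sum>k\<in>wall_key ` wall_types. \<Sum>T\<in>{T \<in> wall_types. wall_key T = k}.
      type_mult T * of_real (sgn (type_length T (short_flag T) U)))"
    by (rule sum.image_gen[OF fin_wall_types])
  also have "\<dots> = 0" by (rule sum.neutral) (use wall_class_sum in auto)
  finally show ?thesis unfolding sum_if by (simp add: sum_subtractf)
qed

lemma right_active_eventually:
  assumes "regular_type T" "s' \<in> {1, -1}"
  shows "\<exists>d>0. \<forall>e. 0 < e \<and> e < d \<longrightarrow> (active T (P0 + (s' * e) *\<^sub>R U) \<longleftrightarrow> right_active T s')"
proof -
  have "\<exists>d>0. \<forall>e. 0 < e \<and> e < d \<longrightarrow> (0 < type_length T f (P0 + (s' * e) *\<^sub>R U) \<longleftrightarrow>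
      0 < type_length T f P0 \<or> type_length T f P0 = 0 \<and> 0 < s' * type_length T f U)"
    if f: "f \<in> inner_flags T" for f
  proof -
    define a b where "a = type_length T f P0" and "b = s' * type_length T f U"
    have aff: "type_length T f (P0 + (s' * e) *\<^sub>R U) = a + e * b" for e
      using type_length_affine[OF assms(1) f] by (simp add: a_def b_def)
    show ?thesis
    proof (cases "a = 0")
      case True
      then show ?thesis unfolding aff a_def[symmetric] b_def[symmetric]
        by (intro exI[of _ 1]) (simp add: zero_less_mult_iff)
    next
      case False
      \<comment> \<open>Below this radius the term \<open>e * b\<close> cannot outweigh
        \<open>a\<close>; the summand 1 avoids a division by 0.\<close>
      have "0 < a + e * b \<longleftrightarrow> 0 < a" if e: "0 < e" "e < \<bar>a\<bar> / (\<bar>b\<bar> + 1)" for e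
      proof -
        have "\<bar>e * b\<bar> \<le> e * (\<bar>b\<bar> + 1)" using e(1) by (simp add: abs_mult)
        also have "\<dots> < \<bar>a\<bar>" using e(2) by (simp add: pos_less_divide_eq)
        finally show ?thesis by linarith
      qed
      moreover have "0 < \<bar>a\<bar> / (\<bar>b\<bar> + 1)" using False by simp
      ultimately show ?thesis unfolding aff a_def[symmetric] b_def[symmetric] using False by blast
    qed
  qed
  then obtain d where d: "\<And>f. f \<in> inner_flags T \<Longrightarrow> 0 < d f"
    "\<And>f e. f \<in> inner_flags T \<Longrightarrow> 0 < e \<Longrightarrow> e < d f \<Longrightarrow> (0 < type_length T f (P0 + (s' * e) *\<^sub>R U) \<longleftrightarrow>
      0 < type_length T f P0 \<or> type_length T f P0 = 0 \<and> 0 < s' * type_length T f U)"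
    by metis
  define m where "m = Min (insert 1 (d ` inner_flags T))"
  have fin: "finite (insert 1 (d ` inner_flags T))" using finite_inner[OF assms(1)] by simp
  have "0 < m" using fin d(1) by (simp add: m_def)
  moreover have "e < d f" if "e < m" "f \<in> inner_flags T" for e f using fin that by (simp add: m_def)
  ultimately show ?thesis unfolding active_def right_active_def using d(2) by (intro exI[of _ m]) simp
qed

text \<open>The two one-sided values agree by \<open>crossing\<close>. The point \<open>P0\<close>
  itself is left out, because the types on the wall are not active there and the count may
  differ.\<close>

lemma count_near_wall:
  "\<exists>c. \<exists>d>0. \<forall>e. e \<noteq> 0 \<and> \<bar>e\<bar> < d \<longrightarrow> type_count (P0 + e *\<^sub>R U) = c"
proof -
  have "\<exists>d>0. \<forall>e. 0 < e \<and> e < d \<longrightarrow>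
      type_count (P0 + (s' * e) *\<^sub>R U) = (\<Sum>T\<in>{T. regular_type T \<and> right_active T s'}. type_mult T)"
    if s': "s' \<in> {1, -1}" for s'
  proof -
    obtain d where d: "\<And>T. regular_type T \<Longrightarrow> 0 < d T"
      "\<And>T e. regular_type T \<Longrightarrow> 0 < e \<Longrightarrow> e < d T \<Longrightarrow> (active T (P0 + (s' * e) *\<^sub>R U) \<longleftrightarrow> right_active T s')"
      using right_active_eventually[OF _ s'] by metis
    define m where "m = Min (insert 1 (d ` {T. regular_type T}))"
    have fin: "finite (insert 1 (d ` {T. regular_type T}))" using finite_regular_types by simp
    have "0 < m" using fin d(1) by (simp add: m_def)
    moreover have "e < d T" if "e < m" "regular_type T" for e T using fin that by (simp add: m_def)
    ultimately show ?thesis unfolding type_count_def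
      using d(2) by (intro exI[of _ m] conjI allI impI sum.cong) auto
  qed
  from this[of 1] this[of "-1"] obtain d1 d2 where d: "0 < d1" "0 < d2"
    "\<And>e. 0 < e \<Longrightarrow> e < d1 \<Longrightarrow> type_count (P0 + e *\<^sub>R U) = (\<Sum>T\<in>{T. regular_type T \<and> right_active T 1}. type_mult T)"
    "\<And>e. 0 < e \<Longrightarrow> e < d2 \<Longrightarrow> type_count (P0 + (- e) *\<^sub>R U) = (\<Sum>T\<in>{T. regular_type T \<and> right_active T (- 1)}. type_mult T)"
    by auto
  have "type_count (P0 + e *\<^sub>R U) = (\<Sum>T\<in>{T. regular_type T \<and> right_active T 1}. type_mult T)"
    if "e \<noteq> 0" "\<bar>e\<bar> < min d1 d2" for e
    using d(3)[of e] d(4)[of "- e"] crossing that by (cases "0 < e") auto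
  then show ?thesis using d(1,2) by (intro exI[of _ "\<Sum>T\<in>{T. regular_type T \<and> right_active T 1}. type_mult T"] exI[of _ "min d1 d2"]) auto
qed

end

text \<open>
  The conditions that do not lie on the boundary of the image of a cell.
\<close>

definition off_walls :: "conditions \<Rightarrow> bool" where
  "off_walls P \<longleftrightarrow> (\<forall>T. regular_type T \<longrightarrow> (\<forall>f\<in>inner_flags T. 0 \<le> type_length T f P) \<longrightarrow> active T P)"

section \<open>Generic lines and the invariance of the count\<close>

lemma finite_common_radius:
  assumes "finite A" "\<And>a. a \<in> A \<Longrightarrow> \<exists>d>0. \<forall>e. \<bar>e\<bar> < d \<longrightarrow> Q a (e :: real)"
  shows "\<exists>d>0. \<forall>e. \<bar>e\<bar> < d \<longrightarrow> (\<forall>a\<in>A. Q a e)"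
  using assms
proof (induction A rule: finite_induct)
  case empty
  then show ?case by (intro exI[of _ 1]) auto
next
  case (insert a A)
  obtain d1 where "0 < d1" "\<And>e. \<bar>e\<bar> < d1 \<Longrightarrow> (\<forall>a\<in>A. Q a e)" using insert by (metis insertCI)
  moreover obtain d2 where "0 < d2" "\<And>e. \<bar>e\<bar> < d2 \<Longrightarrow> Q a e" using insert(4)[of a] by auto
  ultimately show ?case by (intro exI[of _ "min d1 d2"]) auto
qed

text \<open>Off the walls a type is active or has an edge of negative length. Both persist under
  small changes, and there are finitely many types.\<close>

lemma off_walls_near:
  assumes P: "off_walls P"
  shows "\<exists>d>0. \<forall>e. \<bar>e\<bar> < d \<longrightarrow> type_count (P + e *\<^sub>R w) = type_count P"
proof -
  have aff_sign: "\<exists>d>0. \<forall>e. \<bar>e\<bar> < d \<longrightarrow> sgn (a + e * b) = sgn a" if "a \<noteq> 0" for a b :: real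
  proof -
    have "sgn (a + e * b) = sgn a" if e: "\<bar>e\<bar> < \<bar>a\<bar> / (\<bar>b\<bar> + 1)" for e
    proof -
      have "\<bar>e * b\<bar> \<le> \<bar>e\<bar> * (\<bar>b\<bar> + 1)" by (simp add: abs_mult algebra_simps)
      also have "\<dots> < \<bar>a\<bar>" using e by (simp add: pos_less_divide_eq)
      finally show ?thesis by (simp add: sgn_if) linarith
    qed
    moreover have "0 < \<bar>a\<bar> / (\<bar>b\<bar> + 1)" using that by simp
    ultimately show ?thesis by blast
  qed
  have T: "\<exists>d>0. \<forall>e. \<bar>e\<bar> < d \<longrightarrow> (active T (P + e *\<^sub>R w) \<longleftrightarrow> active T P)" if T: "T \<in> {T. regular_type T}" for T
  proof (cases "active T P")
    case True
    have "\<exists>d>0. \<forall>e. \<bar>e\<bar> < d \<longrightarrow> 0 < type_length T f (P + e *\<^sub>R w)" if f: "f \<in> inner_flags T" for f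
    proof -
      have p: "0 < type_length T f P" using True f by (simp add: active_def)
      then obtain d where "0 < d" "\<And>e. \<bar>e\<bar> < d \<Longrightarrow> sgn (type_length T f P + e * type_length T f w) = sgn (type_length T f P)"
        using aff_sign[of "type_length T f P" "type_length T f w"] by auto
      then show ?thesis using p type_length_affine[of T f] T f by (intro exI[of _ d]) (auto simp: sgn_1_pos)
    qed
    then have "\<exists>d>0. \<forall>e. \<bar>e\<bar> < d \<longrightarrow> (\<forall>f\<in>inner_flags T. 0 < type_length T f (P + e *\<^sub>R w))"
      using T by (intro finite_common_radius finite_inner) auto
    then show ?thesis using True by (auto simp: active_def)
  next
    case False
    then obtain f where f: "f \<in> inner_flags T" "type_length T f P < 0"
      using P T unfolding off_walls_def by force
    then obtain d where "0 < d" "\<And>e. \<bar>e\<bar> < d \<Longrightarrow> sgn (type_length T f P + e * type_length T f w) = sgn (type_length T f P)"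
      using aff_sign[of "type_length T f P" "type_length T f w"] by auto
    moreover have "type_length T f (P + e *\<^sub>R w) = type_length T f P + e * type_length T f w" for e
      using type_length_affine[of T f] T f(1) by simp
    ultimately have "\<bar>e\<bar> < d \<Longrightarrow> type_length T f (P + e *\<^sub>R w) < 0" for e
      using f(2) by (metis sgn_1_neg)
    then have "\<bar>e\<bar> < d \<Longrightarrow> \<not> active T (P + e *\<^sub>R w)" for e using f(1) unfolding active_def by force
    then show ?thesis using False \<open>0 < d\<close> by blast
  qed
  obtain d where "0 < d" "\<And>e T. \<bar>e\<bar> < d \<Longrightarrow> regular_type T \<Longrightarrow> active T (P + e *\<^sub>R w) \<longleftrightarrow> active T P"
    using finite_common_radius[OF finite_regular_types, of "\<lambda>T e. active T (P + e *\<^sub>R w) \<longleftrightarrow> active T P", OF T] by blast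
  then show ?thesis unfolding type_count_def by (intro exI[of _ d]) (auto intro!: sum.cong)
qed

text \<open>The point found for the other forms is moved along a vector on which the new form does
  not vanish; each form forbids at most one value of the parameter.\<close>

lemma avoid_hyperplanes:
  assumes "finite \<Lambda>" "\<And>l. l \<in> \<Lambda> \<Longrightarrow> linear l \<and> (\<exists>z. l z \<noteq> (0::real))"
  shows "\<exists>w :: conditions. \<forall>l\<in>\<Lambda>. l w \<noteq> 0"
  using assms
proof (induction \<Lambda> rule: finite_induct)
  case (insert l \<Lambda>)
  obtain w where w: "\<forall>k\<in>\<Lambda>. k w \<noteq> 0" using insert by auto
  obtain z where z: "l z \<noteq> 0" using insert(4)[of l] by blast
  have "finite (insert (- l w / l z) ((\<lambda>k. - k w / k z) ` \<Lambda>))" using insert(1) by simp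
  then obtain e where e: "e \<notin> insert (- l w / l z) ((\<lambda>k. - k w / k z) ` \<Lambda>)"
    using ex_new_if_finite[OF infinite_UNIV_char_0] by blast
  have lin: "k (w + e *\<^sub>R z) = k w + e * k z" if "k \<in> insert l \<Lambda>" for k
    using insert(4)[OF that] by (simp add: linear_add linear_scale)
  have "k (w + e *\<^sub>R z) \<noteq> 0" if k: "k \<in> insert l \<Lambda>" for k
  proof (cases "k z = 0")
    case True
    then show ?thesis using lin[OF k] w k z by auto
  next
    case False
    then have "e \<noteq> - k w / k z" using e k by auto
    then show ?thesis using lin[OF k] False by (simp add: field_simps eq_neg_iff_add_eq_0)
  qed
  then show ?case by blast
qed auto

lemma perturb:
  assumes P: "off_walls P"
    and L: "finite \<Lambda>" "\<And>l. l \<in> \<Lambda> \<Longrightarrow> linear l \<and> (\<exists>z. l z \<noteq> (0::real))"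
  shows "\<exists>P'. type_count P' = type_count P \<and> (\<forall>l\<in>\<Lambda>. l P' \<noteq> 0)"
proof -
  obtain w where w: "\<forall>l\<in>\<Lambda>. l w \<noteq> 0" using avoid_hyperplanes[OF L] by blast
  obtain d where d: "0 < d" "\<And>e. \<bar>e\<bar> < d \<Longrightarrow> type_count (P + e *\<^sub>R w) = type_count P"
    using off_walls_near[OF P] by blast
  have "infinite {0<..<d}" using d(1) by (simp add: infinite_Ioo)
  moreover have "finite ((\<lambda>l. - l P / l w) ` \<Lambda>)" using L(1) by simp
  ultimately obtain e where e: "e \<in> {0<..<d}" "e \<notin> (\<lambda>l. - l P / l w) ` \<Lambda>"
    by (meson finite_subset subsetI)
  have "l (P + e *\<^sub>R w) \<noteq> 0" if l: "l \<in> \<Lambda>" for l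
  proof -
    have "l (P + e *\<^sub>R w) = l P + e * l w" using L(2)[OF l] by (simp add: linear_add linear_scale)
    moreover have "e \<noteq> - l P / l w" using e l by blast
    ultimately show ?thesis using w l by (simp add: field_simps eq_neg_iff_add_eq_0)
  qed
  then show ?thesis using d(2)[of e] e by (intro exI[of _ "P + e *\<^sub>R w"]) auto
qed

text \<open>The value that \<open>h\<close> takes near \<open>t\<close>, but not at
  \<open>t\<close>, is a locally constant function of \<open>t\<close> and hence constant on the
  connected real line. It does not see isolated exceptional values, and at \<open>a\<close> and
  \<open>b\<close> it agrees with \<open>h\<close>.\<close>

lemma locally_constant_off_point:
  fixes h :: "real \<Rightarrow> 'b"
  assumes "\<And>t. \<exists>c. \<exists>d>0. \<forall>e. e \<noteq> 0 \<and> \<bar>e\<bar> < d \<longrightarrow> h (t + e) = c"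
    and "\<exists>d>0. \<forall>e. \<bar>e\<bar> < d \<longrightarrow> h (a + e) = h a" "\<exists>d>0. \<forall>e. \<bar>e\<bar> < d \<longrightarrow> h (b + e) = h b"
  shows "h a = h b"
proof -
  obtain g d where gd: "\<And>t. 0 < d t" "\<And>t e. e \<noteq> 0 \<Longrightarrow> \<bar>e\<bar> < d t \<Longrightarrow> h (t + e) = g t"
    using assms(1) by metis
  have uniq: "g t = c" if "0 < d'" "\<And>e. e \<noteq> 0 \<Longrightarrow> \<bar>e\<bar> < d' \<Longrightarrow> h (t + e) = c" for t c d'
  proof -
    define e where "e = min d' (d t) / 2"
    have "e \<noteq> 0" "\<bar>e\<bar> < d'" "\<bar>e\<bar> < d t" using that(1) gd(1)[of t] by (auto simp: e_def)
    then show ?thesis using gd(2)[of e t] that(2)[of e] by simp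
  qed
  have loc: "g t' = g t" if "\<bar>t' - t\<bar> < d t" for t t'
  proof (cases "t' = t")
    case False
    show ?thesis
    proof (rule uniq[of "min \<bar>t' - t\<bar> (d t - \<bar>t' - t\<bar>)"])
      show "0 < min \<bar>t' - t\<bar> (d t - \<bar>t' - t\<bar>)" using False that by simp
      fix e assume e: "e \<noteq> 0" "\<bar>e\<bar> < min \<bar>t' - t\<bar> (d t - \<bar>t' - t\<bar>)"
      then have "t' - t + e \<noteq> 0" "\<bar>t' - t + e\<bar> < d t" by linarith+
      then show "h (t' + e) = g t" using gd(2)[of "t' - t + e" t] by simp
    qed
  qed simp
  have "g a = g b"
  proof (rule connected_local_const[of UNIV])
    show "\<forall>t\<in>UNIV. \<forall>\<^sub>F t' in at t within UNIV. g t = g t'"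
    proof
      fix t
      show "\<forall>\<^sub>F t' in at t within UNIV. g t = g t'"
        unfolding eventually_at using gd(1)[of t] loc by (intro exI[of _ "d t"]) (auto simp: dist_real_def)
    qed
  qed auto
  moreover have "g a = h a" "g b = h b"
    using assms(2,3) uniq by metis+
  ultimately show ?thesis by simp
qed

text \<open>\<open>P\<close> and \<open>Q\<close> are first moved such that on the whole line
  through them no two different edges of a type have length 0 at once and every zero of a length is
  simple. Then \<open>count_near_wall\<close> applies at every point of the line.\<close>

theorem type_count_invariant:
  assumes P: "off_walls P" and Q: "off_walls Q"
  shows "type_count P = type_count Q"
proof -
  define I where "I = Sigma {T. regular_type T} inner_flags"
  define \<Lambda> where "\<Lambda> = (\<lambda>(T, f). type_length T f) ` I"
  have fin_I: "finite I" unfolding I_def using finite_regular_types finite_inner by blast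
  have dual: "\<exists>Z. type_length T f Z = 1 \<and> (\<forall>g\<in>inner_flags T. g \<noteq> f \<longrightarrow> g \<noteq> labels - f \<longrightarrow> type_length T g Z = 0)"
    and lin: "linear (type_length T f)" if "regular_type T" "f \<in> inner_flags T" for T f
  proof -
    interpret regular_tree r s n v F T using regular_tree_iff that(1) by simp
    show "linear (type_length T f)"
      "\<exists>Z. type_length T f Z = 1 \<and> (\<forall>g\<in>inner_flags T. g \<noteq> f \<longrightarrow> g \<noteq> labels - f \<longrightarrow> type_length T g Z = 0)"
      using dual_condition type_length_linear that(2) by blast+
  qed
  have \<Lambda>: "linear l \<and> (\<exists>z. l z \<noteq> 0)" if l: "l \<in> \<Lambda>" for l
  proof -
    obtain T f where Tf: "regular_type T" "f \<in> inner_flags T" "l = type_length T f"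
      using l by (auto simp: \<Lambda>_def I_def)
    then show ?thesis using dual[OF Tf(1,2)] lin[OF Tf(1,2)] by force
  qed
  \<comment> \<open>No length vanishes at \<open>P'\<close>. This makes the forms
    \<open>mixed\<close> below non-zero, and every length with a zero on the line non-constant
    there.\<close>
  obtain P' where P': "type_count P' = type_count P" "\<forall>l\<in>\<Lambda>. l P' \<noteq> 0"
    using perturb[OF P _ \<Lambda>] finite_imageI[OF fin_I] unfolding \<Lambda>_def by blast
  have nzP: "type_length T f P' \<noteq> 0" if "regular_type T" "f \<in> inner_flags T" for T f
    using P'(2) that by (auto simp: \<Lambda>_def I_def)
  \<comment> \<open>The 2 by 2 determinant of the two lengths at \<open>P'\<close> and
    \<open>X\<close>. Both lengths are affine along the line from \<open>P'\<close> to
    \<open>Q'\<close>, so they have no common zero on it if this is non-zero at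
    \<open>Q'\<close>.\<close>
  define mixed where "mixed T f g = (\<lambda>X. type_length T f P' * type_length T g X - type_length T g P' * type_length T f X)" for T f g
  define J where "J = {(T, f, g). regular_type T \<and> f \<in> inner_flags T \<and> g \<in> inner_flags T \<and> g \<noteq> f \<and> g \<noteq> labels - f}"
  define M where "M = \<Lambda> \<union> (\<lambda>(T, f, g). mixed T f g) ` J"
  have "finite J"
    by (rule finite_subset[of _ "Sigma {T. regular_type T} (\<lambda>T. inner_flags T \<times> inner_flags T)"])
      (use finite_regular_types finite_inner in \<open>auto simp: J_def\<close>)
  then have fin_M: "finite M" using fin_I by (simp add: M_def \<Lambda>_def)
  have M: "linear l \<and> (\<exists>z. l z \<noteq> 0)" if l: "l \<in> M" for l
  proof (cases "l \<in> \<Lambda>")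
    case False
    then obtain T f g where J: "regular_type T" "f \<in> inner_flags T" "g \<in> inner_flags T" "g \<noteq> f" "g \<noteq> labels - f"
      "l = mixed T f g" using l by (auto simp: M_def J_def)
    interpret regular_tree r s n v F T using regular_tree_iff J(1) by simp
    have "f \<noteq> g" "f \<noteq> labels - g" using J(4,5) inner_flagsD(7)[OF J(3)] by metis+
    \<comment> \<open>The dual condition of \<open>g\<close> shows that \<open>mixed\<close> is not
      the zero form, as it depends on the length of \<open>g\<close> with the non-zero coefficient
      \<open>type_length T f P'\<close>.\<close>
    then obtain Z where "type_length T g Z = 1" "type_length T f Z = 0" using dual[OF J(1,3)] J(2) by blast
    then have "l Z \<noteq> 0" using nzP[OF J(1,2)] by (simp add: J(6) mixed_def)
    moreover have "linear l" unfolding J(6) mixed_def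
      using lin[OF J(1,2)] lin[OF J(1,3)]
      by (intro linearI) (simp_all add: linear_add linear_scale algebra_simps)
    ultimately show ?thesis by blast
  qed (use \<Lambda> in blast)
  obtain Q' where Q': "type_count Q' = type_count Q" "\<forall>l\<in>M. l Q' \<noteq> 0"
    using perturb[OF Q fin_M M] by blast
  have nzQ: "type_length T f Q' \<noteq> 0" if "regular_type T" "f \<in> inner_flags T" for T f
    using Q'(2) that by (auto simp: M_def \<Lambda>_def I_def)
  have off: "off_walls P'" "off_walls Q'"
    unfolding off_walls_def active_def using nzP nzQ by (metis less_eq_real_def)+
  define U where "U = Q' - P'"
  define h where "h t = type_count (P' + t *\<^sub>R U)" for t
  have aff: "type_length T f (P' + t *\<^sub>R U) = (1 - t) * type_length T f P' + t * type_length T f Q'"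
    if "regular_type T" "f \<in> inner_flags T" for T f t
  proof -
    have U: "type_length T f U = type_length T f Q' - type_length T f P'"
      unfolding U_def by (rule linear_diff[OF lin[OF that]])
    show ?thesis unfolding type_length_affine[OF that] U by (simp add: algebra_simps)
  qed
  have "h 0 = h 1"
  proof (rule locally_constant_off_point)
    fix t
    have "\<exists>c. \<exists>d>0. \<forall>e. e \<noteq> 0 \<and> \<bar>e\<bar> < d \<longrightarrow> type_count ((P' + t *\<^sub>R U) + e *\<^sub>R U) = c"
    proof (rule count_near_wall)
      fix T f g
      assume a: "regular_type T" "f \<in> inner_flags T" "g \<in> inner_flags T" "g \<noteq> f" "g \<noteq> labels - f"
        "type_length T f (P' + t *\<^sub>R U) = 0"
      show "type_length T g (P' + t *\<^sub>R U) \<noteq> 0"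
      proof
        assume "type_length T g (P' + t *\<^sub>R U) = 0"
        then have e: "t * type_length T g Q' = - (1 - t) * type_length T g P'"
          "t * type_length T f Q' = - (1 - t) * type_length T f P'"
          using a(6) aff[OF a(1,2)] aff[OF a(1,3)] by (simp_all add: algebra_simps)
        \<comment> \<open>At a common zero both values at \<open>Q'\<close> are, up to the factor
          \<open>t\<close>, the same multiple of those at \<open>P'\<close>, which makes the
          determinant vanish.\<close>
        have "t * mixed T f g Q' = type_length T f P' * (t * type_length T g Q') - type_length T g P' * (t * type_length T f Q')"
          by (simp add: mixed_def algebra_simps)
        also have "\<dots> = 0" unfolding e by (simp add: algebra_simps)
        finally have "t = 0 \<or> mixed T f g Q' = 0" by simp
        moreover have "mixed T f g Q' \<noteq> 0"
        proof -
          have "(T, f, g) \<in> J" using a(1-5) by (simp add: J_def)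
          then have "mixed T f g \<in> M" unfolding M_def by (intro UnI2 image_eqI[of _ _ "(T, f, g)"]) simp_all
          then show ?thesis using Q'(2) by blast
        qed
        ultimately have "t = 0" by blast
        then show False using a(6) nzP[OF a(1,2)] by simp
      qed
    next
      fix T f assume a: "regular_type T" "f \<in> inner_flags T" "type_length T f (P' + t *\<^sub>R U) = 0"
      \<comment> \<open>An affine function with a zero on the line and a non-zero value at
        \<open>P'\<close> has non-zero slope.\<close>
      then show "type_length T f U \<noteq> 0" using type_length_affine[OF a(1,2)] nzP[OF a(1,2)] by auto
    qed
    then show "\<exists>c. \<exists>d>0. \<forall>e. e \<noteq> 0 \<and> \<bar>e\<bar> < d \<longrightarrow> h (t + e) = c"
      by (simp add: h_def scaleR_add_left add.assoc)
  next
    show "\<exists>d>0. \<forall>e. \<bar>e\<bar> < d \<longrightarrow> h (0 + e) = h 0"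
      using off_walls_near[OF off(1), of U] by (simp add: h_def)
    have "P' + (1 + e) *\<^sub>R U = Q' + e *\<^sub>R U" for e by (simp add: U_def scaleR_add_left)
    then show "\<exists>d>0. \<forall>e. \<bar>e\<bar> < d \<longrightarrow> h (1 + e) = h 1"
      using off_walls_near[OF off(2), of U] by (simp add: h_def U_def)
  qed
  then show ?thesis using P'(1) Q'(1) by (simp add: h_def U_def)
qed

end

section \<open>The type of a marked curve\<close>

locale marked_tree = broccoli_data +
  fixes C :: oriented_curve
  assumes mc: "is_marked_curve r s n v C"
begin

lemma fin_verts: "finite (verts C)" and fin_flags: "finite (flags C)"
  and base_in: "f \<in> flags C \<Longrightarrow> base C f \<in> verts C"
  and opp_in: "f \<in> flags C \<Longrightarrow> opp C f \<in> flags C"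
  and opp_opp: "f \<in> flags C \<Longrightarrow> opp C (opp C f) = f"
  and connected: "connected_curve C" and genus0: "genus C = 0"
  and valence: "V \<in> verts C \<Longrightarrow> 3 \<le> card (flags_at C V)"
  using mc by (auto simp: is_marked_curve_def)

lemma len_pos: "f \<in> bounded_flags C \<Longrightarrow> 0 < len C f"
  and len_opp: "f \<in> bounded_flags C \<Longrightarrow> len C (opp C f) = len C f"
  and dir_opp: "f \<in> bounded_flags C \<Longrightarrow> dir C (opp C f) = - dir C f"
  and pos_opp: "f \<in> bounded_flags C \<Longrightarrow>
      pos C (base C (opp C f)) = pos C (base C f) + len C f *\<^sub>R real_vec (dir C f)"
  and balanced: "V \<in> verts C \<Longrightarrow> (\<Sum>f\<in>flags_at C V. dir C f) = 0"
  and xend_bij: "bij_betw (xend C) {1..r + s} {f \<in> ends C. dir C f = 0}"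
  and yend_bij: "bij_betw (yend C) {1..n} {f \<in> ends C. dir C f \<noteq> 0}"
  and yend_dir: "j \<in> {1..n} \<Longrightarrow> dir C (yend C j) = v j"
  using mc by (auto simp: is_marked_curve_def)

lemma bounded_iff: "f \<in> bounded_flags C \<longleftrightarrow> f \<in> flags C \<and> opp C f \<noteq> f"
  and ends_iff: "f \<in> ends C \<longleftrightarrow> f \<in> flags C \<and> opp C f = f"
  and flags_at_iff: "f \<in> flags_at C V \<longleftrightarrow> f \<in> flags C \<and> base C f = V"
  by (auto simp: bounded_flags_def ends_def flags_at_def)

lemma bounded_opp: "f \<in> bounded_flags C \<Longrightarrow> opp C f \<in> bounded_flags C"
  using opp_in opp_opp by (metis bounded_iff)

section \<open>The labels behind a flag of a genus 0 graph\<close>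

definition end_flag :: "nat \<Rightarrow> nat" where
  "end_flag l = (if l \<le> r + s then xend C l else yend C (l - (r + s)))"

lemma end_flag_x: "i \<in> {1..r + s} \<Longrightarrow> end_flag i = xend C i"
  and end_flag_y: "j \<in> {1..n} \<Longrightarrow> end_flag (r + s + j) = yend C j"
  by (auto simp: end_flag_def)

lemma end_flag_dir: "l \<in> labels \<Longrightarrow> dir C (end_flag l) = label_dir l"
proof -
  assume "l \<in> labels"
  then show ?thesis
  proof (cases rule: label_cases)
    case (3 j)
    then show ?thesis using yend_dir[of j] by (auto simp: end_flag_def label_dir_def)
  qed (use bij_betwE[OF xend_bij] in \<open>auto simp: end_flag_def label_dir_def\<close>)
qed

lemma end_flag_bij: "bij_betw end_flag labels (ends C)"
proof -
  have lab: "labels = {1..r + s} \<union> (\<lambda>j. r + s + j) ` {1..n}"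
    unfolding labels_split by auto
  have "bij_betw end_flag {1..r + s} {f \<in> ends C. dir C f = 0}"
    using xend_bij by (rule bij_betw_cong[THEN iffD1, rotated]) (simp add: end_flag_x)
  moreover have "bij_betw end_flag ((\<lambda>j. r + s + j) ` {1..n}) {f \<in> ends C. dir C f \<noteq> 0}"
  proof (rule bij_betw_imageI)
    have "inj_on (end_flag \<circ> (\<lambda>j. r + s + j)) {1..n} \<longleftrightarrow> inj_on (yend C) {1..n}"
      by (rule inj_on_cong) (simp add: end_flag_y)
    then show "inj_on end_flag ((\<lambda>j. r + s + j) ` {1..n})"
      using bij_betw_imp_inj_on[OF yend_bij] by (intro inj_on_imageI) simp
    have "end_flag ` (\<lambda>j. r + s + j) ` {1..n} = yend C ` {1..n}"
      unfolding image_image by (rule image_cong[OF refl]) (rule end_flag_y)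
    then show "end_flag ` (\<lambda>j. r + s + j) ` {1..n} = {f \<in> ends C. dir C f \<noteq> 0}"
      using bij_betw_imp_surj_on[OF yend_bij] by simp
  qed
  ultimately have "bij_betw end_flag labels ({f \<in> ends C. dir C f = 0} \<union> {f \<in> ends C. dir C f \<noteq> 0})"
    unfolding lab by (rule bij_betw_combine) auto
  moreover have "{f \<in> ends C. dir C f = 0} \<union> {f \<in> ends C. dir C f \<noteq> 0} = ends C" by auto
  ultimately show ?thesis by simp
qed

lemma end_flag_end: "l \<in> labels \<Longrightarrow> end_flag l \<in> ends C"
  using bij_betwE[OF end_flag_bij] by blast

lemma end_flag_inj: "l \<in> labels \<Longrightarrow> k \<in> labels \<Longrightarrow> end_flag l = end_flag k \<Longrightarrow> l = k"
  using bij_betw_imp_inj_on[OF end_flag_bij] by (auto dest: inj_onD)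

lemma end_flag_surj: "f \<in> ends C \<Longrightarrow> \<exists>l\<in>labels. f = end_flag l"
  using bij_betw_imp_surj_on[OF end_flag_bij] by blast

text \<open>The steps of walks without backtracking: along the edge of \<open>f\<close> to its far
  vertex, then out of it by another flag. An end has no continuation.\<close>

definition ahead :: "(nat \<times> nat) set" where
  "ahead = {(f, g). f \<in> bounded_flags C \<and> g \<in> flags C \<and> base C g = base C (opp C f) \<and> g \<noteq> opp C f}"

definition behind_labels :: "nat \<Rightarrow> nat set" where
  "behind_labels f = {l \<in> labels. (f, end_flag l) \<in> ahead\<^sup>*}"

abbreviation adjacent :: "(nat \<times> nat) set" where
  "adjacent \<equiv> {(base C f, base C (opp C f)) | f. f \<in> flags C}"

lemma verts_connected: "V \<in> verts C \<Longrightarrow> W \<in> verts C \<Longrightarrow> (V, W) \<in> adjacent\<^sup>*"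
  using connected by (auto simp: connected_curve_def)

lemma ahead_flags: "(f, g) \<in> ahead \<Longrightarrow> f \<in> flags C \<and> g \<in> flags C"
  by (auto simp: ahead_def bounded_iff)

text \<open>The distances from a root select a spanning tree: every other vertex has one
  \<open>up_flag\<close> towards the root. Once \<open>bounded_up\<close> shows that there are no
  further edges, the walks without backtracking that start at the root are those along
  \<open>down\<close> flags.\<close>

definition dist_from :: "nat \<Rightarrow> nat \<Rightarrow> nat" where
  "dist_from V0 W = (LEAST k. (V0, W) \<in> adjacent ^^ k)"

definition up_flag :: "nat \<Rightarrow> nat \<Rightarrow> nat" where
  "up_flag V0 W = (SOME f. f \<in> flags C \<and> base C f = W \<and> dist_from V0 (base C (opp C f)) + 1 = dist_from V0 W)"

definition down :: "nat \<Rightarrow> nat \<Rightarrow> bool" where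
  "down V0 f \<longleftrightarrow> f \<in> flags C \<and> \<not> (base C f \<noteq> V0 \<and> f = up_flag V0 (base C f))"

context
  fixes V0 assumes V0: "V0 \<in> verts C"
begin

lemma dist_path: "W \<in> verts C \<Longrightarrow> (V0, W) \<in> adjacent ^^ dist_from V0 W"
proof -
  assume "W \<in> verts C"
  then have "\<exists>k. (V0, W) \<in> adjacent ^^ k" using verts_connected[OF V0] unfolding rtrancl_power by simp
  then show ?thesis unfolding dist_from_def by (rule LeastI_ex)
qed

lemma dist_le: "(V0, W) \<in> adjacent ^^ k \<Longrightarrow> dist_from V0 W \<le> k"
  unfolding dist_from_def by (rule Least_le)

lemma dist_zero: "W \<in> verts C \<Longrightarrow> dist_from V0 W = 0 \<Longrightarrow> W = V0"
  using dist_path[of W] by simp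

lemma up_flag:
  assumes "W \<in> verts C" "W \<noteq> V0"
  shows "up_flag V0 W \<in> bounded_flags C" "base C (up_flag V0 W) = W"
    "dist_from V0 (base C (opp C (up_flag V0 W))) + 1 = dist_from V0 W"
proof -
  have "dist_from V0 W \<noteq> 0" using dist_zero assms by blast
  then obtain k where k: "dist_from V0 W = Suc k" using not0_implies_Suc by blast
  then have "(V0, W) \<in> adjacent ^^ Suc k" using dist_path[OF assms(1)] by simp
  then obtain X where X: "(V0, X) \<in> adjacent ^^ k" "(X, W) \<in> adjacent" by (rule relpow_Suc_E)
  then obtain g where g: "g \<in> flags C" "X = base C g" "W = base C (opp C g)" by auto
  have le: "dist_from V0 X \<le> k" using dist_le[OF X(1)] .
  have "(V0, W) \<in> adjacent ^^ Suc (dist_from V0 X)"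
    using dist_path[of X] base_in[OF g(1)] X(2) g(2) by (auto intro: relpow_Suc_I)
  then have "dist_from V0 W \<le> Suc (dist_from V0 X)" by (rule dist_le)
  then have "dist_from V0 X + 1 = dist_from V0 W" using le k by simp
  then have "opp C g \<in> flags C \<and> base C (opp C g) = W \<and> dist_from V0 (base C (opp C (opp C g))) + 1 = dist_from V0 W"
    using g opp_in opp_opp by simp
  then have u: "up_flag V0 W \<in> flags C \<and> base C (up_flag V0 W) = W \<and>
      dist_from V0 (base C (opp C (up_flag V0 W))) + 1 = dist_from V0 W"
    unfolding up_flag_def by (rule someI)
  then show "base C (up_flag V0 W) = W" "dist_from V0 (base C (opp C (up_flag V0 W))) + 1 = dist_from V0 W" by auto
  have "opp C (up_flag V0 W) \<noteq> up_flag V0 W" using u by auto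
  then show "up_flag V0 W \<in> bounded_flags C" using u by (simp add: bounded_iff)
qed

text \<open>Genus \<open>0\<close> enters here: there are as many edges as vertices other than the root.\<close>

lemma bounded_up:
  assumes f: "f \<in> bounded_flags C"
  shows "(base C f \<noteq> V0 \<and> f = up_flag V0 (base C f)) \<or>
     (base C (opp C f) \<noteq> V0 \<and> opp C f = up_flag V0 (base C (opp C f)))"
proof -
  let ?e = "\<lambda>W. {up_flag V0 W, opp C (up_flag V0 W)}"
  let ?A = "verts C - {V0}"
  have inj: "inj_on ?e ?A"
  proof (rule inj_onI, rule ccontr)
    fix W X assume WX: "W \<in> ?A" "X \<in> ?A" "?e W = ?e X" "W \<noteq> X"
    have b: "base C (up_flag V0 W) = W" "base C (up_flag V0 X) = X" using up_flag WX(1,2) by auto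
    have "up_flag V0 W \<in> ?e X" "up_flag V0 X \<in> ?e W" using WX(3) by blast+
    moreover have "up_flag V0 W \<noteq> up_flag V0 X" using b WX(4) by metis
    ultimately have "up_flag V0 W = opp C (up_flag V0 X)" "up_flag V0 X = opp C (up_flag V0 W)" by auto
    then show False using up_flag(3)[of W] up_flag(3)[of X] WX(1,2) b by auto
  qed
  have sub: "?e ` ?A \<subseteq> bounded_edges C" unfolding bounded_edges_def using up_flag(1) by auto
  have "card (bounded_edges C) + 1 = card (verts C)" using genus0 by (simp add: genus_def)
  then have "card (bounded_edges C) = card ?A" using V0 fin_verts by simp
  moreover have "finite (bounded_edges C)" unfolding bounded_edges_def bounded_flags_def using fin_flags by simp
  ultimately have "?e ` ?A = bounded_edges C" using sub inj by (intro card_seteq) (simp_all add: card_image)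
  moreover have "{f, opp C f} \<in> bounded_edges C" using f by (auto simp: bounded_edges_def)
  ultimately obtain W where W: "W \<in> ?A" "{f, opp C f} = ?e W" by auto
  then have "up_flag V0 W = f \<or> up_flag V0 W = opp C f" by auto
  then show ?thesis using up_flag(2)[of W] W(1) by auto
qed

lemma down_step:
  assumes "down V0 f" "(f, g) \<in> ahead"
  shows "down V0 g" "base C g \<noteq> V0" "opp C f = up_flag V0 (base C g)"
    "dist_from V0 (base C g) = dist_from V0 (base C f) + 1"
proof -
  have f: "f \<in> bounded_flags C" "base C g = base C (opp C f)" "g \<in> flags C" "g \<noteq> opp C f" using assms(2) by (auto simp: ahead_def)
  have *: "base C (opp C f) \<noteq> V0" "opp C f = up_flag V0 (base C (opp C f))"
    using bounded_up[OF f(1)] assms(1) by (auto simp: down_def)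
  then show g: "base C g \<noteq> V0" "opp C f = up_flag V0 (base C g)" using f(2) by auto
  then show "down V0 g" using f(3,4) by (simp add: down_def)
  have "opp C (opp C f) = f" using opp_opp f(1) by (simp add: bounded_iff)
  then show "dist_from V0 (base C g) = dist_from V0 (base C f) + 1"
    using up_flag(3)[OF base_in[OF f(3)] g(1)] g(2) by metis
qed

lemma down_steps: "(f, g) \<in> ahead\<^sup>* \<Longrightarrow> down V0 f \<Longrightarrow> down V0 g"
  by (induction rule: rtrancl_induct) (use down_step in auto)

lemma root_down: "f \<in> flags_at C V0 \<Longrightarrow> down V0 f"
  by (simp add: down_def flags_at_iff)

text \<open>Among flags pointing down, the predecessor of a step is unique, being opposite to the
  \<open>up_flag\<close> at the new base. Walking back thus leads to one flag at the root; hence the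
  labels behind different flags of a vertex are disjoint.\<close>

lemma root_unique:
  assumes "(f, e) \<in> ahead\<^sup>*" "f \<in> flags_at C V0"
  shows "(f', e) \<in> ahead\<^sup>* \<Longrightarrow> f' \<in> flags_at C V0 \<Longrightarrow> f' = f"
  using assms
proof (induction rule: rtrancl_induct)
  case base
  from base(1) show ?case
  proof (cases rule: rtranclE)
    case (step h)
    then have "base C f \<noteq> V0" using down_step(2) down_steps root_down[OF base(2)] by blast
    then show ?thesis using base(3) by (simp add: flags_at_iff)
  qed simp
next
  case (step g e)
  have g: "down V0 g" using down_steps[OF step(1) root_down[OF step(6)]] .
  from step(4) show ?case
  proof (cases rule: rtranclE)
    case base
    then show ?thesis using down_step(2)[OF g step(2)] step(5) by (simp add: flags_at_iff)
  next
    case (step h)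
    have h: "down V0 h" using down_steps[OF step(1) root_down[OF \<open>f' \<in> flags_at C V0\<close>]] .
    have "opp C h = opp C g" using down_step(3)[OF h step(2)] down_step(3)[OF g \<open>(g, e) \<in> ahead\<close>] by simp
    moreover have "h \<in> flags C" "g \<in> flags C" using h g by (auto simp: down_def)
    ultimately have "h = g" using opp_opp by metis
    then show ?thesis using step(1) \<open>(f', g) \<in> ahead\<^sup>* \<Longrightarrow> f' \<in> flags_at C V0 \<Longrightarrow> f \<in> flags_at C V0 \<Longrightarrow> f' = f\<close>
      \<open>f' \<in> flags_at C V0\<close> \<open>f \<in> flags_at C V0\<close> by blast
  qed
qed

lemma down_reached: "down V0 f \<Longrightarrow> \<exists>f0\<in>flags_at C V0. (f0, f) \<in> ahead\<^sup>*"
proof (induction "dist_from V0 (base C f)" arbitrary: f rule: less_induct)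
  case less
  have f: "f \<in> flags C" using less.prems by (simp add: down_def)
  show ?case
  proof (cases "base C f = V0")
    case True
    then show ?thesis using f by (auto simp: flags_at_iff)
  next
    case False
    define u where "u = up_flag V0 (base C f)"
    note uf = up_flag[OF base_in[OF f] False, folded u_def]
    have ou: "opp C u \<in> bounded_flags C" "opp C (opp C u) = u" using bounded_opp opp_opp uf(1) by (auto simp: bounded_iff)
    have fu: "f \<noteq> u" using less.prems False by (auto simp: down_def u_def)
    have "down V0 (opp C u)"
    proof (rule ccontr)
      assume "\<not> down V0 (opp C u)"
      then have "base C (opp C u) \<noteq> V0" "opp C u = up_flag V0 (base C (opp C u))"
        using ou(1) by (auto simp: down_def bounded_iff)
      then have "dist_from V0 (base C (opp C (opp C u))) + 1 = dist_from V0 (base C (opp C u))"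
        using up_flag(3)[of "base C (opp C u)"] base_in ou(1) by (metis bounded_iff)
      then show False using uf(2,3) ou(2) by simp
    qed
    then obtain f0 where f0: "f0 \<in> flags_at C V0" "(f0, opp C u) \<in> ahead\<^sup>*" using less.hyps uf(3) by force
    have "(opp C u, f) \<in> ahead" unfolding ahead_def using ou f fu uf(2) by auto
    then show ?thesis using f0 by (meson rtrancl.rtrancl_into_rtrancl)
  qed
qed

lemma end_down: "f \<in> ends C \<Longrightarrow> down V0 f"
  using up_flag(1)[OF base_in, of f] by (auto simp: down_def ends_iff bounded_iff)

text \<open>The valence allows a walk to continue at every vertex, and the distance from the root
  grows with each step, so the walk must stop at an end.\<close>

lemma down_reaches_end: "down V0 f \<Longrightarrow> \<exists>e\<in>ends C. (f, e) \<in> ahead\<^sup>*"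
proof (induction "Max (dist_from V0 ` verts C) - dist_from V0 (base C f)" arbitrary: f rule: less_induct)
  case less
  have f: "f \<in> flags C" using less.prems by (simp add: down_def)
  show ?case
  proof (cases "f \<in> ends C")
    case False
    then have fb: "f \<in> bounded_flags C" using f by (simp add: ends_iff bounded_iff)
    define W where "W = base C (opp C f)"
    have W: "W \<in> verts C" using base_in opp_in f by (simp add: W_def)
    have "\<not> flags_at C W \<subseteq> {opp C f}"
    proof
      assume "flags_at C W \<subseteq> {opp C f}"
      then have "card (flags_at C W) \<le> card {opp C f}" by (rule card_mono[rotated]) simp
      then show False using valence[OF W] by simp
    qed
    then obtain g where "g \<in> flags_at C W" and ne: "g \<noteq> opp C f" by blast
    then have g: "g \<in> flags C" "base C g = W" "g \<noteq> opp C f" by (simp_all add: flags_at_iff)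
    then have st: "(f, g) \<in> ahead" using fb by (simp add: ahead_def W_def)
    note ds = down_step[OF less.prems st]
    have "dist_from V0 (base C g) \<le> Max (dist_from V0 ` verts C)" using base_in[OF g(1)] fin_verts by simp
    then obtain e where "e \<in> ends C" "(g, e) \<in> ahead\<^sup>*" using less.hyps[OF _ ds(1)] ds(4) by force
    then show ?thesis using st by (meson converse_rtrancl_into_rtrancl)
  qed blast
qed

end

lemma behind_nonempty: "f \<in> flags C \<Longrightarrow> behind_labels f \<noteq> {}"
proof -
  assume f: "f \<in> flags C"
  obtain e where e: "e \<in> ends C" "(f, e) \<in> ahead\<^sup>*"
    using down_reaches_end[OF base_in[OF f]] f by (auto simp: down_def)
  obtain l where "l \<in> labels" "e = end_flag l" using end_flag_surj[OF e(1)] by blast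
  then show ?thesis using e(2) by (auto simp: behind_labels_def)
qed

lemma behind_sub: "behind_labels f \<subseteq> labels" by (auto simp: behind_labels_def)

lemma behind_disjoint:
  assumes "f \<in> flags C" "g \<in> flags C" "base C f = base C g" "f \<noteq> g"
  shows "behind_labels f \<inter> behind_labels g = {}"
proof (rule equals0I)
  fix l assume "l \<in> behind_labels f \<inter> behind_labels g"
  then have "(f, end_flag l) \<in> ahead\<^sup>*" "(g, end_flag l) \<in> ahead\<^sup>*" by (auto simp: behind_labels_def)
  then show False using root_unique[OF base_in[OF assms(1)], of f "end_flag l" g] assms by (auto simp: flags_at_iff)
qed

lemma behind_cover:
  assumes V: "V \<in> verts C" and l: "l \<in> labels"
  shows "\<exists>f\<in>flags_at C V. l \<in> behind_labels f"
  using down_reached[OF V end_down[OF V end_flag_end[OF l]]] l by (auto simp: behind_labels_def)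

lemma behind_step: "(f, g) \<in> ahead \<Longrightarrow> behind_labels g \<subseteq> behind_labels f"
  by (auto simp: behind_labels_def intro: converse_rtrancl_into_rtrancl)

lemma behind_steps: "(f, g) \<in> ahead\<^sup>* \<Longrightarrow> behind_labels g \<subseteq> behind_labels f"
  by (auto simp: behind_labels_def intro: rtrancl_trans)

lemma behind_end: "l \<in> labels \<Longrightarrow> behind_labels (end_flag l) = {l}"
proof -
  assume l: "l \<in> labels"
  have "k = l" if "k \<in> labels" "(end_flag l, end_flag k) \<in> ahead\<^sup>*" for k
  proof -
    have "(end_flag l, g) \<notin> ahead" for g using end_flag_end[OF l] by (auto simp: ahead_def ends_iff bounded_iff)
    then have "end_flag l = end_flag k" using that(2) by (metis converse_rtranclE)
    then show ?thesis using end_flag_inj[OF l that(1)] by simp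
  qed
  then show ?thesis using l by (auto simp: behind_labels_def)
qed

lemma behind_bounded:
  assumes "f \<in> bounded_flags C"
  shows "behind_labels f = (\<Union>g\<in>flags_at C (base C (opp C f)) - {opp C f}. behind_labels g)"
proof
  show "(\<Union>g\<in>flags_at C (base C (opp C f)) - {opp C f}. behind_labels g) \<subseteq> behind_labels f"
  proof (rule UN_least)
    fix g assume "g \<in> flags_at C (base C (opp C f)) - {opp C f}"
    then have "(f, g) \<in> ahead" using assms by (auto simp: ahead_def flags_at_iff)
    then show "behind_labels g \<subseteq> behind_labels f" by (rule behind_step)
  qed
  show "behind_labels f \<subseteq> (\<Union>g\<in>flags_at C (base C (opp C f)) - {opp C f}. behind_labels g)"
  proof
    fix l assume "l \<in> behind_labels f"
    then have l: "l \<in> labels" "(f, end_flag l) \<in> ahead\<^sup>*" by (auto simp: behind_labels_def)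
    have "f \<noteq> end_flag l" using end_flag_end[OF l(1)] assms by (auto simp: ends_iff bounded_iff)
    then obtain g where g: "(f, g) \<in> ahead" "(g, end_flag l) \<in> ahead\<^sup>*" using l(2) by (metis converse_rtranclE)
    then have "l \<in> behind_labels g" "g \<in> flags_at C (base C (opp C f)) - {opp C f}"
      using l(1) by (auto simp: behind_labels_def ahead_def flags_at_iff)
    then show "l \<in> (\<Union>g\<in>flags_at C (base C (opp C f)) - {opp C f}. behind_labels g)" by blast
  qed
qed

lemma behind_opp:
  assumes f: "f \<in> bounded_flags C"
  shows "behind_labels (opp C f) = labels - behind_labels f"
proof -
  have of: "opp C f \<in> flags C" using opp_in f by (simp add: bounded_iff)
  define W where "W = base C (opp C f)"
  have W: "W \<in> verts C" using base_in[OF of] by (simp add: W_def)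
  have "behind_labels (opp C f) \<inter> behind_labels f = {}"
  proof (rule equals0I)
    fix l assume "l \<in> behind_labels (opp C f) \<inter> behind_labels f"
    then obtain g where "g \<in> flags_at C (base C (opp C f)) - {opp C f}" "l \<in> behind_labels g" "l \<in> behind_labels (opp C f)"
      unfolding behind_bounded[OF f] by blast
    then show False using behind_disjoint[OF of, of g] by (auto simp: flags_at_iff)
  qed
  moreover have "labels \<subseteq> behind_labels (opp C f) \<union> behind_labels f"
    using behind_cover[OF W] unfolding behind_bounded[OF f] W_def by blast
  ultimately show ?thesis using behind_sub by blast
qed

lemma other_flags:
  assumes "V \<in> verts C"
  shows "\<exists>h\<in>flags_at C V. h \<noteq> f \<and> h \<noteq> g"
proof (rule ccontr)
  assume "\<not> ?thesis"
  then have "flags_at C V \<subseteq> {f, g}" by blast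
  then have "card (flags_at C V) \<le> card {f, g}" by (intro card_mono) auto
  also have "\<dots> \<le> 2" by (simp add: card_insert_if)
  finally show False using valence[OF assms] by simp
qed

lemma ahead_psubset:
  assumes "(f, g) \<in> ahead"
  shows "behind_labels g \<subset> behind_labels f"
proof -
  have f: "f \<in> bounded_flags C" "g \<in> flags C" "base C g = base C (opp C f)" "g \<noteq> opp C f" using assms by (auto simp: ahead_def)
  obtain h where h: "h \<in> flags C" "base C h = base C g" "h \<noteq> g" "h \<noteq> opp C f"
    using other_flags[OF base_in[OF f(2)], of g "opp C f"] by (auto simp: flags_at_iff)
  then have "(f, h) \<in> ahead" using f by (simp add: ahead_def)
  then have "behind_labels h \<subseteq> behind_labels f" by (rule behind_step)
  then show ?thesis
    using behind_step[OF assms] behind_nonempty[OF h(1)] behind_disjoint[OF h(1) f(2) h(2,3)] by blast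
qed

text \<open>Let \<open>V\<close> be the base of \<open>f\<close>. If \<open>g\<close> points away
  from \<open>V\<close>, it lies strictly further along \<open>f\<close> or behind another flag of
  \<open>V\<close>. If it points towards \<open>V\<close>, the labels behind \<open>f\<close> and
  behind one flag \<open>f0\<close> of \<open>V\<close> exhaust all labels, and a third flag of
  \<open>V\<close> would have none.\<close>

lemma behind_inj:
  assumes f: "f \<in> flags C" and g: "g \<in> flags C" and eq: "behind_labels f = behind_labels g"
  shows "f = g"
proof (rule ccontr)
  assume ne: "f \<noteq> g"
  define V where "V = base C f"
  have V: "V \<in> verts C" using base_in[OF f] by (simp add: V_def)
  have fV: "f \<in> flags_at C V" using f by (simp add: V_def flags_at_iff)
  have bne: "base C g \<noteq> V"
    using behind_disjoint[OF f g _ ne] behind_nonempty[OF f] eq unfolding V_def by auto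
  show False
  proof (cases "down V g")
    case True
    obtain f0 where f0: "f0 \<in> flags_at C V" "(f0, g) \<in> ahead\<^sup>*" using down_reached[OF V True] by blast
    show False
    proof (cases "f0 = f")
      case True
      then obtain h where "(f, h) \<in> ahead" "(h, g) \<in> ahead\<^sup>*" using f0(2) ne by (metis converse_rtranclE)
      then show False using ahead_psubset behind_steps eq by blast
    next
      case False
      then have "behind_labels f0 \<inter> behind_labels f = {}"
        using behind_disjoint f0(1) fV by (auto simp: flags_at_iff)
      then show False using behind_steps[OF f0(2)] eq behind_nonempty[OF f] by blast
    qed
  next
    case False
    then have gu: "g = up_flag V (base C g)" using g by (simp add: down_def)
    have gb: "g \<in> bounded_flags C" using up_flag(1)[OF V base_in[OF g] bne] gu by simp
    have og: "opp C (opp C g) = g" "opp C g \<in> flags C" using opp_opp opp_in g by auto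
    have "down V (opp C g)"
    proof (rule ccontr)
      assume nd: "\<not> down V (opp C g)"
      then have 1: "base C (opp C g) \<noteq> V" "opp C g = up_flag V (base C (opp C g))" using og(2) by (auto simp: down_def)
      have "dist_from V (base C (opp C (opp C g))) + 1 = dist_from V (base C (opp C g))"
        using up_flag(3)[OF V base_in[OF og(2)] 1(1)] 1(2) by metis
      moreover have "dist_from V (base C (opp C g)) + 1 = dist_from V (base C g)"
        using up_flag(3)[OF V base_in[OF g] bne] gu by metis
      ultimately show False using og(1) by simp
    qed
    then obtain f0 where f0: "f0 \<in> flags_at C V" "(f0, opp C g) \<in> ahead\<^sup>*" using down_reached[OF V] by blast
    have sub: "labels - behind_labels f0 \<subseteq> behind_labels f"
      using behind_steps[OF f0(2)] behind_opp[OF gb] behind_sub[of g] eq by blast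
    obtain h where h: "h \<in> flags_at C V" "h \<noteq> f" "h \<noteq> f0" using other_flags[OF V] by blast
    have "behind_labels h \<inter> behind_labels f0 = {}" "behind_labels h \<inter> behind_labels f = {}"
      using behind_disjoint h f0(1) fV by (auto simp: flags_at_iff)
    then show False using sub behind_sub[of h] behind_nonempty[of h] h(1) by (auto simp: flags_at_iff)
  qed
qed

section \<open>The partitions induced by a curve\<close>

definition block_vertex :: "nat \<Rightarrow> nat set set" where "block_vertex V = behind_labels ` flags_at C V"

definition curve_type :: "nat set set set" where "curve_type = block_vertex ` verts C"

lemma fin_flags_at: "finite (flags_at C V)" using fin_flags by (simp add: flags_at_def)

lemma card_behind: "f \<in> flags C \<Longrightarrow> 2 \<le> card (behind_labels f) \<longleftrightarrow> f \<in> bounded_flags C"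
proof
  assume f: "f \<in> flags C" "2 \<le> card (behind_labels f)"
  show "f \<in> bounded_flags C"
  proof (rule ccontr)
    assume "f \<notin> bounded_flags C"
    then have "f \<in> ends C" using f(1) by (simp add: bounded_iff ends_iff)
    then obtain l where "l \<in> labels" "f = end_flag l" using end_flag_surj by blast
    then show False using behind_end f(2) by simp
  qed
next
  assume f: "f \<in> flags C" "f \<in> bounded_flags C"
  obtain g where g: "g \<in> flags_at C (base C (opp C f))" "g \<noteq> opp C f"
    using other_flags[OF base_in[OF opp_in[OF f(1)]]] by blast
  then have "(f, g) \<in> ahead" using f by (simp add: ahead_def flags_at_iff)
  then have "behind_labels g \<subset> behind_labels f" "g \<in> flags C" using ahead_psubset ahead_flags by auto
  moreover have fin: "finite (behind_labels x)" for x using finite_subset[OF behind_sub fin_labels] .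
  ultimately have "card (behind_labels g) < card (behind_labels f)" "0 < card (behind_labels g)"
    using behind_nonempty[of g] by (auto intro: psubset_card_mono simp: card_gt_0_iff)
  then show "2 \<le> card (behind_labels f)" by simp
qed

lemma block_vertex_inj:
  assumes "V \<in> verts C" "W \<in> verts C" "b \<in> block_vertex V" "b \<in> block_vertex W"
  shows "V = W"
proof -
  obtain f g where "f \<in> flags_at C V" "g \<in> flags_at C W" "b = behind_labels f" "b = behind_labels g"
    using assms(3,4) by (auto simp: block_vertex_def)
  then show ?thesis using behind_inj[of f g] by (auto simp: flags_at_iff)
qed

lemma block_vertex_nonempty: "V \<in> verts C \<Longrightarrow> block_vertex V \<noteq> {}"
  using other_flags[of V] by (auto simp: block_vertex_def)

lemma inj_block_vertex: "inj_on block_vertex (verts C)"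
  using block_vertex_inj block_vertex_nonempty by (auto intro!: inj_onI) (metis ex_in_conv)

lemma inj_behind: "inj_on behind_labels (flags C)"
  using behind_inj by (auto intro: inj_onI)

lemma part_block_vertex: "V \<in> verts C \<Longrightarrow> partition_on labels (block_vertex V)"
  unfolding partition_on_def disjoint_def
proof (intro conjI ballI impI)
  assume V: "V \<in> verts C"
  show "\<Union>(block_vertex V) = labels" using behind_cover[OF V] behind_sub by (auto simp: block_vertex_def)
  show "{} \<notin> block_vertex V" using behind_nonempty by (fastforce simp: block_vertex_def flags_at_iff)
  fix a b assume ab: "a \<in> block_vertex V" "b \<in> block_vertex V" "a \<noteq> b"
  then obtain f g where "f \<in> flags_at C V" "g \<in> flags_at C V" "a = behind_labels f" "b = behind_labels g"
    by (auto simp: block_vertex_def)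
  then show "a \<inter> b = {}" using behind_disjoint[of f g] ab(3) by (auto simp: flags_at_iff)
qed

lemma tree_curve_type: "partition_tree labels curve_type"
  unfolding partition_tree_def
proof (intro conjI ballI allI impI)
  show "finite curve_type" using fin_verts by (simp add: curve_type_def)
  have "card (verts C) \<noteq> 0" using genus0 by (simp add: genus_def)
  then show "curve_type \<noteq> {}" by (auto simp: curve_type_def)
  fix V assume "V \<in> curve_type"
  then obtain W where W: "W \<in> verts C" "V = block_vertex W" by (auto simp: curve_type_def)
  show "partition_on labels V" using part_block_vertex[OF W(1)] W(2) by simp
  have "card V = card (flags_at C W)"
    unfolding W(2) block_vertex_def by (intro card_image inj_on_subset[OF inj_behind]) (auto simp: flags_at_iff)
  then show "3 \<le> card V" using valence[OF W(1)] by simp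
next
  fix V W f assume "V \<in> curve_type" "W \<in> curve_type" "f \<in> V" "f \<in> W"
  then show "V = W" using block_vertex_inj by (auto simp: curve_type_def)
next
  fix V b assume V: "V \<in> curve_type" "b \<in> V" "2 \<le> card b"
  then obtain f where f: "f \<in> flags C" "b = behind_labels f" by (auto simp: curve_type_def block_vertex_def flags_at_iff)
  then have "f \<in> bounded_flags C" using card_behind V(3) by simp
  then have "labels - b = behind_labels (opp C f)" using behind_opp f(2) by simp
  then have "labels - b \<in> block_vertex (base C (opp C f))" using opp_in[OF f(1)] by (auto simp: block_vertex_def flags_at_iff)
  then show "\<exists>W\<in>curve_type. labels - b \<in> W" using base_in[OF opp_in[OF f(1)]] by (auto simp: curve_type_def)
qed

text \<open>Balancing at the far vertex expresses a direction by those of the flags ahead, and in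
  the end by the directions of the ends behind the flag. So the partitions determine all directions,
  those of contracted edges included.\<close>

lemma dir_behind: "f \<in> flags C \<Longrightarrow> dir C f = bdir (behind_labels f)"
proof (induction "card (behind_labels f)" arbitrary: f rule: less_induct)
  case less
  show ?case
  proof (cases "f \<in> bounded_flags C")
    case False
    then obtain l where l: "l \<in> labels" "f = end_flag l"
      using end_flag_surj[of f] less.prems by (auto simp: ends_iff bounded_iff)
    then show ?thesis using behind_end end_flag_dir by (simp add: bdir_def)
  next
    case True
    define W where "W = base C (opp C f)"
    have of: "opp C f \<in> flags C" and W: "W \<in> verts C" using opp_in base_in less.prems by (auto simp: W_def)
    have "opp C f \<in> flags_at C W" using of by (simp add: flags_at_iff W_def)
    then have "- dir C f + (\<Sum>g\<in>flags_at C W - {opp C f}. dir C g) = 0"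
      using balanced[OF W] sum.remove[OF fin_flags_at] dir_opp[OF True] by metis
    then have "dir C f = (\<Sum>g\<in>flags_at C W - {opp C f}. dir C g)"
      unfolding add_eq_0_iff by simp
    also have "\<dots> = (\<Sum>g\<in>flags_at C W - {opp C f}. bdir (behind_labels g))"
    proof (rule sum.cong[OF refl])
      fix g assume "g \<in> flags_at C W - {opp C f}"
      then have g: "(f, g) \<in> ahead" "g \<in> flags C" using True by (auto simp: ahead_def flags_at_iff W_def)
      have "card (behind_labels g) < card (behind_labels f)"
        using ahead_psubset[OF g(1)] finite_subset[OF behind_sub fin_labels] by (intro psubset_card_mono) auto
      then show "dir C g = bdir (behind_labels g)" using less.hyps g(2) by blast
    qed
    also have "\<dots> = bdir (behind_labels f)"
      unfolding behind_bounded[OF True] W_def[symmetric] bdir_def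
      using fin_flags_at[of W] behind_disjoint finite_subset[OF behind_sub fin_labels]
      by (subst sum.UNION_disjoint) (auto simp: flags_at_iff)
    finally show ?thesis .
  qed
qed

end

section \<open>Vertex profiles and the six kinds of vertices\<close>

context broccoli_data
begin

definition block_edges :: "nat set set \<Rightarrow> bool \<Rightarrow> bool \<Rightarrow> nat set set" where
  "block_edges V ev ou = {b \<in> V - markings. even_vec (bdir b) = ev \<and> (charge b = 1) = ou}"

definition block_profile :: "nat set set \<Rightarrow> nat \<times> nat \<times> nat \<times> nat \<times> nat \<times> nat" where
  "block_profile V =
     (card {i \<in> {1..r}. {i} \<in> V}, card {i \<in> {r + 1..r + s}. {i} \<in> V},
      card (block_edges V True False), card (block_edges V True True),
      card (block_edges V False False), card (block_edges V False True))"

lemma card_filter_three: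
  assumes "V - markings = {a, b, c}" "a \<noteq> b" "a \<noteq> c" "b \<noteq> c"
  shows "card (block_edges V ev ou) = (if even_vec (bdir a) = ev \<and> (charge a = 1) = ou then 1 else 0) +
     (if even_vec (bdir b) = ev \<and> (charge b = 1) = ou then 1 else 0) +
     (if even_vec (bdir c) = ev \<and> (charge c = 1) = ou then 1 else 0)"
  unfolding block_edges_def assms(1) filter_insert using assms(2-4) by simp

lemma profile_join:
  assumes "partition_on labels V" "is_join V a b c"
  shows "block_profile V \<in> {(0,0,0,0,2,1), (0,0,1,0,1,1), (0,0,2,1,0,0)}"
proof -
  have m: "V \<inter> markings = {}" by (rule join_unmarked(2)[OF assms(2)])
  then have "{i \<in> {1..r}. {i} \<in> V} = {}" "{i \<in> {r + 1..r + s}. {i} \<in> V} = {}"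
    by (auto simp: markings_def)
  moreover have ne: "a \<noteq> b" "a \<noteq> c" "b \<noteq> c" "charge a = 0" "charge b = 0" "charge c = 1"
    "even_vec (bdir a) \<or> even_vec (bdir b) \<or> \<not> even_vec (bdir c)" using assms(2) by (auto simp: is_join_def)
  moreover have "even_vec (bdir c) = even_vec (bdir a + bdir b)"
    unfolding join_dirs[OF assms] by (auto simp add: even_vec_def)
  then have "even_vec (bdir a) \<Longrightarrow> even_vec (bdir c) = even_vec (bdir b)"
    "even_vec (bdir b) \<Longrightarrow> even_vec (bdir c) = even_vec (bdir a)" by (auto simp: even_vec_def)
  ultimately show ?thesis
    unfolding block_profile_def card_filter_three[OF join_unmarked(1)[OF assms(2)] ne(1-3)] by auto
qed

lemma markings_of_vertex:
  assumes "broccoli_vertex V" "i \<in> {1..r + s}" "{i} \<in> V"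
  shows "{k \<in> {1..r + s}. {k} \<in> V} = {i}"
proof -
  have "k = i" if "k \<in> {1..r + s}" "{k} \<in> V" for k
    using vertex_marking_eq[OF assms] vertex_marking_eq[OF assms(1) that] by simp
  then show ?thesis using assms(2,3) by blast
qed

lemma profile_real:
  assumes "is_real V i a b"
  shows "block_profile V = (1,0,0,0,0,2)"
proof -
  have i: "i \<in> {1..r}" "{i} \<in> V" using assms by (auto simp: is_real_def)
  have "broccoli_vertex V" using assms by (auto simp: broccoli_vertex_def real_vertex_def)
  then have "{k \<in> {1..r + s}. {k} \<in> V} = {i}" using i by (intro markings_of_vertex) auto
  moreover have "{k \<in> {1..r}. {k} \<in> V} = {k \<in> {1..r + s}. {k} \<in> V} \<inter> {1..r}"
    "{k \<in> {r + 1..r + s}. {k} \<in> V} = {k \<in> {1..r + s}. {k} \<in> V} \<inter> {r + 1..r + s}" by auto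
  ultimately have m: "{k \<in> {1..r}. {k} \<in> V} = {i}" "{k \<in> {r + 1..r + s}. {k} \<in> V} = {}" using i by auto
  have "a \<noteq> b" "charge a = 1" "charge b = 1" "\<not> even_vec (bdir a)" "\<not> even_vec (bdir b)"
    using assms by (auto simp: is_real_def)
  then show ?thesis
    unfolding block_profile_def m block_edges_def real_unmarked[OF assms] filter_insert by simp
qed

lemma profile_complex:
  assumes "partition_on labels V" "is_complex V i a b c"
  shows "block_profile V \<in> {(0,1,0,0,0,3), (0,1,0,1,0,2)}"
proof -
  have i: "i \<in> {r + 1..r + s}" "{i} \<in> V" using assms(2) by (auto simp: is_complex_def)
  have "broccoli_vertex V" using assms(2) by (auto simp: broccoli_vertex_def complex_vertex_def)
  then have "{k \<in> {1..r + s}. {k} \<in> V} = {i}" using i by (intro markings_of_vertex) auto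
  moreover have "{k \<in> {1..r}. {k} \<in> V} = {k \<in> {1..r + s}. {k} \<in> V} \<inter> {1..r}"
    "{k \<in> {r + 1..r + s}. {k} \<in> V} = {k \<in> {1..r + s}. {k} \<in> V} \<inter> {r + 1..r + s}" by auto
  ultimately have m: "{k \<in> {1..r}. {k} \<in> V} = {}" "{k \<in> {r + 1..r + s}. {k} \<in> V} = {i}" using i by auto
  have ne: "a \<noteq> b" "a \<noteq> c" "b \<noteq> c" "charge a = 1" "charge b = 1" "charge c = 1"
    "\<not> (even_vec (bdir a) \<and> even_vec (bdir b) \<and> even_vec (bdir c))"
    using assms(2) by (auto simp: is_complex_def)
  moreover have "even_vec (bdir c) = even_vec (bdir a + bdir b)"
    unfolding complex_dirs[OF assms] by (auto simp add: even_vec_def)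
  then have "even_vec (bdir a) \<Longrightarrow> even_vec (bdir c) = even_vec (bdir b)"
    "even_vec (bdir b) \<Longrightarrow> even_vec (bdir c) = even_vec (bdir a)" by (auto simp: even_vec_def)
  ultimately show ?thesis
    unfolding block_profile_def m card_filter_three[OF complex_unmarked[OF assms(2)] ne(1-3)] by auto
qed

context
  fixes V assumes V: "partition_on labels V" and ch: "b \<in> V \<Longrightarrow> b \<in> markings \<or> charge b = 0 \<or> charge b = 1"
begin

lemma fin_V: "finite V" using finite_elements[OF fin_labels V] .

lemma fin_block_edges: "finite (block_edges V ev ou)" using fin_V by (simp add: block_edges_def)

lemma V_decomp:
  "V = (\<lambda>i. {i}) ` {i \<in> {1..r}. {i} \<in> V} \<union> (\<lambda>i. {i}) ` {i \<in> {r + 1..r + s}. {i} \<in> V} \<union>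
     block_edges V True False \<union> block_edges V True True \<union> block_edges V False False \<union> block_edges V False True"
    (is "V = ?A \<union> ?B \<union> ?C \<union> ?D \<union> ?E \<union> ?F")
proof (intro set_eqI iffI)
  fix b assume b: "b \<in> V"
  show "b \<in> ?A \<union> ?B \<union> ?C \<union> ?D \<union> ?E \<union> ?F"
  proof (cases "b \<in> markings")
    case True
    then obtain i where i: "i \<in> {1..r + s}" "b = {i}" by (auto simp: markings_def)
    then have "i \<in> {1..r} \<or> i \<in> {r + 1..r + s}" by auto
    then show ?thesis using i(2) b by blast
  next
    case False
    then show ?thesis using b unfolding block_edges_def by (cases "even_vec (bdir b)"; cases "charge b = 1") auto
  qed
next
  fix b assume "b \<in> ?A \<union> ?B \<union> ?C \<union> ?D \<union> ?E \<union> ?F"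
  then show "b \<in> V" unfolding block_edges_def by blast
qed

lemma block_edgesD:
  "b \<in> block_edges V True ou \<Longrightarrow> even_vec (bdir b)" "b \<in> block_edges V False ou \<Longrightarrow> \<not> even_vec (bdir b)"
  "b \<in> block_edges V ev True \<Longrightarrow> charge b = 1" "b \<in> block_edges V ev False \<Longrightarrow> charge b = 0"
  using ch by (auto simp: block_edges_def)

lemma real_of_profile:
  assumes "block_profile V = (1,0,0,0,0,2)" shows "real_vertex V"
proof -
  have c: "card {i \<in> {1..r}. {i} \<in> V} = 1" "{i \<in> {r + 1..r + s}. {i} \<in> V} = {}"
    "block_edges V True False = {}" "block_edges V True True = {}" "block_edges V False False = {}"
    "card (block_edges V False True) = 2"
    using assms fin_block_edges unfolding block_profile_def by simp_all
  obtain i where i: "{i \<in> {1..r}. {i} \<in> V} = {i}" using c(1) by (rule card_1_singletonE)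
  obtain a b where ab: "block_edges V False True = {a, b}" "a \<noteq> b" using c(6) unfolding card_2_iff by blast
  have "V = {{i}, a, b}" using V_decomp unfolding i c(2-5) ab(1) by (simp add: insert_commute)
  moreover have "a \<in> block_edges V False True" "b \<in> block_edges V False True" using ab(1) by simp_all
  moreover have "i \<in> {1..r}" using i by blast
  ultimately show ?thesis unfolding real_vertex_def is_real_def using ab(2) block_edgesD by metis
qed

lemma join_of_profile:
  shows "block_profile V = (0,0,0,0,2,1) \<Longrightarrow> join_vertex V \<and> (\<forall>f\<in>V. \<not> even_vec (bdir f))"
    and "block_profile V = (0,0,1,0,1,1) \<Longrightarrow> join_vertex V \<and> (\<exists>f\<in>V. even_vec (bdir f))"
    and "block_profile V = (0,0,2,1,0,0) \<Longrightarrow> join_vertex V \<and> (\<exists>f\<in>V. even_vec (bdir f))"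
proof -
  assume "block_profile V = (0,0,0,0,2,1)"
  then have c: "{i \<in> {1..r}. {i} \<in> V} = {}" "{i \<in> {r + 1..r + s}. {i} \<in> V} = {}"
    "block_edges V True False = {}" "block_edges V True True = {}" "card (block_edges V False False) = 2"
    "card (block_edges V False True) = 1"
    using fin_block_edges unfolding block_profile_def by simp_all
  obtain d where d: "block_edges V False True = {d}" using c(6) by (rule card_1_singletonE)
  obtain a b where ab: "block_edges V False False = {a, b}" "a \<noteq> b" using c(5) unfolding card_2_iff by blast
  have W: "V = {a, b, d}" using V_decomp unfolding c(1-4) ab(1) d by (simp add: insert_commute)
  have m: "a \<in> block_edges V False False" "b \<in> block_edges V False False" "d \<in> block_edges V False True" using ab(1) d by simp_all
  then have p: "charge a = 0" "charge b = 0" "charge d = 1" "\<not> even_vec (bdir a)" "\<not> even_vec (bdir b)" "\<not> even_vec (bdir d)"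
    using block_edgesD by blast+
  then have "a \<noteq> d" "b \<noteq> d" by auto
  then have "is_join V a b d" unfolding is_join_def using W ab(2) p by simp
  then show "join_vertex V \<and> (\<forall>f\<in>V. \<not> even_vec (bdir f))" unfolding join_vertex_def using W p by auto
next
  assume "block_profile V = (0,0,1,0,1,1)"
  then have c: "{i \<in> {1..r}. {i} \<in> V} = {}" "{i \<in> {r + 1..r + s}. {i} \<in> V} = {}"
    "card (block_edges V True False) = 1" "block_edges V True True = {}" "card (block_edges V False False) = 1"
    "card (block_edges V False True) = 1"
    using fin_block_edges unfolding block_profile_def by simp_all
  obtain d where d: "block_edges V False True = {d}" using c(6) by (rule card_1_singletonE)
  obtain a where a: "block_edges V True False = {a}" using c(3) by (rule card_1_singletonE)
  obtain b where b: "block_edges V False False = {b}" using c(5) by (rule card_1_singletonE)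
  have W: "V = {a, b, d}" using V_decomp unfolding c(1,2,4) a b d by (simp add: insert_commute)
  have m: "a \<in> block_edges V True False" "b \<in> block_edges V False False" "d \<in> block_edges V False True" using a b d by simp_all
  then have p: "charge a = 0" "charge b = 0" "charge d = 1" "even_vec (bdir a)" "\<not> even_vec (bdir b)" "\<not> even_vec (bdir d)"
    using block_edgesD by blast+
  then have "a \<noteq> d" "b \<noteq> d" "a \<noteq> b" by auto
  then have "is_join V a b d" unfolding is_join_def using W p by simp
  then show "join_vertex V \<and> (\<exists>f\<in>V. even_vec (bdir f))" unfolding join_vertex_def using W p by auto
next
  assume "block_profile V = (0,0,2,1,0,0)"
  then have c: "{i \<in> {1..r}. {i} \<in> V} = {}" "{i \<in> {r + 1..r + s}. {i} \<in> V} = {}"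
    "card (block_edges V True False) = 2" "card (block_edges V True True) = 1" "block_edges V False False = {}"
    "block_edges V False True = {}"
    using fin_block_edges unfolding block_profile_def by simp_all
  obtain d where d: "block_edges V True True = {d}" using c(4) by (rule card_1_singletonE)
  obtain a b where ab: "block_edges V True False = {a, b}" "a \<noteq> b" using c(3) unfolding card_2_iff by blast
  have W: "V = {a, b, d}" using V_decomp unfolding c(1,2,5,6) ab(1) d by (simp add: insert_commute)
  have m: "a \<in> block_edges V True False" "b \<in> block_edges V True False" "d \<in> block_edges V True True" using ab(1) d by simp_all
  then have p: "charge a = 0" "charge b = 0" "charge d = 1" "even_vec (bdir a)" "even_vec (bdir b)" "even_vec (bdir d)"
    using block_edgesD by blast+
  then have "a \<noteq> d" "b \<noteq> d" by auto
  then have "is_join V a b d" unfolding is_join_def using W ab(2) p by simp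
  then show "join_vertex V \<and> (\<exists>f\<in>V. even_vec (bdir f))" unfolding join_vertex_def using W p by auto
qed

lemma complex_of_profile:
  shows "block_profile V = (0,1,0,0,0,3) \<Longrightarrow> complex_vertex V \<and> (\<forall>f\<in>V - markings. \<not> even_vec (bdir f))"
    and "block_profile V = (0,1,0,1,0,2) \<Longrightarrow> complex_vertex V \<and> (\<exists>f\<in>V - markings. even_vec (bdir f))"
proof -
  assume "block_profile V = (0,1,0,0,0,3)"
  then have c: "{i \<in> {1..r}. {i} \<in> V} = {}" "card {i \<in> {r + 1..r + s}. {i} \<in> V} = 1"
    "block_edges V True False = {}" "block_edges V True True = {}" "block_edges V False False = {}"
    "card (block_edges V False True) = 3"
    using fin_block_edges unfolding block_profile_def by simp_all
  obtain i where i: "{i \<in> {r + 1..r + s}. {i} \<in> V} = {i}" using c(2) by (rule card_1_singletonE)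
  obtain a b d where abd: "block_edges V False True = {a, b, d}" "a \<noteq> b" "b \<noteq> d" "a \<noteq> d" using c(6) unfolding card_3_iff by blast
  have W: "V = {{i}, a, b, d}" using V_decomp unfolding i c(1,3-5) abd(1) by (simp add: insert_commute)
  have m: "a \<in> block_edges V False True" "b \<in> block_edges V False True" "d \<in> block_edges V False True" using abd(1) by simp_all
  then have p: "charge a = 1" "charge b = 1" "charge d = 1" "\<not> even_vec (bdir a)" "\<not> even_vec (bdir b)" "\<not> even_vec (bdir d)"
    using block_edgesD by blast+
  have "i \<in> {r + 1..r + s}" using i by blast
  then have j: "is_complex V i a b d" unfolding is_complex_def using W abd(2-4) p by simp
  show "complex_vertex V \<and> (\<forall>f\<in>V - markings. \<not> even_vec (bdir f))"
    unfolding complex_unmarked[OF j] using j p unfolding complex_vertex_def by auto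
next
  assume "block_profile V = (0,1,0,1,0,2)"
  then have c: "{i \<in> {1..r}. {i} \<in> V} = {}" "card {i \<in> {r + 1..r + s}. {i} \<in> V} = 1"
    "block_edges V True False = {}" "card (block_edges V True True) = 1" "block_edges V False False = {}"
    "card (block_edges V False True) = 2"
    using fin_block_edges unfolding block_profile_def by simp_all
  obtain i where i: "{i \<in> {r + 1..r + s}. {i} \<in> V} = {i}" using c(2) by (rule card_1_singletonE)
  obtain d where d: "block_edges V True True = {d}" using c(4) by (rule card_1_singletonE)
  obtain a b where ab: "block_edges V False True = {a, b}" "a \<noteq> b" using c(6) unfolding card_2_iff by blast
  have W: "V = {{i}, d, a, b}" using V_decomp unfolding i c(1,3,5) ab(1) d by (simp add: insert_commute)
  have m: "a \<in> block_edges V False True" "b \<in> block_edges V False True" "d \<in> block_edges V True True" using ab(1) d by simp_all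
  then have p: "charge a = 1" "charge b = 1" "charge d = 1" "\<not> even_vec (bdir a)" "\<not> even_vec (bdir b)" "even_vec (bdir d)"
    using block_edgesD by blast+
  then have ne: "d \<noteq> a" "d \<noteq> b" by auto
  have "i \<in> {r + 1..r + s}" using i by blast
  then have j: "is_complex V i d a b" unfolding is_complex_def using W ab(2) ne p by simp
  show "complex_vertex V \<and> (\<exists>f\<in>V - markings. even_vec (bdir f))"
    unfolding complex_unmarked[OF j] using j p unfolding complex_vertex_def by auto
qed

end

end

section \<open>Orientations recovered from charges\<close>

locale oriented_tree = marked_tree +
  assumes oc: "C \<in> oriented_curves r s n v F"
begin

lemma outw_opp: "f \<in> bounded_flags C \<Longrightarrow> outw C (opp C f) \<longleftrightarrow> \<not> outw C f"
  and outw_end: "j \<in> {1..n} \<Longrightarrow> outw C (yend C j) \<longleftrightarrow> j \<notin> F"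
  using oc unfolding oriented_curves_def inward_ends_def by blast+

lemma marking_flag: "i \<in> {1..r + s} \<Longrightarrow> behind_labels (xend C i) = {i}"
  using behind_end[of i] by (simp add: end_flag_x labels_def)

lemma xend_flag: "i \<in> {1..r + s} \<Longrightarrow> xend C i \<in> flags C"
  using bij_betwE[OF xend_bij] by (auto simp: ends_iff)

lemma yend_flag: "j \<in> {1..n} \<Longrightarrow> yend C j \<in> flags C" "j \<in> {1..n} \<Longrightarrow> behind_labels (yend C j) = {r + s + j}"
  using bij_betwE[OF yend_bij] behind_end[of "r + s + j"] by (auto simp: ends_iff end_flag_y labels_def)

lemma marking_iff: "f \<in> flags C \<Longrightarrow> behind_labels f \<in> markings \<longleftrightarrow> f \<in> xend C ` {1..r + s}"
proof
  assume f: "f \<in> flags C" "behind_labels f \<in> markings"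
  then obtain i where i: "i \<in> {1..r + s}" "behind_labels f = {i}" by (auto simp: markings_def)
  then have "f = xend C i" using behind_inj[OF f(1) xend_flag] marking_flag by simp
  then show "f \<in> xend C ` {1..r + s}" using i by blast
qed (auto simp: marking_flag markings_def)

lemma unmarked_iff: "f \<in> flags C \<Longrightarrow> f \<in> unmarked_flags r s C \<longleftrightarrow> behind_labels f \<notin> markings"
  using marking_iff by (auto simp: unmarked_flags_def)

lemma marking_at: "i \<in> {1..r + s} \<Longrightarrow> base C (xend C i) = V \<longleftrightarrow> {i} \<in> block_vertex V"
proof
  assume i: "i \<in> {1..r + s}" "base C (xend C i) = V"
  then show "{i} \<in> block_vertex V"
    using xend_flag marking_flag unfolding block_vertex_def by (intro image_eqI[of _ _ "xend C i"]) (auto simp: flags_at_iff)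
next
  assume i: "i \<in> {1..r + s}" "{i} \<in> block_vertex V"
  then obtain f where f: "f \<in> flags_at C V" "behind_labels f = {i}" by (auto simp: block_vertex_def)
  then have "f = xend C i" using behind_inj[OF _ xend_flag[OF i(1)], of f] marking_flag[OF i(1)] by (simp add: flags_at_iff)
  then show "base C (xend C i) = V" using f(1) by (simp add: flags_at_iff)
qed

text \<open>The orientation is the one that the label partitions prescribe. This holds for all
  broccoli curves (\<open>coherent_curve\<close>), so their combinatorial type carries no
  information beyond the partitions.\<close>

definition coherent :: bool where
  "coherent \<longleftrightarrow> (\<forall>f\<in>unmarked_flags r s C. outw C f \<longleftrightarrow> charge (behind_labels f) = 1)"

lemma vertex_profile_eq:
  assumes coherent
  shows "vertex_profile r s C V = block_profile (block_vertex V)"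
proof -
  have "{i \<in> {1..r}. base C (xend C i) = V} = {i \<in> {1..r}. {i} \<in> block_vertex V}"
    "{i \<in> {r + 1..r + s}. base C (xend C i) = V} = {i \<in> {r + 1..r + s}. {i} \<in> block_vertex V}"
    by (intro Collect_cong conj_cong refl marking_at; simp)+
  moreover have "num_edges r s C V ev ou = card (block_edges (block_vertex V) ev ou)" for ev ou
  proof -
    let ?A = "{f \<in> flags_at C V \<inter> unmarked_flags r s C. even_vec (dir C f) = ev \<and> outw C f = ou}"
    have "block_edges (block_vertex V) ev ou = behind_labels ` ?A"
    proof (intro set_eqI iffI)
      fix b assume b: "b \<in> block_edges (block_vertex V) ev ou"
      then obtain f where f: "f \<in> flags_at C V" "b = behind_labels f" by (auto simp: block_edges_def block_vertex_def)
      have "f \<in> ?A" using b f assms unmarked_iff[of f] dir_behind[of f] unfolding block_edges_def coherent_def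
        by (auto simp: flags_at_iff)
      then show "b \<in> behind_labels ` ?A" using f(2) by blast
    next
      fix b assume "b \<in> behind_labels ` ?A"
      then obtain f where f: "f \<in> ?A" "b = behind_labels f" by blast
      then have ff: "f \<in> flags C" by (simp add: flags_at_iff)
      have "b \<in> block_vertex V" using f by (simp add: block_vertex_def)
      then show "b \<in> block_edges (block_vertex V) ev ou"
        using f assms unmarked_iff[OF ff] dir_behind[OF ff] unfolding block_edges_def coherent_def by auto
    qed
    moreover have "inj_on behind_labels ?A" by (rule inj_on_subset[OF inj_behind]) (auto simp: flags_at_iff)
    ultimately show ?thesis unfolding num_edges_def by (simp add: card_image)
  qed
  ultimately show ?thesis unfolding vertex_profile_def block_profile_def by simp
qed

lemma block_charges:
  assumes coherent "b \<in> block_vertex V" "V \<in> verts C"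
    and "\<And>f. f \<in> flags C \<Longrightarrow> f \<in> bounded_flags C \<Longrightarrow> charge (behind_labels f) = 0 \<or> charge (behind_labels f) = 1"
  shows "b \<in> markings \<or> charge b = 0 \<or> charge b = 1"
proof -
  obtain f where f: "f \<in> flags C" "b = behind_labels f" using assms(2) by (auto simp: block_vertex_def flags_at_iff)
  show ?thesis
  proof (cases "f \<in> bounded_flags C")
    case True then show ?thesis using assms(4) f by blast
  next
    case False
    then have "f \<in> ends C" using f(1) by (simp add: bounded_iff ends_iff)
    then obtain l where l: "l \<in> labels" "f = end_flag l" using end_flag_surj by blast
    then have b: "b = {l}" using f behind_end by simp
    from l(1) show ?thesis
    proof (cases rule: label_cases)
      case (3 j)
      then show ?thesis using end_block(2)[of j] b by (auto split: if_splits)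
    qed (auto simp: b markings_def)
  qed
qed

text \<open>The charge as read off locally from the orientation; \<open>charge_flow\<close>
  identifies it with the sum of the label charges behind the flag.\<close>

definition flow_charge :: "nat \<Rightarrow> int" where
  "flow_charge f = (if f \<in> xend C ` {1..r} then - 1 else if f \<in> xend C ` {r + 1..r + s} then - 2
     else if outw C f then 1 else 0)"

text \<open>In each of the six profiles the number of outflows exceeds by 1 the number of real
  markings plus twice the number of complex ones.\<close>

lemma flow_charge_vertex:
  assumes V: "V \<in> verts C" and vt: "vertex1 r s C V \<or> vertex2 r s C V \<or> vertex3 r s C V \<or> vertex4 r s C V \<or> vertex5 r s C V \<or> vertex6 r s C V"
  shows "(\<Sum>f\<in>flags_at C V. flow_charge f) = 1"
proof -
  define A B where "A = {i \<in> {1..r}. base C (xend C i) = V}" and "B = {i \<in> {r + 1..r + s}. base C (xend C i) = V}"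
  define Out where "Out = {f \<in> flags_at C V \<inter> unmarked_flags r s C. outw C f}"
  define In where "In = {f \<in> flags_at C V \<inter> unmarked_flags r s C. \<not> outw C f}"
  have injx: "inj_on (xend C) {1..r + s}" using bij_betw_imp_inj_on[OF xend_bij] .
  have AB: "A \<subseteq> {1..r + s}" "B \<subseteq> {1..r + s}" "A \<inter> B = {}" by (auto simp: A_def B_def)
  have iA: "inj_on (xend C) A" "inj_on (xend C) B" using inj_on_subset[OF injx] AB by auto
  have fin: "finite A" "finite B" "finite Out" "finite In" using fin_flags_at by (simp_all add: A_def B_def Out_def In_def)
  have split: "flags_at C V = xend C ` A \<union> xend C ` B \<union> Out \<union> In"
  proof (intro set_eqI iffI)
    fix f assume f: "f \<in> flags_at C V"
    show "f \<in> xend C ` A \<union> xend C ` B \<union> Out \<union> In"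
    proof (cases "f \<in> unmarked_flags r s C")
      case False
      then obtain i where i: "i \<in> {1..r + s}" "f = xend C i" using f by (auto simp: unmarked_flags_def flags_at_iff)
      then have "i \<in> A \<or> i \<in> B" using f by (auto simp: A_def B_def flags_at_iff)
      then show ?thesis using i by blast
    qed (use f in \<open>auto simp: Out_def In_def\<close>)
  next
    fix f assume "f \<in> xend C ` A \<union> xend C ` B \<union> Out \<union> In"
    then show "f \<in> flags_at C V" using xend_flag by (auto simp: A_def B_def Out_def In_def flags_at_iff)
  qed
  have "xend C ` A \<inter> xend C ` B = {}" using inj_on_image_Int[OF injx AB(1,2)] AB(3) by simp
  moreover have "xend C ` X \<inter> Out = {}" "xend C ` X \<inter> In = {}" if "X \<subseteq> {1..r + s}" for X
    using that by (auto simp: Out_def In_def unmarked_flags_def)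
  moreover have "Out \<inter> In = {}" by (auto simp: Out_def In_def)
  ultimately have "(\<Sum>f\<in>flags_at C V. flow_charge f) = (\<Sum>f\<in>xend C ` A. flow_charge f) + (\<Sum>f\<in>xend C ` B. flow_charge f)
      + (\<Sum>f\<in>Out. flow_charge f) + (\<Sum>f\<in>In. flow_charge f)"
    unfolding split using fin AB by (simp add: sum.union_disjoint Int_Un_distrib2)
  also have "(\<Sum>f\<in>xend C ` A. flow_charge f) = (\<Sum>f\<in>xend C ` A. - 1)"
    by (rule sum.cong) (auto simp: flow_charge_def A_def)
  also have "(\<Sum>f\<in>xend C ` B. flow_charge f) = (\<Sum>f\<in>xend C ` B. - 2)"
  proof (rule sum.cong[OF refl])
    fix f assume f: "f \<in> xend C ` B"
    have "xend C ` {1..r} \<inter> xend C ` {r + 1..r + s} = xend C ` ({1..r} \<inter> {r + 1..r + s})"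
      by (rule inj_on_image_Int[OF injx, symmetric]) auto
    then have "xend C ` {1..r} \<inter> xend C ` {r + 1..r + s} = {}" by simp
    then show "flow_charge f = - 2" using f by (auto simp: flow_charge_def B_def)
  qed
  also have "(\<Sum>f\<in>Out. flow_charge f) = (\<Sum>f\<in>Out. 1)"
    by (rule sum.cong) (auto simp: flow_charge_def Out_def unmarked_flags_def)
  also have "(\<Sum>f\<in>In. flow_charge f) = (\<Sum>f\<in>In. 0)"
    by (rule sum.cong) (auto simp: flow_charge_def In_def unmarked_flags_def)
  also have "(\<Sum>f\<in>Out. 1) = int (num_edges r s C V True True) + int (num_edges r s C V False True)"
  proof -
    have "Out = {f \<in> flags_at C V \<inter> unmarked_flags r s C. even_vec (dir C f) = True \<and> outw C f = True} \<union>
      {f \<in> flags_at C V \<inter> unmarked_flags r s C. even_vec (dir C f) = False \<and> outw C f = True}" by (auto simp: Out_def)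
    then show ?thesis unfolding num_edges_def using fin_flags_at by (simp add: card_Un_disjoint disjoint_iff)
  qed
  finally have total: "(\<Sum>f\<in>flags_at C V. flow_charge f) = - int (card A) - 2 * int (card B)
      + int (num_edges r s C V True True) + int (num_edges r s C V False True)"
    using iA by (simp add: card_image)
  have "vertex_profile r s C V = (card A, card B, num_edges r s C V True False, num_edges r s C V True True,
      num_edges r s C V False False, num_edges r s C V False True)"
    unfolding vertex_profile_def A_def B_def ..
  then show ?thesis using vt
    unfolding total vertex1_def vertex2_def vertex3_def vertex4_def vertex5_def vertex6_def
    by (elim disjE) simp_all
qed

text \<open>Both sides agree at the ends by the choice of \<open>label_charge\<close>. Across a
  bounded edge both are the sum over the flags ahead: the charge because the labels are partitioned,
  the flow because it sums up to 1 at the far vertex and the orientation is reversed on the opposite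
  flag.\<close>

lemma charge_flow:
  assumes br: "\<And>V. V \<in> verts C \<Longrightarrow> vertex1 r s C V \<or> vertex2 r s C V \<or> vertex3 r s C V \<or> vertex4 r s C V \<or> vertex5 r s C V \<or> vertex6 r s C V"
  shows "f \<in> flags C \<Longrightarrow> charge (behind_labels f) = flow_charge f"
proof (induction "card (behind_labels f)" arbitrary: f rule: less_induct)
  case less
  show ?case
  proof (cases "f \<in> bounded_flags C")
    case False
    then obtain l where l: "l \<in> labels" "f = end_flag l"
      using end_flag_surj[of f] less.prems by (auto simp: ends_iff bounded_iff)
    have b: "behind_labels f = {l}" using l behind_end by simp
    have injx: "inj_on (xend C) {1..r + s}" using bij_betw_imp_inj_on[OF xend_bij] .
    from l(1) show ?thesis
    proof (cases rule: label_cases)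
      case 1
      then show ?thesis using l(2) real_charge[of l] unfolding b by (auto simp: flow_charge_def end_flag_def)
    next
      case 2
      have "xend C l \<notin> xend C ` {1..r}" using inj_onD[OF injx, of l] 2 by force
      then show ?thesis using l(2) 2 complex_charge[of l] unfolding b by (auto simp: flow_charge_def end_flag_def)
    next
      case (3 j)
      then have f: "f = yend C j" using l(2) end_flag_y by simp
      have "behind_labels f \<notin> markings" using 3 unfolding b by (auto simp: markings_def)
      then have "f \<notin> xend C ` {1..r + s}" using marking_iff less.prems by blast
      moreover have "{1..r} \<subseteq> {1..r + s}" "{r + 1..r + s} \<subseteq> {1..r + s}" by auto
      ultimately have "f \<notin> xend C ` {1..r}" "f \<notin> xend C ` {r + 1..r + s}" by blast+
      then show ?thesis using end_block(2)[OF 3(1)] outw_end[OF 3(1)] f 3(2) unfolding b by (auto simp: flow_charge_def)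
    qed
  next
    case True
    define W where "W = base C (opp C f)"
    have of: "opp C f \<in> flags C" and W: "W \<in> verts C" using opp_in base_in less.prems by (auto simp: W_def)
    have "opp C f \<in> flags_at C W" using of by (simp add: flags_at_iff W_def)
    then have eq: "1 = flow_charge (opp C f) + (\<Sum>g\<in>flags_at C W - {opp C f}. flow_charge g)"
      using flow_charge_vertex[OF W br[OF W]] sum.remove[OF fin_flags_at] by metis
    have nx: "g \<notin> xend C ` {1..r}" "g \<notin> xend C ` {r + 1..r + s}" if "g \<in> bounded_flags C" for g
      using that bij_betwE[OF xend_bij] by (auto simp: bounded_iff ends_iff)
    have "flow_charge f = 1 - flow_charge (opp C f)"
      using nx[OF True] nx[OF bounded_opp[OF True]] outw_opp[OF True] by (simp add: flow_charge_def)
    also have "\<dots> = (\<Sum>g\<in>flags_at C W - {opp C f}. flow_charge g)" using eq by simp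
    also have "\<dots> = (\<Sum>g\<in>flags_at C W - {opp C f}. charge (behind_labels g))"
    proof (rule sum.cong[OF refl])
      fix g assume "g \<in> flags_at C W - {opp C f}"
      then have g: "(f, g) \<in> ahead" "g \<in> flags C" using True by (auto simp: ahead_def flags_at_iff W_def)
      have "card (behind_labels g) < card (behind_labels f)"
        using ahead_psubset[OF g(1)] finite_subset[OF behind_sub fin_labels] by (intro psubset_card_mono) auto
      then show "flow_charge g = charge (behind_labels g)" using less.hyps g(2) by simp
    qed
    also have "\<dots> = charge (behind_labels f)"
      unfolding behind_bounded[OF True] W_def[symmetric] charge_def
      using fin_flags_at[of W] behind_disjoint finite_subset[OF behind_sub fin_labels]
      by (subst sum.UNION_disjoint) (auto simp: flags_at_iff)
    finally show ?thesis by simp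
  qed
qed

definition curve_pos :: "nat set set \<Rightarrow> real \<times> real" where
  "curve_pos W = pos C (THE V. V \<in> verts C \<and> block_vertex V = W)"

lemma curve_pos_eq: "V \<in> verts C \<Longrightarrow> curve_pos (block_vertex V) = pos C V"
  unfolding curve_pos_def using inj_block_vertex
  by (intro arg_cong[of _ _ "pos C"] the_equality) (auto dest: inj_onD)

interpretation ptree labels curve_type using tree_curve_type fin_labels by unfold_locales

lemma vertex_of_behind: "f \<in> flags C \<Longrightarrow> vertex_of curve_type (behind_labels f) = block_vertex (base C f)"
  using base_in by (intro vertex_of_eq) (auto simp: curve_type_def block_vertex_def flags_at_iff)

lemma inner_curve_type: "b \<in> inner_flags curve_type \<longleftrightarrow> (\<exists>f\<in>bounded_flags C. b = behind_labels f)"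
proof
  assume "b \<in> inner_flags curve_type"
  then obtain f where f: "f \<in> flags C" "b = behind_labels f" "2 \<le> card b"
    by (auto simp: inner_flags_def curve_type_def block_vertex_def flags_at_iff)
  then show "\<exists>f\<in>bounded_flags C. b = behind_labels f" using card_behind by blast
next
  assume "\<exists>f\<in>bounded_flags C. b = behind_labels f"
  then obtain f where f: "f \<in> bounded_flags C" "b = behind_labels f" by blast
  then have "f \<in> flags C" "2 \<le> card b" using card_behind by (auto simp: bounded_iff)
  moreover then have "b \<in> block_vertex (base C f)" using f by (auto simp: block_vertex_def flags_at_iff)
  ultimately show "b \<in> inner_flags curve_type" using base_in by (auto simp: inner_flags_def curve_type_def)
qed

lemma curve_edge_vector:
  assumes "f \<in> bounded_flags C"
  shows "curve_pos (vertex_of curve_type (labels - behind_labels f)) - curve_pos (vertex_of curve_type (behind_labels f))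
     = len C f *\<^sub>R rdir (behind_labels f)"
proof -
  have f: "f \<in> flags C" "opp C f \<in> flags C" using assms opp_in by (auto simp: bounded_iff)
  have "curve_pos (vertex_of curve_type (labels - behind_labels f)) = pos C (base C (opp C f))"
    using vertex_of_behind[OF f(2)] curve_pos_eq[OF base_in[OF f(2)]] behind_opp[OF assms] by simp
  moreover have "curve_pos (vertex_of curve_type (behind_labels f)) = pos C (base C f)"
    using vertex_of_behind[OF f(1)] curve_pos_eq[OF base_in[OF f(1)]] by simp
  ultimately show ?thesis using pos_opp[OF assms] dir_behind[OF f(1)] by simp
qed

lemma evaluation_eq: "evaluation r s v F C = evaluate curve_type curve_pos"
proof -
  have "pos C (base C (xend C i)) = curve_pos (vertex_of curve_type {i})" if "i \<in> {1..r + s}" for i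
    using vertex_of_behind[OF xend_flag[OF that]] marking_flag[OF that] curve_pos_eq[OF base_in[OF xend_flag[OF that]]] by simp
  moreover have "pos C (base C (yend C j)) = curve_pos (vertex_of curve_type {r + s + j})" if "j \<in> F" for j
  proof -
    have j: "j \<in> {1..n}" using that F_sub by blast
    show ?thesis
      using vertex_of_behind[OF yend_flag(1)[OF j]] yend_flag(2)[OF j] curve_pos_eq[OF base_in[OF yend_flag(1)[OF j]]] by simp
  qed
  ultimately show ?thesis unfolding evaluation_def evaluate_def by (auto intro!: sum.cong)
qed

lemma curve_solves: "solves curve_type (evaluation r s v F C) curve_pos"
  unfolding solves_def evaluation_eq
proof (intro conjI ballI impI)
  fix b assume "b \<in> inner_flags curve_type"
  then obtain f where f: "f \<in> bounded_flags C" "b = behind_labels f" using inner_curve_type by blast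
  have "curve_pos (vertex_of curve_type (labels - b)) = curve_pos (vertex_of curve_type b) + len C f *\<^sub>R rdir b"
    using curve_edge_vector[OF f(1)] unfolding f(2) by (simp add: algebra_simps)
  then show "det2 (rdir b) (curve_pos (vertex_of curve_type b)) = det2 (rdir b) (curve_pos (vertex_of curve_type (labels - b)))"
    by (simp add: det2_add_right det2_scale_right det2_self)
qed (use vertex_of_eq in \<open>auto simp: lookup_evaluate\<close>)

end

locale broccoli_curve = oriented_tree +
  assumes bc: "C \<in> broccoli_curves r s n v F"
begin

lemma kinds: "V \<in> verts C \<Longrightarrow> vertex1 r s C V \<or> vertex2 r s C V \<or> vertex3 r s C V \<or> vertex4 r s C V \<or> vertex5 r s C V \<or> vertex6 r s C V"
  using bc by (simp add: broccoli_curves_def)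

lemma coherent_curve: coherent
  unfolding coherent_def
proof
  fix f assume f: "f \<in> unmarked_flags r s C"
  have "{1..r} \<subseteq> {1..r + s}" "{r + 1..r + s} \<subseteq> {1..r + s}" by auto
  then have "f \<notin> xend C ` {1..r}" "f \<notin> xend C ` {r + 1..r + s}" using f unfolding unmarked_flags_def by blast+
  moreover have "f \<in> flags C" using f by (simp add: unmarked_flags_def)
  ultimately show "outw C f \<longleftrightarrow> charge (behind_labels f) = 1"
    using charge_flow[OF kinds, of f] by (simp add: flow_charge_def)
qed

lemma bounded_charge: "f \<in> bounded_flags C \<Longrightarrow> charge (behind_labels f) = 0 \<or> charge (behind_labels f) = 1"
proof -
  assume f: "f \<in> bounded_flags C"
  then have "f \<notin> xend C ` {1..r}" "f \<notin> xend C ` {r + 1..r + s}" "f \<in> flags C"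
    using bij_betwE[OF xend_bij] by (auto simp: bounded_iff ends_iff)
  then show ?thesis using charge_flow[OF kinds, of f] by (simp add: flow_charge_def)
qed

lemma broccoli_block:
  assumes V: "V \<in> verts C"
  shows "broccoli_vertex (block_vertex V)" "vertex_mult r s C V = block_mult (block_vertex V)"
proof -
  let ?W = "block_vertex V"
  note part = part_block_vertex[OF V]
  have ch: "b \<in> markings \<or> charge b = 0 \<or> charge b = 1" if "b \<in> ?W" for b
    using block_charges[OF coherent_curve that V] bounded_charge by blast
  have prof: "vertex_profile r s C V = block_profile ?W" by (rule vertex_profile_eq[OF coherent_curve])
  have vd: "vertex_det r s C V = block_det ?W"
  proof -
    have "?W - markings = behind_labels ` (flags_at C V \<inter> unmarked_flags r s C)"
      unfolding block_vertex_def using unmarked_iff by (auto simp: flags_at_iff)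
    moreover have "behind_labels f = behind_labels g \<longleftrightarrow> f = g" if "f \<in> flags_at C V" "g \<in> flags_at C V" for f g
      using behind_inj that by (auto simp: flags_at_iff)
    ultimately have "(\<exists>f\<in>?W - markings. \<exists>g\<in>?W - markings. f \<noteq> g \<and> a = nat \<bar>det2 (bdir f) (bdir g)\<bar>) \<longleftrightarrow>
      (\<exists>f\<in>flags_at C V \<inter> unmarked_flags r s C. \<exists>g\<in>flags_at C V \<inter> unmarked_flags r s C. f \<noteq> g \<and> a = nat \<bar>det2 (dir C f) (dir C g)\<bar>)" for a
      using dir_behind by (auto simp: flags_at_iff)
    then show ?thesis unfolding vertex_det_def block_det_def by simp
  qed
  note defs = vertex1_def vertex2_def vertex3_def vertex4_def vertex5_def vertex6_def prof
  show "broccoli_vertex ?W"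
    using kinds[OF V] real_of_profile[OF part ch] join_of_profile[OF part ch] complex_of_profile[OF part ch]
    unfolding defs broccoli_vertex_def by blast
  note disj = vertex_kinds_disjoint[of ?W]
  have cases: "(vertex1 r s C V \<and> real_vertex ?W) \<or>
     (vertex2 r s C V \<and> join_vertex ?W \<and> (\<forall>f\<in>?W. \<not> even_vec (bdir f))) \<or>
     ((vertex3 r s C V \<or> vertex4 r s C V) \<and> join_vertex ?W \<and> (\<exists>f\<in>?W. even_vec (bdir f))) \<or>
     (vertex5 r s C V \<and> complex_vertex ?W \<and> (\<forall>f\<in>?W - markings. \<not> even_vec (bdir f))) \<or>
     (vertex6 r s C V \<and> complex_vertex ?W \<and> (\<exists>f\<in>?W - markings. even_vec (bdir f)))"
    using kinds[OF V] real_of_profile[OF part ch] join_of_profile[OF part ch] complex_of_profile[OF part ch]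
    unfolding defs by blast
  have excl: "vertex1 r s C V \<Longrightarrow> \<not> vertex2 r s C V \<and> \<not> vertex6 r s C V"
    "vertex3 r s C V \<or> vertex4 r s C V \<or> vertex5 r s C V \<Longrightarrow> \<not> vertex1 r s C V \<and> \<not> vertex2 r s C V \<and> \<not> vertex6 r s C V"
    "vertex2 r s C V \<or> vertex6 r s C V \<Longrightarrow> \<not> vertex1 r s C V"
    unfolding vertex1_def vertex2_def vertex3_def vertex4_def vertex5_def vertex6_def by auto
  show "vertex_mult r s C V = block_mult ?W"
    using cases
  proof (elim disjE)
    assume "vertex1 r s C V \<and> real_vertex ?W"
    then show ?thesis unfolding vertex_mult_def block_mult_def Let_def by simp
  next
    assume a: "vertex2 r s C V \<and> join_vertex ?W \<and> (\<forall>f\<in>?W. \<not> even_vec (bdir f))"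
    then show ?thesis unfolding vertex_mult_def block_mult_def Let_def vd using excl(3) disj(1) by simp
  next
    assume a: "(vertex3 r s C V \<or> vertex4 r s C V) \<and> join_vertex ?W \<and> (\<exists>f\<in>?W. even_vec (bdir f))"
    then have n: "\<not> vertex1 r s C V" "\<not> vertex2 r s C V" "\<not> vertex6 r s C V" using excl(2) by blast+
    have nn: "\<not> ((join_vertex ?W \<and> (\<forall>f\<in>?W. \<not> even_vec (bdir f))) \<or> (complex_vertex ?W \<and> (\<exists>f\<in>?W - markings. even_vec (bdir f))))"
      using a disj(2) by blast
    have "block_mult ?W = of_nat (block_det ?W) * \<i> powi (int (block_det ?W) - 1)"
      unfolding block_mult_def if_not_P[OF nn] using a disj(1) by simp
    then show ?thesis unfolding vertex_mult_def Let_def vd using n by simp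
  next
    assume a: "vertex5 r s C V \<and> complex_vertex ?W \<and> (\<forall>f\<in>?W - markings. \<not> even_vec (bdir f))"
    then have n: "\<not> vertex1 r s C V" "\<not> vertex2 r s C V" "\<not> vertex6 r s C V" using excl(2) by blast+
    have nn: "\<not> ((join_vertex ?W \<and> (\<forall>f\<in>?W. \<not> even_vec (bdir f))) \<or> (complex_vertex ?W \<and> (\<exists>f\<in>?W - markings. even_vec (bdir f))))"
      using a disj(2) by blast
    have "block_mult ?W = of_nat (block_det ?W) * \<i> powi (int (block_det ?W) - 1)"
      unfolding block_mult_def if_not_P[OF nn] using a disj(3) by simp
    then show ?thesis unfolding vertex_mult_def Let_def vd using n by simp
  next
    assume a: "vertex6 r s C V \<and> complex_vertex ?W \<and> (\<exists>f\<in>?W - markings. even_vec (bdir f))"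
    then show ?thesis unfolding vertex_mult_def block_mult_def Let_def vd using excl(3) disj(3) by simp
  qed
qed

lemma broccoli_curve_type: "broccoli_type curve_type"
  unfolding broccoli_type_def using tree_curve_type broccoli_block by (auto simp: curve_type_def)

lemma curve_mult_eq:
  "curve_mult r s n C = (\<Prod>k=1..n. \<i> powi (int (weight (v k)) - 1)) * type_mult curve_type"
proof -
  have "(\<Prod>V\<in>verts C. vertex_mult r s C V) = type_mult curve_type"
    unfolding type_mult_def curve_type_def by (simp add: prod.reindex[OF inj_block_vertex] broccoli_block(2))
  moreover have "(\<Prod>k=1..n. \<i> powi (int (weight (dir C (yend C k))) - 1)) = (\<Prod>k=1..n. \<i> powi (int (weight (v k)) - 1))"
    by (rule prod.cong) (auto simp: yend_dir)
  ultimately show ?thesis unfolding curve_mult_def by simp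
qed

end

section \<open>Isomorphisms\<close>

lemma (in marked_tree) Union_curve_type: "\<Union>curve_type = behind_labels ` flags C"
proof (intro set_eqI iffI)
  fix b assume "b \<in> \<Union>curve_type"
  then show "b \<in> behind_labels ` flags C" by (auto simp: curve_type_def block_vertex_def flags_at_iff)
next
  fix b assume "b \<in> behind_labels ` flags C"
  then obtain f where f: "f \<in> flags C" "b = behind_labels f" by blast
  then have "b \<in> block_vertex (base C f)" by (auto simp: block_vertex_def flags_at_iff)
  then show "b \<in> \<Union>curve_type" using base_in[OF f(1)] unfolding curve_type_def by blast
qed

locale two_trees = C: oriented_tree r s n v F C + D: oriented_tree r s n v F D for r s n v F C D
begin

context
  fixes \<phi> \<psi> assumes iso: "type_iso r s n \<phi> \<psi> C D"
begin

lemma iso_facts: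
  "\<phi> ` verts C = verts D" "inj_on \<phi> (verts C)" "inj_on \<psi> (flags D)" "\<psi> ` flags D = flags C"
  "g \<in> flags D \<Longrightarrow> base D g = \<phi> (base C (\<psi> g))" "g \<in> flags D \<Longrightarrow> \<psi> (opp D g) = opp C (\<psi> g)"
  "g \<in> unmarked_flags r s D \<Longrightarrow> outw D g \<longleftrightarrow> outw C (\<psi> g)"
  "i \<in> {1..r + s} \<Longrightarrow> xend C i = \<psi> (xend D i)" "j \<in> {1..n} \<Longrightarrow> yend C j = \<psi> (yend D j)"
proof -
  note i = iso[unfolded type_iso_def type_contraction_def]
  show "\<phi> ` verts C = verts D" "inj_on \<phi> (verts C)" "inj_on \<psi> (flags D)" "\<psi> ` flags D = flags C"
    using i by simp_all
  show "g \<in> flags D \<Longrightarrow> base D g = \<phi> (base C (\<psi> g))" "g \<in> flags D \<Longrightarrow> \<psi> (opp D g) = opp C (\<psi> g)"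
    using i by simp_all
  show "g \<in> unmarked_flags r s D \<Longrightarrow> outw D g \<longleftrightarrow> outw C (\<psi> g)" using i by simp
  show "i \<in> {1..r + s} \<Longrightarrow> xend C i = \<psi> (xend D i)" "j \<in> {1..n} \<Longrightarrow> yend C j = \<psi> (yend D j)"
    using i by blast+
qed

lemma \<psi>_in: "g \<in> flags D \<Longrightarrow> \<psi> g \<in> flags C" using iso_facts(4) by blast

lemma iso_end: "l \<in> C.labels \<Longrightarrow> C.end_flag l = \<psi> (D.end_flag l)"
proof -
  assume "l \<in> C.labels"
  then show ?thesis
  proof (cases rule: C.label_cases)
    case (3 j)
    then show ?thesis using iso_facts(9)[of j] C.end_flag_y[of j] D.end_flag_y[of j] by simp
  next
    case 1
    then show ?thesis using iso_facts(8)[of l] C.end_flag_x[of l] D.end_flag_x[of l] by simp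
  next
    case 2
    then show ?thesis using iso_facts(8)[of l] C.end_flag_x[of l] D.end_flag_x[of l] by simp
  qed
qed

lemma iso_ahead:
  assumes g: "g \<in> flags D" "h \<in> flags D"
  shows "(g, h) \<in> D.ahead \<longleftrightarrow> (\<psi> g, \<psi> h) \<in> C.ahead"
proof -
  have o: "opp D g \<in> flags D" using D.opp_in g(1) .
  have inj: "\<psi> x = \<psi> y \<longleftrightarrow> x = y" if "x \<in> flags D" "y \<in> flags D" for x y
    using inj_onD[OF iso_facts(3) _ that] by blast
  have b: "base C (\<psi> h) \<in> verts C" "base C (\<psi> (opp D g)) \<in> verts C" using C.base_in \<psi>_in g(2) o by auto
  have "base D h = base D (opp D g) \<longleftrightarrow> base C (\<psi> h) = base C (opp C (\<psi> g))"
    unfolding iso_facts(5)[OF g(2)] iso_facts(5)[OF o] iso_facts(6)[OF g(1), symmetric]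
    by (rule inj_on_eq_iff[OF iso_facts(2) b])
  moreover have "opp D g \<noteq> g \<longleftrightarrow> opp C (\<psi> g) \<noteq> \<psi> g"
    unfolding iso_facts(6)[OF g(1), symmetric] using inj[OF o g(1)] by blast
  moreover have "h \<noteq> opp D g \<longleftrightarrow> \<psi> h \<noteq> opp C (\<psi> g)"
    unfolding iso_facts(6)[OF g(1), symmetric] using inj[OF g(2) o] by blast
  ultimately show ?thesis
    unfolding C.ahead_def D.ahead_def using g \<psi>_in[OF g(1)] \<psi>_in[OF g(2)] by (simp add: C.bounded_iff D.bounded_iff)
qed

lemma iso_behind:
  assumes g: "g \<in> flags D"
  shows "D.behind_labels g = C.behind_labels (\<psi> g)"
proof -
  have 1: "(\<psi> g, \<psi> e) \<in> C.ahead\<^sup>*" if "(g, e) \<in> D.ahead\<^sup>*" for e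
    using that
  proof (induction rule: rtrancl_induct)
    case (step x y)
    have "x \<in> flags D" "y \<in> flags D" using D.ahead_flags step(2) by auto
    then have "(\<psi> x, \<psi> y) \<in> C.ahead" using iso_ahead step(2) by blast
    then show ?case using step(3) by (rule rtrancl_into_rtrancl[rotated])
  qed simp
  have 2: "\<exists>e'\<in>flags D. e = \<psi> e' \<and> (g, e') \<in> D.ahead\<^sup>*" if "(\<psi> g, e) \<in> C.ahead\<^sup>*" for e
    using that
  proof (induction rule: rtrancl_induct)
    case base
    then show ?case using g by blast
  next
    case (step x y)
    then obtain x' where x': "x' \<in> flags D" "x = \<psi> x'" "(g, x') \<in> D.ahead\<^sup>*" by blast
    have "y \<in> flags C" using C.ahead_flags step(2) by blast
    then obtain y' where y': "y' \<in> flags D" "y = \<psi> y'" using iso_facts(4) by blast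
    have "(x', y') \<in> D.ahead" using iso_ahead[OF x'(1) y'(1)] step(2) x'(2) y'(2) by simp
    then have "(g, y') \<in> D.ahead\<^sup>*" using x'(3) by (rule rtrancl_into_rtrancl[rotated])
    then show ?case using y' by blast
  qed
  have "(g, D.end_flag l) \<in> D.ahead\<^sup>* \<longleftrightarrow> (\<psi> g, C.end_flag l) \<in> C.ahead\<^sup>*" if l: "l \<in> C.labels" for l
  proof
    show "(g, D.end_flag l) \<in> D.ahead\<^sup>* \<Longrightarrow> (\<psi> g, C.end_flag l) \<in> C.ahead\<^sup>*" using 1 iso_end[OF l] by simp
    assume "(\<psi> g, C.end_flag l) \<in> C.ahead\<^sup>*"
    then obtain e where e: "e \<in> flags D" "\<psi> (D.end_flag l) = \<psi> e" "(g, e) \<in> D.ahead\<^sup>*" using 2 iso_end[OF l] by metis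
    have "D.end_flag l \<in> flags D" using D.end_flag_end[OF l] by (simp add: D.ends_iff)
    then have "D.end_flag l = e" using inj_onD[OF iso_facts(3) e(2)] e(1) by blast
    then show "(g, D.end_flag l) \<in> D.ahead\<^sup>*" using e(3) by simp
  qed
  then show ?thesis unfolding C.behind_labels_def D.behind_labels_def by blast
qed

lemma iso_block_vertex:
  assumes V: "V \<in> verts C"
  shows "D.block_vertex (\<phi> V) = C.block_vertex V"
proof -
  have "\<psi> ` flags_at D (\<phi> V) = flags_at C V"
  proof (intro set_eqI iffI)
    fix f assume "f \<in> \<psi> ` flags_at D (\<phi> V)"
    then obtain g where g: "g \<in> flags D" "base D g = \<phi> V" "f = \<psi> g" by (auto simp: D.flags_at_iff)
    then have "base C (\<psi> g) = V" using iso_facts(5)[OF g(1)] inj_onD[OF iso_facts(2), of "base C (\<psi> g)" V] C.base_in \<psi>_in V by auto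
    then show "f \<in> flags_at C V" using g \<psi>_in by (simp add: C.flags_at_iff)
  next
    fix f assume f: "f \<in> flags_at C V"
    then obtain g where g: "g \<in> flags D" "f = \<psi> g" using iso_facts(4) by (auto simp: C.flags_at_iff)
    then show "f \<in> \<psi> ` flags_at D (\<phi> V)" using iso_facts(5)[OF g(1)] f by (auto simp: C.flags_at_iff D.flags_at_iff)
  qed
  then have "C.block_vertex V = C.behind_labels ` \<psi> ` flags_at D (\<phi> V)" by (simp add: C.block_vertex_def)
  also have "\<dots> = D.behind_labels ` flags_at D (\<phi> V)"
    unfolding image_image by (rule image_cong[OF refl]) (simp add: iso_behind D.flags_at_iff)
  finally show ?thesis by (simp add: D.block_vertex_def)
qed

lemma iso_curve_type: "D.curve_type = C.curve_type"
  unfolding C.curve_type_def D.curve_type_def iso_facts(1)[symmetric] image_image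
  by (rule image_cong[OF refl]) (rule iso_block_vertex)

lemma iso_coherent:
  assumes C.coherent shows D.coherent
  unfolding D.coherent_def
proof
  fix g assume g: "g \<in> unmarked_flags r s D"
  then have gf: "g \<in> flags D" by (simp add: unmarked_flags_def)
  have "\<psi> g \<in> unmarked_flags r s C"
    using C.unmarked_iff[OF \<psi>_in[OF gf]] D.unmarked_iff[OF gf] g iso_behind[OF gf] by simp
  then show "outw D g \<longleftrightarrow> C.charge (D.behind_labels g) = 1"
    using assms iso_facts(7)[OF g] iso_behind[OF gf] unfolding C.coherent_def by simp
qed

lemma iso_broccoli:
  assumes "C \<in> broccoli_curves r s n v F" shows "D \<in> broccoli_curves r s n v F"
proof -
  interpret B: broccoli_curve r s n v F C by unfold_locales (rule assms)
  have "vertex_profile r s D (\<phi> V) = vertex_profile r s C V" if "V \<in> verts C" for V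
    using C.vertex_profile_eq[OF B.coherent_curve] D.vertex_profile_eq[OF iso_coherent[OF B.coherent_curve]]
      iso_block_vertex[OF that] by simp
  note prof = this
  have "vertex1 r s D W \<or> vertex2 r s D W \<or> vertex3 r s D W \<or> vertex4 r s D W \<or> vertex5 r s D W \<or> vertex6 r s D W"
    if W: "W \<in> verts D" for W
  proof -
    obtain V where V: "V \<in> verts C" "W = \<phi> V" using W iso_facts(1) by blast
    show ?thesis using B.kinds[OF V(1)]
      unfolding vertex1_def vertex2_def vertex3_def vertex4_def vertex5_def vertex6_def V(2) prof[OF V(1)] .
  qed
  then show ?thesis using D.oc by (simp add: broccoli_curves_def)
qed

lemma iso_evaluation:
  assumes "\<forall>V\<in>verts C. pos D (\<phi> V) = pos C V"
  shows "evaluation r s v F D = evaluation r s v F C"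
proof -
  have b: "pos D (base D g) = pos C (base C (\<psi> g))" if "g \<in> flags D" for g
    using assms iso_facts(5)[OF that] C.base_in[OF \<psi>_in[OF that]] by simp
  have "pos D (base D (xend D i)) = pos C (base C (xend C i))" if "i \<in> {1..r + s}" for i
    using b[OF D.xend_flag[OF that]] iso_facts(8)[OF that] by simp
  moreover have "pos D (base D (yend D j)) = pos C (base C (yend C j))" if "j \<in> F" for j
    using b[OF D.yend_flag(1)] iso_facts(9) that C.F_sub by auto
  ultimately show ?thesis unfolding evaluation_def by (auto intro!: sum.cong)
qed

end

text \<open>Vertices and flags are matched by their partitions and blocks, which determine
  everything except positions and lengths. The directions have to be non-zero for the positions to
  determine the lengths.\<close>

lemma isomorphicI:
  assumes T: "D.curve_type = C.curve_type" and coh: C.coherent D.coherent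
    and pos: "\<And>W. W \<in> C.curve_type \<Longrightarrow> D.curve_pos W = C.curve_pos W"
    and nz: "\<And>f. f \<in> inner_flags C.curve_type \<Longrightarrow> C.rdir f \<noteq> 0"
  shows "isomorphic r s n C D"
proof -
  define \<phi> where "\<phi> V = inv_into (verts D) D.block_vertex (C.block_vertex V)" for V
  define \<psi> where "\<psi> g = inv_into (flags C) C.behind_labels (D.behind_labels g)" for g
  have UC: "C.behind_labels ` flags C = \<Union>C.curve_type"
    by (rule C.Union_curve_type[symmetric])
  have UD: "D.behind_labels ` flags D = \<Union>C.curve_type"
    unfolding T[symmetric] by (rule D.Union_curve_type[symmetric])
  have \<psi>: "\<psi> g \<in> flags C" "C.behind_labels (\<psi> g) = D.behind_labels g" if "g \<in> flags D" for g
  proof -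
    have "D.behind_labels g \<in> C.behind_labels ` flags C" unfolding UC UD[symmetric] using that by (rule imageI)
    then show "\<psi> g \<in> flags C" "C.behind_labels (\<psi> g) = D.behind_labels g"
      unfolding \<psi>_def by (rule inv_into_into, rule f_inv_into_f)
  qed
  have \<psi>_eq: "\<psi> g = f" if "g \<in> flags D" "f \<in> flags C" "C.behind_labels f = D.behind_labels g" for f g
    using C.behind_inj[OF \<psi>(1)[OF that(1)] that(2)] \<psi>(2)[OF that(1)] that(3) by simp
  have \<phi>: "\<phi> V \<in> verts D" "D.block_vertex (\<phi> V) = C.block_vertex V" if "V \<in> verts C" for V
  proof -
    have "C.block_vertex V \<in> D.block_vertex ` verts D"
      using that T unfolding C.curve_type_def D.curve_type_def by blast
    then show "\<phi> V \<in> verts D" "D.block_vertex (\<phi> V) = C.block_vertex V"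
      unfolding \<phi>_def by (rule inv_into_into, rule f_inv_into_f)
  qed
  have \<phi>_eq: "\<phi> V = W" if "V \<in> verts C" "W \<in> verts D" "D.block_vertex W = C.block_vertex V" for V W
    using inj_onD[OF D.inj_block_vertex _ \<phi>(1)[OF that(1)] that(2)] \<phi>(2)[OF that(1)] that(3) by simp
  have base: "base D g = \<phi> (base C (\<psi> g))" if g: "g \<in> flags D" for g
  proof -
    have "D.block_vertex (base D g) = C.block_vertex (base C (\<psi> g))"
      using C.vertex_of_behind[OF \<psi>(1)[OF g]] D.vertex_of_behind[OF g] \<psi>(2)[OF g] T by simp
    then show ?thesis using \<phi>_eq[OF C.base_in[OF \<psi>(1)[OF g]] D.base_in[OF g]] by simp
  qed
  have bnd: "\<psi> g \<in> bounded_flags C \<longleftrightarrow> g \<in> bounded_flags D" if "g \<in> flags D" for g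
    using C.card_behind[OF \<psi>(1)[OF that]] D.card_behind[OF that] \<psi>(2)[OF that] by simp
  have opp: "\<psi> (opp D g) = opp C (\<psi> g)" if g: "g \<in> flags D" for g
  proof (cases "g \<in> bounded_flags D")
    case True
    then have "C.behind_labels (opp C (\<psi> g)) = D.behind_labels (opp D g)"
      using C.behind_opp bnd[OF g] D.behind_opp \<psi>(2)[OF g] by simp
    then show ?thesis using \<psi>_eq D.opp_in C.opp_in \<psi>(1) g by blast
  next
    case False
    then show ?thesis using bnd[OF g] g \<psi>(1)[OF g] by (simp add: C.bounded_iff D.bounded_iff)
  qed
  have surj: "\<psi> ` flags D = flags C"
  proof
    show "\<psi> ` flags D \<subseteq> flags C" using \<psi>(1) by blast
    show "flags C \<subseteq> \<psi> ` flags D"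
    proof
      fix f assume f: "f \<in> flags C"
      then have "C.behind_labels f \<in> D.behind_labels ` flags D" unfolding UD UC[symmetric] by (rule imageI)
      then obtain g where g: "g \<in> flags D" "C.behind_labels f = D.behind_labels g" by blast
      then have "\<psi> g = f" using \<psi>_eq f by blast
      then show "f \<in> \<psi> ` flags D" using g(1) by blast
    qed
  qed
  have ti: "type_iso r s n \<phi> \<psi> C D"
    unfolding type_iso_def type_contraction_def
  proof (intro conjI ballI)
    show "inj_on \<phi> (verts C)"
      using \<phi>(2) C.inj_block_vertex by (metis (no_types, lifting) inj_on_def)
    show "\<phi> ` verts C = verts D"
    proof
      show "\<phi> ` verts C \<subseteq> verts D" using \<phi>(1) by blast
      show "verts D \<subseteq> \<phi> ` verts C"
      proof
        fix W assume W: "W \<in> verts D"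
        then have "D.block_vertex W \<in> C.block_vertex ` verts C" using T unfolding C.curve_type_def D.curve_type_def by blast
        then obtain V where V: "V \<in> verts C" "D.block_vertex W = C.block_vertex V" by blast
        then have "\<phi> V = W" using \<phi>_eq W by blast
        then show "W \<in> \<phi> ` verts C" using V(1) by blast
      qed
    qed
    show "inj_on \<psi> (flags D)"
      using \<psi>(2) D.behind_inj by (metis (no_types, lifting) inj_on_def)
    show "\<psi> ` flags D \<subseteq> flags C" "\<psi> ` flags D = flags C" using surj by simp_all
  next
    fix g assume g: "g \<in> flags D"
    show "base D g = \<phi> (base C (\<psi> g))" "\<psi> (opp D g) = opp C (\<psi> g)" using base[OF g] opp[OF g] .
    show "dir D g = dir C (\<psi> g)" using C.dir_behind[OF \<psi>(1)[OF g]] D.dir_behind[OF g] \<psi>(2)[OF g] by simp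
  next
    fix g assume g: "g \<in> unmarked_flags r s D"
    then have gf: "g \<in> flags D" by (simp add: unmarked_flags_def)
    then have "\<psi> g \<in> unmarked_flags r s C"
      using C.unmarked_iff[OF \<psi>(1)[OF gf]] D.unmarked_iff[OF gf] g \<psi>(2)[OF gf] by simp
    then show "outw D g \<longleftrightarrow> outw C (\<psi> g)"
      using coh g \<psi>(2)[OF gf] unfolding C.coherent_def D.coherent_def by simp
  next
    fix i assume i: "i \<in> {1..r + s}"
    show "xend C i = \<psi> (xend D i)"
      using \<psi>_eq[OF D.xend_flag[OF i] C.xend_flag[OF i]] C.marking_flag[OF i] D.marking_flag[OF i] by simp
  next
    fix j assume j: "j \<in> {1..n}"
    show "yend C j = \<psi> (yend D j)"
      using \<psi>_eq[OF D.yend_flag(1)[OF j] C.yend_flag(1)[OF j]] C.yend_flag(2)[OF j] D.yend_flag(2)[OF j] by simp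
  next
    fix f assume "f \<in> flags C - \<psi> ` flags D"
    then show "f \<in> bounded_flags C" "\<phi> (base C (opp C f)) = \<phi> (base C f)" using surj by auto
  qed
  moreover have "pos D (\<phi> V) = pos C V" if V: "V \<in> verts C" for V
    using pos[of "C.block_vertex V"] C.curve_pos_eq[OF V] D.curve_pos_eq[OF \<phi>(1)[OF V]] \<phi>(2)[OF V] V
    by (simp add: C.curve_type_def)
  moreover have "len D g = len C (\<psi> g)" if g: "g \<in> bounded_flags D" for g
  proof -
    have gf: "g \<in> flags D" using g by (simp add: D.bounded_iff)
    have gb: "\<psi> g \<in> bounded_flags C" using bnd[OF gf] g by simp
    define b where "b = D.behind_labels g"
    have b: "b \<in> inner_flags C.curve_type" unfolding C.inner_curve_type b_def using gb \<psi>(2)[OF gf] by metis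
    interpret ptree C.labels C.curve_type using C.tree_curve_type C.fin_labels by unfold_locales
    have "vertex_of C.curve_type b \<in> C.curve_type" "vertex_of C.curve_type (C.labels - b) \<in> C.curve_type"
      using inner_flagsD[OF b] by auto
    then have "len D g *\<^sub>R C.rdir b = len C (\<psi> g) *\<^sub>R C.rdir b"
      using C.curve_edge_vector[OF gb] D.curve_edge_vector[OF g] pos unfolding b_def \<psi>(2)[OF gf] T by auto
    then show ?thesis using nz[OF b] by simp
  qed
  ultimately show ?thesis unfolding isomorphic_def using ti by blast
qed

end

section \<open>Realization of types\<close>

context broccoli_data
begin

text \<open>Vertices and flags of a curve are natural numbers, so blocks and partitions are coded as
  such.\<close>

definition vertex_code :: "nat set set \<Rightarrow> nat" where "vertex_code V = set_encode (set_encode ` V)"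

definition vertex_decode :: "nat \<Rightarrow> nat set set" where "vertex_decode k = set_decode ` set_decode k"

definition realize :: "nat set set set \<Rightarrow> (nat set set \<Rightarrow> real \<times> real) \<Rightarrow> (nat set \<Rightarrow> real) \<Rightarrow> oriented_curve" where
  "realize T q l = \<lparr>
     verts = vertex_code ` T, flags = set_encode ` \<Union>T,
     base = (\<lambda>k. vertex_code (vertex_of T (set_decode k))),
     opp = (\<lambda>k. if set_decode k \<in> inner_flags T then set_encode (labels - set_decode k) else k),
     len = (\<lambda>k. l (set_decode k)), pos = (\<lambda>k. q (vertex_decode k)),
     dir = (\<lambda>k. bdir (set_decode k)), xend = (\<lambda>i. set_encode {i}), yend = (\<lambda>j. set_encode {r + s + j}),
     outw = (\<lambda>k. charge (set_decode k) = 1)\<rparr>"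

end

text \<open>The vertices need not be broccoli vertices, since the curves in the closure are realized
  in the same way. Charges 0 and 1 on the bounded edges are what a consistent orientation
  requires.\<close>

locale realizable = broccoli_data +
  fixes T and q :: "nat set set \<Rightarrow> real \<times> real" and l :: "nat set \<Rightarrow> real"
  assumes tree_T: "partition_tree labels T"
    and charges: "f \<in> inner_flags T \<Longrightarrow> charge f = 0 \<or> charge f = 1"
    and edge: "f \<in> inner_flags T \<Longrightarrow> q (vertex_of T (labels - f)) = q (vertex_of T f) + l f *\<^sub>R rdir f"
    and l_pos: "f \<in> inner_flags T \<Longrightarrow> 0 < l f" and l_compl: "f \<in> inner_flags T \<Longrightarrow> l (labels - f) = l f"

sublocale realizable \<subseteq> ptree labels T
  using tree_T fin_labels by unfold_locales

context realizable
begin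

abbreviation "K \<equiv> realize T q l"

lemma label_ex: "\<exists>\<rho>. \<rho> \<in> labels"
proof -
  obtain V where V: "V \<in> T" using T_nonempty by blast
  obtain h where h: "h \<in> V" using third_block[OF V, of "{}" "{}"] by blast
  then show ?thesis using block_nonempty[OF V h] block_sub[OF V h] by blast
qed

lemma decode: "b \<in> \<Union>T \<Longrightarrow> set_decode (set_encode b) = b"
  using fin_block set_encode_inverse by blast

lemma encode_eq: "a \<in> \<Union>T \<Longrightarrow> b \<in> \<Union>T \<Longrightarrow> set_encode a = set_encode b \<longleftrightarrow> a = b"
  using decode by metis

lemma vertex_decode: "V \<in> T \<Longrightarrow> vertex_decode (vertex_code V) = V"
proof -
  assume V: "V \<in> T"
  have "set_decode ` set_encode ` V = (\<lambda>b. b) ` V"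
    unfolding image_image by (rule image_cong[OF refl]) (use decode V in blast)
  then have "set_decode ` set_encode ` V = V" by simp
  then show ?thesis using fin_vertex[OF V] by (simp add: vertex_decode_def vertex_code_def set_encode_inverse)
qed

lemma vertex_code_eq: "V \<in> T \<Longrightarrow> W \<in> T \<Longrightarrow> vertex_code V = vertex_code W \<longleftrightarrow> V = W"
  using vertex_decode by metis

lemma K_simps:
  "verts K = vertex_code ` T" "flags K = set_encode ` \<Union>T" "xend K i = set_encode {i}" "yend K j = set_encode {r + s + j}"
  "b \<in> \<Union>T \<Longrightarrow> base K (set_encode b) = vertex_code (vertex_of T b)"
  "b \<in> \<Union>T \<Longrightarrow> dir K (set_encode b) = bdir b" "b \<in> \<Union>T \<Longrightarrow> outw K (set_encode b) \<longleftrightarrow> charge b = 1"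
  "b \<in> \<Union>T \<Longrightarrow> len K (set_encode b) = l b" "V \<in> T \<Longrightarrow> pos K (vertex_code V) = q V"
  "b \<in> inner_flags T \<Longrightarrow> opp K (set_encode b) = set_encode (labels - b)"
  "b \<in> \<Union>T \<Longrightarrow> b \<notin> inner_flags T \<Longrightarrow> opp K (set_encode b) = set_encode b"
  using decode vertex_decode by (auto simp: realize_def inner_flags_def)

lemma inner_in: "b \<in> inner_flags T \<Longrightarrow> b \<in> \<Union>T" by (simp add: inner_flags_def)

lemma inner_compl_ne: "b \<in> inner_flags T \<Longrightarrow> set_encode (labels - b) \<noteq> set_encode b"
  using inner_flagsD(6,8) encode_eq inner_in by metis

lemma K_bounded: "bounded_flags K = set_encode ` inner_flags T"
proof (intro set_eqI iffI)
  fix f assume "f \<in> bounded_flags K"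
  then obtain b where b: "b \<in> \<Union>T" "f = set_encode b" "opp K f \<noteq> f" unfolding bounded_flags_def K_simps(2) by blast
  then have "b \<in> inner_flags T" using K_simps(11) by blast
  then show "f \<in> set_encode ` inner_flags T" using b by blast
next
  fix f assume "f \<in> set_encode ` inner_flags T"
  then obtain b where b: "b \<in> inner_flags T" "f = set_encode b" by blast
  then show "f \<in> bounded_flags K"
    unfolding bounded_flags_def K_simps(2) using K_simps(10) inner_compl_ne inner_in by auto
qed

lemma outer_block: "b \<in> \<Union>T \<Longrightarrow> b \<notin> inner_flags T \<Longrightarrow> \<exists>i\<in>labels. b = {i}"
proof -
  assume b: "b \<in> \<Union>T" "b \<notin> inner_flags T"
  then obtain V where V: "V \<in> T" "b \<in> V" by blast
  have "card b = 1" using card_block[OF V] b by (simp add: inner_flags_def)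
  then obtain i where "b = {i}" by (rule card_1_singletonE)
  then show ?thesis using block_sub[OF V] by blast
qed

lemma K_ends: "ends K = (\<lambda>i. set_encode {i}) ` labels"
proof (intro set_eqI iffI)
  fix f assume "f \<in> ends K"
  then obtain b where b: "b \<in> \<Union>T" "f = set_encode b" "opp K f = f" unfolding ends_def K_simps(2) by blast
  then have "b \<notin> inner_flags T" using K_simps(10) inner_compl_ne by metis
  then obtain i where "i \<in> labels" "b = {i}" using outer_block[OF b(1)] by blast
  then show "f \<in> (\<lambda>i. set_encode {i}) ` labels" using b(2) by blast
next
  fix f assume "f \<in> (\<lambda>i. set_encode {i}) ` labels"
  then obtain i where i: "i \<in> labels" "f = set_encode {i}" by blast
  have "{i} \<in> \<Union>T" "{i} \<notin> inner_flags T" using singleton_in[OF i(1)] by (simp_all add: inner_flags_def)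
  then have "opp K f = f" unfolding i(2) by (rule K_simps(11))
  moreover have "f \<in> set_encode ` \<Union>T" unfolding i(2) using singleton_in[OF i(1)] by (rule imageI)
  ultimately show "f \<in> ends K" unfolding ends_def K_simps(2) by blast
qed

lemma K_flags_at: "V \<in> T \<Longrightarrow> flags_at K (vertex_code V) = set_encode ` V"
proof (intro set_eqI iffI)
  fix f assume V: "V \<in> T" and "f \<in> flags_at K (vertex_code V)"
  then obtain b where b: "b \<in> \<Union>T" "f = set_encode b" "base K f = vertex_code V" unfolding flags_at_def K_simps(2) by blast
  then have "vertex_of T b = V" using K_simps(5)[OF b(1)] vertex_code_eq[OF vertex_of_in(1)[OF b(1)] V] by simp
  then have "b \<in> V" using vertex_of_in(2)[OF b(1)] by simp
  then show "f \<in> set_encode ` V" using b(2) by blast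
next
  fix f assume V: "V \<in> T" and "f \<in> set_encode ` V"
  then obtain b where b: "b \<in> V" "f = set_encode b" by blast
  then have "b \<in> \<Union>T" "vertex_of T b = V" using V vertex_of_eq by blast+
  then show "f \<in> flags_at K (vertex_code V)" unfolding flags_at_def K_simps(2) using b(2) K_simps(5) by auto
qed

lemma inj_encode: "inj_on set_encode (\<Union>T)" using encode_eq by (simp add: inj_on_def)

lemma inj_vertex_code: "inj_on vertex_code T" using vertex_code_eq by (simp add: inj_on_def)

lemma K_connected: "connected_curve K"
  unfolding connected_curve_def
proof (intro ballI)
  let ?E = "{(base K f, base K (opp K f)) | f. f \<in> flags K}"
  fix x y assume "x \<in> verts K" "y \<in> verts K"
  then obtain V W where VW: "V \<in> T" "W \<in> T" "x = vertex_code V" "y = vertex_code W" unfolding K_simps(1) by blast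
  obtain \<rho> where \<rho>: "\<rho> \<in> labels" using label_ex by blast
  define R where "R = {(A, B). A \<in> T \<and> B \<in> T \<and> (\<exists>f\<in>A. labels - f \<in> B)}"
  have stepE: "(vertex_code A, vertex_code B) \<in> ?E" if AB: "(A, B) \<in> R" for A B
  proof -
    obtain f where f: "A \<in> T" "B \<in> T" "f \<in> A" "labels - f \<in> B" using AB by (auto simp: R_def)
    then have fi: "f \<in> inner_flags T" unfolding inner_flags_compl by blast
    have "vertex_of T f = A" "vertex_of T (labels - f) = B" using vertex_of_eq f by blast+
    moreover have "f \<in> \<Union>T" "labels - f \<in> \<Union>T" using f by blast+
    ultimately have "base K (set_encode f) = vertex_code A" "base K (opp K (set_encode f)) = vertex_code B" "set_encode f \<in> flags K"
      using K_simps(5) K_simps(10)[OF fi] unfolding K_simps(2) by auto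
    then show ?thesis by (intro CollectI exI[of _ "set_encode f"]) simp
  qed
  have symR: "(B, A) \<in> R" if AB: "(A, B) \<in> R" for A B
  proof -
    obtain f where f: "A \<in> T" "B \<in> T" "f \<in> A" "labels - f \<in> B" using AB by (auto simp: R_def)
    then have "labels - (labels - f) = f" using block_sub by blast
    then have "labels - (labels - f) \<in> A" using f(3) by simp
    then show ?thesis unfolding R_def using f(1,2,4) by blast
  qed
  have lift: "(vertex_code A, vertex_code B) \<in> ?E\<^sup>*" if "(A, B) \<in> R\<^sup>*" for A B
    using that
  proof (induction rule: rtrancl_induct)
    case (step B C)
    then show ?case using stepE[OF step(2)] by (meson rtrancl.rtrancl_into_rtrancl)
  qed simp
  have "R\<inverse> = R" using symR by auto
  then have symR': "(B, A) \<in> R\<^sup>*" if "(A, B) \<in> R\<^sup>*" for A B using that by (metis converseD converseI rtrancl_converse)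
  obtain X where X: "X \<in> T" "{\<rho>} \<in> X" "(V, X) \<in> R\<^sup>*" using walk_to_label[OF VW(1) \<rho>] unfolding R_def by blast
  obtain Y where Y: "Y \<in> T" "{\<rho>} \<in> Y" "(W, Y) \<in> R\<^sup>*" using walk_to_label[OF VW(2) \<rho>] unfolding R_def by blast
  have "X = Y" using uniq[OF X(1) Y(1) X(2) Y(2)] .
  then have "(V, W) \<in> R\<^sup>*" using X(3) symR'[OF Y(3)] by (simp add: rtrancl_trans)
  then show "(x, y) \<in> ?E\<^sup>*" using lift VW(3,4) by simp
qed

lemma K_genus: "genus K = 0"
proof -
  obtain \<rho> where \<rho>: "\<rho> \<in> labels" using label_ex by blast
  have "bounded_edges K = (\<lambda>b. {set_encode b, set_encode (labels - b)}) ` inner_flags T"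
    unfolding bounded_edges_def K_bounded image_image by (rule image_cong[OF refl]) (simp add: K_simps(10))
  also have "\<dots> = (\<lambda>b. {set_encode b, set_encode (labels - b)}) ` away_flags T \<rho>" (is "?g ` _ = _")
  proof
    show "?g ` inner_flags T \<subseteq> ?g ` away_flags T \<rho>"
    proof
      fix e assume "e \<in> ?g ` inner_flags T"
      then obtain b where b: "b \<in> inner_flags T" "e = ?g b" by blast
      have "?g (labels - b) = ?g b" unfolding inner_flagsD(7)[OF b(1)] by (rule insert_commute)
      then have "e = ?g (labels - b)" using b(2) by simp
      then show "e \<in> ?g ` away_flags T \<rho>"
        using inner_flags_away[OF \<rho> b(1)] b(2) by (elim disjE) (auto intro: image_eqI)
    qed
  qed (auto simp: away_flags_def)
  finally have be: "bounded_edges K = ?g ` away_flags T \<rho>" .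
  have "inj_on ?g (away_flags T \<rho>)"
  proof (rule inj_onI)
    fix a b assume ab: "a \<in> away_flags T \<rho>" "b \<in> away_flags T \<rho>" "?g a = ?g b"
    then have i: "a \<in> inner_flags T" "b \<in> inner_flags T" "\<rho> \<notin> a" "\<rho> \<notin> b" by (auto simp: away_flags_def)
    have "set_encode a \<in> ?g b" using ab(3) by blast
    then have "a = b \<or> a = labels - b"
      using encode_eq[of a b] encode_eq[of a "labels - b"] inner_in i(1,2) inner_flagsD(6)[OF i(2)] by auto
    then show "a = b" using i(3,4) \<rho> by blast
  qed
  then have "card (bounded_edges K) = card (away_flags T \<rho>)" unfolding be by (rule card_image)
  moreover have "card (verts K) = card T" unfolding K_simps(1) using inj_vertex_code by (rule card_image)
  ultimately show ?thesis using card_away_flags[OF \<rho>] by (simp add: genus_def)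
qed

lemma label_ge: "l' \<in> labels \<Longrightarrow> label_dir l' = 0 \<longleftrightarrow> l' \<in> {1..r + s}"
proof -
  assume "l' \<in> labels"
  then show ?thesis by (cases rule: label_cases) (use v_nonzero in \<open>auto simp: label_dir_def\<close>)
qed

lemma K_marked: "is_marked_curve r s n v K"
  unfolding is_marked_curve_def
proof (intro conjI)
  show "finite (verts K)" "finite (flags K)" unfolding K_simps(1,2) using fin_T fin_Union by auto
  show "connected_curve K" "genus K = 0" by (rule K_connected, rule K_genus)
  show "\<forall>f\<in>flags K. base K f \<in> verts K \<and> opp K f \<in> flags K \<and> opp K (opp K f) = f"
  proof
    fix f assume "f \<in> flags K"
    then obtain b where b: "b \<in> \<Union>T" "f = set_encode b" unfolding K_simps(2) by blast
    have 1: "base K f \<in> verts K" unfolding K_simps(1) b(2) K_simps(5)[OF b(1)] using vertex_of_in(1)[OF b(1)] by blast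
    show "base K f \<in> verts K \<and> opp K f \<in> flags K \<and> opp K (opp K f) = f"
    proof (cases "b \<in> inner_flags T")
      case True
      note d = inner_flagsD(6,7)[OF True]
      have "opp K f = set_encode (labels - b)" "opp K (set_encode (labels - b)) = set_encode b"
        using K_simps(10)[OF True] K_simps(10)[OF d(1)] d(2) b(2) by simp_all
      moreover have "set_encode (labels - b) \<in> flags K" unfolding K_simps(2) using inner_in[OF d(1)] by blast
      ultimately show ?thesis using 1 b(2) by simp
    next
      case False
      then show ?thesis using 1 K_simps(11)[OF b(1)] b \<open>f \<in> flags K\<close> by simp
    qed
  qed
  show "\<forall>V\<in>verts K. 3 \<le> card (flags_at K V)"
  proof
    fix x assume "x \<in> verts K"
    then obtain V where V: "V \<in> T" "x = vertex_code V" unfolding K_simps(1) by blast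
    have "inj_on set_encode V" using inj_on_subset[OF inj_encode] V(1) by blast
    then show "3 \<le> card (flags_at K x)" unfolding V(2) K_flags_at[OF V(1)] using card3[OF V(1)] by (simp add: card_image)
  qed
  show "\<forall>V\<in>verts K. (\<Sum>f\<in>flags_at K V. dir K f) = 0"
  proof
    fix x assume "x \<in> verts K"
    then obtain V where V: "V \<in> T" "x = vertex_code V" unfolding K_simps(1) by blast
    have "inj_on set_encode V" using inj_on_subset[OF inj_encode] V(1) by blast
    then have "(\<Sum>f\<in>flags_at K x. dir K f) = (\<Sum>b\<in>V. dir K (set_encode b))" unfolding V(2) K_flags_at[OF V(1)] by (simp add: sum.reindex)
    also have "\<dots> = (\<Sum>b\<in>V. bdir b)" by (rule sum.cong[OF refl]) (use V(1) K_simps(6) in blast)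
    finally show "(\<Sum>f\<in>flags_at K x. dir K f) = 0" using partition_sums(1)[OF part[OF V(1)]] by simp
  qed
  show "\<forall>f\<in>bounded_flags K. 0 < len K f \<and> len K (opp K f) = len K f \<and> dir K (opp K f) = - dir K f \<and>
        pos K (base K (opp K f)) = pos K (base K f) + len K f *\<^sub>R real_vec (dir K f)"
  proof
    fix f assume "f \<in> bounded_flags K"
    then obtain b where b: "b \<in> inner_flags T" "f = set_encode b" unfolding K_bounded by blast
    note d = inner_flagsD[OF b(1)]
    have m: "b \<in> \<Union>T" "labels - b \<in> \<Union>T" using inner_in b(1) d(6) by auto
    show "0 < len K f \<and> len K (opp K f) = len K f \<and> dir K (opp K f) = - dir K f \<and>
        pos K (base K (opp K f)) = pos K (base K f) + len K f *\<^sub>R real_vec (dir K f)"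
      unfolding b(2) K_simps(10)[OF b(1)] K_simps(5,6,8)[OF m(1)] K_simps(5,6,8)[OF m(2)] K_simps(9)[OF d(1)] K_simps(9)[OF d(3)]
      using l_pos[OF b(1)] l_compl[OF b(1)] bdir_compl[OF d(5)] edge[OF b(1)] by simp
  qed
  have dir_end: "dir K (set_encode {i}) = label_dir i" if "i \<in> labels" for i
    using K_simps(6)[OF singleton_in[OF that]] by (simp add: bdir_def)
  have inj1: "inj_on (\<lambda>i. set_encode {i}) A" for A :: "nat set"
    by (rule inj_onI) (metis finite.emptyI finite.insertI set_encode_inverse singleton_inject)
  show "bij_betw (xend K) {1..r + s} {f \<in> ends K. dir K f = 0}"
  proof (rule bij_betw_imageI)
    show "inj_on (xend K) {1..r + s}" unfolding K_simps(3) by (rule inj1)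
    have "{f \<in> ends K. dir K f = 0} = (\<lambda>i. set_encode {i}) ` {i \<in> labels. label_dir i = 0}"
      unfolding K_ends using dir_end by auto
    also have "{i \<in> labels. label_dir i = 0} = {1..r + s}" using label_ge by (auto simp: labels_def)
    finally show "xend K ` {1..r + s} = {f \<in> ends K. dir K f = 0}" unfolding K_simps(3) by simp
  qed
  show "bij_betw (yend K) {1..n} {f \<in> ends K. dir K f \<noteq> 0}"
  proof (rule bij_betw_imageI)
    show "inj_on (yend K) {1..n}" unfolding K_simps(4) using inj1[of UNIV] by (auto simp: inj_on_def)
    have "{f \<in> ends K. dir K f \<noteq> 0} = (\<lambda>i. set_encode {i}) ` {i \<in> labels. label_dir i \<noteq> 0}"
      unfolding K_ends using dir_end by auto
    also have "{i \<in> labels. label_dir i \<noteq> 0} = (\<lambda>j. r + s + j) ` {1..n}" using label_ge unfolding labels_split by auto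
    also have "(\<lambda>i. set_encode {i}) ` (\<lambda>j. r + s + j) ` {1..n} = yend K ` {1..n}"
      unfolding image_image by (rule image_cong[OF refl]) (rule K_simps(4)[symmetric])
    finally show "yend K ` {1..n} = {f \<in> ends K. dir K f \<noteq> 0}" ..
  qed
  show "\<forall>j\<in>{1..n}. dir K (yend K j) = v j"
  proof
    fix j assume j: "j \<in> {1..n}"
    then show "dir K (yend K j) = v j" unfolding K_simps(4) using dir_end[of "r + s + j"] by (simp add: labels_def label_dir_def)
  qed
qed

lemma K_oriented: "K \<in> oriented_curves r s n v F"
  unfolding oriented_curves_def inward_ends_def
proof (intro CollectI conjI ballI)
  show "is_marked_curve r s n v K" by (rule K_marked)
  fix f assume "f \<in> bounded_flags K"
  then obtain b where b: "b \<in> inner_flags T" "f = set_encode b" unfolding K_bounded by blast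
  note d = inner_flagsD[OF b(1)]
  have m: "b \<in> \<Union>T" "labels - b \<in> \<Union>T" using inner_in b(1) d(6) by auto
  show "outw K (opp K f) = (\<not> outw K f)"
    unfolding b(2) K_simps(10)[OF b(1)] K_simps(7)[OF m(1)] K_simps(7)[OF m(2)]
    using charges[OF b(1)] charge_compl[OF d(5)] by auto
next
  have "outw K (yend K j) \<longleftrightarrow> j \<notin> F" if j: "j \<in> {1..n}" for j
    unfolding K_simps(4) using K_simps(7)[OF singleton_in[of "r + s + j"]] end_block(2)[OF j] j by (auto simp: labels_def)
  then show "{j \<in> {1..n}. \<not> outw K (yend K j)} = F" using F_sub by auto
qed

end

sublocale realizable \<subseteq> R: oriented_tree r s n v F K
  using K_marked K_oriented by unfold_locales

context realizable
begin

text \<open>Both the block and the set of labels behind the coded flag are the union over the flags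
  at the far vertex. So passing from a type to a curve and back is the identity.\<close>

lemma K_behind: "b \<in> \<Union>T \<Longrightarrow> R.behind_labels (set_encode b) = b"
proof (induction "card b" arbitrary: b rule: less_induct)
  case less
  show ?case
  proof (cases "b \<in> inner_flags T")
    case False
    then obtain i where i: "i \<in> labels" "b = {i}" using outer_block less.prems by blast
    have "R.end_flag i = set_encode {i}" using i(1)
    proof (cases rule: label_cases)
      case (3 j)
      then show ?thesis using R.end_flag_y[of j] K_simps(4) by simp
    qed (use R.end_flag_x[of i] K_simps(3) in auto)
    then show ?thesis using R.behind_end[OF i(1)] i(2) by simp
  next
    case True
    note d = inner_flagsD[OF True]
    have fb: "set_encode b \<in> bounded_flags K" unfolding K_bounded using True by blast
    define V where "V = vertex_of T (labels - b)"
    have V: "V \<in> T" "labels - b \<in> V" using d by (simp_all add: V_def)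
    have m: "labels - b \<in> \<Union>T" using V by blast
    have fl: "flags_at K (base K (opp K (set_encode b))) - {opp K (set_encode b)} = set_encode ` (V - {labels - b})"
    proof -
      have "set_encode ` (V - {labels - b}) = set_encode ` V - set_encode ` {labels - b}"
        by (rule inj_on_image_set_diff[OF inj_encode]) (use V in blast)+
      then show ?thesis
        unfolding K_simps(10)[OF True] K_simps(5)[OF m] V_def[symmetric] K_flags_at[OF V(1)] by simp
    qed
    have "R.behind_labels (set_encode c) = c" if "c \<in> V - {labels - b}" for c
    proof (rule less.hyps)
      have "c \<subset> b" using beyond_psub[OF V, of c] that d(5) by blast
      then show "card c < card b" using finite_subset[OF d(5) fin_labels] by (intro psubset_card_mono)
      show "c \<in> \<Union>T" using that V(1) by blast
    qed
    then have "(\<Union>g\<in>set_encode ` (V - {labels - b}). R.behind_labels g) = \<Union>(V - {labels - b})" by simp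
    also have "\<dots> = b"
    proof
      show "\<Union>(V - {labels - b}) \<subseteq> b" using beyond_psub[OF V _ _ d(5)] by blast
      show "b \<subseteq> \<Union>(V - {labels - b})" using Union_vertex[OF V(1)] d(5) by blast
    qed
    finally show ?thesis using R.behind_bounded[OF fb] unfolding fl by simp
  qed
qed

lemma K_block_vertex: "V \<in> T \<Longrightarrow> R.block_vertex (vertex_code V) = V"
proof -
  assume V: "V \<in> T"
  have "R.behind_labels ` set_encode ` V = (\<lambda>b. b) ` V"
    unfolding image_image by (rule image_cong[OF refl]) (use K_behind V in blast)
  then show ?thesis unfolding R.block_vertex_def K_flags_at[OF V] by simp
qed

lemma K_curve_type: "R.curve_type = T"
proof -
  have "R.curve_type = (\<lambda>V. V) ` T"
    unfolding R.curve_type_def K_simps(1) image_image by (rule image_cong[OF refl K_block_vertex])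
  then show ?thesis by simp
qed

lemma K_curve_pos: "V \<in> T \<Longrightarrow> R.curve_pos V = q V"
  using R.curve_pos_eq[of "vertex_code V"] K_block_vertex K_simps(1,9) by auto

lemma K_coherent: R.coherent
  unfolding R.coherent_def
proof
  fix f assume "f \<in> unmarked_flags r s K"
  then obtain b where b: "b \<in> \<Union>T" "f = set_encode b" unfolding unmarked_flags_def K_simps(2) by blast
  show "outw K f \<longleftrightarrow> charge (R.behind_labels f) = 1" unfolding b(2) K_simps(7)[OF b(1)] K_behind[OF b(1)] ..
qed

lemma K_evaluation: "evaluation r s v F K = evaluate T q"
proof -
  have "evaluate T R.curve_pos = evaluate T q"
    unfolding evaluate_def
  proof (intro arg_cong2[of _ _ _ _ Pair] sum.cong[OF refl])
    fix i assume "i \<in> {1..r + s}"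
    then have "{i} \<in> \<Union>T" by (intro singleton_in) (auto simp: labels_def)
    then show "Poly_Mapping.single i (R.curve_pos (vertex_of T {i})) = Poly_Mapping.single i (q (vertex_of T {i}))"
      using K_curve_pos[OF vertex_of_in(1)] by simp
  next
    fix j assume "j \<in> F"
    then have "{r + s + j} \<in> \<Union>T" using F_sub by (intro singleton_in) (auto simp: labels_def)
    then show "Poly_Mapping.single j (det2 (real_vec (v j)) (R.curve_pos (vertex_of T {r + s + j}))) =
        Poly_Mapping.single j (det2 (real_vec (v j)) (q (vertex_of T {r + s + j})))"
      using K_curve_pos[OF vertex_of_in(1)] by simp
  qed
  then show ?thesis using R.evaluation_eq unfolding K_curve_type by simp
qed

lemma K_broccoli:
  assumes "\<And>V. V \<in> T \<Longrightarrow> broccoli_vertex V"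
  shows "K \<in> broccoli_curves r s n v F"
  unfolding broccoli_curves_def
proof (intro CollectI conjI ballI)
  show "K \<in> oriented_curves r s n v F" by (rule K_oriented)
  fix x assume "x \<in> verts K"
  then obtain V where V: "V \<in> T" "x = vertex_code V" unfolding K_simps(1) by blast
  have prof: "vertex_profile r s K x = block_profile V"
    using R.vertex_profile_eq[OF K_coherent] K_block_vertex[OF V(1)] V(2) by simp
  have "block_profile V \<in> {(1,0,0,0,0,2), (0,0,0,0,2,1), (0,0,1,0,1,1), (0,0,2,1,0,0), (0,1,0,0,0,3), (0,1,0,1,0,2)}"
    using assms[OF V(1)] unfolding broccoli_vertex_def
  proof (elim disjE)
    assume "join_vertex V"
    then obtain a b c where "is_join V a b c" by (auto simp: join_vertex_def)
    from profile_join[OF part[OF V(1)] this] show ?thesis by blast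
  next
    assume "real_vertex V"
    then obtain i a b where "is_real V i a b" by (auto simp: real_vertex_def)
    from profile_real[OF this] show ?thesis by simp
  next
    assume "complex_vertex V"
    then obtain i a b c where "is_complex V i a b c" by (auto simp: complex_vertex_def)
    from profile_complex[OF part[OF V(1)] this] show ?thesis by blast
  qed
  then show "vertex1 r s K x \<or> vertex2 r s K x \<or> vertex3 r s K x \<or> vertex4 r s K x \<or> vertex5 r s K x \<or> vertex6 r s K x"
    unfolding vertex1_def vertex2_def vertex3_def vertex4_def vertex5_def vertex6_def prof by blast
qed

end

section \<open>General position\<close>

lemma dim_le_relation:
  fixes z :: "'i \<Rightarrow> 'b::real_vector"
  assumes I: "finite I" "k \<in> I" and rel: "(\<Sum>i\<in>I. c i *\<^sub>R z i) = 0" "c k \<noteq> 0" and A: "A \<subseteq> span (z ` I)"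
  shows "dim A \<le> card I - 1"
proof -
  have "c k *\<^sub>R z k + (\<Sum>i\<in>I - {k}. c i *\<^sub>R z i) = 0" using rel(1) sum.remove[OF I, of "\<lambda>i. c i *\<^sub>R z i"] by simp
  then have "c k *\<^sub>R z k = - (\<Sum>i\<in>I - {k}. c i *\<^sub>R z i)" by (simp add: eq_neg_iff_add_eq_0)
  moreover have "- (\<Sum>i\<in>I - {k}. c i *\<^sub>R z i) \<in> span (z ` (I - {k}))"
    by (intro span_neg span_sum span_scale span_base) blast
  ultimately have "(1 / c k) *\<^sub>R (c k *\<^sub>R z k) \<in> span (z ` (I - {k}))" by (metis span_scale)
  then have zk: "z k \<in> span (z ` (I - {k}))" using rel(2) by simp
  have "z ` I \<subseteq> span (z ` (I - {k}))"
  proof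
    fix x assume "x \<in> z ` I"
    then obtain i where i: "i \<in> I" "x = z i" by blast
    show "x \<in> span (z ` (I - {k}))"
    proof (cases "i = k")
      case False
      then show ?thesis using i by (intro span_base) blast
    qed (use zk i in simp)
  qed
  then have "span (z ` I) \<subseteq> span (z ` (I - {k}))" by (rule span_minimal) (rule subspace_span)
  then have "dim A \<le> card (z ` (I - {k}))" using A I(1) by (intro dim_le_card) auto
  also have "\<dots> \<le> card (I - {k})" using I(1) by (intro card_image_le) simp
  finally show ?thesis using I by simp
qed

lemma single_scaleR: "Poly_Mapping.single i (c *\<^sub>R x) = c *\<^sub>R Poly_Mapping.single i x"
  by (rule poly_mapping_eqI) (simp add: lookup_scaleR lookup_single when_def)

context broccoli_data
begin

lemma evaluate_add: "evaluate T (\<lambda>V. q V + q' V) = evaluate T q + evaluate T q'"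
  unfolding evaluate_def by (simp add: single_add det2_add_right sum.distrib)

lemma evaluate_scale: "evaluate T (\<lambda>V. c *\<^sub>R q V) = c *\<^sub>R evaluate T q"
  unfolding evaluate_def
  by (simp add: single_scaleR det2_scale_right scaleR_right.sum) (simp add: single_scaleR[symmetric])

lemma evaluate_zero: "evaluate T (\<lambda>V. 0) = 0"
  using evaluate_scale[of T 0 "\<lambda>V. 0"] by simp

lemma evaluate_sum: "evaluate T (\<lambda>V. \<Sum>i\<in>I. c i *\<^sub>R q i V) = (\<Sum>i\<in>I. c i *\<^sub>R evaluate T (q i))"
  by (induction I rule: infinite_finite_induct) (simp_all add: evaluate_zero evaluate_add evaluate_scale)

end

section \<open>The parameters of a cell and the dimension of its image\<close>

locale type_tree = broccoli_data +
  fixes T assumes tree_T: "partition_tree labels T"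

sublocale type_tree \<subseteq> ptree labels T
  using tree_T fin_labels by unfold_locales

context type_tree
begin

lemma end_in: "i \<in> {1..r + s} \<Longrightarrow> {i} \<in> \<Union>T" "j \<in> F \<Longrightarrow> {r + s + j} \<in> \<Union>T"
  using F_sub by (intro singleton_in; auto simp: labels_def)+

lemma evaluate_cong:
  assumes "\<And>V. V \<in> T \<Longrightarrow> q V = q' V" shows "evaluate T q = evaluate T q'"
  unfolding evaluate_def
  using assms vertex_of_in(1)[OF end_in(1)] vertex_of_in(1)[OF end_in(2)]
  by (intro arg_cong2[of _ _ _ _ Pair] sum.cong[OF refl]) simp_all

context
  fixes \<rho> assumes \<rho>: "\<rho> \<in> labels"
begin

lemma away_inner: "S \<in> away_flags T \<rho> \<Longrightarrow> S \<in> inner_flags T" by (simp add: away_flags_def)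

lemma fin_away: "finite (away_flags T \<rho>)" using fin_inner by (simp add: away_flags_def)

lemma shift_step:
  assumes f: "f \<in> inner_flags T" and S: "S \<in> inner_flags T"
  shows "side_shift S (vertex_of T (labels - f)) - side_shift S (vertex_of T f) =
    (if S = f \<or> S = labels - f then rdir f else 0)"
proof -
  note fd = inner_flagsD[OF f]
  consider "S = f" | "S = labels - f" | "S \<noteq> f" "S \<noteq> labels - f" by blast
  then show ?thesis
  proof cases
    case 1
    then show ?thesis using side_shift_change(2,3)[OF f f] by (simp add: side_shift_def)
  next
    case 2
    have "\<not> on_side labels S (vertex_of T (labels - f))" "on_side labels S (vertex_of T f)"
      using side_shift_change(2,3)[OF f S] unfolding 2 fd(7) by auto
    then show ?thesis using 2 bdir_compl[OF fd(5)] by (simp add: side_shift_def real_vec_minus)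
  next
    case 3
    then have "f \<noteq> S" "f \<noteq> labels - S" using inner_flagsD(7)[OF S] by metis+
    then have "on_side labels S (vertex_of T f) \<longleftrightarrow> on_side labels S (vertex_of T (labels - f))"
      by (rule side_shift_change(1)[OF f S])
    then show ?thesis using 3 by (simp add: side_shift_def)
  qed
qed

lemma shift_sum_step:
  assumes f: "f \<in> inner_flags T" and g: "g (labels - f) = (g f :: real)"
  shows "(\<Sum>S\<in>away_flags T \<rho>. g S *\<^sub>R side_shift S (vertex_of T (labels - f))) =
    (\<Sum>S\<in>away_flags T \<rho>. g S *\<^sub>R side_shift S (vertex_of T f)) + g f *\<^sub>R rdir f"
proof -
  let ?A = "away_flags T \<rho>"
  have "(\<Sum>S\<in>?A. g S *\<^sub>R side_shift S (vertex_of T (labels - f))) - (\<Sum>S\<in>?A. g S *\<^sub>R side_shift S (vertex_of T f))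
      = (\<Sum>S\<in>?A. g S *\<^sub>R (side_shift S (vertex_of T (labels - f)) - side_shift S (vertex_of T f)))"
    by (simp add: sum_subtractf scaleR_diff_right)
  also have "\<dots> = (\<Sum>S\<in>?A. if S = f \<or> S = labels - f then g f *\<^sub>R rdir f else 0)"
    by (rule sum.cong[OF refl]) (use shift_step[OF f away_inner] g in auto)
  also have "\<dots> = g f *\<^sub>R rdir f"
  proof -
    obtain e where e: "e \<in> ?A" "e = f \<or> e = labels - f" using inner_flags_away[OF \<rho> f] by blast
    have uni: "S = e" if "S \<in> ?A" "S = f \<or> S = labels - f" for S
      using that e \<rho> unfolding away_flags_def by auto
    have "(\<Sum>S\<in>?A. if S = f \<or> S = labels - f then g f *\<^sub>R rdir f else 0) = (\<Sum>S\<in>?A. if S = e then g f *\<^sub>R rdir f else 0)"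
    proof (rule sum.cong[OF refl])
      fix S assume "S \<in> ?A"
      then have "(S = f \<or> S = labels - f) = (S = e)" using uni e(2) by metis
      then show "(if S = f \<or> S = labels - f then g f *\<^sub>R rdir f else 0) = (if S = e then g f *\<^sub>R rdir f else 0)" by (simp only:)
    qed
    then show ?thesis using e(1) fin_away by (simp add: sum.delta)
  qed
  finally show ?thesis by (simp add: algebra_simps)
qed

text \<open>Both sides change by the same vector across every edge, so their difference is constant
  along walks, and every vertex is connected to the one with the root label.\<close>

lemma shift_decomposition:
  assumes q: "\<And>f. f \<in> inner_flags T \<Longrightarrow> q (vertex_of T (labels - f)) = q (vertex_of T f) + g f *\<^sub>R rdir f"
    and g: "\<And>f. f \<in> inner_flags T \<Longrightarrow> g (labels - f) = (g f :: real)"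
  shows "\<exists>c. \<forall>V\<in>T. q V = c + (\<Sum>S\<in>away_flags T \<rho>. g S *\<^sub>R side_shift S V)"
proof -
  define d where "d V = q V - (\<Sum>S\<in>away_flags T \<rho>. g S *\<^sub>R side_shift S V)" for V
  define R where "R = {(A, B). A \<in> T \<and> B \<in> T \<and> (\<exists>f\<in>A. labels - f \<in> B)}"
  have step: "d A = d B" if AB: "(A, B) \<in> R" for A B
  proof -
    obtain f where f: "A \<in> T" "B \<in> T" "f \<in> A" "labels - f \<in> B" using AB by (auto simp: R_def)
    then have fi: "f \<in> inner_flags T" unfolding inner_flags_compl by blast
    have v: "vertex_of T f = A" "vertex_of T (labels - f) = B" using vertex_of_eq f by blast+
    show ?thesis using q[OF fi] shift_sum_step[OF fi g[OF fi]] unfolding v d_def by simp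
  qed
  have path: "d A = d B" if "(A, B) \<in> R\<^sup>*" for A B
    using that by (induction rule: rtrancl_induct) (use step in auto)
  have "d V = d (vertex_of T {\<rho>})" if V: "V \<in> T" for V
  proof -
    obtain W where W: "W \<in> T" "{\<rho>} \<in> W" "(V, W) \<in> R\<^sup>*" using walk_to_label[OF V \<rho>] unfolding R_def by blast
    then show ?thesis using path[OF W(3)] vertex_of_eq[OF W(1,2)] by simp
  qed
  then have "\<forall>V\<in>T. q V = d (vertex_of T {\<rho>}) + (\<Sum>S\<in>away_flags T \<rho>. g S *\<^sub>R side_shift S V)"
    unfolding d_def by (simp add: algebra_simps)
  then show ?thesis by blast
qed

text \<open>The infinitesimal motions belonging to the parameters of a cell: two translations, and
  the lengthening of each bounded edge.\<close>

definition motion :: "bool + nat set \<Rightarrow> nat set set \<Rightarrow> real \<times> real" where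
  "motion i V = (case i of Inl b \<Rightarrow> if b then (1, 0) else (0, 1) | Inr S \<Rightarrow> side_shift S V)"

definition motion_index :: "(bool + nat set) set" where
  "motion_index = Inl ` UNIV \<union> Inr ` away_flags T \<rho>"

lemma motion_index: "finite motion_index" "card motion_index = 2 + card (away_flags T \<rho>)"
proof -
  show "finite motion_index" using fin_away by (simp add: motion_index_def)
  have "card motion_index = card (Inl ` (UNIV :: bool set) :: (bool + nat set) set) + card (Inr ` away_flags T \<rho> :: (bool + nat set) set)"
    unfolding motion_index_def using fin_away by (intro card_Un_disjoint) auto
  then show "card motion_index = 2 + card (away_flags T \<rho>)" by (simp add: card_image)
qed

lemma motion_decomposition:
  assumes q: "\<And>f. f \<in> inner_flags T \<Longrightarrow> q (vertex_of T (labels - f)) = q (vertex_of T f) + g f *\<^sub>R rdir f"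
    and g: "\<And>f. f \<in> inner_flags T \<Longrightarrow> g (labels - f) = (g f :: real)"
  shows "\<exists>c. (\<forall>V\<in>T. q V = (\<Sum>i\<in>motion_index. c i *\<^sub>R motion i V)) \<and>
     evaluate T q = (\<Sum>i\<in>motion_index. c i *\<^sub>R evaluate T (motion i))"
proof -
  obtain c0 where c0: "\<forall>V\<in>T. q V = c0 + (\<Sum>S\<in>away_flags T \<rho>. g S *\<^sub>R side_shift S V)"
    using shift_decomposition[where g = g, OF q g] by blast
  define c where "c i = (case i of Inl b \<Rightarrow> if b then fst c0 else snd c0 | Inr S \<Rightarrow> g S)" for i
  have "(\<Sum>i\<in>motion_index. c i *\<^sub>R motion i V) = c0 + (\<Sum>S\<in>away_flags T \<rho>. g S *\<^sub>R side_shift S V)" for V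
  proof -
    have "(\<Sum>i\<in>motion_index. c i *\<^sub>R motion i V) = (\<Sum>i\<in>Inl ` UNIV. c i *\<^sub>R motion i V) + (\<Sum>i\<in>Inr ` away_flags T \<rho>. c i *\<^sub>R motion i V)"
      unfolding motion_index_def using fin_away by (intro sum.union_disjoint) auto
    also have "(\<Sum>i\<in>Inl ` UNIV. c i *\<^sub>R motion i V) = c0"
      by (simp add: sum.reindex UNIV_bool c_def motion_def prod_eq_iff)
    also have "(\<Sum>i\<in>Inr ` away_flags T \<rho>. c i *\<^sub>R motion i V) = (\<Sum>S\<in>away_flags T \<rho>. g S *\<^sub>R side_shift S V)"
      by (simp add: sum.reindex c_def motion_def)
    finally show ?thesis .
  qed
  then have "\<forall>V\<in>T. q V = (\<Sum>i\<in>motion_index. c i *\<^sub>R motion i V)" using c0 by simp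
  moreover then have "evaluate T q = (\<Sum>i\<in>motion_index. c i *\<^sub>R evaluate T (motion i))"
    using evaluate_cong[of q] evaluate_sum[of T c motion motion_index] by simp
  ultimately show ?thesis by blast
qed

end

end

text \<open>The positions are combinations of the motions, with the edge lengths and a translation
  as coefficients, and evaluation is linear in the positions. So the image of a cell is spanned by
  one vector for each parameter.\<close>

lemma (in oriented_tree) evaluation_in_span:
  assumes \<rho>: "\<rho> \<in> labels"
  shows "evaluation r s v F C \<in> span ((\<lambda>i. evaluate curve_type (type_tree.motion r s n v i)) ` type_tree.motion_index curve_type \<rho>)"
proof -
  interpret type_tree r s n v F curve_type using tree_curve_type by unfold_locales
  define g where "g b = len C (inv_into (flags C) behind_labels b)" for b
  have g: "g (behind_labels f) = len C f" if "f \<in> flags C" for f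
    unfolding g_def using inv_into_f_f[OF inj_behind that] by simp
  have "\<exists>c. (\<forall>V\<in>curve_type. curve_pos V = (\<Sum>i\<in>motion_index \<rho>. c i *\<^sub>R motion i V)) \<and>
     evaluate curve_type curve_pos = (\<Sum>i\<in>motion_index \<rho>. c i *\<^sub>R evaluate curve_type (motion i))"
  proof (rule motion_decomposition[OF \<rho>, where g = g])
    fix b assume "b \<in> inner_flags curve_type"
    then obtain f where f: "f \<in> bounded_flags C" "b = behind_labels f" using inner_curve_type by blast
    then have ff: "f \<in> flags C" "opp C f \<in> flags C" using opp_in by (auto simp: bounded_iff)
    show "curve_pos (vertex_of curve_type (labels - b)) = curve_pos (vertex_of curve_type b) + g b *\<^sub>R rdir b"
      using curve_edge_vector[OF f(1)] unfolding f(2) g[OF ff(1)] by (simp add: algebra_simps)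
    show "g (labels - b) = g b"
      unfolding f(2) behind_opp[OF f(1), symmetric] g[OF ff(1)] g[OF ff(2)] by (rule len_opp[OF f(1)])
  qed
  then obtain c where "evaluation r s v F C = (\<Sum>i\<in>motion_index \<rho>. c i *\<^sub>R evaluate curve_type (motion i))"
    unfolding evaluation_eq by blast
  then show ?thesis by (simp add: span_sum span_scale span_base)
qed

context oriented_tree
begin

lemma type_contraction_refl: "type_contraction r s n id id C C"
  unfolding type_contraction_def by simp

lemma same_type_refl: "same_type r s n C C"
  unfolding same_type_def type_iso_def using type_contraction_refl by (intro exI[of _ id]) simp

lemma cell_in_span:
  assumes \<rho>: "\<rho> \<in> labels"
  shows "evaluation r s v F ` broccoli_cell r s n v F C \<subseteq>
    span ((\<lambda>i. evaluate curve_type (type_tree.motion r s n v i)) ` type_tree.motion_index curve_type \<rho>)"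
proof
  fix P assume "P \<in> evaluation r s v F ` broccoli_cell r s n v F C"
  then obtain D where D: "D \<in> broccoli_space r s n v F" "same_type r s n D C" "P = evaluation r s v F D"
    by (auto simp: broccoli_cell_def)
  have o: "D \<in> oriented_curves r s n v F" using D(1) by (simp add: broccoli_space_def)
  interpret D: oriented_tree r s n v F D
    using o by unfold_locales (auto simp: oriented_curves_def)
  interpret DC: two_trees r s n v F D C by unfold_locales
  obtain \<phi> \<psi> where "type_iso r s n \<phi> \<psi> D C" using D(2) by (auto simp: same_type_def)
  then have "curve_type = D.curve_type" by (rule DC.iso_curve_type)
  then show "P \<in> span ((\<lambda>i. evaluate curve_type (type_tree.motion r s n v i)) ` type_tree.motion_index curve_type \<rho>)"
    using D.evaluation_in_span[OF \<rho>] D(3) by simp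
qed

lemma cell_differences_in_span:
  assumes "\<rho> \<in> labels"
  shows "{x - y | x y. x \<in> evaluation r s v F ` broccoli_cell r s n v F C \<and> y \<in> evaluation r s v F ` broccoli_cell r s n v F C}
    \<subseteq> span ((\<lambda>i. evaluate curve_type (type_tree.motion r s n v i)) ` type_tree.motion_index curve_type \<rho>)"
  using cell_in_span[OF assms] by (blast intro: span_diff)

lemma not_general:
  assumes sp: "C \<in> broccoli_space r s n v F" and gp: "general_position r s n v F P" and P: "evaluation r s v F C = P"
    and dim: "int (dim {x - y | x y. x \<in> evaluation r s v F ` broccoli_cell r s n v F C \<and> y \<in> evaluation r s v F ` broccoli_cell r s n v F C})
       \<le> int r + int n - 2"
  shows False
proof -
  \<comment> \<open>By the condition on \<open>r\<close>, \<open>s\<close> and \<open>F\<close> the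
    space of conditions has dimension \<open>r + n - 1\<close>.\<close>
  have "int r + int n - 2 = int (2 * (r + s) + card F) - 1" using count by simp
  then have "P \<notin> evaluation r s v F ` broccoli_cell r s n v F C" using gp sp dim unfolding general_position_def by simp
  moreover have "C \<in> broccoli_cell r s n v F C" using sp same_type_refl by (simp add: broccoli_cell_def)
  ultimately show False using P by blast
qed

end

lemma (in broccoli_curve) in_space: "C \<in> broccoli_space r s n v F"
  unfolding broccoli_space_def
proof (intro CollectI conjI exI[of _ "\<lambda>_. C"] allI)
  show "C \<in> oriented_curves r s n v F" "C \<in> broccoli_curves r s n v F" by (rule oc, rule bc)
  show "curves_tendsto r s n (\<lambda>_. C) C"
    unfolding curves_tendsto_def using type_contraction_refl by (intro exI[of _ "\<lambda>_. id"]) simp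
qed

text \<open>Vertices with a complex marking have valence 4, all others 3. For \<open>e\<close>
  bounded edges the flag count reads \<open>3 * (e + 1) + s = r + s + n + 2 * e\<close>, so
  \<open>e\<close> is \<open>r + n - 3\<close>. With two translations this gives
  \<open>r + n - 1\<close> parameters, as many as there are conditions.\<close>

lemma (in broccoli_tree) card_away:
  assumes \<rho>: "\<rho> \<in> labels"
  shows "card (away_flags T \<rho>) + 3 = r + n"
proof -
  let ?K = "{V \<in> T. complex_vertex V}"
  have cV: "card V = 3 + (if complex_vertex V then 1 else 0)" if V: "V \<in> T" for V
  proof -
    have mark: "{i} \<in> markings \<Longrightarrow> charge a = 1 \<Longrightarrow> {i} \<noteq> a" for i a using charge_marking by fastforce
    from bvertex[OF V] show ?thesis unfolding broccoli_vertex_def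
    proof (elim disjE)
      assume j: "join_vertex V"
      then obtain a b c where "is_join V a b c" by (auto simp: join_vertex_def)
      then have "card V = 3" by (auto simp: is_join_def)
      then show ?thesis using vertex_kinds_disjoint(2)[OF j] by simp
    next
      assume rv: "real_vertex V"
      then obtain i a b where i: "is_real V i a b" by (auto simp: real_vertex_def)
      then have "{i} \<in> markings" by (auto simp: is_real_def markings_def)
      then have "{i} \<noteq> a" "{i} \<noteq> b" using mark i by (auto simp: is_real_def)
      then have "card V = 3" using i by (auto simp: is_real_def)
      then show ?thesis using vertex_kinds_disjoint(3) rv by auto
    next
      assume cv: "complex_vertex V"
      then obtain i a b c where i: "is_complex V i a b c" by (auto simp: complex_vertex_def)
      then have "{i} \<in> markings" by (auto simp: is_complex_def markings_def)
      then have "{i} \<noteq> a" "{i} \<noteq> b" "{i} \<noteq> c" using mark i by (auto simp: is_complex_def)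
      then have "card V = 4" using i by (auto simp: is_complex_def)
      then show ?thesis using cv by simp
    qed
  qed
  have "bij_betw (\<lambda>i. vertex_of T {i}) {r + 1..r + s} ?K"
  proof (rule bij_betw_imageI)
    have sing: "{i} \<in> \<Union>T" if "i \<in> {r + 1..r + s}" for i using singleton_in[of i] that by (auto simp: labels_def)
    show "inj_on (\<lambda>i. vertex_of T {i}) {r + 1..r + s}"
    proof (rule inj_onI)
      fix i j assume ij: "i \<in> {r + 1..r + s}" "j \<in> {r + 1..r + s}" "vertex_of T {i} = vertex_of T {j}"
      have 1: "i \<in> {1..r + s}" "j \<in> {1..r + s}" using ij by auto
      note vi = vertex_of_in[OF sing[OF ij(1)]] and vj = vertex_of_in[OF sing[OF ij(2)]]
      show "i = j"
        using vertex_marking_eq[OF bvertex[OF vi(1)] 1(1) vi(2)] vertex_marking_eq[OF bvertex[OF vj(1)] 1(2) vj(2)] ij(3) by metis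
    qed
    show "(\<lambda>i. vertex_of T {i}) ` {r + 1..r + s} = ?K"
    proof (intro set_eqI iffI)
      fix V assume "V \<in> (\<lambda>i. vertex_of T {i}) ` {r + 1..r + s}"
      then obtain i where i: "i \<in> {r + 1..r + s}" "V = vertex_of T {i}" by blast
      have V: "V \<in> T" "{i} \<in> V" using vertex_of_in[OF sing[OF i(1)]] i(2) by auto
      have m: "{i} \<in> markings" "charge {i} = - 2" using i(1) complex_charge by (auto simp: markings_def)
      have "\<not> join_vertex V" using join_unmarked(2) V(2) m(1) unfolding join_vertex_def by blast
      moreover have "\<not> real_vertex V"
      proof
        assume "real_vertex V"
        then obtain k a b where "is_real V k a b" by (auto simp: real_vertex_def)
        then show False using V(2) m(2) real_charge[of k] by (auto simp: is_real_def)
      qed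
      ultimately show "V \<in> ?K" using bvertex[OF V(1)] V(1) by (auto simp: broccoli_vertex_def)
    next
      fix V assume V: "V \<in> ?K"
      then obtain i a b c where "is_complex V i a b c" by (auto simp: complex_vertex_def)
      then have "i \<in> {r + 1..r + s}" "{i} \<in> V" by (auto simp: is_complex_def)
      moreover have "vertex_of T {i} = V" using V \<open>{i} \<in> V\<close> by (intro vertex_of_eq) simp_all
      ultimately show "V \<in> (\<lambda>i. vertex_of T {i}) ` {r + 1..r + s}" by blast
    qed
  qed
  then have "card ?K = s" using bij_betw_same_card by fastforce
  moreover have "(\<Sum>V\<in>T. card V) = 3 * card T + card ?K"
  proof -
    have "(\<Sum>V\<in>T. card V) = (\<Sum>V\<in>T. 3 + (if complex_vertex V then 1 else 0))" by (rule sum.cong[OF refl cV])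
    also have "\<dots> = 3 * card T + card ?K"
      using fin_T by (simp add: sum.distrib sum.inter_filter[symmetric])
    finally show ?thesis .
  qed
  ultimately show ?thesis
    using sum_card_vertices[OF \<rho>] card_away_flags[OF \<rho>] by (simp add: labels_def)
qed

context broccoli_curve
begin

interpretation T: broccoli_tree r s n v F curve_type
  using broccoli_curve_type by unfold_locales

interpretation T: type_tree r s n v F curve_type
  using tree_curve_type by unfold_locales

text \<open>
  At a vertex with two parallel incoming edges all edges are parallel, and the vertex can move
  along them without changing the conditions. So the cell has too small an image.
\<close>

lemma regular_curve_type:
  assumes gp: "general_position r s n v F P" and P: "evaluation r s v F C = P"
  shows "regular_type curve_type"
proof (rule ccontr)
  assume "\<not> regular_type curve_type"
  then obtain V where V: "V \<in> curve_type" "degenerate V"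
    using broccoli_curve_type by (auto simp: regular_type_def)
  then obtain a b c where j: "is_join V a b c" "det2 (bdir a) (bdir b) = 0" by (auto simp: degenerate_def)
  obtain \<rho> where \<rho>: "\<rho> \<in> labels" using T.block_nonempty[OF V(1)] T.block_sub[OF V(1)] T.third_block[OF V(1), of "{}" "{}"] by blast
  let ?I = "T.motion_index \<rho>" and ?z = "\<lambda>i. evaluate curve_type (T.motion i)"
  have "\<exists>k\<in>?I. \<exists>c. (\<Sum>i\<in>?I. c i *\<^sub>R ?z i) = 0 \<and> c k \<noteq> 0"
  proof (cases "\<exists>f\<in>inner_flags curve_type. rdir f = 0")
    \<comment> \<open>A contracted bounded edge: its length is a parameter that moves no
      vertex.\<close>
    case True
    then obtain f where f: "f \<in> inner_flags curve_type" "rdir f = 0" by blast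
    have "rdir (labels - f) = 0" using f(2) bdir_compl[OF T.inner_flags_sub[OF f(1)]] by (simp add: real_vec_minus)
    then obtain S where S: "S \<in> away_flags curve_type \<rho>" "rdir S = 0" using T.inner_flags_away[OF \<rho> f(1)] f(2) by blast
    have "T.motion (Inr S) = (\<lambda>_. 0)" using S(2) by (intro ext) (simp add: T.motion_def[OF \<rho>] side_shift_def)
    then have "?z (Inr S) = 0" using evaluate_zero by simp
    then have "(\<Sum>i\<in>?I. (if i = Inr S then 1 else 0 :: real) *\<^sub>R ?z i) = 0" by (intro sum.neutral) auto
    moreover have "Inr S \<in> ?I" using S(1) by (simp add: T.motion_index_def[OF \<rho>])
    ultimately show ?thesis by (intro bexI[of _ "Inr S"] exI[of _ "\<lambda>i. if i = Inr S then 1 else 0"]) auto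
  next
    case False
    note p = T.part[OF V(1)]
    have m: "a \<in> V" "b \<in> V" "c \<in> V" "V = {a, b, c}" "charge a = 0" using j(1) by (auto simp: is_join_def)
    define u where "u = rdir a"
    \<comment> \<open>An inner edge has a non-zero direction in this case, and an end of charge 0 is
      a fixed end.\<close>
    have "u \<noteq> 0"
    proof (cases "a \<in> inner_flags curve_type")
      case True then show ?thesis using False by (auto simp: u_def)
    next
      case na: False
      then have "card a = 1" using T.card_block[OF V(1) m(1)] V(1) m(1) by (force simp: inner_flags_def)
      then obtain l where l: "a = {l}" by (rule card_1_singletonE)
      then have "l \<in> labels" using T.block_sub[OF V(1) m(1)] by simp
      then obtain i where "i \<in> F" "l = r + s + i" using singleton_charge0 m(5) l by blast
      then have "bdir a = v i" "i \<in> {1..n}" using end_block(1)[of i] F_sub l by auto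
      then show ?thesis using v_nonzero by (simp add: u_def real_vec_eq_0)
    qed
    have par: "det2 (rdir x) u = 0" if "x \<in> V" for x
    proof -
      have "x = a \<or> x = b \<or> x = c" using that m(4) by blast
      moreover have "det2 (bdir b) (bdir a) = 0" using j(2) det2_swap[of "bdir a" "bdir b"] by (metis neg_equal_0_iff_equal)
      ultimately show ?thesis unfolding u_def det2_real_vec
        using join_dirs[OF p j(1)] by (auto simp: det2_self det2_minus_left det2_add_left det2_diff_left)
    qed
    define q where "q W = (if W = V then u else 0)" for W
    define g where "g f = edge_length curve_type q f" for f
    have comp: "g (labels - f) = g f" if f: "f \<in> inner_flags curve_type" for f
      unfolding g_def edge_length_def T.inner_flagsD(7)[OF f] bdir_compl[OF T.inner_flags_sub[OF f]] real_vec_minus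
      by (simp add: inner_diff_left)
    have qe: "q (vertex_of curve_type (labels - f)) = q (vertex_of curve_type f) + g f *\<^sub>R rdir f" if f: "f \<in> inner_flags curve_type" for f
    proof -
      note fd = T.inner_flagsD[OF f]
      have "det2 (rdir f) (q (vertex_of curve_type f)) = 0" using par fd(2) unfolding q_def by (auto simp: det2_zero_right)
      moreover have "det2 (rdir f) (q (vertex_of curve_type (labels - f))) = 0"
        using par[of "labels - f"] fd(4) bdir_compl[OF fd(5)] unfolding q_def
        by (auto simp: det2_zero_right real_vec_minus det2_minus_left)
      ultimately have "det2 (rdir f) (q (vertex_of curve_type (labels - f)) - q (vertex_of curve_type f)) = 0"
        by (simp add: det2_diff_right)
      then have "q (vertex_of curve_type (labels - f)) - q (vertex_of curve_type f) = g f *\<^sub>R rdir f"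
        unfolding g_def edge_length_def using False f by (intro det2_zero_parallel) auto
      then show ?thesis by (simp add: algebra_simps)
    qed
    obtain c where c: "\<forall>W\<in>curve_type. q W = (\<Sum>i\<in>?I. c i *\<^sub>R T.motion i W)" "evaluate curve_type q = (\<Sum>i\<in>?I. c i *\<^sub>R ?z i)"
      using T.motion_decomposition[OF \<rho>, where g = g, OF qe comp] by blast
    have "evaluate curve_type q = 0"
    proof -
      have 1: "q (vertex_of curve_type {i}) = 0" if i: "i \<in> {1..r + s}" for i
      proof -
        have "{i} \<notin> V" using join_unmarked(2)[OF j(1)] i by (auto simp: markings_def)
        then have "vertex_of curve_type {i} \<noteq> V" using T.vertex_of_in(2)[OF T.end_in(1)[OF i]] by auto
        then show ?thesis by (simp add: q_def)
      qed
      have 2: "det2 (real_vec (v k)) (q (vertex_of curve_type {r + s + k})) = 0" if k: "k \<in> F" for k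
      proof (cases "vertex_of curve_type {r + s + k} = V")
        case True
        then have "det2 (rdir {r + s + k}) u = 0" using par T.vertex_of_in(2)[OF T.end_in(2)[OF k]] by blast
        moreover have "bdir {r + s + k} = v k" using end_block(1)[of k] F_sub k by blast
        ultimately show ?thesis using True by (simp add: q_def)
      qed (simp add: q_def det2_zero_right)
      show ?thesis unfolding evaluate_def using 1 2 by (intro prod_eqI) simp_all
    qed
    then have rel: "(\<Sum>i\<in>?I. c i *\<^sub>R ?z i) = 0" using c(2) by simp
    \<comment> \<open>The relation is non-trivial, since the combination moves \<open>V\<close> by
      \<open>u\<close>.\<close>
    have "\<exists>k\<in>?I. c k \<noteq> 0"
    proof (rule ccontr)
      assume "\<not> ?thesis"
      then have "q V = 0" using c(1) V(1) by simp
      then show False using \<open>u \<noteq> 0\<close> by (simp add: q_def)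
    qed
    then show ?thesis using rel by blast
  qed
  then obtain k cf where k: "k \<in> ?I" "(\<Sum>i\<in>?I. cf i *\<^sub>R ?z i) = 0" "cf k \<noteq> 0" by blast
  have "dim {x - y | x y. x \<in> evaluation r s v F ` broccoli_cell r s n v F C \<and> y \<in> evaluation r s v F ` broccoli_cell r s n v F C}
      \<le> card ?I - 1"
    by (rule dim_le_relation[OF T.motion_index(1)[OF \<rho>] k cell_differences_in_span[OF \<rho>]])
  moreover have card_gt: "0 < card ?I" using k(1) T.motion_index(1)[OF \<rho>] by (metis card_gt_0_iff empty_iff)
  moreover have "card ?I + 1 = r + n" using T.motion_index(2)[OF \<rho>] T.card_away[OF \<rho>] by linarith
  ultimately have "int (dim {x - y | x y. x \<in> evaluation r s v F ` broccoli_cell r s n v F C \<and> y \<in> evaluation r s v F ` broccoli_cell r s n v F C})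
       \<le> int r + int n - 2" using card_gt by linarith
  then show False by (rule not_general[OF in_space gp P])
qed

end

section \<open>Counting curves by their types\<close>

context broccoli_data
begin

lemma evaluate_solves:
  assumes T: "partition_tree labels T" and P: "P \<in> condition_space r s F" and sol: "solves T P q"
  shows "evaluate T q = P"
proof -
  interpret type_tree r s n v F T using T by unfold_locales
  have P0: "Poly_Mapping.lookup (fst P) i = 0" if "i \<notin> {1..r + s}" for i
    using P that by (auto simp: condition_space_def in_keys_iff)
  have P1: "Poly_Mapping.lookup (snd P) j = 0" if "j \<notin> F" for j
    using P that by (auto simp: condition_space_def in_keys_iff)
  show ?thesis
  proof (rule prod_eqI; rule poly_mapping_eqI)
    fix i show "Poly_Mapping.lookup (fst (evaluate T q)) i = Poly_Mapping.lookup (fst P) i"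
    proof (cases "i \<in> {1..r + s}")
      case True
      note vi = vertex_of_in[OF end_in(1)[OF True]]
      have "q (vertex_of T {i}) = Poly_Mapping.lookup (fst P) i" using sol vi True unfolding solves_def by blast
      then show ?thesis using lookup_evaluate(1)[OF True] by simp
    next
      case False
      then have "Poly_Mapping.lookup (fst (evaluate T q)) i = 0"
        unfolding evaluate_def fst_conv lookup_sum by (intro sum.neutral ballI) (auto simp: lookup_single when_def)
      then show ?thesis using P0[OF False] by simp
    qed
  next
    fix j show "Poly_Mapping.lookup (snd (evaluate T q)) j = Poly_Mapping.lookup (snd P) j"
    proof (cases "j \<in> F")
      case True
      note vj = vertex_of_in[OF end_in(2)[OF True]]
      have "det2 (real_vec (v j)) (q (vertex_of T {r + s + j})) = Poly_Mapping.lookup (snd P) j"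
        using sol vj True unfolding solves_def by blast
      then show ?thesis using lookup_evaluate(2)[OF True] by simp
    next
      case False
      then have "Poly_Mapping.lookup (snd (evaluate T q)) j = 0"
        unfolding evaluate_def snd_conv lookup_sum by (intro sum.neutral ballI) (auto simp: lookup_single when_def)
      then show ?thesis using P1[OF False] by simp
    qed
  qed
qed

lemma broccoli_curveI: "C \<in> broccoli_curves r s n v F \<Longrightarrow> broccoli_curve r s n v F C"
  by unfold_locales (auto simp: broccoli_curves_def oriented_curves_def)

abbreviation type_of :: "oriented_curve \<Rightarrow> nat set set set" where
  "type_of C \<equiv> marked_tree.curve_type r s n C"

lemma iso_class:
  assumes C: "C \<in> broccoli_curves r s n v F" and CE: "(C, E) \<in> curve_iso r s n v F"
  shows "E \<in> broccoli_curves r s n v F" "evaluation r s v F E = evaluation r s v F C" "type_of E = type_of C"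
proof -
  interpret C: broccoli_curve r s n v F C by (rule broccoli_curveI[OF C])
  have E: "E \<in> oriented_curves r s n v F" "isomorphic r s n C E" using CE by (auto simp: curve_iso_def)
  interpret E: oriented_tree r s n v F E using E(1) by unfold_locales (auto simp: oriented_curves_def)
  interpret CE: two_trees r s n v F C E by unfold_locales
  obtain \<phi> \<psi> where i: "type_iso r s n \<phi> \<psi> C E" "\<forall>V\<in>verts C. pos E (\<phi> V) = pos C V"
    using E(2) by (auto simp: isomorphic_def)
  show "E \<in> broccoli_curves r s n v F" by (rule CE.iso_broccoli[OF i(1) C])
  show "evaluation r s v F E = evaluation r s v F C" by (rule CE.iso_evaluation[OF i])
  show "type_of E = type_of C" by (rule CE.iso_curve_type[OF i(1)])
qed

lemma same_type_isomorphic: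
  assumes C: "C \<in> broccoli_curves r s n v F" and E: "E \<in> broccoli_curves r s n v F"
    and ev: "evaluation r s v F E = evaluation r s v F C" and ty: "type_of E = type_of C"
    and reg: "regular_type (type_of C)"
  shows "(C, E) \<in> curve_iso r s n v F"
proof -
  interpret C: broccoli_curve r s n v F C by (rule broccoli_curveI[OF C])
  interpret E: broccoli_curve r s n v F E by (rule broccoli_curveI[OF E])
  interpret CE: two_trees r s n v F C E by unfold_locales
  interpret R: regular_tree r s n v F "type_of C" using regular_tree_iff reg by simp
  have "isomorphic r s n C E"
  proof (rule CE.isomorphicI[OF ty C.coherent_curve E.coherent_curve])
    fix W assume W: "W \<in> C.curve_type"
    show "E.curve_pos W = C.curve_pos W"
      using R.solves_unique[OF E.curve_solves[unfolded ty ev] C.curve_solves W] .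
  next
    fix f assume "f \<in> inner_flags C.curve_type"
    then show "rdir f \<noteq> 0" by (rule R.inner_rdir_nonzero)
  qed
  then show ?thesis using C E by (auto simp: curve_iso_def broccoli_curves_def)
qed

lemma active_type_of:
  assumes C: "C \<in> broccoli_curves r s n v F" and reg: "regular_type (type_of C)"
  shows "active (type_of C) (evaluation r s v F C)"
proof -
  interpret C: broccoli_curve r s n v F C by (rule broccoli_curveI[OF C])
  interpret R: regular_tree r s n v F "type_of C" using regular_tree_iff reg by simp
  show ?thesis unfolding active_def
  proof
    fix b assume b: "b \<in> inner_flags (type_of C)"
    then obtain f where f: "f \<in> bounded_flags C" "b = C.behind_labels f" using C.inner_curve_type by blast
    have "type_length (type_of C) b (evaluation r s v F C) = len C f"
      unfolding R.type_length_eq[OF b C.curve_solves] edge_length_def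
      using C.curve_edge_vector[OF f(1)] R.inner_rdir_nonzero[OF b] unfolding f(2) by simp
    then show "0 < type_length (type_of C) b (evaluation r s v F C)" using C.len_pos[OF f(1)] by simp
  qed
qed

lemma active_type_realized:
  assumes reg: "regular_type T" and act: "active T P" and P: "P \<in> condition_space r s F"
  shows "\<exists>C. C \<in> broccoli_curves r s n v F \<and> evaluation r s v F C = P \<and> type_of C = T"
proof -
  interpret T: regular_tree r s n v F T using regular_tree_iff reg by simp
  have tree: "partition_tree labels T" using T.bt by (simp add: broccoli_type_def)
  interpret K: realizable r s n v F T "position T P" "\<lambda>f. type_length T f P"
  proof
    fix f assume f: "f \<in> inner_flags T"
    show "position T P (vertex_of T (labels - f)) = position T P (vertex_of T f) + type_length T f P *\<^sub>R rdir f"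
      using T.edge_vector[OF T.position_solves f] unfolding type_length_def by (simp add: algebra_simps)
  qed (use tree T.inner_charges act T.type_length_compl in \<open>auto simp: active_def\<close>)
  show ?thesis
  proof (intro exI conjI)
    show "K.K \<in> broccoli_curves r s n v F" by (rule K.K_broccoli[OF T.bvertex])
    show "evaluation r s v F K.K = P" unfolding K.K_evaluation by (rule evaluate_solves[OF tree P T.position_solves])
    show "type_of K.K = T" by (rule K.K_curve_type)
  qed
qed

text \<open>In general position all curves through \<open>P\<close> have regular types. A regular
  type and the conditions determine positions and lengths, hence the isomorphism class, and the
  types that occur are exactly those with positive lengths. The weights of the ends give a common
  factor.\<close>

lemma broccoli_number_eq:
  assumes P: "P \<in> condition_space r s F" and gp: "general_position r s n v F P"
  shows "broccoli_number r s n v F P =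
    1 / of_nat (card (symmetry_group n v F)) * ((\<Prod>k=1..n. \<i> powi (int (weight (v k)) - 1)) * type_count P)"
proof -
  define X where "X = {C \<in> broccoli_curves r s n v F. evaluation r s v F C = P}"
  define I where "I = curve_iso r s n v F"
  define c where "c = (\<Prod>k=1..n. \<i> powi (int (weight (v k)) - 1))"
  define rep where "rep K = (SOME C. C \<in> K)" for K :: "oriented_curve set"
  have reg: "regular_type (type_of C)" if "C \<in> X" for C
  proof -
    interpret C: broccoli_curve r s n v F C using that by (intro broccoli_curveI) (simp add: X_def)
    show ?thesis using C.regular_curve_type[OF gp] that by (simp add: X_def)
  qed
  have iso: "(C, E) \<in> I" if "C \<in> X" "E \<in> X" "type_of E = type_of C" for C E
    unfolding I_def using same_type_isomorphic[of C E] reg that by (simp add: X_def)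
  have members: "E \<in> X" "type_of E = type_of C" if "C \<in> X" "(C, E) \<in> I" for C E
    using iso_class[of C E] that unfolding X_def I_def by auto
  have repX: "rep (I `` {C}) \<in> X" "type_of (rep (I `` {C})) = type_of C" if C: "C \<in> X" for C
  proof -
    have "C \<in> I `` {C}" using iso[OF C C] by simp
    then have "rep (I `` {C}) \<in> I `` {C}" unfolding rep_def by (rule someI)
    then have "(C, rep (I `` {C})) \<in> I" by simp
    from members[OF C this] show "rep (I `` {C}) \<in> X" "type_of (rep (I `` {C})) = type_of C" .
  qed
  have bij: "bij_betw (\<lambda>K. type_of (rep K)) (X // I) {T. regular_type T \<and> active T P}"
  proof (rule bij_betw_imageI)
    show "inj_on (\<lambda>K. type_of (rep K)) (X // I)"
    proof (rule inj_onI)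
      fix K K' assume K: "K \<in> X // I" "K' \<in> X // I" "type_of (rep K) = type_of (rep K')"
      obtain C where C: "C \<in> X" "K = I `` {C}" using K(1) by (rule quotientE)
      obtain C' where C': "C' \<in> X" "K' = I `` {C'}" using K(2) by (rule quotientE)
      have ty: "type_of C = type_of C'" using K(3) repX(2)[OF C(1)] repX(2)[OF C'(1)] unfolding C(2) C'(2) by metis
      have "I `` {C} \<subseteq> I `` {C'}"
      proof
        fix E assume "E \<in> I `` {C}"
        then have "(C, E) \<in> I" by simp
        from members[OF C(1) this] have "E \<in> X" "type_of E = type_of C'" using ty by metis+
        then show "E \<in> I `` {C'}" using iso[OF C'(1)] by simp
      qed
      moreover have "I `` {C'} \<subseteq> I `` {C}"
      proof
        fix E assume "E \<in> I `` {C'}"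
        then have "(C', E) \<in> I" by simp
        from members[OF C'(1) this] have "E \<in> X" "type_of E = type_of C" using ty by metis+
        then show "E \<in> I `` {C}" using iso[OF C(1)] by simp
      qed
      ultimately show "K = K'" unfolding C(2) C'(2) by (rule subset_antisym)
    qed
    show "(\<lambda>K. type_of (rep K)) ` (X // I) = {T. regular_type T \<and> active T P}"
    proof (intro subset_antisym subsetI)
      fix T assume "T \<in> (\<lambda>K. type_of (rep K)) ` (X // I)"
      then obtain K where K: "K \<in> X // I" "T = type_of (rep K)" by blast
      obtain C where C: "C \<in> X" "K = I `` {C}" using K(1) by (rule quotientE)
      have T: "T = type_of C" using K(2) repX(2)[OF C(1)] unfolding C(2) by metis
      have "active (type_of C) P" using active_type_of[of C] C(1) reg[OF C(1)] by (simp add: X_def)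
      then show "T \<in> {T. regular_type T \<and> active T P}" unfolding T using reg[OF C(1)] by (intro CollectI conjI)
    next
      fix T assume T: "T \<in> {T. regular_type T \<and> active T P}"
      then obtain C where C: "C \<in> X" "type_of C = T" using active_type_realized[of T P] P by (auto simp: X_def)
      have "type_of (rep (I `` {C})) = T" using repX(2)[OF C(1)] C(2) by metis
      moreover have "I `` {C} \<in> X // I" using C(1) by (rule quotientI)
      ultimately show "T \<in> (\<lambda>K. type_of (rep K)) ` (X // I)" by (metis imageI)
    qed
  qed
  have "(\<Sum>K\<in>X // I. curve_mult r s n (rep K)) = (\<Sum>K\<in>X // I. c * type_mult (type_of (rep K)))"
  proof (rule sum.cong[OF refl])
    fix K assume "K \<in> X // I"
    then obtain C where C: "C \<in> X" "K = I `` {C}" by (rule quotientE)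
    interpret R: broccoli_curve r s n v F "rep K"
      using repX(1)[OF C(1)] unfolding C(2) by (intro broccoli_curveI) (simp add: X_def)
    show "curve_mult r s n (rep K) = c * type_mult (type_of (rep K))" unfolding c_def by (rule R.curve_mult_eq)
  qed
  also have "\<dots> = (\<Sum>T\<in>{T. regular_type T \<and> active T P}. c * type_mult T)"
    by (rule sum.reindex_bij_betw[OF bij])
  also have "\<dots> = c * type_count P" unfolding type_count_def by (rule sum_distrib_left[symmetric])
  finally show ?thesis unfolding broccoli_number_def X_def I_def c_def rep_def by (rule arg_cong)
qed

end

section \<open>Contracting edges\<close>

context ptree_edge
begin

definition "contracted = insert merged rest"
definition "collapse V = (if V = V1 \<or> V = V2 then merged else V)"

lemma merged_two: "\<exists>i p. i \<in> merged \<and> p \<in> merged \<and> i \<noteq> p"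
proof -
  have "2 \<le> card merged" using card_merged by simp
  then obtain A where "A \<subseteq> merged" "card A = 2" by (meson obtain_subset_with_card_n)
  then show ?thesis by (auto simp: card_2_iff)
qed

lemma contracted_tree: "partition_tree L contracted"
  unfolding partition_tree_def
proof (intro conjI ballI allI impI)
  show "finite contracted" "contracted \<noteq> {}" using fin_T by (auto simp: contracted_def rest_def)
  fix V assume "V \<in> contracted"
  then consider "V \<in> rest" | "V = merged" by (auto simp: contracted_def)
  then show "partition_on L V" "3 \<le> card V"
    using part rest(1) card3 part_merged card_merged by (cases; simp)+
next
  fix V W f assume VW: "V \<in> contracted" "W \<in> contracted" "f \<in> V" "f \<in> W"
  consider "V \<in> rest" "W \<in> rest" | "V \<in> rest" "W = merged" | "W \<in> rest" "V = merged" | "V = merged" "W = merged"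
    using VW(1,2) unfolding contracted_def by blast
  then show "V = W"
  proof cases
    case 1 show ?thesis by (rule uniq[OF rest(1)[OF 1(1)] rest(1)[OF 1(2)] VW(3,4)])
  next
    case 2
    then have "f \<in> V1 \<or> f \<in> V2" using VW(4) merged_in(1) by metis
    then show ?thesis using rest_blocks[OF 2(1) VW(3)] by metis
  next
    case 3
    then have "f \<in> V1 \<or> f \<in> V2" using VW(3) merged_in(1) by metis
    then show ?thesis using rest_blocks[OF 3(1) VW(4)] by metis
  qed simp
next
  fix V f assume V: "V \<in> contracted" "f \<in> V" "2 \<le> card f"
  obtain i p where ip: "i \<in> merged" "p \<in> merged" "i \<noteq> p" using merged_two by blast
  show "\<exists>X\<in>contracted. L - f \<in> X"
  proof (cases "V \<in> rest")
    case True
    then show ?thesis using rest_opposite[OF ip True V(2,3)] unfolding contracted_def by blast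
  next
    case False
    then have "f \<in> merged" using V(1,2) by (simp add: contracted_def)
    then show ?thesis using merged_opposite[OF ip _ V(3)] unfolding contracted_def by blast
  qed
qed

lemma ptree_contracted: "ptree L contracted"
  using contracted_tree fin_L by unfold_locales

lemma Union_contracted: "\<Union>contracted = \<Union>T - {S, L - S}"
proof -
  have "\<Union>T = \<Union>(rest \<union> {V1, V2})" by (rule arg_cong[OF T_eq])
  then have UT: "\<Union>T = \<Union>rest \<union> V1 \<union> V2" by auto
  have "S \<notin> \<Union>rest" "L - S \<notin> \<Union>rest" using rest_blocks V12(2,4) by blast+
  then show ?thesis unfolding UT contracted_def merged_def using S_notin by blast
qed

lemma inner_contracted: "inner_flags contracted = inner_flags T - {S, L - S}"
  unfolding inner_flags_def Union_contracted by blast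

lemma collapse_image: "collapse ` T = contracted"
proof -
  have "collapse ` T = collapse ` (rest \<union> {V1, V2})" by (rule arg_cong[OF T_eq])
  also have "\<dots> = collapse ` rest \<union> {merged}" by (simp add: image_Un collapse_def)
  also have "collapse ` rest = (\<lambda>V. V) ` rest"
    by (rule image_cong[OF refl]) (metis collapse_def rest(2,3))
  finally show ?thesis by (simp add: contracted_def)
qed

lemma vertex_contracted:
  assumes "f \<in> \<Union>contracted" shows "vertex_of contracted f = collapse (vertex_of T f)"
proof -
  have f: "f \<in> \<Union>T" "f \<noteq> S" "f \<noteq> L - S" using assms unfolding Union_contracted by blast+
  note vf = vertex_of_in[OF f(1)]
  have "f \<in> collapse (vertex_of T f)"
    using vf(2) f(2,3) merged_in(5,6) by (auto simp: collapse_def)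
  moreover have "collapse (vertex_of T f) \<in> contracted" unfolding collapse_image[symmetric] using vf(1) by (rule imageI)
  ultimately show ?thesis by (rule ptree.vertex_of_eq[OF ptree_contracted, rotated])
qed

end

context broccoli_data
begin

text \<open>Edges of length 0 are contracted one after the other. \<open>\<mu>\<close> records the
  new vertices, and the positions descend because the two vertices of such an edge coincide.\<close>

lemma contract_zero:
  assumes "partition_tree labels T"
    and "\<forall>f\<in>inner_flags T. q (vertex_of T (labels - f)) = q (vertex_of T f) + l f *\<^sub>R rdir f"
    and "\<forall>f\<in>inner_flags T. l (labels - f) = (l f :: real)"
  shows "\<exists>T' \<mu> q'. partition_tree labels T' \<and> \<mu> ` T = T' \<and> \<Union>T' \<subseteq> \<Union>T \<and>
     (\<forall>f\<in>\<Union>T'. vertex_of T' f = \<mu> (vertex_of T f)) \<and>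
     (\<forall>f\<in>\<Union>T - \<Union>T'. f \<in> inner_flags T \<and> l f = 0 \<and> \<mu> (vertex_of T (labels - f)) = \<mu> (vertex_of T f)) \<and>
     (\<forall>V\<in>T. q' (\<mu> V) = (q V :: real \<times> real)) \<and> (\<forall>f\<in>inner_flags T'. l f \<noteq> 0)"
  using assms
proof (induction "card (inner_flags T)" arbitrary: T q rule: less_induct)
  case less
  interpret type_tree r s n v F T using less.prems(1) by unfold_locales
  show ?case
  proof (cases "\<exists>S\<in>inner_flags T. l S = 0")
    case False
    then show ?thesis using less.prems(1) by (intro exI[of _ T] exI[of _ id] exI[of _ q]) simp
  next
    case True
    then obtain S where S: "S \<in> inner_flags T" "l S = 0" by blast
    note Sd = inner_flagsD[OF S(1)]
    interpret E: ptree_edge labels T S using S(1) by unfold_locales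
    define q1 where "q1 W = (if W = E.merged then q E.V1 else q W)" for W
    \<comment> \<open>The fused vertex is new, so \<open>q1\<close> can be defined by testing for
      it.\<close>
    have notT: "E.merged \<notin> T"
    proof
      assume m: "E.merged \<in> T"
      obtain g h where "g \<in> E.V1 - {S}" using E.V1_two by blast
      then have "g \<in> E.merged" "g \<in> E.V1" using E.merged_in(5) by blast+
      then have "E.merged = E.V1" using uniq[OF m E.V12(1)] by metis
      then show False using E.merged_in(3) E.V12(2) by metis
    qed
    have qV: "q E.V2 = q E.V1" using less.prems(2)[rule_format, OF S(1)] S(2) by (simp add: E.V1_def E.V2_def)
    have q1: "q1 (E.collapse V) = q V" if "V \<in> T" for V
    proof (cases "V = E.V1 \<or> V = E.V2")
      case True
      then have "E.collapse V = E.merged" unfolding E.collapse_def by (rule if_P)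
      then show ?thesis using True qV unfolding q1_def by metis
    next
      case False
      then have "E.collapse V = V" unfolding E.collapse_def by (rule if_not_P)
      then show ?thesis using notT that unfolding q1_def by metis
    qed
    have inn: "f \<in> inner_flags T" "f \<in> \<Union>E.contracted" "labels - f \<in> \<Union>E.contracted" if "f \<in> inner_flags E.contracted" for f
    proof -
      show "f \<in> inner_flags T" using that unfolding E.inner_contracted by blast
      show "f \<in> \<Union>E.contracted" using that by (simp add: inner_flags_def)
      have "labels - f \<in> inner_flags E.contracted" using that by (rule ptree.inner_flagsD(6)[OF E.ptree_contracted])
      then show "labels - f \<in> \<Union>E.contracted" by (simp add: inner_flags_def)
    qed
    have smaller: "card (inner_flags E.contracted) < card (inner_flags T)"
      unfolding E.inner_contracted using S(1) fin_inner by (intro psubset_card_mono) blast+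
    have edge1: "q1 (vertex_of E.contracted (labels - f)) = q1 (vertex_of E.contracted f) + l f *\<^sub>R rdir f"
      if f: "f \<in> inner_flags E.contracted" for f
      unfolding E.vertex_contracted[OF inn(2)[OF f]] E.vertex_contracted[OF inn(3)[OF f]]
        q1[OF inner_flagsD(1)[OF inn(1)[OF f]]] q1[OF inner_flagsD(3)[OF inn(1)[OF f]]]
      by (rule less.prems(2)[rule_format, OF inn(1)[OF f]])
    have compl1: "l (labels - f) = l f" if f: "f \<in> inner_flags E.contracted" for f by (rule less.prems(3)[rule_format, OF inn(1)[OF f]])
    have edges1: "\<forall>f\<in>inner_flags E.contracted. q1 (vertex_of E.contracted (labels - f)) = q1 (vertex_of E.contracted f) + l f *\<^sub>R rdir f"
      using edge1 by (rule ballI)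
    have compls1: "\<forall>f\<in>inner_flags E.contracted. l (labels - f) = l f" using compl1 by (rule ballI)
    from less.hyps[OF smaller E.contracted_tree edges1 compls1]
    obtain T' \<mu> q' where T': "partition_tree labels T'" "\<mu> ` E.contracted = T'" "\<Union>T' \<subseteq> \<Union>E.contracted"
      and vT': "\<forall>f\<in>\<Union>T'. vertex_of T' f = \<mu> (vertex_of E.contracted f)"
      and zT': "\<forall>f\<in>\<Union>E.contracted - \<Union>T'. f \<in> inner_flags E.contracted \<and> l f = 0 \<and>
          \<mu> (vertex_of E.contracted (labels - f)) = \<mu> (vertex_of E.contracted f)"
      and qT': "\<forall>V\<in>E.contracted. q' (\<mu> V) = q1 V" and nz: "\<forall>f\<in>inner_flags T'. l f \<noteq> 0"
      by (elim exE conjE) (rule that)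
    show ?thesis
    proof (intro exI[of _ T'] exI[of _ "\<mu> \<circ> E.collapse"] exI[of _ q'] conjI ballI)
      show "partition_tree labels T'" by (rule T'(1))
      show "(\<mu> \<circ> E.collapse) ` T = T'" unfolding image_comp[symmetric] E.collapse_image by (rule T'(2))
      show "\<Union>T' \<subseteq> \<Union>T" using T'(3) unfolding E.Union_contracted by blast
      show "vertex_of T' f = (\<mu> \<circ> E.collapse) (vertex_of T f)" if f: "f \<in> \<Union>T'" for f
        using bspec[OF vT' f] E.vertex_contracted[OF subsetD[OF T'(3) f]] by simp
      show "q' ((\<mu> \<circ> E.collapse) V) = q V" if V: "V \<in> T" for V
      proof -
        have "E.collapse V \<in> E.contracted" unfolding E.collapse_image[symmetric] using V by (rule imageI)
        then show ?thesis using qT' q1[OF V] by simp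
      qed
      show "l f \<noteq> 0" if "f \<in> inner_flags T'" for f using bspec[OF nz that] .
      fix f assume f: "f \<in> \<Union>T - \<Union>T'"
      have "f \<in> inner_flags T \<and> l f = 0 \<and> \<mu> (E.collapse (vertex_of T (labels - f))) = \<mu> (E.collapse (vertex_of T f))"
      proof (cases "f \<in> \<Union>E.contracted")
        case True
        then have z: "f \<in> inner_flags E.contracted" "l f = 0"
          "\<mu> (vertex_of E.contracted (labels - f)) = \<mu> (vertex_of E.contracted f)" using zT' f by blast+
        show ?thesis
          using inn(1)[OF z(1)] z(2) z(3)[unfolded E.vertex_contracted[OF inn(2)[OF z(1)]] E.vertex_contracted[OF inn(3)[OF z(1)]]]
          by (intro conjI)
      next
        case False
        then have fS: "f = S \<or> f = labels - S" using f unfolding E.Union_contracted by blast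
        have cm: "E.collapse (vertex_of T S) = E.merged" "E.collapse (vertex_of T (labels - S)) = E.merged"
          unfolding E.V1_def[symmetric] E.V2_def[symmetric] E.collapse_def by simp_all
        from fS show ?thesis
        proof
          assume "f = S" then show ?thesis using S cm by metis
        next
          assume "f = labels - S" then show ?thesis using S cm Sd(6,7) less.prems(3)[rule_format, OF S(1)] by metis
        qed
      qed
      then show "f \<in> inner_flags T" "l f = 0" "(\<mu> \<circ> E.collapse) (vertex_of T (labels - f)) = (\<mu> \<circ> E.collapse) (vertex_of T f)"
        by simp_all
    qed
  qed
qed

end

text \<open>With fewer than \<open>r + n - 3\<close> lengths the cell has fewer parameters than
  there are conditions.\<close>

lemma (in oriented_tree) not_general_small:
  assumes sp: "C \<in> broccoli_space r s n v F" and gp: "general_position r s n v F P" and P: "evaluation r s v F C = P"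
    and \<rho>: "\<rho> \<in> labels" and small: "card (away_flags curve_type \<rho>) + 4 \<le> r + n"
  shows False
proof -
  interpret type_tree r s n v F curve_type using tree_curve_type by unfold_locales
  let ?A = "{x - y | x y. x \<in> evaluation r s v F ` broccoli_cell r s n v F C \<and> y \<in> evaluation r s v F ` broccoli_cell r s n v F C}"
  let ?M = "(\<lambda>i. evaluate curve_type (motion i)) ` motion_index \<rho>"
  have "dim ?A \<le> card ?M" using motion_index(1)[OF \<rho>] by (intro dim_le_card cell_differences_in_span[OF \<rho>]) simp
  also have "\<dots> \<le> 2 + card (away_flags curve_type \<rho>)"
    unfolding motion_index(2)[OF \<rho>, symmetric] by (rule card_image_le[OF motion_index(1)[OF \<rho>]])
  finally have "int (dim ?A) \<le> int r + int n - 2" using small by linarith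
  then show False by (rule not_general[OF sp gp P])
qed

context broccoli_data
begin

text \<open>The definition of general position concerns cells in the closure of the set of broccoli
  curves, so the contracted curve has to be exhibited as a limit: in curves of type \<open>T\<close>
  the zero lengths are replaced by positive ones tending to 0.\<close>

lemma general_position_off_walls:
  assumes P: "P \<in> condition_space r s F" and gp: "general_position r s n v F P"
  shows "off_walls P"
  unfolding off_walls_def
proof (intro allI impI)
  fix T assume reg: "regular_type T" and ge: "\<forall>f\<in>inner_flags T. 0 \<le> type_length T f P"
  interpret T: regular_tree r s n v F T using regular_tree_iff reg by simp
  have tree: "partition_tree labels T" using T.bt by (simp add: broccoli_type_def)
  interpret TT: type_tree r s n v F T using tree by unfold_locales
  show "active T P"
  proof (rule ccontr)
    assume "\<not> active T P"
    then obtain f0 where f0: "f0 \<in> inner_flags T" "\<not> 0 < type_length T f0 P" by (auto simp: active_def)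
    define q where "q = position T P"
    define l where "l f = type_length T f P" for f
    have q: "q (vertex_of T (labels - f)) = q (vertex_of T f) + l f *\<^sub>R rdir f" if f: "f \<in> inner_flags T" for f
      using T.edge_vector[OF T.position_solves f] unfolding type_length_def q_def l_def by (simp add: algebra_simps)
    have lc: "l (labels - f) = l f" if f: "f \<in> inner_flags T" for f unfolding l_def by (rule T.type_length_compl[OF f])
    have l_ge: "0 \<le> l f" if "f \<in> inner_flags T" for f using ge that by (simp add: l_def)
    have l0: "l f0 = 0" using f0 ge unfolding l_def by force
    have qs: "\<forall>f\<in>inner_flags T. q (vertex_of T (labels - f)) = q (vertex_of T f) + l f *\<^sub>R rdir f" using q by (rule ballI)
    have lcs: "\<forall>f\<in>inner_flags T. l (labels - f) = l f" using lc by (rule ballI)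
    from contract_zero[OF tree qs lcs]
    obtain T' \<mu> q' where T': "partition_tree labels T'" "\<mu> ` T = T'" "\<Union>T' \<subseteq> \<Union>T"
      and vT': "\<forall>f\<in>\<Union>T'. vertex_of T' f = \<mu> (vertex_of T f)"
      and zT': "\<forall>f\<in>\<Union>T - \<Union>T'. f \<in> inner_flags T \<and> l f = 0 \<and> \<mu> (vertex_of T (labels - f)) = \<mu> (vertex_of T f)"
      and qT': "\<forall>V\<in>T. q' (\<mu> V) = q V" and nz: "\<forall>f\<in>inner_flags T'. l f \<noteq> 0"
      by (elim exE conjE) (rule that)
    interpret T': type_tree r s n v F T' using T'(1) by unfold_locales
    have inT: "b \<in> inner_flags T" if "b \<in> inner_flags T'" for b using that T'(3) unfolding inner_flags_def by blast
    have inT': "b \<in> inner_flags T' \<longleftrightarrow> b \<in> inner_flags T" if "b \<in> \<Union>T'" for b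
      using that T'(3) unfolding inner_flags_def by blast
    have qv: "q' (vertex_of T' b) = q (vertex_of T b)" if b: "b \<in> \<Union>T'" for b
      using bspec[OF vT' b] bspec[OF qT' T.vertex_of_in(1)[OF subsetD[OF T'(3) b]]] by simp
    interpret D: realizable r s n v F T' q' l
    proof
      fix f assume f: "f \<in> inner_flags T'"
      note fT = inT[OF f]
      have m: "f \<in> \<Union>T'" "labels - f \<in> \<Union>T'" using f T'.inner_flagsD(6)[OF f] by (simp_all add: inner_flags_def)
      show "charge f = 0 \<or> charge f = 1" by (rule T.inner_charges[OF fT])
      show "q' (vertex_of T' (labels - f)) = q' (vertex_of T' f) + l f *\<^sub>R rdir f"
        unfolding qv[OF m(1)] qv[OF m(2)] by (rule q[OF fT])
      have "l f \<noteq> 0" using bspec[OF nz f] .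
      then show "0 < l f" using l_ge[OF fT] by simp
      show "l (labels - f) = l f" by (rule lc[OF fT])
    qed (rule T'(1))
    obtain \<rho> where \<rho>: "\<rho> \<in> labels" using D.label_ex by blast
    define e where "e k = inverse (real (Suc k))" for k
    define z where "z k f = (if l f = 0 then e k else 0)" for k f
    \<comment> \<open>Each shift lengthens exactly its own edge, so the edge lengths of
      \<open>qk k\<close> are \<open>lk k\<close>. These curves need not satisfy the conditions
      \<open>P\<close>; their limit does.\<close>
    define qk where "qk k V = q V + (\<Sum>S\<in>away_flags T \<rho>. z k S *\<^sub>R side_shift S V)" for k V
    define lk where "lk k f = l f + z k f" for k f
    have e: "0 < e k" for k by (simp add: e_def)
    have e_lim: "e \<longlonglongrightarrow> 0" unfolding e_def by (rule LIMSEQ_inverse_real_of_nat)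
    have z_lim: "(\<lambda>k. z k f) \<longlonglongrightarrow> 0" for f using e_lim by (cases "l f = 0") (simp_all add: z_def)
    have real_k: "realizable r s n v F T (qk k) (lk k)" for k
    proof
      fix f assume f: "f \<in> inner_flags T"
      have zc: "z k (labels - f) = z k f" unfolding z_def lc[OF f] ..
      show "charge f = 0 \<or> charge f = 1" by (rule T.inner_charges[OF f])
      show "qk k (vertex_of T (labels - f)) = qk k (vertex_of T f) + lk k f *\<^sub>R rdir f"
        unfolding qk_def lk_def q[OF f] TT.shift_sum_step[OF \<rho> f zc] by (simp add: scaleR_add_left)
      show "0 < lk k f" using l_ge[OF f] e[of k] by (simp add: lk_def z_def)
      show "lk k (labels - f) = lk k f" unfolding lk_def zc lc[OF f] ..
    qed (rule tree)
    define X where "X k = realize T (qk k) (lk k)" for k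
    have brX: "X k \<in> broccoli_curves r s n v F" for k
      unfolding X_def by (rule realizable.K_broccoli[OF real_k T.bvertex])
    define \<phi> where "\<phi> x = vertex_code (\<mu> (vertex_decode x))" for x
    have \<phi>: "\<phi> (vertex_code V) = vertex_code (\<mu> V)" if "V \<in> T" for V
      unfolding \<phi>_def realizable.vertex_decode[OF real_k that] ..
    note Ks = realizable.K_simps[OF real_k, folded X_def]
    have base_X: "\<phi> (base (X k) (set_encode b)) = vertex_code (\<mu> (vertex_of T b))" if b: "b \<in> \<Union>T" for k b
      unfolding Ks(5)[OF b] by (rule \<phi>[OF T.vertex_of_in(1)[OF b]])
    have flags_D: "\<exists>b\<in>\<Union>T'. g = set_encode b" if "g \<in> flags D.K" for g using that unfolding D.K_simps(2) by blast
    have rest: "flags (X k) - flags D.K = set_encode ` (\<Union>T - \<Union>T')" for k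
      unfolding Ks(2) D.K_simps(2)
      by (rule inj_on_image_set_diff[OF realizable.inj_encode[OF real_k], symmetric]) (use T'(3) in blast)+
    \<comment> \<open>The identity serves as map of flags, because \<open>realize\<close> names a
      flag by its block and contraction leaves the blocks of the remaining edges unchanged.\<close>
    have contraction: "type_contraction r s n \<phi> id (X k) D.K" for k
      unfolding type_contraction_def
    proof (intro conjI ballI)
      have "\<phi> ` verts (X k) = (\<lambda>V. vertex_code (\<mu> V)) ` T"
        unfolding Ks(1) image_image by (rule image_cong[OF refl \<phi>])
      also have "\<dots> = vertex_code ` \<mu> ` T" by (simp only: image_image)
      also have "\<dots> = verts D.K" unfolding T'(2) by (rule D.K_simps(1)[symmetric])
      finally show "\<phi> ` verts (X k) = verts D.K" .
      show "inj_on id (flags D.K)" by simp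
      show "id ` flags D.K \<subseteq> flags (X k)" unfolding Ks(2) D.K_simps(2) image_id id_apply by (rule image_mono[OF T'(3)])
    next
      fix g assume "g \<in> flags D.K"
      from flags_D[OF this] obtain b where b: "b \<in> \<Union>T'" "g = set_encode b" by (elim bexE) (rule that)
      note bT = subsetD[OF T'(3) b(1)]
      show "base D.K g = \<phi> (base (X k) (id g))"
        unfolding b(2) id_apply D.K_simps(5)[OF b(1)] base_X[OF bT] bspec[OF vT' b(1)] ..
      show "id (opp D.K g) = opp (X k) (id g)"
      proof (cases "b \<in> inner_flags T'")
        case True
        show ?thesis unfolding b(2) id_apply D.K_simps(10)[OF True] Ks(10)[OF inT[OF True]] ..
      next
        case False
        then have "b \<notin> inner_flags T" using inT'[OF b(1)] by blast
        then show ?thesis unfolding b(2) id_apply D.K_simps(11)[OF b(1) False] Ks(11)[OF bT \<open>b \<notin> inner_flags T\<close>] by simp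
      qed
      show "dir D.K g = dir (X k) (id g)" unfolding b(2) id_apply D.K_simps(6)[OF b(1)] Ks(6)[OF bT] ..
    next
      fix g assume "g \<in> unmarked_flags r s D.K"
      then have "g \<in> flags D.K" by (simp add: unmarked_flags_def)
      from flags_D[OF this] obtain b where b: "b \<in> \<Union>T'" "g = set_encode b" by (elim bexE) (rule that)
      show "outw D.K g = outw (X k) (id g)"
        unfolding b(2) id_apply D.K_simps(7)[OF b(1)] Ks(7)[OF subsetD[OF T'(3) b(1)]] ..
    next
      show "xend (X k) i = id (xend D.K i)" for i unfolding Ks(3) D.K_simps(3) by simp
      show "yend (X k) j = id (yend D.K j)" for j unfolding Ks(4) D.K_simps(4) by simp
    next
      fix f assume "f \<in> flags (X k) - id ` flags D.K"
      then have "f \<in> flags (X k) - flags D.K" by simp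
      then obtain b where b: "b \<in> \<Union>T - \<Union>T'" "f = set_encode b" unfolding rest by (elim imageE) (rule that)
      have zb: "b \<in> inner_flags T" "\<mu> (vertex_of T (labels - b)) = \<mu> (vertex_of T b)" using bspec[OF zT' b(1)] by blast+
      have m: "b \<in> \<Union>T" "labels - b \<in> \<Union>T" using zb(1) T.inner_flagsD(6)[OF zb(1)] by (simp_all add: inner_flags_def)
      show "f \<in> bounded_flags (X k)"
        unfolding X_def realizable.K_bounded[OF real_k] b(2) using zb(1) by (rule imageI)
      show "\<phi> (base (X k) (opp (X k) f)) = \<phi> (base (X k) f)"
        unfolding b(2) Ks(10)[OF zb(1)] base_X[OF m(1)] base_X[OF m(2)] zb(2) ..
    qed
    have "curves_tendsto r s n X D.K"
      unfolding curves_tendsto_def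
    proof (rule exI[of _ "\<lambda>_. \<phi>"], rule exI[of _ "\<lambda>_. id"], intro conjI allI ballI)
      show "type_contraction r s n \<phi> id (X k) D.K" for k by (rule contraction)
    next
      fix g assume "g \<in> flags D.K"
      from flags_D[OF this] obtain b where b: "b \<in> \<Union>T'" "g = set_encode b" by (elim bexE) (rule that)
      note bT = subsetD[OF T'(3) b(1)]
      have "(\<lambda>k. qk k (vertex_of T b)) \<longlonglongrightarrow> q (vertex_of T b) + (\<Sum>S\<in>away_flags T \<rho>. 0 *\<^sub>R side_shift S (vertex_of T b))"
        unfolding qk_def by (intro tendsto_add tendsto_const tendsto_sum tendsto_scaleR z_lim)
      then have "(\<lambda>k. qk k (vertex_of T b)) \<longlonglongrightarrow> q (vertex_of T b)" by simp
      then show "(\<lambda>k. pos (X k) (base (X k) (id g))) \<longlonglongrightarrow> pos D.K (base D.K g)"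
        unfolding b(2) id_apply D.K_simps(5)[OF b(1)] Ks(5)[OF bT] D.K_simps(9)[OF T'.vertex_of_in(1)[OF b(1)]]
          Ks(9)[OF T.vertex_of_in(1)[OF bT]] qv[OF b(1)] .
    next
      fix g assume "g \<in> bounded_flags D.K"
      then have "g \<in> flags D.K" by (simp add: bounded_flags_def)
      from flags_D[OF this] obtain b where b: "b \<in> \<Union>T'" "g = set_encode b" by (elim bexE) (rule that)
      have "(\<lambda>k. lk k b) \<longlonglongrightarrow> l b + 0" unfolding lk_def by (intro tendsto_add tendsto_const z_lim)
      then show "(\<lambda>k. len (X k) (id g)) \<longlonglongrightarrow> len D.K g"
        unfolding b(2) id_apply D.K_simps(8)[OF b(1)] Ks(8)[OF subsetD[OF T'(3) b(1)]] by simp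
    next
      have "(\<lambda>k. len (X k) f) \<longlonglongrightarrow> 0" if prems: "f \<in> set_encode ` (\<Union>T - \<Union>T')" for f
      proof -
        obtain b where b: "b \<in> \<Union>T - \<Union>T'" "f = set_encode b" using prems by (elim imageE) (rule that)
        have "l b = 0" "b \<in> \<Union>T" using bspec[OF zT' b(1)] b(1) by blast+
        then show ?thesis unfolding b(2) Ks(8)[OF \<open>b \<in> \<Union>T\<close>] lk_def using z_lim by simp
      qed
      then have "(\<lambda>k. \<Sum>f\<in>set_encode ` (\<Union>T - \<Union>T'). len (X k) f) \<longlonglongrightarrow> 0" by (rule tendsto_null_sum)
      then show "(\<lambda>k. \<Sum>f\<in>flags (X k) - id ` flags D.K. len (X k) f) \<longlonglongrightarrow> 0" unfolding image_id id_apply rest .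
    qed
    then have space: "D.K \<in> broccoli_space r s n v F"
      unfolding broccoli_space_def using brX D.K_oriented by blast
    have "evaluate T' q' = evaluate T q"
      unfolding evaluate_def
      by (intro arg_cong2[of _ _ _ _ Pair] sum.cong[OF refl]) (simp_all only: qv[OF T'.end_in(1)] qv[OF T'.end_in(2)])
    then have eval: "evaluation r s v F D.K = P"
      unfolding D.K_evaluation q_def using evaluate_solves[OF tree P T.position_solves] by simp
    \<comment> \<open>At least one length is lost, so the number of edges falls below the
      \<open>r + n - 3\<close> of a broccoli type.\<close>
    have "away_flags T' \<rho> \<subset> away_flags T \<rho>"
    proof (rule psubsetI)
      show "away_flags T' \<rho> \<subseteq> away_flags T \<rho>" using inT by (auto simp: away_flags_def)
      obtain f where f: "f \<in> away_flags T \<rho>" "l f = 0"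
        using T.inner_flags_away[OF \<rho> f0(1)] l0 lc[OF f0(1)] by metis
      then have "f \<notin> away_flags T' \<rho>" using nz by (auto simp: away_flags_def)
      then show "away_flags T' \<rho> \<noteq> away_flags T \<rho>" using f(1) by metis
    qed
    then have "card (away_flags T' \<rho>) < card (away_flags T \<rho>)" by (rule psubset_card_mono[OF TT.fin_away[OF \<rho>]])
    then have "card (away_flags D.R.curve_type \<rho>) + 4 \<le> r + n" unfolding D.K_curve_type using T.card_away[OF \<rho>] by linarith
    then show False by (rule D.R.not_general_small[OF space gp eval \<rho>])
  qed
qed

end

text \<open>When balancing is summed over all vertices, the two flags of a bounded edge cancel and
  markings contribute 0.\<close>

lemma marked_curve_degree_sum:
  assumes mc: "is_marked_curve r s n v C"
  shows "(\<Sum>j=1..n. v j) = 0"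
proof -
  have fin: "finite (verts C)" "finite (flags C)" and base: "base C ` flags C \<subseteq> verts C"
    and opp: "\<And>f. f \<in> flags C \<Longrightarrow> opp C f \<in> flags C \<and> opp C (opp C f) = f"
    and dir: "\<And>f. f \<in> bounded_flags C \<Longrightarrow> dir C (opp C f) = - dir C f"
    and bal: "\<And>V. V \<in> verts C \<Longrightarrow> (\<Sum>f\<in>flags_at C V. dir C f) = 0"
    and y: "bij_betw (yend C) {1..n} {f \<in> ends C. dir C f \<noteq> 0}" "\<And>j. j \<in> {1..n} \<Longrightarrow> dir C (yend C j) = v j"
    using mc unfolding is_marked_curve_def by auto
  have "(\<Sum>V\<in>verts C. \<Sum>f\<in>flags_at C V. dir C f) = (\<Sum>f\<in>flags C. dir C f)"
    unfolding flags_at_def by (rule sum.group[OF fin(2,1) base])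
  then have "(\<Sum>f\<in>flags C. dir C f) = 0" using bal by simp
  moreover have "(\<Sum>f\<in>flags C. dir C f) = (\<Sum>f\<in>bounded_flags C. dir C f) + (\<Sum>f\<in>ends C. dir C f)"
  proof -
    have "flags C = bounded_flags C \<union> ends C" "bounded_flags C \<inter> ends C = {}" by (auto simp: bounded_flags_def ends_def)
    then show ?thesis using fin(2) by (metis finite_Un sum.union_disjoint)
  qed
  moreover have "(\<Sum>f\<in>bounded_flags C. dir C f) = 0"
  proof -
    have "(\<Sum>f\<in>bounded_flags C. dir C f) = (\<Sum>f\<in>bounded_flags C. dir C (opp C f))"
      by (rule sum.reindex_bij_witness[of _ "opp C" "opp C"]) (use opp in \<open>auto simp: bounded_flags_def\<close>)
    also have "\<dots> = - (\<Sum>f\<in>bounded_flags C. dir C f)" using dir by (simp add: sum_negf)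
    finally show ?thesis by (simp add: prod_eq_iff)
  qed
  moreover have "(\<Sum>f\<in>ends C. dir C f) = (\<Sum>j=1..n. v j)"
  proof -
    have "(\<Sum>j=1..n. v j) = (\<Sum>j\<in>{1..n}. dir C (yend C j))" by (rule sum.cong[OF refl]) (simp add: y(2))
    also have "\<dots> = (\<Sum>f\<in>{f \<in> ends C. dir C f \<noteq> 0}. dir C f)" by (rule sum.reindex_bij_betw[OF y(1)])
    also have "\<dots> = (\<Sum>f\<in>ends C. dir C f)"
      using fin(2) by (intro sum.mono_neutral_left) (auto simp: ends_def)
    finally show ?thesis ..
  qed
  ultimately show ?thesis by simp
qed

theorem theorem3p6:
  fixes r s n :: nat and v :: "nat \<Rightarrow> int \<times> int" and F :: "nat set"
    and P Q :: "conditions"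
  assumes "\<forall>j\<in>{1..n}. v j \<noteq> 0"
    and "F \<subseteq> {1..n}"
    and "int r + 2 * int s + int (card F) = int n - 1"
    and "P \<in> condition_space r s F" and "general_position r s n v F P"
    and "Q \<in> condition_space r s F" and "general_position r s n v F Q"
  shows "broccoli_number r s n v F P = broccoli_number r s n v F Q"
proof (cases "broccoli_curves r s n v F = {}")
  \<comment> \<open>Both sums are empty here. Otherwise a curve exists and supplies the balanced
    degree.\<close>
  case True
  then show ?thesis by (simp add: broccoli_number_def quotient_def)
next
  case False
  then obtain C :: oriented_curve where "is_marked_curve r s n v C" by (auto simp: broccoli_curves_def oriented_curves_def)
  then have "(\<Sum>j=1..n. v j) = 0" by (rule marked_curve_degree_sum)
  then interpret broccoli_data r s n v F using assms(1-3) by unfold_locales auto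
  show ?thesis
    using type_count_invariant[OF general_position_off_walls[OF assms(4,5)] general_position_off_walls[OF assms(6,7)]]
      broccoli_number_eq[OF assms(4,5)] broccoli_number_eq[OF assms(6,7)] by simp
qed

end
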